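(* Consider the continuous-time Markov decision process (CTMDP) model described in the context, and suppose Condition 1 and Condition 2 are satisfied. Then the constrained total undiscounted CTMDP problem (minimize $E^\pi_\gamma[\int_0^\infty\int_A c_0(\xi_t,a)\pi(da|\omega,t)dt]$ over $\pi\in\Pi$ subject to $E^\pi_\gamma[\int_0^\infty\int_A c_j(\xi_t,a)\pi(da|\omega,t)dt]\le d_j$, $j=1,\dots,N$) admits an optimal policy which is stationary.
   Context: CTMDP model. $S$ and $A$ are nonempty Borel spaces, $\gamma$ is a probability measure on $\mathcal B(S)$, and $q(dy|x,a)$ is a signed kernel on $\mathcal B(S)$ given $(x,a)\in S\times A$ such that $\tilde q(\Gamma|x,a):=q(\Gamma\setminus\{x\}|x,a)\ge0$ for all $\Gamma\in\mathcal B(S)$, $q(S|x,a)=0$, and, with $q_x(a):=-q(\{x\}|x,a)\ge0$, $\sup_{a\in A}q_x(a)<\infty$ for each $x\in S$ (no bound uniform in $x$ is assumed). Conventions: $0/0:=0$, $0\cdot\infty:=0$, $c/0:=+\infty$ for $c>0$. Let $x_\infty\notin S$ be an isolated point. The sample space $\Omega$ consists of sequences $\omega=(x_0,\theta_1,x_1,\theta_2,\dots)$ with $x_n\in S$, $\theta_n\in(0,\infty)$, together with sequences $(x_0,\theta_1,\dots,\theta_n,x_n,\infty,x_\infty,\infty,x_\infty,\dots)$; $t_0:=0$, $t_n:=t_{n-1}+\theta_n$, $t_\infty:=\lim_n t_n$, $\xi_t:=\sum_{n\ge0}I\{t_n\le t<t_{n+1}\}x_n+I\{t_\infty\le t\}x_\infty$.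 A policy $\pi=(\pi_n)_{n\ge1}$ is a sequence of stochastic kernels $\pi_n(da|x_0,\theta_1,\dots,x_{n-1},s)$ on $A$ ($s>0$ is the time since the last jump), and $\pi(da|\omega,t):=\sum_{n\ge0}I\{t_n<t\le t_{n+1}\}\pi_{n+1}(da|x_0,\theta_1,\dots,x_n,t-t_n)$ for $t<t_\infty$ (after $t_\infty$ a dummy action at which all rates and costs vanish is used). A policy is stationary if $\pi_n(da|x_0,\dots,x_{n-1},s)=\varphi(da|x_{n-1})$ for one stochastic kernel $\varphi$ from $S$ to $A$. $\Pi$ denotes the set of all policies. Under $\pi$, $P^\pi_\gamma$ is the unique probability on $\Omega$ such that $x_0\sim\gamma$, $P^\pi_\gamma(\theta_{n+1}\ge t|x_0,\theta_1,\dots,x_n)=\exp(-\int_0^t\int_A q_{x_n}(a)\pi_{n+1}(da|x_0,\dots,x_n,s)ds)$, and $P^\pi_\gamma(x_{n+1}\in\Gamma|x_0,\dots,x_n,\theta_{n+1})=\frac{\int_A\tilde q(\Gamma|x_n,a)\pi_{n+1}(da|x_0,\dots,x_n,\theta_{n+1})}{\int_A q_{x_n}(a)\pi_{n+1}(da|x_0,\dots,x_n,\theta_{n+1})}$ for $\Gamma\in\mathcal B(S)$, the remaining probability going to $x_\infty$ (in particular $x_{n+1}=x_\infty$ when $\theta_{n+1}=\infty$); $E^\pi_\gamma$ is its expectation. Costs: measurable $c_0,\dots,c_N:S\times A\to[0,\infty)$, with $c_i(x_\infty,\cdot):=0$; constants $d_1,\dots,d_N\in[0,\infty)$. A policy is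 feasible if it satisfies the constraints, feasible with a finite value if moreover its $c_0$-objective is finite, and optimal if it is feasible and its objective equals the infimum of the objective over all feasible policies. Condition 1: (a) $A$ is compact; (b) for each bounded continuous $f$ on $S$, $(x,a)\mapsto\int_S f(y)\tilde q(dy|x,a)/q_x(a)$ is continuous on $S\times A$; (c) $(x,a)\mapsto q_x(a)$ is continuous; (d) each $c_i$, $i=0,\dots,N$, is lower semicontinuous on $S\times A$. Condition 2: there exists a feasible policy with a finite value. *)

theory Defs
  imports "HOL-Analysis.Analysis" "HOL-Probability.Probability"
begin

definition SM :: "'s::topological_space set \<Rightarrow> 's measure" where
  "SM S = restrict_space borel S"

definition posR :: "real measure" where
  "posR = restrict_space borel {0<..}"

text \<open>Measurable space on S extended by the isolated point x_inf (represented by None).\<close>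
definition optM :: "'s measure \<Rightarrow> 's option measure" where
  "optM M = sigma UNIV (insert {None} ((\<lambda>B. Some ` B) ` sets M))"

text \<open>History (x_0,theta_1,...,x_{n-1},theta_n) as pairs (x_k,theta_{k+1}), k<n, together with x_n.\<close>
definition histM :: "'s::topological_space set \<Rightarrow> nat \<Rightarrow> ((nat \<Rightarrow> 's \<times> real) \<times> 's) measure" where
  "histM S n = PiM {..<n} (\<lambda>_. SM S \<Otimes>\<^sub>M posR) \<Otimes>\<^sub>M SM S"

definition qt :: "('s \<Rightarrow> 'b \<Rightarrow> 's set \<Rightarrow> real) \<Rightarrow> 's \<Rightarrow> 'b \<Rightarrow> 's set \<Rightarrow> real" where
  "qt q x a \<Gamma> = q x a (\<Gamma> - {x})"

definition qx :: "('s \<Rightarrow> 'b \<Rightarrow> 's set \<Rightarrow> real) \<Rightarrow> 's \<Rightarrow> 'b \<Rightarrow> real" where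
  "qx q x a = - q x a {x}"

definition qtM :: "('s::topological_space \<Rightarrow> 'b \<Rightarrow> 's set \<Rightarrow> real) \<Rightarrow> 's set \<Rightarrow> 's \<Rightarrow> 'b \<Rightarrow> 's measure" where
  "qtM q S x a = measure_of S (sets (SM S)) (\<lambda>\<Gamma>. ennreal (qt q x a \<Gamma>))"

definition signed_kernel :: "'s::topological_space set \<Rightarrow> 'b::topological_space set \<Rightarrow> ('s \<Rightarrow> 'b \<Rightarrow> 's set \<Rightarrow> real) \<Rightarrow> bool" where
  "signed_kernel S A q \<longleftrightarrow>
     (\<forall>x\<in>S. \<forall>a\<in>A. \<forall>F. range F \<subseteq> sets (SM S) \<longrightarrow> disjoint_family F \<longrightarrow>
         (\<lambda>i. q x a (F i)) sums q x a (\<Union>i. F i)) \<and>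
     (\<forall>\<Gamma>\<in>sets (SM S). (\<lambda>(x,a). q x a \<Gamma>) \<in> borel_measurable (SM S \<Otimes>\<^sub>M SM A))"

definition lsc_on :: "'a::topological_space set \<Rightarrow> ('a \<Rightarrow> real) \<Rightarrow> bool" where
  "lsc_on T f \<longleftrightarrow> (\<forall>r. openin (top_of_set T) {z\<in>T. r < f z})"

type_synonym ('s,'b) policy = "nat \<Rightarrow> ((nat \<Rightarrow> 's \<times> real) \<times> 's) \<times> real \<Rightarrow> 'b measure"

text \<open>pol n is pi_{n+1}(da | x_0,theta_1,...,x_n, s).\<close>
definition is_policy :: "'s::topological_space set \<Rightarrow> 'b::topological_space set \<Rightarrow> ('s,'b) policy \<Rightarrow> bool" where
  "is_policy S A pol \<longleftrightarrow> (\<forall>n. pol n \<in> measurable (histM S n \<Otimes>\<^sub>M posR) (prob_algebra (SM A)))"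

definition stationary :: "'s::topological_space set \<Rightarrow> 'b::topological_space set \<Rightarrow> ('s,'b) policy \<Rightarrow> bool" where
  "stationary S A pol \<longleftrightarrow> (\<exists>\<phi>. \<phi> \<in> measurable (SM S) (prob_algebra (SM A)) \<and>
      (\<forall>n h x s. ((h,x),s) \<in> space (histM S n \<Otimes>\<^sub>M posR) \<longrightarrow> pol n ((h,x),s) = \<phi> x))"

type_synonym 's path = "nat \<Rightarrow> 's option \<times> ennreal"

text \<open>omega n = (x_n, theta_n); theta_0 = 0 is a dummy; None is x_inf; top is theta = infinity.\<close>
definition xs :: "'s path \<Rightarrow> nat \<Rightarrow> 's option" where "xs \<omega> n = fst (\<omega> n)"
definition th :: "'s path \<Rightarrow> nat \<Rightarrow> ennreal" where "th \<omega> n = snd (\<omega> n)"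

definition OmegaM :: "'s::topological_space set \<Rightarrow> 's path measure" where
  "OmegaM S = PiM UNIV (\<lambda>_. optM (SM S) \<Otimes>\<^sub>M (borel :: ennreal measure))"

definition Omega :: "'s set \<Rightarrow> 's path set" where
  "Omega S = {\<omega>. th \<omega> 0 = 0 \<and> xs \<omega> 0 \<in> Some ` S \<and>
      (\<forall>n. xs \<omega> n \<in> Some ` S \<or> xs \<omega> n = None) \<and>
      (\<forall>n. 0 < th \<omega> (Suc n)) \<and>
      (\<forall>n. th \<omega> (Suc n) = \<top> \<longleftrightarrow> xs \<omega> (Suc n) = None) \<and>
      (\<forall>n. th \<omega> (Suc n) = \<top> \<longrightarrow> th \<omega> (Suc (Suc n)) = \<top>)}"

definition jt :: "'s path \<Rightarrow> nat \<Rightarrow> ennreal" where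
  "jt \<omega> n = (\<Sum>k\<in>{1..n}. th \<omega> k)"

definition jinf :: "'s path \<Rightarrow> ennreal" where
  "jinf \<omega> = (SUP n. jt \<omega> n)"

definition state_at :: "'s path \<Rightarrow> real \<Rightarrow> 's option" where
  "state_at \<omega> t = (if \<exists>n. jt \<omega> n \<le> ennreal t \<and> ennreal t < jt \<omega> (Suc n)
      then xs \<omega> (THE n. jt \<omega> n \<le> ennreal t \<and> ennreal t < jt \<omega> (Suc n)) else None)"

definition alive :: "nat \<Rightarrow> 's path \<Rightarrow> bool" where
  "alive n \<omega> \<longleftrightarrow> (\<forall>k\<le>n. xs \<omega> k \<noteq> None)"

definition hist :: "nat \<Rightarrow> 's path \<Rightarrow> (nat \<Rightarrow> 's \<times> real) \<times> 's" where
  "hist n \<omega> = (restrict (\<lambda>k. (the (xs \<omega> k), enn2real (th \<omega> (Suc k)))) {..<n}, the (xs \<omega> n))"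

definition polAt :: "('s,'b) policy \<Rightarrow> 's path \<Rightarrow> real \<Rightarrow> 'b measure" where
  "polAt pol \<omega> t = (let n = (THE n. jt \<omega> n < ennreal t \<and> ennreal t \<le> jt \<omega> (Suc n))
      in pol n (hist n \<omega>, t - enn2real (jt \<omega> n)))"

definition cost_rate :: "('s \<times> 'b \<Rightarrow> real) \<Rightarrow> ('s,'b) policy \<Rightarrow> 's path \<Rightarrow> real \<Rightarrow> ennreal" where
  "cost_rate c pol \<omega> t = (if ennreal t < jinf \<omega> \<and> (\<exists>n. jt \<omega> n < ennreal t \<and> ennreal t \<le> jt \<omega> (Suc n))
      then \<integral>\<^sup>+ a. ennreal (c (the (state_at \<omega> t), a)) \<partial>(polAt pol \<omega> t) else 0)"

definition path_cost :: "('s \<times> 'b \<Rightarrow> real) \<Rightarrow> ('s,'b) policy \<Rightarrow> 's path \<Rightarrow> ennreal" where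
  "path_cost c pol \<omega> = (\<integral>\<^sup>+ t\<in>{0..}. cost_rate c pol \<omega> t \<partial>lborel)"

definition jump_ratio :: "('s \<Rightarrow> 'b \<Rightarrow> 's set \<Rightarrow> real) \<Rightarrow> 's \<Rightarrow> 'b measure \<Rightarrow> 's set \<Rightarrow> real" where
  "jump_ratio q x \<mu> \<Gamma> = (\<integral>a. qt q x a \<Gamma> \<partial>\<mu>) / (\<integral>a. qx q x a \<partial>\<mu>)"

definition strategic ::
  "'s::topological_space set \<Rightarrow> 's measure \<Rightarrow> ('s \<Rightarrow> 'b \<Rightarrow> 's set \<Rightarrow> real) \<Rightarrow> ('s,'b) policy \<Rightarrow> 's path measure \<Rightarrow> bool" where
  "strategic S \<gamma> q pol P \<longleftrightarrow>
     sets P = sets (OmegaM S) \<and> prob_space P \<and> (AE \<omega> in P. \<omega> \<in> Omega S) \<and>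
     (\<forall>\<Gamma>\<in>sets (SM S). emeasure P {\<omega>\<in>space P. xs \<omega> 0 \<in> Some ` \<Gamma>} = emeasure \<gamma> \<Gamma>) \<and>
     (\<forall>n. \<forall>H\<in>sets (histM S n). \<forall>t>0.
        emeasure P {\<omega>\<in>space P. alive n \<omega> \<and> hist n \<omega> \<in> H \<and> ennreal t \<le> th \<omega> (Suc n)} =
        (\<integral>\<^sup>+ \<omega>\<in>{\<omega>\<in>space P. alive n \<omega> \<and> hist n \<omega> \<in> H}.
           ennreal (exp (- (LINT s:{0<..t}|lborel. (\<integral>a. qx q (snd (hist n \<omega>)) a \<partial>(pol n (hist n \<omega>, s)))))) \<partial>P)) \<and>
     (\<forall>n. \<forall>H\<in>sets (histM S n). \<forall>B\<in>sets (borel :: real measure). B \<subseteq> {0<..} \<longrightarrow> (\<forall>\<Gamma>\<in>sets (SM S).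
        emeasure P {\<omega>\<in>space P. alive n \<omega> \<and> hist n \<omega> \<in> H \<and> th \<omega> (Suc n) \<in> ennreal ` B \<and> xs \<omega> (Suc n) \<in> Some ` \<Gamma>} =
        (\<integral>\<^sup>+ \<omega>\<in>{\<omega>\<in>space P. alive n \<omega> \<and> hist n \<omega> \<in> H \<and> th \<omega> (Suc n) \<in> ennreal ` B}.
           ennreal (jump_ratio q (snd (hist n \<omega>)) (pol n (hist n \<omega>, enn2real (th \<omega> (Suc n)))) \<Gamma>) \<partial>P)))"

definition Pstrat :: "'s::topological_space set \<Rightarrow> 's measure \<Rightarrow> ('s \<Rightarrow> 'b \<Rightarrow> 's set \<Rightarrow> real) \<Rightarrow> ('s,'b) policy \<Rightarrow> 's path measure" where
  "Pstrat S \<gamma> q pol = (THE P. strategic S \<gamma> q pol P)"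

definition objective ::
  "'s::topological_space set \<Rightarrow> 's measure \<Rightarrow> ('s \<Rightarrow> 'b \<Rightarrow> 's set \<Rightarrow> real) \<Rightarrow> ('s \<times> 'b \<Rightarrow> real) \<Rightarrow> ('s,'b) policy \<Rightarrow> ennreal" where
  "objective S \<gamma> q c pol = (\<integral>\<^sup>+ \<omega>. path_cost c pol \<omega> \<partial>(Pstrat S \<gamma> q pol))"

definition feasible ::
  "'s::topological_space set \<Rightarrow> 'b::topological_space set \<Rightarrow> 's measure \<Rightarrow> ('s \<Rightarrow> 'b \<Rightarrow> 's set \<Rightarrow> real) \<Rightarrow>
   (nat \<Rightarrow> 's \<times> 'b \<Rightarrow> real) \<Rightarrow> nat \<Rightarrow> (nat \<Rightarrow> real) \<Rightarrow> ('s,'b) policy \<Rightarrow> bool" where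
  "feasible S A \<gamma> q c N d pol \<longleftrightarrow> is_policy S A pol \<and>
     (\<forall>j\<in>{1..N}. objective S \<gamma> q (c j) pol \<le> ennreal (d j))"

end

theory Submission
  imports Defs
begin

text \<open>
  With the jump kernel \<open>Q = q~ / q\<close> and the costs per jump \<open>c\<^sub>i / q\<close>, a policy of finite cost induces measures \<open>\<mu>\<^sub>n\<close>
  on state-action pairs, the \<open>n\<close>-th one describing the \<open>n\<close>-th sojourn: the state marginal of \<open>\<mu>\<^sub>0\<close> is \<open>\<gamma>\<close>, that of
  \<open>\<mu>\<^sub>n\<^sub>+\<^sub>1\<close> is \<open>\<mu>\<^sub>n Q\<close>, and the integrals of \<open>c\<^sub>i / q\<close> against \<open>\<Sum>n. \<mu>\<^sub>n\<close> are bounded by the objectives. Since the action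
  space is compact and \<open>Q\<close> is weakly continuous, sequences of such measures are weakly compact, and since \<open>c\<^sub>i / q\<close> is lower
  semicontinuous, a limit along a minimizing sequence of policies is at least as good.

  To return to a stationary policy, let \<open>V\<close> be the limit of value iteration for the sum of all costs. On \<open>V = 0\<close> there is
  a measurable selector which costs nothing and never leaves \<open>V = 0\<close>. On \<open>V > 0\<close> the measure \<open>\<Sum>n. \<mu>\<^sub>n / q\<close> is \<open>\<sigma>\<close>-finite,
  because the \<open>n\<close>-th iterate has a finite integral, and its disintegration over the state space is the policy sought: the
  occupation measure which it generates is dominated by \<open>\<Sum>n. \<mu>\<^sub>n\<close>.
\<close>

section \<open>Measures from positive functionals\<close>

definition pos_functional :: "'a measure \<Rightarrow> (('a \<Rightarrow> ennreal) \<Rightarrow> ennreal) \<Rightarrow> bool" where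
  "pos_functional M \<Phi> \<longleftrightarrow>
    (\<forall>f g. (\<forall>x\<in>space M. f x = g x) \<longrightarrow> \<Phi> f = \<Phi> g) \<and>
    (\<forall>f\<in>borel_measurable M. \<forall>g\<in>borel_measurable M. \<Phi> (\<lambda>x. f x + g x) = \<Phi> f + \<Phi> g) \<and>
    (\<forall>f\<in>borel_measurable M. \<forall>c. \<Phi> (\<lambda>x. c * f x) = c * \<Phi> f) \<and>
    (\<forall>F. (\<forall>i::nat. F i \<in> borel_measurable M) \<longrightarrow> incseq F \<longrightarrow> \<Phi> (\<lambda>x. SUP i. F i x) = (SUP i. \<Phi> (F i)))"

definition functional_measure :: "'a measure \<Rightarrow> (('a \<Rightarrow> ennreal) \<Rightarrow> ennreal) \<Rightarrow> 'a measure" where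
  "functional_measure M \<Phi> = measure_of (space M) (sets M) (\<lambda>E. \<Phi> (indicator E))"

lemma pos_functionalD:
  assumes "pos_functional M \<Phi>"
  shows "(\<And>x. x \<in> space M \<Longrightarrow> f x = g x) \<Longrightarrow> \<Phi> f = \<Phi> g"
    and "f \<in> borel_measurable M \<Longrightarrow> g \<in> borel_measurable M \<Longrightarrow> \<Phi> (\<lambda>x. f x + g x) = \<Phi> f + \<Phi> g"
    and "f \<in> borel_measurable M \<Longrightarrow> \<Phi> (\<lambda>x. c * f x) = c * \<Phi> f"
    and "(\<And>i::nat. F i \<in> borel_measurable M) \<Longrightarrow> incseq F \<Longrightarrow> \<Phi> (\<lambda>x. SUP i. F i x) = (SUP i. \<Phi> (F i))"
  using assms by (simp_all add: pos_functional_def)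

lemma pos_functional_zero: "pos_functional M \<Phi> \<Longrightarrow> \<Phi> (\<lambda>x. 0) = 0"
  using pos_functionalD(3)[of M \<Phi> "\<lambda>x. 0" 0] by simp

lemma sets_functional_measure[simp, measurable_cong]: "sets (functional_measure M \<Phi>) = sets M"
  and space_functional_measure[simp]: "space (functional_measure M \<Phi>) = space M"
  by (simp_all add: functional_measure_def)

lemma pos_functional_sum:
  assumes \<Phi>: "pos_functional M \<Phi>" and f: "\<And>i. i \<in> I \<Longrightarrow> f i \<in> borel_measurable M"
  shows "\<Phi> (\<lambda>x. \<Sum>i\<in>I. f i x) = (\<Sum>i\<in>I. \<Phi> (f i))"
  using f
proof (induction I rule: infinite_finite_induct)
  case (insert i I)
  then show ?case using pos_functionalD(2)[OF \<Phi>, of "f i" "\<lambda>x. \<Sum>i\<in>I. f i x"] by simp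
qed (simp_all add: pos_functional_zero[OF \<Phi>])

lemma emeasure_functional_measure:
  assumes \<Phi>: "pos_functional M \<Phi>" and E: "E \<in> sets M"
  shows "emeasure (functional_measure M \<Phi>) E = \<Phi> (indicator E)"
  unfolding functional_measure_def
proof (rule emeasure_measure_of_sigma)
  show "sigma_algebra (space M) (sets M)" ..
  show "positive (sets M) (\<lambda>E. \<Phi> (indicator E))"
    using pos_functional_zero[OF \<Phi>] by (simp add: positive_def indicator_def[abs_def])
  show "countably_additive (sets M) (\<lambda>E. \<Phi> (indicator E))"
    unfolding countably_additive_def
  proof (intro allI impI)
    fix F :: "nat \<Rightarrow> 'a set" assume F: "range F \<subseteq> sets M" "disjoint_family F"
    then have [measurable]: "F i \<in> sets M" for i by auto
    have "\<Phi> (indicator (\<Union>i. F i)) = \<Phi> (\<lambda>x. SUP n. \<Sum>i<n. indicator (F i) x)"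
      by (rule pos_functionalD(1)[OF \<Phi>]) (simp add: suminf_indicator[OF F(2), symmetric] suminf_eq_SUP)
    also have "\<dots> = (SUP n. \<Phi> (\<lambda>x. \<Sum>i<n. indicator (F i) x))"
      by (rule pos_functionalD(4)[OF \<Phi>]) (auto simp: incseq_def le_fun_def intro!: sum_mono2)
    also have "\<dots> = (\<Sum>i. \<Phi> (indicator (F i)))"
      using pos_functional_sum[OF \<Phi>, of _ "\<lambda>i. indicator (F i)"] by (simp add: suminf_eq_SUP)
    finally show "(\<Sum>i. \<Phi> (indicator (F i))) = \<Phi> (indicator (\<Union>i. F i))" ..
  qed
qed fact

lemma nn_integral_functional_measure:
  assumes \<Phi>: "pos_functional M \<Phi>" and f: "f \<in> borel_measurable M"
  shows "(\<integral>\<^sup>+x. f x \<partial>functional_measure M \<Phi>) = \<Phi> f"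
  using f
proof (induction rule: borel_measurable_induct)
  case (cong f g)
  then show ?case
    using pos_functionalD(1)[OF \<Phi>, of f g] nn_integral_cong[of "functional_measure M \<Phi>" f g] by simp
next
  case (set A)
  then show ?case by (simp add: emeasure_functional_measure[OF \<Phi>])
next
  case (mult u c)
  then show ?case by (simp add: nn_integral_cmult pos_functionalD(3)[OF \<Phi>])
next
  case (add u v)
  then show ?case by (simp add: nn_integral_add pos_functionalD(2)[OF \<Phi>])
next
  case (seq U)
  have "(\<integral>\<^sup>+x. (SUP i. U i) x \<partial>functional_measure M \<Phi>) = (\<integral>\<^sup>+x. (SUP i. U i x) \<partial>functional_measure M \<Phi>)"
    by (simp add: image_comp)
  also have "\<dots> = (SUP i. \<Phi> (U i))"
    using seq by (subst nn_integral_monotone_convergence_SUP) auto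
  also have "\<dots> = \<Phi> (\<lambda>x. SUP i. U i x)"
    using seq by (simp add: pos_functionalD(4)[OF \<Phi>])
  finally show ?case by (simp add: image_comp SUP_apply[abs_def])
qed

lemma pos_functional_nn_integral: "sets N = sets M \<Longrightarrow> pos_functional M (\<lambda>f. \<integral>\<^sup>+x. f x \<partial>N)"
  unfolding pos_functional_def
  by (auto simp: nn_integral_add nn_integral_cmult measurable_cong_sets[of N M] sets_eq_imp_space_eq[of N M]
    nn_integral_monotone_convergence_SUP intro!: nn_integral_cong)

lemma pos_functional_eval: "x \<in> space M \<Longrightarrow> pos_functional M (\<lambda>f. f x)"
  unfolding pos_functional_def by auto

lemma incseq_pos_functional:
  assumes \<Phi>: "pos_functional M \<Phi>" and F: "\<And>i::nat. F i \<in> borel_measurable M" "incseq F"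
  shows "incseq (\<lambda>i. \<Phi> (F i))"
proof (rule incseq_SucI)
  fix i
  have [measurable]: "F i \<in> borel_measurable M" for i by fact
  have "\<Phi> (F (Suc i)) = \<Phi> (\<lambda>x. F i x + (F (Suc i) x - F i x))"
    using incseq_SucD[OF F(2), of i]
    by (intro pos_functionalD(1)[OF \<Phi>]) (simp add: le_fun_def add_diff_inverse_ennreal)
  also have "\<dots> = \<Phi> (F i) + \<Phi> (\<lambda>x. F (Suc i) x - F i x)" by (rule pos_functionalD(2)[OF \<Phi>]) simp_all
  finally show "\<Phi> (F i) \<le> \<Phi> (F (Suc i))" by simp
qed

lemma pos_functional_integral:
  assumes \<Phi>: "\<And>h. h \<in> space L \<Longrightarrow> pos_functional M (\<Phi> h)"
    and meas: "\<And>f. f \<in> borel_measurable M \<Longrightarrow> (\<lambda>h. \<Phi> h f) \<in> borel_measurable L"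
  shows "pos_functional M (\<lambda>f. \<integral>\<^sup>+h. \<Phi> h f \<partial>L)"
  unfolding pos_functional_def
proof (intro conjI allI ballI impI)
  fix f g :: "_ \<Rightarrow> ennreal" assume "\<forall>x\<in>space M. f x = g x"
  then show "(\<integral>\<^sup>+h. \<Phi> h f \<partial>L) = (\<integral>\<^sup>+h. \<Phi> h g \<partial>L)"
    by (intro nn_integral_cong pos_functionalD(1)[OF \<Phi>]) simp_all
next
  fix f g :: "_ \<Rightarrow> ennreal" assume f: "f \<in> borel_measurable M" and g: "g \<in> borel_measurable M"
  have "(\<integral>\<^sup>+h. \<Phi> h (\<lambda>x. f x + g x) \<partial>L) = (\<integral>\<^sup>+h. \<Phi> h f + \<Phi> h g \<partial>L)"
    using pos_functionalD(2)[OF \<Phi> f g] by (intro nn_integral_cong) auto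
  then show "(\<integral>\<^sup>+h. \<Phi> h (\<lambda>x. f x + g x) \<partial>L) = (\<integral>\<^sup>+h. \<Phi> h f \<partial>L) + (\<integral>\<^sup>+h. \<Phi> h g \<partial>L)"
    using meas f g by (simp add: nn_integral_add)
next
  fix f :: "_ \<Rightarrow> ennreal" and c :: ennreal assume f: "f \<in> borel_measurable M"
  have "(\<integral>\<^sup>+h. \<Phi> h (\<lambda>x. c * f x) \<partial>L) = (\<integral>\<^sup>+h. c * \<Phi> h f \<partial>L)"
    using pos_functionalD(3)[OF \<Phi> f] by (intro nn_integral_cong) auto
  then show "(\<integral>\<^sup>+h. \<Phi> h (\<lambda>x. c * f x) \<partial>L) = c * (\<integral>\<^sup>+h. \<Phi> h f \<partial>L)"
    using meas f by (simp add: nn_integral_cmult)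
next
  fix F :: "nat \<Rightarrow> _ \<Rightarrow> ennreal" assume F: "\<forall>i. F i \<in> borel_measurable M" "incseq F"
  have "(\<integral>\<^sup>+h. \<Phi> h (\<lambda>x. SUP i. F i x) \<partial>L) = (\<integral>\<^sup>+h. (SUP i. \<Phi> h (F i)) \<partial>L)"
    using pos_functionalD(4)[OF \<Phi>] F by (intro nn_integral_cong) auto
  also have "\<dots> = (SUP i. \<integral>\<^sup>+h. \<Phi> h (F i) \<partial>L)"
    using meas F incseq_pos_functional[OF \<Phi>, of _ F]
    by (intro nn_integral_monotone_convergence_SUP_AE) (auto simp: incseq_Suc_iff)
  finally show "(\<integral>\<^sup>+h. \<Phi> h (\<lambda>x. SUP i. F i x) \<partial>L) = (SUP i. \<integral>\<^sup>+h. \<Phi> h (F i) \<partial>L)" .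
qed

lemma pos_functional_cmult: "pos_functional M \<Phi> \<Longrightarrow> pos_functional M (\<lambda>f. c * \<Phi> f)"
  unfolding pos_functional_def
  by (intro conjI allI impI ballI; elim conjE)
    (simp_all add: distrib_left SUP_mult_left_ennreal mult.left_commute, metis)

lemma pos_functional_add:
  assumes "pos_functional M \<Phi>" "pos_functional M \<Psi>"
  shows "pos_functional M (\<lambda>f. \<Phi> f + \<Psi> f)"
  unfolding pos_functional_def
proof (intro conjI allI ballI impI)
  fix f g :: "_ \<Rightarrow> ennreal" assume "\<forall>x\<in>space M. f x = g x"
  then show "\<Phi> f + \<Psi> f = \<Phi> g + \<Psi> g"
    using pos_functionalD(1)[OF assms(1), of f g] pos_functionalD(1)[OF assms(2), of f g] by simp
next
  fix F :: "nat \<Rightarrow> _ \<Rightarrow> ennreal" assume F: "\<forall>i. F i \<in> borel_measurable M" "incseq F"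
  show "\<Phi> (\<lambda>x. SUP i. F i x) + \<Psi> (\<lambda>x. SUP i. F i x) = (SUP i. \<Phi> (F i) + \<Psi> (F i))"
    using F by (simp add: pos_functionalD(4)[OF assms(1)] pos_functionalD(4)[OF assms(2)]
       ennreal_SUP_add[symmetric] incseq_pos_functional[OF assms(1)] incseq_pos_functional[OF assms(2)])
qed (simp_all add: pos_functionalD(2-3)[OF assms(1)] pos_functionalD(2-3)[OF assms(2)] distrib_left ac_simps)

lemma pos_functional_suminf:
  assumes "\<And>n::nat. pos_functional M (\<Phi> n)"
  shows "pos_functional M (\<lambda>f. \<Sum>n. \<Phi> n f)"
  using pos_functional_integral[of "count_space UNIV" M \<Phi>] assms
  by (simp add: nn_integral_count_space_nat)

lemma pos_functional_map:
  assumes \<Phi>: "pos_functional M \<Phi>" and T: "T \<in> measurable M N"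
  shows "pos_functional N (\<lambda>f. \<Phi> (\<lambda>x. f (T x)))"
  unfolding pos_functional_def
proof (intro conjI allI ballI impI)
  fix f g :: "_ \<Rightarrow> ennreal" assume "\<forall>x\<in>space N. f x = g x"
  then show "\<Phi> (\<lambda>x. f (T x)) = \<Phi> (\<lambda>x. g (T x))"
    using measurable_space[OF T] by (intro pos_functionalD(1)[OF \<Phi>]) auto
next
  fix F :: "nat \<Rightarrow> _ \<Rightarrow> ennreal" assume F: "\<forall>i. F i \<in> borel_measurable N" "incseq F"
  have [measurable]: "F i \<in> borel_measurable N" "T \<in> measurable M N" for i using F T by auto
  show "\<Phi> (\<lambda>x. SUP i. F i (T x)) = (SUP i. \<Phi> (\<lambda>x. F i (T x)))"
    using F(2) by (intro pos_functionalD(4)[OF \<Phi>]) (auto simp: incseq_def le_fun_def)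
qed (use T in \<open>simp_all add: pos_functionalD(2-3)[OF \<Phi>]\<close>)

lemma pos_functional_density:
  assumes \<Phi>: "pos_functional M \<Phi>" and w: "w \<in> borel_measurable M"
  shows "pos_functional M (\<lambda>f. \<Phi> (\<lambda>x. w x * f x))"
  unfolding pos_functional_def
proof (intro conjI allI ballI impI)
  fix f :: "_ \<Rightarrow> ennreal" and c :: ennreal assume f: "f \<in> borel_measurable M"
  show "\<Phi> (\<lambda>x. w x * (c * f x)) = c * \<Phi> (\<lambda>x. w x * f x)"
    using pos_functionalD(3)[OF \<Phi>, of "\<lambda>x. w x * f x" c] f w by (simp add: ac_simps)
next
  fix F :: "nat \<Rightarrow> _ \<Rightarrow> ennreal" assume F: "\<forall>i. F i \<in> borel_measurable M" "incseq F"
  have [measurable]: "F i \<in> borel_measurable M" "w \<in> borel_measurable M" for i using F w by auto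
  have "\<Phi> (\<lambda>x. w x * (SUP i. F i x)) = \<Phi> (\<lambda>x. SUP i. w x * F i x)"
    by (simp add: SUP_mult_left_ennreal)
  also have "\<dots> = (SUP i. \<Phi> (\<lambda>x. w x * F i x))"
    using F(2)
    by (intro pos_functionalD(4)[OF \<Phi>]) (auto simp: incseq_def le_fun_def intro!: mult_left_mono)
  finally show "\<Phi> (\<lambda>x. w x * (SUP i. F i x)) = (SUP i. \<Phi> (\<lambda>x. w x * F i x))" .
next
  fix f g :: "_ \<Rightarrow> ennreal" assume "\<forall>x\<in>space M. f x = g x"
  then show "\<Phi> (\<lambda>x. w x * f x) = \<Phi> (\<lambda>x. w x * g x)" by (intro pos_functionalD(1)[OF \<Phi>]) simp
qed (use w in \<open>simp_all add: pos_functionalD(2)[OF \<Phi>] distrib_left\<close>)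

lemma pos_functional_eqI:
  assumes \<Phi>: "pos_functional M \<Phi>" and \<Psi>: "pos_functional M \<Psi>"
    and G: "Int_stable G" "G \<subseteq> Pow (space M)" "sets M = sigma_sets (space M) G"
    and C: "range C \<subseteq> G" "(\<Union>i::nat. C i) = space M" "\<And>i. \<Phi> (indicator (C i)) \<noteq> \<infinity>"
    and eq: "\<And>X. X \<in> G \<Longrightarrow> \<Phi> (indicator X) = \<Psi> (indicator X)" and f: "f \<in> borel_measurable M"
  shows "\<Phi> f = \<Psi> f"
proof -
  have G_sets: "X \<in> sets M" if "X \<in> G" for X using that by (simp add: G(3))
  have "functional_measure M \<Phi> = functional_measure M \<Psi>"
  proof (rule measure_eqI_generator_eq[OF G(1,2) _ _ _ C(1,2)])
    show "emeasure (functional_measure M \<Phi>) X = emeasure (functional_measure M \<Psi>) X" if "X \<in> G" for X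
      using eq[OF that] G_sets[OF that] by (simp add: emeasure_functional_measure \<Phi> \<Psi>)
    show "emeasure (functional_measure M \<Phi>) (C i) \<noteq> \<infinity>" for i
      using C(1,3) G_sets by (simp add: emeasure_functional_measure \<Phi> image_subset_iff)
  qed (simp_all add: G(3))
  then show ?thesis
    using nn_integral_functional_measure[OF \<Phi> f] nn_integral_functional_measure[OF \<Psi> f] by simp
qed

lemma sets_pair_measure_generator:
  assumes G: "G \<subseteq> Pow (space N)" "sets N = sigma_sets (space N) G"
    and C: "range C \<subseteq> G" "(\<Union>i::nat. C i) = space N"
  shows "sets (M \<Otimes>\<^sub>M N) = sigma_sets (space (M \<Otimes>\<^sub>M N)) {X \<times> Y |X Y. X \<in> sets M \<and> Y \<in> G}"
proof -
  have "sets (M \<Otimes>\<^sub>M N) = sets (sigma (space M \<times> space N) {X \<times> Y |X Y. X \<in> sets M \<and> Y \<in> G})"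
    by (rule sets_pair_eq[where Ca="{space M}" and Cb="range C"])
      (use G C sets.space_closed[of M] in \<open>auto simp: sets.sigma_sets_eq\<close>)
  also have "\<dots> = sigma_sets (space M \<times> space N) {X \<times> Y |X Y. X \<in> sets M \<and> Y \<in> G}"
    using G(1) sets.space_closed[of M] by (intro sets_measure_of) blast
  finally show ?thesis by (simp add: space_pair_measure)
qed

lemma pos_functional_pair_eqI:
  assumes \<Phi>: "pos_functional (M \<Otimes>\<^sub>M N) \<Phi>" and \<Psi>: "pos_functional (M \<Otimes>\<^sub>M N) \<Psi>"
    and G: "Int_stable G" "G \<subseteq> Pow (space N)" "sets N = sigma_sets (space N) G"
    and C: "range C \<subseteq> G" "(\<Union>i::nat. C i) = space N" "\<And>i. \<Phi> (indicator (space M \<times> C i)) \<noteq> \<infinity>"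
    and eq: "\<And>X Y. X \<in> sets M \<Longrightarrow> Y \<in> G \<Longrightarrow> \<Phi> (indicator (X \<times> Y)) = \<Psi> (indicator (X \<times> Y))"
    and f: "f \<in> borel_measurable (M \<Otimes>\<^sub>M N)"
  shows "\<Phi> f = \<Psi> f"
proof (rule pos_functional_eqI[OF \<Phi> \<Psi> _ _ sets_pair_measure_generator[OF G(2,3) C(1,2)] _ _ _ _ f])
  show "Int_stable {X \<times> Y |X Y. X \<in> sets M \<and> Y \<in> G}"
  proof (rule Int_stableI, clarify)
    fix X Y X' Y' assume "X \<in> sets M" "Y \<in> G" "X' \<in> sets M" "Y' \<in> G"
    then show "\<exists>X'' Y''. (X \<times> Y) \<inter> (X' \<times> Y') = X'' \<times> Y'' \<and> X'' \<in> sets M \<and> Y'' \<in> G"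
      using Int_stableD[OF G(1)]
      by (intro exI[of _ "X \<inter> X'"] exI[of _ "Y \<inter> Y'"]) (simp add: Times_Int_Times)
  qed
  show "{X \<times> Y |X Y. X \<in> sets M \<and> Y \<in> G} \<subseteq> Pow (space (M \<Otimes>\<^sub>M N))"
    using G(2) sets.sets_into_space by (fastforce simp: space_pair_measure)
  show "range (\<lambda>i. space M \<times> C i) \<subseteq> {X \<times> Y |X Y. X \<in> sets M \<and> Y \<in> G}" using C(1) by blast
  show "(\<Union>i. space M \<times> C i) = space (M \<Otimes>\<^sub>M N)" using C(2) by (auto simp: space_pair_measure)
qed (use C(3) eq in auto)

section \<open>Lower semicontinuous functions\<close>

definition lsc :: "'a::topological_space set \<Rightarrow> ('a \<Rightarrow> ennreal) \<Rightarrow> bool" where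
  "lsc T f \<longleftrightarrow> (\<forall>r. openin (top_of_set T) {z\<in>T. r < f z})"

lemma lscD: "lsc T f \<Longrightarrow> openin (top_of_set T) {z\<in>T. r < f z}"
  by (simp add: lsc_def)

lemma lsc_cong: "(\<And>z. z \<in> T \<Longrightarrow> f z = g z) \<Longrightarrow> lsc T f \<longleftrightarrow> lsc T g"
  unfolding lsc_def by (auto intro!: arg_cong[where f="openin _"] cong: conj_cong)

lemma lsc_SUP: "(\<And>i. i \<in> I \<Longrightarrow> lsc T (f i)) \<Longrightarrow> lsc T (\<lambda>z. SUP i\<in>I. f i z)"
proof (unfold lsc_def, intro allI)
  fix r :: ennreal assume open_i: "\<And>i. i \<in> I \<Longrightarrow> \<forall>r. openin (top_of_set T) {z \<in> T. r < f i z}"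
  have "{z \<in> T. r < (SUP i\<in>I. f i z)} = (\<Union>i\<in>I. {z \<in> T. r < f i z})" by (auto simp: less_SUP_iff)
  then show "openin (top_of_set T) {z \<in> T. r < (SUP i\<in>I. f i z)}" using open_i by auto
qed

lemma continuous_imp_lsc:
  fixes f :: "'a::topological_space \<Rightarrow> real"
  assumes "continuous_on T f" shows "lsc T (\<lambda>z. ennreal (f z))"
  unfolding lsc_def
proof
  fix r
  have "continuous_on T (\<lambda>z. ennreal (f z))" using assms by (intro continuous_on_ennreal)
  then have "openin (top_of_set T) (T \<inter> (\<lambda>z. ennreal (f z)) -` {r<..})"
    by (rule continuous_openin_preimage_gen) simp
  moreover have "T \<inter> (\<lambda>z. ennreal (f z)) -` {r<..} = {z\<in>T. r < ennreal (f z)}" by auto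
  ultimately show "openin (top_of_set T) {z\<in>T. r < ennreal (f z)}" by simp
qed

lemma lsc_subset: "lsc T f \<Longrightarrow> U \<subseteq> T \<Longrightarrow> lsc U f"
  unfolding lsc_def
proof
  fix r assume T: "\<forall>r. openin (top_of_set T) {z \<in> T. r < f z}" "U \<subseteq> T"
  then obtain V where V: "open V" "{z \<in> T. r < f z} = T \<inter> V" by (metis openin_open)
  then have "{z \<in> U. r < f z} = U \<inter> V" using T(2) by blast
  then show "openin (top_of_set U) {z \<in> U. r < f z}" using V by (auto simp: openin_open)
qed

lemma lsc_compose:
  assumes f: "lsc T f" and g: "continuous_on U g" "g \<in> U \<rightarrow> T"
  shows "lsc U (\<lambda>x. f (g x))"
  unfolding lsc_def
proof
  fix r
  have "openin (top_of_set U) (U \<inter> g -` {z\<in>T. r < f z})"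
    by (rule continuous_openin_preimage[OF g lscD[OF f]])
  moreover have "U \<inter> g -` {z\<in>T. r < f z} = {x\<in>U. r < f (g x)}" using g(2) by auto
  ultimately show "openin (top_of_set U) {x\<in>U. r < f (g x)}" by simp
qed

lemma closedin_fst_image:
  assumes "compact K" "closedin (top_of_set (T \<times> K)) F"
  shows "closedin (top_of_set T) (fst ` F)"
proof -
  have "compact_space (top_of_set K)" using assms(1) by (simp add: compact_space_subtopology)
  then have "closed_map (prod_topology (top_of_set T) (top_of_set K)) (top_of_set T) fst"
    by (rule Abstract_Topological_Spaces.closed_map_fst)
  moreover have "closedin (prod_topology (top_of_set T) (top_of_set K)) F"
    using assms(2) by simp
  ultimately show ?thesis by (auto simp: closed_map_def)
qed

lemma lsc_attains_INF:
  assumes f: "lsc K f" and K: "compact K" "K \<noteq> {}"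
  shows "\<exists>y\<in>K. f y = (INF y\<in>K. f y)"
proof (rule ccontr)
  assume not_attained: "\<not> ?thesis"
  define above where "above y = {z\<in>K. f y < f z}" for y
  have "\<exists>z\<in>K. f z < f y" if "y \<in> K" for y
    using not_attained that INF_lower[OF that, of f] by (metis INF_less_iff order_le_less)
  then have cover: "K \<subseteq> \<Union>(above ` K)" by (auto simp: above_def)
  moreover have "\<forall>U\<in>above ` K. openin (top_of_set K) U" using lscD[OF f] by (auto simp: above_def)
  ultimately obtain \<D> where "\<D> \<subseteq> above ` K" "finite \<D>" "K \<subseteq> \<Union>\<D>"
    using K(1) unfolding compact_eq_openin_cover by meson
  then obtain Y where Y: "Y \<subseteq> K" "finite Y" "K \<subseteq> \<Union>(above ` Y)" by (metis finite_subset_image)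
  then have "Y \<noteq> {}" using K(2) by auto
  then obtain y where y: "y \<in> Y" "\<And>z. z \<in> Y \<Longrightarrow> f y \<le> f z"
    using Y(2) by (metis arg_min_if_finite(1,2) not_le)
  then have "y \<in> \<Union>(above ` Y)" using Y by blast
  then show False using y(2) by (force simp: above_def not_le)
qed

lemma lsc_INF:
  assumes f: "lsc (T \<times> K) f" and K: "compact K" "K \<noteq> {}"
  shows "lsc T (\<lambda>x. INF y\<in>K. f (x, y))"
  unfolding lsc_def
proof
  fix r
  have closed_sublevel: "closedin (top_of_set (T \<times> K)) (T \<times> K - {z \<in> T \<times> K. r < f z})"
    using closedin_diff[OF closedin_topspace lscD[OF f, of r]] by simp
  have "r < (INF y\<in>K. f (x, y)) \<longleftrightarrow> (\<forall>y\<in>K. r < f (x, y))" if "x \<in> T" for x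
  proof -
    have "lsc K (\<lambda>y. f (x, y))" using that by (intro lsc_compose[OF f] continuous_intros) auto
    from lsc_attains_INF[OF this K] show ?thesis by (metis INF_lower less_le_trans)
  qed
  then have "{x \<in> T. r < (INF y\<in>K. f (x, y))} = T - fst ` (T \<times> K - {z \<in> T \<times> K. r < f z})"
    by (force simp: image_iff)
  then show "openin (top_of_set T) {x \<in> T. r < (INF y\<in>K. f (x, y))}"
    using openin_diff[OF openin_topspace closedin_fst_image[OF K(1) closed_sublevel]] by simp
qed

definition dense_seq :: "nat \<Rightarrow> 'a::{metric_space,second_countable_topology}" where
  "dense_seq = (SOME f. \<forall>X. open X \<longrightarrow> X \<noteq> {} \<longrightarrow> (\<exists>n. f n \<in> X))"

lemma dense_seq: "open X \<Longrightarrow> X \<noteq> {} \<Longrightarrow> \<exists>n. dense_seq n \<in> X"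
proof -
  obtain D :: "'a set" where D: "countable D" "\<And>X. open X \<Longrightarrow> X \<noteq> {} \<Longrightarrow> \<exists>d\<in>D. d \<in> X"
    by (rule countable_dense_setE) blast
  have "D \<noteq> {}" using D(2)[of UNIV] by auto
  then have "range (from_nat_into D) = D" using D(1) by (rule range_from_nat_into)
  then have "\<exists>f::nat\<Rightarrow>'a. \<forall>X. open X \<longrightarrow> X \<noteq> {} \<longrightarrow> (\<exists>n. f n \<in> X)"
    using D(2) by (intro exI[of _ "from_nat_into D"]) (metis imageE)
  from someI_ex[OF this] show "open X \<Longrightarrow> X \<noteq> {} \<Longrightarrow> \<exists>n. dense_seq n \<in> X"
    unfolding dense_seq_def by blast
qed

definition tent :: "nat \<Rightarrow> 'a::{metric_space,second_countable_topology} \<Rightarrow> real" where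
  "tent l z = max 0 (1 - real (snd (prod_decode l)) * dist z (dense_seq (fst (prod_decode l))))"

lemma tent_nonneg: "0 \<le> tent l z" and tent_le_1: "tent l z \<le> 1"
  by (auto simp: tent_def)

lemma continuous_on_tent[continuous_intros]: "continuous_on X f \<Longrightarrow> continuous_on X (\<lambda>x. tent l (f x))"
  unfolding tent_def by (intro continuous_intros)

lemma measurable_tent[measurable]: "tent l \<in> borel_measurable borel"
  by (intro borel_measurable_continuous_onI continuous_intros)

lemma tent_lipschitz: "\<bar>tent l y - tent l z\<bar> \<le> real l * dist y z"
proof -
  let ?n = "real (snd (prod_decode l))" and ?d = "dense_seq (fst (prod_decode l)) :: 'a"
  have "snd (prod_decode l) \<le> l" by (metis le_prod_encode_2 prod.collapse prod_decode_inverse)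
  then have n: "?n * dist y z \<le> real l * dist y z" by (intro mult_right_mono) auto
  have "\<bar>tent l y - tent l z\<bar> \<le> \<bar>?n * dist z ?d - ?n * dist y ?d\<bar>" unfolding tent_def by auto
  also have "\<dots> = ?n * \<bar>dist z ?d - dist y ?d\<bar>" by (simp add: abs_mult flip: right_diff_distrib)
  also have "\<dots> \<le> ?n * dist y z"
    using dist_triangle[of z ?d y] dist_triangle[of y ?d z]
    by (intro mult_left_mono) (auto simp: dist_commute)
  finally show ?thesis using n by simp
qed

lemma tent_local:
  assumes "0 < \<delta>" "c < 1"
  shows "\<exists>l. c < tent l z \<and> (\<forall>y. 0 < tent l y \<longrightarrow> dist y z < \<delta>)"
proof -
  obtain n :: nat where n: "2 / \<delta> < real n" using reals_Archimedean2 by blast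
  then have n_pos: "0 < real n" using assms(1) by (meson divide_pos_pos less_trans zero_less_numeral)
  define \<epsilon> where "\<epsilon> = min (\<delta> / 2) ((1 - c) / real n)"
  have "0 < \<epsilon>" using assms n_pos by (simp add: \<epsilon>_def)
  then obtain i where i: "dense_seq i \<in> ball z \<epsilon>" using dense_seq[of "ball z \<epsilon>"] by auto
  define l where "l = prod_encode (i, n)"
  have t: "tent l y = max 0 (1 - real n * dist y (dense_seq i))" for y :: 'a
    by (simp add: tent_def l_def)
  have "real n * dist z (dense_seq i) < real n * ((1 - c) / real n)"
    using i n_pos by (intro mult_strict_left_mono) (auto simp: \<epsilon>_def)
  then have "c < tent l z" using n_pos by (simp add: t)
  moreover have "dist y z < \<delta>" if "0 < tent l y" for y
  proof -
    have "real n * dist y (dense_seq i) < 1" using that by (simp add: t)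
    then have "dist y (dense_seq i) < 1 / real n" using n_pos by (simp add: field_simps)
    also have "\<dots> < \<delta> / 2" using n n_pos assms(1) by (simp add: field_simps)
    finally have "dist y (dense_seq i) < \<delta> / 2" .
    moreover have "dist z (dense_seq i) < \<delta> / 2" using i by (simp add: \<epsilon>_def)
    ultimately show ?thesis by (metis dist_triangle_half_l dist_commute)
  qed
  ultimately show ?thesis by auto
qed

lemma tent_separates: "(\<And>l. tent l y = tent l z) \<Longrightarrow> y = z"
  using tent_local[of "dist y z" 0 z]
  by (metis dist_commute less_irrefl zero_less_dist_iff zero_less_one)

lemma ex_tent_minorant:
  fixes h :: "'a::{metric_space,second_countable_topology} \<Rightarrow> ennreal"
  assumes h: "lsc T h" and z: "z \<in> T" and y: "y < h z"
  shows "\<exists>w l. w \<in> \<rat> \<and> 0 \<le> w \<and> y \<le> ennreal (w * tent l z) \<and> (\<forall>z'\<in>T. ennreal (w * tent l z') \<le> h z')"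
proof -
  obtain y' where y': "y < y'" "y' < h z" using dense y by blast
  then obtain b where b: "y' = ennreal b" "0 \<le> b" by (cases y') auto
  then obtain a where a: "y = ennreal a" "0 \<le> a" using y' by (cases y) auto
  have "a < b" using y' a b by (simp add: ennreal_less_iff)
  then obtain w where w: "w \<in> \<rat>" "a < w" "w < b" using Rats_dense_in_real by blast
  have "ennreal w < h z" using w y' b a by (meson ennreal_leI le_less_trans less_imp_le)
  moreover obtain U where U: "open U" "{z\<in>T. ennreal w < h z} = T \<inter> U"
    using lscD[OF h, of "ennreal w"] by (auto simp: openin_open)
  ultimately obtain \<delta> where \<delta>: "0 < \<delta>" "ball z \<delta> \<subseteq> U" using z openE by blast
  obtain l where l: "a / w < tent l z" "\<And>z'. 0 < tent l z' \<Longrightarrow> dist z' z < \<delta>"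
    using tent_local[OF \<delta>(1), of "a / w" z] w a by auto
  have "ennreal (w * tent l z') \<le> h z'" if "z' \<in> T" for z'
  proof (cases "0 < tent l z'")
    case True
    have "ennreal (w * tent l z') \<le> ennreal w"
      using w a tent_le_1[of l z'] by (intro ennreal_leI) (simp add: mult_left_le)
    also have "\<dots> < h z'" using l(2)[OF True] \<delta>(2) U(2) that by (auto simp: dist_commute subset_iff)
    finally show ?thesis by simp
  next
    case False
    then show ?thesis using tent_nonneg[of l z'] by simp
  qed
  moreover have "a \<le> w * tent l z" using l(1) w a by (simp add: divide_less_eq mult.commute)
  ultimately show ?thesis using w a by (intro exI[of _ w] exI[of _ l]) (auto intro: ennreal_leI)
qed

lemma lsc_eq_SUP_tent:
  fixes h :: "'a::{metric_space,second_countable_topology} \<Rightarrow> ennreal"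
  assumes h: "lsc T h"
  obtains r :: "nat \<Rightarrow> real" and j :: "nat \<Rightarrow> nat"
  where "\<And>k. 0 \<le> r k" "\<And>z. z \<in> T \<Longrightarrow> h z = (SUP k. ennreal (r k * tent (j k) z))"
proof -
  define C where "C = {(w, l). w \<in> \<rat> \<and> 0 \<le> w \<and> (\<forall>z\<in>T. ennreal (w * tent l z) \<le> h z)}"
  have "countable C" by (rule countable_subset[of _ "\<rat> \<times> UNIV"]) (auto simp: C_def countable_rat)
  moreover have "(0, 0) \<in> C" by (simp add: C_def)
  ultimately have range: "range (from_nat_into C) = C" by (intro range_from_nat_into) auto
  have p: "from_nat_into C k \<in> C" for k using range by blast
  define r j where "r k = fst (from_nat_into C k)" and "j k = snd (from_nat_into C k)" for k
  have minorant: "0 \<le> r k" "z \<in> T \<Longrightarrow> ennreal (r k * tent (j k) z) \<le> h z" for k z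
    using p[of k] by (auto simp: r_def j_def C_def)
  have "h z \<le> (SUP k. ennreal (r k * tent (j k) z))" if z: "z \<in> T" for z
  proof (rule dense_le)
    fix y assume "y < h z"
    then obtain w l where "y \<le> ennreal (w * tent l z)" "(w, l) \<in> C"
      using ex_tent_minorant[OF h z, of y] unfolding C_def by blast
    moreover then obtain k where "from_nat_into C k = (w, l)" using range by (metis imageE)
    then have "w = r k" "l = j k" by (simp_all add: r_def j_def)
    ultimately show "y \<le> (SUP k. ennreal (r k * tent (j k) z))" by (auto intro: SUP_upper2)
  qed
  then show thesis using that[of r j] minorant by (meson SUP_least antisym)
qed

lemma lsc_borel_measurable:
  fixes h :: "'a::{metric_space,second_countable_topology} \<Rightarrow> ennreal"
  assumes h: "lsc T h" and M: "space M \<subseteq> T" "(\<lambda>z. z) \<in> measurable M borel"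
  shows "h \<in> borel_measurable M"
proof -
  obtain r :: "nat \<Rightarrow> real" and j where h_eq: "\<And>z. z \<in> T \<Longrightarrow> h z = (SUP k. ennreal (r k * tent (j k) z))"
    by (rule lsc_eq_SUP_tent[OF h]; rule that; assumption)
  have [measurable]: "tent l \<in> borel_measurable M" for l
    using measurable_compose[OF M(2) measurable_tent] by simp
  have "(\<lambda>z. SUP k. ennreal (r k * tent (j k) z)) \<in> borel_measurable M" by measurable
  then show ?thesis using M(1) h_eq
    by (subst measurable_cong[of _ _ "\<lambda>z. SUP k. ennreal (r k * tent (j k) z)"]) auto
qed

primrec running_max :: "(nat \<Rightarrow> 'a \<Rightarrow> real) \<Rightarrow> nat \<Rightarrow> 'a \<Rightarrow> real" where
  "running_max u 0 z = u 0 z"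
| "running_max u (Suc n) z = max (running_max u n z) (u (Suc n) z)"

lemma running_max_ge: "k \<le> n \<Longrightarrow> u k z \<le> running_max u n z"
  by (induction n) (auto simp: le_Suc_eq max.coboundedI1)

lemma running_max_attained: "\<exists>k\<le>n. running_max u n z = u k z"
  by (induction n) (auto simp: max_def intro: le_SucI)

lemma incseq_running_max: "incseq (\<lambda>n. running_max u n z)"
  by (rule incseq_SucI) simp

lemma SUP_running_max: "(SUP n. ennreal (running_max u n z)) = (SUP n. ennreal (u n z))"
proof (rule antisym; rule SUP_least)
  fix n show "ennreal (running_max u n z) \<le> (SUP n. ennreal (u n z))"
    using running_max_attained[of n u z] by (metis UNIV_I SUP_upper)
  show "ennreal (u n z) \<le> (SUP n. ennreal (running_max u n z))"
    using running_max_ge[of n n u z] by (intro SUP_upper2[of n]) (auto intro: ennreal_leI)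
qed

lemma continuous_on_running_max: "(\<And>k. continuous_on X (u k)) \<Longrightarrow> continuous_on X (running_max u n)"
  by (induction n) (auto intro!: continuous_intros)

lemma lsc_increasing_approx:
  fixes h :: "'a::{metric_space,second_countable_topology} \<Rightarrow> ennreal"
  assumes h: "lsc T h"
  obtains \<phi> :: "nat \<Rightarrow> 'a \<Rightarrow> real" and B :: "nat \<Rightarrow> real"
  where "\<And>n. continuous_on UNIV (\<phi> n)" "\<And>n z. 0 \<le> \<phi> n z" "\<And>n z. \<phi> n z \<le> B n" "\<And>z. incseq (\<lambda>n. \<phi> n z)"
    "\<And>z. z \<in> T \<Longrightarrow> h z = (SUP n. ennreal (\<phi> n z))"
proof -
  obtain r :: "nat \<Rightarrow> real" and j where r: "\<And>k. 0 \<le> r k"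
      and h_eq: "\<And>z. z \<in> T \<Longrightarrow> h z = (SUP k. ennreal (r k * tent (j k) z))"
    by (rule lsc_eq_SUP_tent[OF h]; rule that; assumption)
  define u :: "nat \<Rightarrow> 'a \<Rightarrow> real" where "u k z = r k * tent (j k) z" for k z
  have u: "0 \<le> u k z" "u k z \<le> r k" for k z
    using r tent_nonneg[of "j k" z] tent_le_1[of "j k" z] by (auto simp: u_def mult_left_le)
  have bounds: "0 \<le> running_max u n z" "running_max u n z \<le> (\<Sum>k\<le>n. r k)" for n z
  proof -
    obtain k where k: "k \<le> n" "running_max u n z = u k z" using running_max_attained[of n u z] by auto
    then have "r k \<le> (\<Sum>k\<le>n. r k)" using r by (intro member_le_sum) auto
    then show "0 \<le> running_max u n z" "running_max u n z \<le> (\<Sum>k\<le>n. r k)" using k u[of k z] by simp_all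
  qed
  have cont: "continuous_on UNIV (running_max u n)" for n
    unfolding u_def by (intro continuous_on_running_max continuous_intros)
  have "h z = (SUP n. ennreal (running_max u n z))" if "z \<in> T" for z
    unfolding SUP_running_max u_def by (rule h_eq[OF that])
  then show thesis by (rule that[OF cont bounds incseq_running_max])
qed

lemma incseq_ennreal: "incseq f \<Longrightarrow> incseq (\<lambda>n. ennreal (f n))"
  by (auto simp: incseq_def intro: ennreal_leI)

lemma lsc_add:
  fixes f g :: "'a::{metric_space,second_countable_topology} \<Rightarrow> ennreal"
  assumes f: "lsc T f" and g: "lsc T g"
  shows "lsc T (\<lambda>z. f z + g z)"
proof -
  obtain \<phi> :: "nat \<Rightarrow> 'a \<Rightarrow> real" where \<phi>: "\<And>n. continuous_on UNIV (\<phi> n)" "\<And>n z. 0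
      \<le> \<phi> n z" "\<And>z. incseq (\<lambda>n. \<phi> n z)"
    "\<And>z. z \<in> T \<Longrightarrow> f z = (SUP n. ennreal (\<phi> n z))"
    by (rule lsc_increasing_approx[OF f]; rule that; assumption)
  obtain \<psi> :: "nat \<Rightarrow> 'a \<Rightarrow> real" where \<psi>: "\<And>n. continuous_on UNIV (\<psi> n)" "\<And>n z. 0
      \<le> \<psi> n z" "\<And>z. incseq (\<lambda>n. \<psi> n z)"
    "\<And>z. z \<in> T \<Longrightarrow> g z = (SUP n. ennreal (\<psi> n z))"
    by (rule lsc_increasing_approx[OF g]; rule that; assumption)
  have "f z + g z = (SUP n. ennreal (\<phi> n z + \<psi> n z))" if "z \<in> T" for z
    using that \<phi> \<psi> by (simp add: ennreal_SUP_add incseq_ennreal)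
  moreover have "lsc T (\<lambda>z. SUP n. ennreal (\<phi> n z + \<psi> n z))"
    by (intro lsc_SUP continuous_imp_lsc continuous_intros continuous_on_subset[OF \<phi>(1)] continuous_on_subset[OF \<psi>(1)]) auto
  ultimately show ?thesis by (simp cong: lsc_cong)
qed

lemma lsc_sum:
  fixes f :: "'i \<Rightarrow> 'a::{metric_space,second_countable_topology} \<Rightarrow> ennreal"
  shows "(\<And>i. i \<in> I \<Longrightarrow> lsc T (f i)) \<Longrightarrow> lsc T (\<lambda>z. \<Sum>i\<in>I. f i z)"
proof (induction I rule: infinite_finite_induct)
  case (insert i I)
  then show ?case by (simp add: lsc_add)
qed (use continuous_imp_lsc[of T "\<lambda>_. 0"] in simp_all)

lemma lsc_mult_continuous:
  fixes f :: "'a::{metric_space,second_countable_topology} \<Rightarrow> ennreal" and w :: "'a \<Rightarrow> real"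
  assumes f: "lsc T f" and w: "continuous_on T w" "\<And>z. z \<in> T \<Longrightarrow> 0 \<le> w z"
  shows "lsc T (\<lambda>z. f z * ennreal (w z))"
proof -
  obtain \<phi> :: "nat \<Rightarrow> 'a \<Rightarrow> real" where \<phi>: "\<And>n. continuous_on UNIV (\<phi> n)" "\<And>n z. 0 \<le> \<phi> n z"
    "\<And>z. z \<in> T \<Longrightarrow> f z = (SUP n. ennreal (\<phi> n z))"
    by (rule lsc_increasing_approx[OF f]; rule that; assumption)
  have "f z * ennreal (w z) = (SUP n. ennreal (\<phi> n z * w z))" if "z \<in> T" for z
    using that w(2)[OF that] \<phi>(2) by (simp add: \<phi>(3) SUP_mult_right_ennreal ennreal_mult)
  moreover have "lsc T (\<lambda>z. SUP n. ennreal (\<phi> n z * w z))"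
    by (intro lsc_SUP continuous_imp_lsc continuous_on_mult w(1) continuous_on_subset[OF \<phi>(1)]) auto
  ultimately show ?thesis by (simp cong: lsc_cong)
qed

section \<open>Coding separable metric spaces by real numbers\<close>

definition bin_digit :: "nat \<Rightarrow> real \<Rightarrow> bool" where
  "bin_digit i y \<longleftrightarrow> odd \<lfloor>2 ^ Suc i * y\<rfloor>"

lemma floor_double: "\<lfloor>2 * x\<rfloor> = 2 * \<lfloor>x\<rfloor> + of_bool (odd \<lfloor>2 * x :: real\<rfloor>)"
proof -
  have "2 * \<lfloor>x\<rfloor> \<le> \<lfloor>2 * x\<rfloor>" "\<lfloor>2 * x\<rfloor> < 2 * \<lfloor>x\<rfloor> + 2" by linarith+
  then consider "\<lfloor>2 * x\<rfloor> = 2 * \<lfloor>x\<rfloor>" | "\<lfloor>2 * x\<rfloor> = 2 * \<lfloor>x\<rfloor> + 1" by linarith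
  then show ?thesis by cases auto
qed

lemma bin_digit_sums:
  assumes y: "0 \<le> y" "y < 1"
  shows "(\<lambda>i. of_bool (bin_digit i y) / 2 ^ Suc i) sums y"
proof -
  have partial_sum: "(\<Sum>i<n. of_bool (bin_digit i y) / 2 ^ Suc i) = real_of_int \<lfloor>2 ^ n * y\<rfloor> / 2 ^ n" for n
  proof (induction n)
    case 0
    have "\<lfloor>y\<rfloor> = 0" using y by linarith
    then show ?case by simp
  next
    case (Suc n)
    have "\<lfloor>2 ^ Suc n * y\<rfloor> = 2 * \<lfloor>2 ^ n * y\<rfloor> + of_bool (bin_digit n y)"
      using floor_double[of "2 ^ n * y"] by (simp add: bin_digit_def mult.assoc)
    then show ?case using Suc by (simp add: field_simps)
  qed
  have "(\<lambda>n. real_of_int \<lfloor>2 ^ n * y\<rfloor> / 2 ^ n) \<longlonglongrightarrow> y"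
  proof (rule LIMSEQ_I)
    fix e :: real assume "0 < e"
    then obtain N where N: "(1/2) ^ N < e" using real_arch_pow_inv[of e "1/2"] by auto
    have "norm (real_of_int \<lfloor>2 ^ n * y\<rfloor> / 2 ^ n - y) < e" if "n \<ge> N" for n
    proof -
      have "\<bar>real_of_int \<lfloor>2 ^ n * y\<rfloor> - 2 ^ n * y\<bar> \<le> 1" by linarith
      then have "\<bar>real_of_int \<lfloor>2 ^ n * y\<rfloor> - 2 ^ n * y\<bar> / 2 ^ n \<le> 1 / 2 ^ n"
        by (intro divide_right_mono) auto
      moreover have "real_of_int \<lfloor>2 ^ n * y\<rfloor> / 2 ^ n - y = (real_of_int \<lfloor>2 ^ n * y\<rfloor> - 2 ^ n * y) / 2 ^ n"
        by (simp add: diff_divide_distrib)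
      ultimately have "\<bar>real_of_int \<lfloor>2 ^ n * y\<rfloor> / 2 ^ n - y\<bar> \<le> 1 / 2 ^ n" by (simp only: abs_divide) simp
      also have "\<dots> = (1/2) ^ n" by (simp add: power_divide)
      also have "\<dots> \<le> (1/2) ^ N" using that by (intro power_decreasing) auto
      finally show ?thesis using N by simp
    qed
    then show "\<exists>N. \<forall>n\<ge>N. norm (real_of_int \<lfloor>2 ^ n * y\<rfloor> / 2 ^ n - y) < e" by blast
  qed
  then show ?thesis unfolding sums_def partial_sum .
qed

definition bool_series :: "(nat \<Rightarrow> real) \<Rightarrow> (nat \<Rightarrow> bool) \<Rightarrow> real" where
  "bool_series c b = (\<Sum>m. of_bool (b m) * c m)"

lemma summable_bool_series:
  fixes c :: "nat \<Rightarrow> real"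
  assumes "summable c" "\<And>m. 0 \<le> c m"
  shows "summable (\<lambda>m. of_bool (b m) * c m)"
  by (rule summable_comparison_test'[OF assms(1), of 0]) (use assms(2) in auto)

lemma bool_series_bounds:
  assumes c: "summable c" "\<And>m. 0 \<le> c m"
  shows "0 \<le> bool_series c b" "bool_series c b \<le> suminf c"
  unfolding bool_series_def using c summable_bool_series[OF c]
  by (auto intro!: suminf_nonneg suminf_le)

lemma continuous_on_bool_series:
  fixes c :: "nat \<Rightarrow> real" and \<sigma> :: "nat \<Rightarrow> nat"
  assumes "summable c" "\<And>m. 0 \<le> c m"
  shows "continuous_on UNIV (\<lambda>b. bool_series c (\<lambda>m. b (\<sigma> m)))"
  unfolding bool_series_def
proof (rule uniform_limit_theorem[OF always_eventually Weierstrass_m_test[where M=c]])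
  show "\<forall>n. continuous_on UNIV (\<lambda>b. \<Sum>i<n. of_bool (b (\<sigma> i)) * c i)"
  proof (intro allI continuous_on_sum continuous_on_mult_right)
    fix i
    have "continuous_on UNIV (\<lambda>b::nat\<Rightarrow>bool. b (\<sigma> i))" by simp
    then show "continuous_on UNIV (\<lambda>b. of_bool (b (\<sigma> i)) :: real)"
      using continuous_on_compose2[of UNIV "of_bool :: bool \<Rightarrow> real" UNIV "\<lambda>b. b (\<sigma> i)"] by simp
  qed
qed (use assms in auto)

abbreviation cantor_sum :: "(nat \<Rightarrow> bool) \<Rightarrow> real" where
  "cantor_sum \<equiv> bool_series (\<lambda>m. (1/4) ^ m)"

lemma summable_cantor_sum: "summable (\<lambda>m. of_bool (b m) * (1/4::real) ^ m)"
  by (intro summable_bool_series) (auto intro: summable_geometric)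

lemma inj_cantor_sum: "inj cantor_sum"
proof (rule injI, rule ccontr)
  fix b b' assume eq: "cantor_sum b = cantor_sum b'" and ne: "b \<noteq> b'"
  then obtain m0 where "b m0 \<noteq> b' m0" by auto
  define m where "m = (LEAST m. b m \<noteq> b' m)"
  have m: "b m \<noteq> b' m" unfolding m_def by (rule LeastI) fact
  have less: "b i = b' i" if "i < m" for i using not_less_Least that unfolding m_def by blast
  define d where "d i = (of_bool (b i) - of_bool (b' i)) * (1/4::real) ^ i" for i
  have d_eq: "d = (\<lambda>i. of_bool (b i) * (1/4) ^ i - of_bool (b' i) * (1/4) ^ i)"
    by (auto simp: d_def left_diff_distrib)
  have summable_d: "summable d" unfolding d_eq by (intro summable_diff summable_cantor_sum)
  have "suminf d = 0" unfolding d_eq using eq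
    by (subst suminf_diff[symmetric]) (auto simp: summable_cantor_sum bool_series_def)
  moreover have "suminf d = (\<Sum>i. d (i + Suc m)) + (\<Sum>i<Suc m. d i)"
    by (rule suminf_split_initial_segment[OF summable_d])
  moreover have "(\<Sum>i<Suc m. d i) = d m" using less by (simp add: d_def)
  ultimately have "\<bar>d m\<bar> = \<bar>\<Sum>i. d (i + Suc m)\<bar>" by simp
  also have "\<dots> \<le> (\<Sum>i. (1/4) ^ Suc m * (1/4::real) ^ i)"
  proof -
    have d_le: "norm (d (i + Suc m)) \<le> (1/4) ^ Suc m * (1/4::real) ^ i" for i
      by (auto simp: d_def power_add abs_mult)
    have geometric: "summable (\<lambda>i. (1/4) ^ Suc m * (1/4::real) ^ i)"
      by (intro summable_mult summable_geometric) auto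
    show ?thesis
      using summable_norm[of "\<lambda>i. d (i + Suc m)"] suminf_le[of "\<lambda>i. norm (d (i + Suc m))", OF d_le _ geometric]
      summable_comparison_test'[OF geometric, of 0 "\<lambda>i. norm (d (i + Suc m))"] d_le
        by (auto simp: real_norm_def)
  qed
  also have "\<dots> = (1/4) ^ Suc m * (4/3)"
    by (subst suminf_mult) (auto simp: suminf_geometric intro!: summable_geometric)
  also have "\<dots> < (1/4) ^ m" by simp
  also have "\<dots> = \<bar>d m\<bar>" using m by (auto simp: d_def)
  finally show False by simp
qed

lemma compact_bool_seq: "compact (UNIV :: (nat \<Rightarrow> bool) set)"
proof -
  have "compact_space (euclidean :: bool topology)" by (simp add: compact_space_def finite_imp_compact)
  then have "compact_space (product_topology (\<lambda>_::nat. euclidean :: bool topology) UNIV)"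
    by (simp add: compact_space_product_topology)
  then show ?thesis by (simp add: euclidean_product_topology compact_space_def)
qed

lemma continuous_extension_cantor_sum:
  fixes g :: "(nat \<Rightarrow> bool) \<Rightarrow> real"
  assumes g: "continuous_on UNIV g" and B: "\<And>b. \<bar>g b\<bar> \<le> B"
  obtains G where "continuous_on UNIV G" "\<And>b. G (cantor_sum b) = g b"
proof -
  have cont: "continuous_on UNIV cantor_sum"
    using continuous_on_bool_series[where \<sigma>="\<lambda>m. m"] by (simp add: summable_geometric)
  then have "compact (range cantor_sum)" and inv: "continuous_on (range cantor_sum) (inv cantor_sum)"
    using compact_bool_seq inj_cantor_sum by (auto intro!: compact_continuous_image continuous_on_inv)
  then have closed: "closedin (top_of_set UNIV) (range cantor_sum)" using compact_imp_closed by simp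
  have "continuous_on (range cantor_sum) (\<lambda>x. g (inv cantor_sum x))"
    by (rule continuous_on_compose2[OF g inv]) auto
  from Tietze[OF this closed, of B] B[of undefined] B
  obtain G where G: "continuous_on UNIV G" "\<And>x. x \<in> range cantor_sum \<Longrightarrow> G x = g (inv cantor_sum x)"
    by (metis abs_ge_zero order_trans real_norm_def)
  show thesis by (rule that[OF G(1)]) (simp add: G(2) inv_f_f[OF inj_cantor_sum])
qed

(* The points of the space are coded by reals in such a way that all tent functions extend continuously to the real line. *)
locale real_code =
  fixes e :: "'a::{metric_space,second_countable_topology} \<Rightarrow> real" and G :: "nat \<Rightarrow> real \<Rightarrow> real"
  assumes measurable_code[measurable]: "e \<in> borel_measurable borel"
    and code_bounds: "0 \<le> e z" "e z \<le> 2"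
    and continuous_on_G: "continuous_on UNIV (G l)"
    and G_code: "G l (e z) = tent l z"

lemma ex_real_code:
  "\<exists>(e :: 'a::{metric_space,second_countable_topology} \<Rightarrow> real) G. real_code e G"
proof -
  define b :: "'a \<Rightarrow> nat \<Rightarrow> bool" where
    "b z m = bin_digit (snd (prod_decode m)) (tent (fst (prod_decode m)) z / 2)" for z m
  define g where "g l c = bool_series (\<lambda>i. (1/2) ^ i) (\<lambda>i. c (prod_encode (l, i)))" for l c
  have "continuous_on UNIV (g l)" for l
    unfolding g_def by (intro continuous_on_bool_series) (auto intro: summable_geometric)
  moreover have "\<bar>g l c\<bar> \<le> 2" for l c
    using bool_series_bounds[of "\<lambda>i. (1/2) ^ i" "\<lambda>i. c (prod_encode (l, i))"]
    by (simp add: g_def summable_geometric suminf_geometric)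
  ultimately have "\<exists>G. continuous_on UNIV G \<and> (\<forall>c. G (cantor_sum c) = g l c)" for l
    by (metis continuous_extension_cantor_sum)
  then obtain G where G: "\<And>l. continuous_on UNIV (G l)" "\<And>l c. G l (cantor_sum c) = g l c" by metis
  have "real_code (\<lambda>z. cantor_sum (b z)) G"
  proof
    show "(\<lambda>z. cantor_sum (b z)) \<in> borel_measurable borel"
      unfolding bool_series_def b_def bin_digit_def by measurable
    show "0 \<le> cantor_sum (b z)" "cantor_sum (b z) \<le> 2" for z
      using bool_series_bounds[of "\<lambda>i. (1/4) ^ i" "b z"]
      by (simp_all add: summable_geometric suminf_geometric)
    show "G l (cantor_sum (b z)) = tent l z" for l z
    proof -
      have "(\<lambda>i. of_bool (bin_digit i (tent l z / 2)) / 2 ^ Suc i) sums (tent l z / 2)"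
        using tent_nonneg[of l z] tent_le_1[of l z] by (intro bin_digit_sums) auto
      from sums_mult[OF this, of 2] have "(\<lambda>i. of_bool (bin_digit i (tent l z / 2)) * (1/2) ^ i) sums tent l z"
        by (simp add: power_divide)
      then have "g l (b z) = tent l z" by (simp add: g_def bool_series_def b_def sums_iff)
      then show ?thesis by (simp add: G(2))
    qed
  qed (rule G(1))
  then show ?thesis by blast
qed

context real_code
begin

definition codes :: "'a set \<Rightarrow> real set" where
  "codes K = {t\<in>{0..2}. \<exists>z\<in>K. \<forall>l. G l t = tent l z}"

definition decode :: "real \<Rightarrow> 'a" where
  "decode t = (THE z. \<forall>l. G l t = tent l z)"

lemma decode_eq: "(\<And>l. G l t = tent l z) \<Longrightarrow> decode t = z"
  unfolding decode_def by (rule the_equality) (auto intro: tent_separates)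

lemma decode_code: "decode (e z) = z"
  by (rule decode_eq) (rule G_code)

lemma code_in_codes: "z \<in> K \<Longrightarrow> e z \<in> codes K"
  using code_bounds[of z] by (auto simp: codes_def G_code)

lemma decode_codes:
  assumes "t \<in> codes K" shows "decode t \<in> K" "G l t = tent l (decode t)"
proof -
  obtain z where "z \<in> K" "\<And>l. G l t = tent l z" using assms by (auto simp: codes_def)
  moreover from this have "decode t = z" by (intro decode_eq)
  ultimately show "decode t \<in> K" "G l t = tent l (decode t)" by auto
qed

lemma codes_Int_iff: "t \<in> codes K \<Longrightarrow> t \<in> codes (K \<inter> F) \<longleftrightarrow> decode t \<in> F"
  using decode_codes[of t K] decode_codes(1)[of t "K \<inter> F"] by (auto simp: codes_def)

lemma compact_codes:
  assumes K: "compact K" shows "compact (codes K)"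
proof -
  let ?C = "{p :: real \<times> 'a. \<forall>l. G l (fst p) = tent l (snd p)}"
  have "closed ?C"
    by (intro closed_Collect_all closed_Collect_eq continuous_on_compose2[OF continuous_on_G] continuous_intros) auto
  then have "compact (fst ` (({0..2} \<times> K) \<inter> ?C))"
    using K by (intro compact_continuous_image compact_Int_closed compact_Times continuous_intros) auto
  moreover have "fst ` (({0..2} \<times> K) \<inter> ?C) = codes K" by (force simp: codes_def image_iff)
  ultimately show ?thesis by simp
qed

lemma closed_codes: "compact K \<Longrightarrow> closed (codes K)"
  by (intro compact_imp_closed compact_codes)

lemma continuous_on_decode:
  assumes K: "compact K" shows "continuous_on (codes K) decode"
  unfolding continuous_on_closed_invariant
proof (intro allI impI)
  fix F :: "'a set" assume "closed F"
  then have "closed (codes (K \<inter> F))" by (intro closed_codes compact_Int_closed K)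
  moreover have "codes (K \<inter> F) \<subseteq> codes K" by (auto simp: codes_def)
  ultimately show "\<exists>A. closed A \<and> A \<inter> codes K = decode -` F \<inter> codes K"
    using codes_Int_iff[of _ K F] by (intro exI[of _ "codes (K \<inter> F)"]) auto
qed

lemma measurable_decode:
  fixes K :: "nat \<Rightarrow> 'a set"
  assumes K: "\<And>i. compact (K i)"
  shows "decode \<in> borel_measurable (restrict_space borel (\<Union>i. codes (K i)))"
proof (rule borel_measurableI)
  let ?L = "\<Union>i. codes (K i)"
  fix U :: "'a set" assume U: "open U"
  have "decode t \<in> U \<longleftrightarrow> (\<forall>i'. t \<notin> codes (K i' \<inter> - U))" if "t \<in> codes (K i)" for t i
    using decode_codes(1)[of t "K _ \<inter> - U"] codes_Int_iff[OF that, of "- U"] by auto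
  then have "decode -` U \<inter> ?L = ?L - (\<Union>i. codes (K i \<inter> - U))" by blast
  also have "\<dots> \<in> sets borel"
    using closed_codes[OF K] closed_codes[OF compact_Int_closed[OF K closed_Compl[OF U]]]
    by (auto intro!: sets.Diff)
  finally show "decode -` U \<inter> space (restrict_space borel ?L) \<in> sets (restrict_space borel ?L)"
    by (auto simp: sets_restrict_space space_restrict_space image_iff Int_commute intro!: bexI[of _ "decode -` U \<inter> ?L"])
qed

end

lemma ex_compact_code:
  fixes A :: "'a::{metric_space,second_countable_topology} set"
  assumes A: "compact A"
  obtains e :: "'a \<Rightarrow> real" and L \<psi> where "e \<in> borel_measurable borel" "compact L" "L \<subseteq> {0..2}" "continuous_on L \<psi>" "\<psi> ` L = A"
    "\<And>a. a \<in> A \<Longrightarrow> e a \<in> L" "\<And>a. \<psi> (e a) = a"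
proof -
  obtain e :: "'a \<Rightarrow> real" and G where "real_code e G" using ex_real_code by blast
  then interpret real_code e G .
  have "decode ` codes A = A"
  proof
    show "A \<subseteq> decode ` codes A" using code_in_codes[of _ A] decode_code by (metis image_eqI subsetI)
  qed (use decode_codes(1) in auto)
  moreover have "codes A \<subseteq> {0..2}" by (auto simp: codes_def)
  ultimately show ?thesis
    by (intro that[OF measurable_code compact_codes[OF A] _ continuous_on_decode[OF A] _ code_in_codes decode_code])
qed

section \<open>Weak sequential compactness\<close>

lemma nn_integral_eq_SUP_approx:
  fixes \<phi> :: "nat \<Rightarrow> 'a \<Rightarrow> real"
  assumes meas: "\<And>n. \<phi> n \<in> borel_measurable M" and inc: "\<And>x. incseq (\<lambda>n. \<phi> n x)"
    and h_eq: "\<And>x. x \<in> space M \<Longrightarrow> h x = (SUP n. ennreal (\<phi> n x))"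
  shows "(\<integral>\<^sup>+x. h x \<partial>M) = (SUP n. \<integral>\<^sup>+x. ennreal (\<phi> n x) \<partial>M)"
proof -
  have "(\<integral>\<^sup>+x. h x \<partial>M) = (\<integral>\<^sup>+x. (SUP n. ennreal (\<phi> n x)) \<partial>M)" by (intro nn_integral_cong h_eq)
  also have "\<dots> = (SUP n. \<integral>\<^sup>+x. ennreal (\<phi> n x) \<partial>M)"
    using meas inc
    by (intro nn_integral_monotone_convergence_SUP) (auto simp: incseq_def le_fun_def intro!: ennreal_leI)
  finally show ?thesis .
qed

lemma weak_conv_lsc:
  fixes h :: "real \<Rightarrow> ennreal"
  assumes \<nu>: "\<And>k. real_distribution (\<nu> k)" and M: "real_distribution M" and conv: "weak_conv_m \<nu> M"
      and h: "lsc UNIV h"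
  shows "(\<integral>\<^sup>+t. h t \<partial>M) \<le> liminf (\<lambda>k. \<integral>\<^sup>+t. h t \<partial>\<nu> k)"
proof -
  obtain \<phi> :: "nat \<Rightarrow> real \<Rightarrow> real" and B where cont: "\<And>n. continuous_on UNIV (\<phi> n)"
    and bounds: "\<And>n t. 0 \<le> \<phi> n t" "\<And>n t. \<phi> n t \<le> B n" and inc: "\<And>t. incseq (\<lambda>n. \<phi> n t)"
    and h_eq: "\<And>t. h t = (SUP n. ennreal (\<phi> n t))"
    by (rule lsc_increasing_approx[OF h]; rule that) simp_all
  have [measurable]: "\<phi> n \<in> borel_measurable borel" for n
    using cont by (rule borel_measurable_continuous_onI)
  have integral_eq: "(\<integral>\<^sup>+t. ennreal (\<phi> n t) \<partial>N) = ennreal (integral\<^sup>L N (\<phi> n))" if "real_distribution N"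
    for n N
  proof -
    interpret real_distribution N by fact
    show ?thesis
      using bounds by (intro nn_integral_eq_integral integrable_const_bound[where B="B n"]) auto
  qed
  interpret M: real_distribution M by fact
  have "(\<integral>\<^sup>+t. h t \<partial>M) = (SUP n. \<integral>\<^sup>+t. ennreal (\<phi> n t) \<partial>M)"
    using inc h_eq by (intro nn_integral_eq_SUP_approx) simp_all
  also have "\<dots> \<le> liminf (\<lambda>k. \<integral>\<^sup>+t. h t \<partial>\<nu> k)"
  proof (rule SUP_least)
    fix n
    have "(\<lambda>k. integral\<^sup>L (\<nu> k) (\<phi> n)) \<longlonglongrightarrow> integral\<^sup>L M (\<phi> n)"
      by (rule weak_conv_imp_integral_bdd_continuous_conv[OF \<nu> M conv, of _ "B n"])
        (use bounds cont in \<open>auto simp: continuous_on_eq_continuous_at\<close>)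
    then have "(\<integral>\<^sup>+t. ennreal (\<phi> n t) \<partial>M) = liminf (\<lambda>k. \<integral>\<^sup>+t. ennreal (\<phi> n t) \<partial>\<nu> k)"
      unfolding integral_eq[OF M] integral_eq[OF \<nu>]
      by (intro lim_imp_Liminf[symmetric] tendsto_ennrealI) auto
    also have "\<dots> \<le> liminf (\<lambda>k. \<integral>\<^sup>+t. h t \<partial>\<nu> k)"
      unfolding h_eq by (intro Liminf_mono always_eventually allI nn_integral_mono SUP_upper) auto
    finally show "(\<integral>\<^sup>+t. ennreal (\<phi> n t) \<partial>M) \<le> liminf (\<lambda>k. \<integral>\<^sup>+t. h t \<partial>\<nu> k)" .
  qed
  finally show ?thesis .
qed

lemma lsc_indicator: "open U \<Longrightarrow> lsc UNIV (indicator U)"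
  unfolding lsc_def
proof
  fix r :: ennreal assume "open U"
  moreover have "{z \<in> UNIV. r < indicator U z} = (if r < 1 then U else {})"
    by (auto split: split_indicator)
  ultimately show "openin (top_of_set UNIV) {z \<in> UNIV. r < indicator U z}" by auto
qed

lemma tendsto_of_liminf_bounds:
  fixes f g :: "nat \<Rightarrow> ennreal"
  assumes sum: "(\<lambda>k. f k + g k) \<longlonglongrightarrow> a + b" and fin: "a + b < \<infinity>"
    and f: "a \<le> liminf f" and g: "b \<le> liminf g"
  shows "f \<longlonglongrightarrow> a"
proof -
  have lim: "limsup (\<lambda>k. f k + g k) = a + b" using sum by (intro lim_imp_Limsup) simp_all
  have "limsup f \<le> limsup (\<lambda>k. f k + g k)" by (intro Limsup_mono always_eventually) simp
  then have ub: "limsup f \<le> a + b" by (simp add: lim)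
  have "b \<le> liminf (\<lambda>k. (f k + g k) - f k)"
    by (rule order_trans[OF g]) (intro Liminf_mono always_eventually, simp add: ennreal_le_minus_iff add.commute)
  also have "\<dots> \<le> (a + b) - limsup f" unfolding lim[symmetric] by (rule liminf_minus_ennreal) simp
  finally have "b + limsup f \<le> a + b \<or> b = 0" by (auto simp: ennreal_le_minus_iff)
  then have "limsup f \<le> a" using ub fin by (auto simp: add.commute[of a] ennreal_add_left_cancel_le)
  then have "liminf f = a" "limsup f = a"
    using f Liminf_le_Limsup[of sequentially f] by (auto intro!: antisym elim: order_trans)
  then show ?thesis by (simp add: tendsto_iff_Liminf_eq_Limsup)
qed

lemma space_SM[simp]: "space (SM S) = S"
  by (simp add: SM_def space_restrict_space)

lemma measurable_SM_borel[measurable]: "(\<lambda>x. x) \<in> measurable (SM S) borel"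
  unfolding SM_def by (rule measurable_restrict_space1) simp

lemma measurable_pair_SM_borel:
  fixes S :: "'s::second_countable_topology set" and A :: "'b::second_countable_topology set"
  shows "(\<lambda>z. z) \<in> measurable (SM S \<Otimes>\<^sub>M SM A) borel"
proof -
  have "(\<lambda>z. (fst z, snd z)) \<in> measurable (SM S \<Otimes>\<^sub>M SM A) (borel \<Otimes>\<^sub>M borel)" by measurable
  then show ?thesis by (simp add: borel_prod)
qed

lemma space_pair_SM[simp]: "space (SM S \<Otimes>\<^sub>M SM A) = S \<times> A"
  by (simp add: space_pair_measure)

lemma measurable_into_SM: "f \<in> measurable M borel \<Longrightarrow> (\<And>x. x \<in> space M \<Longrightarrow> f x \<in> S) \<Longrightarrow> f \<in> measurable M (SM S)"
  unfolding SM_def by (rule measurable_restrict_space2) auto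

lemma measurable_into_pair_SM:
  fixes f :: "'a \<Rightarrow> 's::second_countable_topology \<times> 'b::second_countable_topology"
  assumes f: "f \<in> borel_measurable M" and S: "\<And>x. x \<in> space M \<Longrightarrow> f x \<in> S \<times> A"
  shows "f \<in> measurable M (SM S \<Otimes>\<^sub>M SM A)"
proof -
  have [measurable]: "f \<in> measurable M (borel \<Otimes>\<^sub>M borel)" using f by (simp add: borel_prod)
  have "(\<lambda>x. (fst (f x), snd (f x))) \<in> measurable M (SM S \<Otimes>\<^sub>M SM A)"
    using S by (intro measurable_Pair measurable_into_SM) (auto simp: mem_Times_iff)
  then show ?thesis by simp
qed

lemma continuous_on_measurable_SM:
  fixes f :: "'s::topological_space \<Rightarrow> real"
  shows "continuous_on S f \<Longrightarrow> f \<in> borel_measurable (SM S)"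
  unfolding SM_def by (rule borel_measurable_continuous_on_restrict)


lemma inner_regular_compacts:
  fixes S :: "'s::polish_space set"
  assumes S: "S \<in> sets borel" and m: "sets m = sets (SM S)" "finite_measure m"
  obtains K :: "nat \<Rightarrow> 's set" where "\<And>i. K i \<subseteq> S" "\<And>i. compact (K i)" "emeasure m S = (SUP i. emeasure m (K i))"
proof -
  interpret finite_measure m by fact
  have space_m: "space m = S" using sets_eq_imp_space_eq[OF m(1)] by simp
  define m_borel where "m_borel = distr m borel (\<lambda>x. x)"
  have "(\<lambda>x. x) \<in> measurable m borel"
    using measurable_SM_borel[of S] by (simp cong: measurable_cong_sets[OF m(1)])
  then have emeasure_m_borel: "emeasure m_borel X = emeasure m (X \<inter> S)" if "X \<in> sets borel" for X
    using that unfolding m_borel_def by (subst emeasure_distr) (auto simp: space_m)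
  let ?\<K> = "{K. K \<subseteq> S \<and> compact K}"
  have "emeasure m_borel S = (SUP K\<in>?\<K>. emeasure m_borel K)"
    by (rule inner_regular) (use S emeasure_m_borel[of UNIV] in \<open>auto simp: m_borel_def\<close>)
  moreover have "?\<K> \<noteq> {}" by (auto intro!: exI[of _ "{}"])
  ultimately obtain f :: "nat \<Rightarrow> ennreal" where f: "range f \<subseteq> emeasure m_borel ` ?\<K>" "emeasure m_borel S
      = (SUP i. f i)"
    using ennreal_SUP_countable_SUP[of ?\<K> "emeasure m_borel"] by auto
  have "\<forall>i. \<exists>K. K \<subseteq> S \<and> compact K \<and> f i = emeasure m_borel K" using f(1) by blast
  then obtain K where K: "\<And>i. K i \<subseteq> S" "\<And>i. compact (K i)" "\<And>i. f i = emeasure m_borel (K i)" by metis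
  have "emeasure m S = (SUP i. emeasure m (K i))"
    using f(2) K S by (simp add: emeasure_m_borel borel_closed compact_imp_closed Int_absorb2)
  then show thesis using K(1,2) by (rule that[rotated 2])
qed

context real_code
begin

definition code_dist :: "'a set \<Rightarrow> real \<Rightarrow> ennreal" where
  "code_dist K t = (INF z\<in>K. ennreal (infdist t {0..2}) + (SUP l. ennreal (\<bar>G l t - tent l z\<bar> / real (Suc l))))"

lemma lsc_code_dist_point:
  "lsc UNIV (\<lambda>p. ennreal (infdist (fst p) {0..2}) + (SUP l. ennreal (\<bar>G l (fst p) - tent l (snd p)\<bar> / real (Suc l))))"
  by (intro lsc_add lsc_SUP continuous_imp_lsc continuous_intros continuous_on_compose2[OF continuous_on_G]) auto

lemma lsc_code_dist:
  assumes "compact K" shows "lsc UNIV (code_dist K)"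
proof (cases "K = {}")
  case True
  then have "code_dist K = (\<lambda>_. \<top>)" by (simp add: code_dist_def fun_eq_iff)
  then show ?thesis by (simp add: lsc_def)
next
  case False
  have "lsc (UNIV \<times> K) (\<lambda>p. ennreal (infdist (fst p) {0..2}) + (SUP l. ennreal (\<bar>G l (fst p) - tent l (snd p)\<bar> / real (Suc l))))"
    by (rule lsc_subset[OF lsc_code_dist_point]) simp
  from lsc_INF[OF this assms False] show ?thesis by (simp add: code_dist_def[abs_def])
qed

lemma codes_if_code_dist_eq_0:
  assumes K: "compact K" and t: "code_dist K t = 0" shows "t \<in> codes K"
proof -
  let ?d = "\<lambda>z. ennreal (infdist t {0..2}) + (SUP l. ennreal (\<bar>G l t - tent l z\<bar> / real (Suc l)))"
  have "K \<noteq> {}" using t by (auto simp: code_dist_def)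
  moreover have "lsc K ?d"
    using lsc_compose[OF lsc_code_dist_point, of K "\<lambda>z. (t, z)"] by (simp add: continuous_intros)
  ultimately obtain z where z: "z \<in> K" "?d z = 0"
    using lsc_attains_INF[OF _ K, of ?d] t by (auto simp: code_dist_def)
  then have "infdist t {0..2} = 0" "\<And>l. ennreal (\<bar>G l t - tent l z\<bar> / real (Suc l)) \<le> 0"
    using infdist_nonneg[of t "{0..2}"] by (auto simp: SUP_eq_iff ennreal_eq_0_iff)
  then have "t \<in> {0..2}" "\<And>l. G l t = tent l z"
    using in_closed_iff_infdist_zero[of "{0..2::real}" t]
    by (auto simp: ennreal_eq_0_iff divide_le_0_iff)
  then show ?thesis using z(1) by (auto simp: codes_def)
qed

lemma code_dist_code:
  assumes "z \<in> K" shows "code_dist K (e x) \<le> ennreal (dist x z)"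
proof -
  have "\<bar>tent l x - tent l z\<bar> / real (Suc l) \<le> dist x z" for l
  proof -
    have "\<bar>tent l x - tent l z\<bar> \<le> real (Suc l) * dist x z"
      using tent_lipschitz[of l x z] by (rule order_trans) (intro mult_right_mono, auto)
    then show ?thesis by (simp add: divide_le_eq mult.commute)
  qed
  then have "ennreal (infdist (e x) {0..2}) + (SUP l. ennreal (\<bar>G l (e x) - tent l z\<bar> / real (Suc l)))
      \<le> ennreal (dist x z)"
    using code_bounds[of x] by (auto simp: G_code infdist_zero intro!: SUP_least ennreal_leI)
  then show ?thesis unfolding code_dist_def by (rule INF_lower2[OF assms])
qed

(* The mass missing from a subprobability measure is put on -1, which is not a code. *)
definition code_distr :: "'a measure \<Rightarrow> real measure" where
  "code_distr \<mu> = functional_measure borel (\<lambda>f. (\<integral>\<^sup>+z. f (e z) \<partial>\<mu>) + (1 - emeasure \<mu> (space \<mu>)) * f (-1))"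

lemma sets_code_distr[simp]: "sets (code_distr \<mu>) = sets borel"
    and space_code_distr[simp]: "space (code_distr \<mu>) = UNIV"
  by (simp_all add: code_distr_def)

lemma nn_integral_code_distr:
  assumes e: "e \<in> borel_measurable \<mu>" and f: "f \<in> borel_measurable borel"
  shows "(\<integral>\<^sup>+t. f t \<partial>code_distr \<mu>) = (\<integral>\<^sup>+z. f (e z) \<partial>\<mu>) + (1 - emeasure \<mu> (space \<mu>)) * f (-1)"
  unfolding code_distr_def
  by (intro nn_integral_functional_measure[OF _ f] pos_functional_add pos_functional_cmult pos_functional_eval
      pos_functional_map[OF pos_functional_nn_integral[OF refl] e]) simp

lemma emeasure_code_distr_eq_1:
  assumes e: "e \<in> borel_measurable \<mu>" and \<mu>: "emeasure \<mu> (space \<mu>)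
      \<le> 1" and X: "X \<in> sets borel" "{-1} \<union> {0..2} \<subseteq> X"
  shows "emeasure (code_distr \<mu>) X = 1"
proof -
  have "emeasure (code_distr \<mu>) X = (\<integral>\<^sup>+t. indicator X t \<partial>code_distr \<mu>)" using X by simp
  also have "\<dots> = emeasure \<mu> (space \<mu>) + (1 - emeasure \<mu> (space \<mu>))"
    using X code_bounds by (subst nn_integral_code_distr[OF e]) (auto simp: subset_iff)
  finally show ?thesis using \<mu> by (simp add: add_diff_inverse_ennreal)
qed

lemma real_distribution_code_distr:
  assumes "e \<in> borel_measurable \<mu>" "emeasure \<mu> (space \<mu>) \<le> 1" shows "real_distribution (code_distr \<mu>)"
  by (intro real_distribution.intro prob_spaceI real_distribution_axioms.intro)
    (simp_all add: emeasure_code_distr_eq_1[OF assms])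

lemma tight_code_distr:
  assumes "\<And>k. e \<in> borel_measurable (\<mu> k)" "\<And>k. emeasure (\<mu> k) (space (\<mu> k)) \<le> 1"
  shows "tight (\<lambda>k. code_distr (\<mu> k))"
  unfolding tight_def
proof (intro conjI allI impI real_distribution_code_distr assms)
  fix \<epsilon> :: real assume "0 < \<epsilon>"
  have "measure (code_distr (\<mu> k)) {-2<..2} = 1" for k
    using emeasure_code_distr_eq_1[OF assms, of "{-2<..2}" k] by (simp add: measure_def subset_iff)
  then show "\<exists>a b. a < b \<and> (\<forall>n. 1 - \<epsilon> < measure (code_distr (\<mu> n)) {a<..b})"
    using \<open>0 < \<epsilon>\<close> by (intro exI[of _ "-2"] exI[of _ 2]) auto
qed

end

definition cutoff :: "real \<Rightarrow> real" where
  "cutoff t = max 0 (min 1 (t + 1))"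

lemma cutoff_nonneg: "0 \<le> cutoff t" and cutoff_le_1: "cutoff t \<le> 1"
    and cutoff_eq_1: "0 \<le> t \<Longrightarrow> cutoff t = 1"
  by (auto simp: cutoff_def)

lemma continuous_on_cutoff: "continuous_on X cutoff"
  unfolding cutoff_def by (intro continuous_intros)

lemma measurable_cutoff[measurable]: "cutoff \<in> borel_measurable borel"
  by (rule borel_measurable_continuous_onI[OF continuous_on_cutoff])

locale coded_weak_limit = real_code e G for e :: "'s::polish_space \<times> 'b::polish_space \<Rightarrow> real" and G +
  fixes S :: "'s set" and A :: "'b set" and \<mu> :: "nat \<Rightarrow> ('s \<times> 'b) measure"
      and m :: "'s measure" and M :: "real measure"
  assumes S: "S \<in> sets borel" and A: "compact A"
    and sets_\<mu>: "\<And>k. sets (\<mu> k) = sets (SM S \<Otimes>\<^sub>M SM A)" and mass_le_1: "\<And>k. emeasure (\<mu> k) (S \<times> A) \<le> 1"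
    and sets_m: "sets m = sets (SM S)" and finite_m: "finite_measure m"
    and marginals: "\<And>(f::'s \<Rightarrow> real) B. continuous_on S f \<Longrightarrow> (\<And>x. 0 \<le> f x) \<Longrightarrow> (\<And>x. f x \<le> B) \<Longrightarrow>
      (\<lambda>k. \<integral>\<^sup>+z. ennreal (f (fst z)) \<partial>\<mu> k) \<longlonglongrightarrow> (\<integral>\<^sup>+x. ennreal (f x) \<partial>m)"
    and real_distribution_M: "real_distribution M" and weak_conv: "weak_conv_m (\<lambda>k. code_distr (\<mu> k)) M"
begin

sublocale m: finite_measure m by (rule finite_m)
sublocale M: real_distribution M by (rule real_distribution_M)

lemma space_m[simp]: "space m = S" and space_\<mu>[simp]: "space (\<mu> k) = S \<times> A"
  using sets_eq_imp_space_eq[OF sets_m] sets_eq_imp_space_eq[OF sets_\<mu>] by simp_all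

lemma code_measurable_\<mu>: "e \<in> borel_measurable (\<mu> k)"
  using measurable_compose[OF measurable_pair_SM_borel measurable_code]
  by (simp cong: measurable_cong_sets[OF sets_\<mu>])

lemma real_distribution_codes: "real_distribution (code_distr (\<mu> k))"
  by (rule real_distribution_code_distr[OF code_measurable_\<mu>]) (simp add: mass_le_1)

lemma integral_code_distr:
  assumes "f \<in> borel_measurable borel"
  shows "(\<integral>\<^sup>+t. f t \<partial>code_distr (\<mu> k)) = (\<integral>\<^sup>+z. f (e z) \<partial>\<mu> k) + (1 - emeasure (\<mu> k) (S \<times> A)) * f (-1)"
  using nn_integral_code_distr[OF code_measurable_\<mu> assms] by simp

lemma lsc_integral_le: "lsc UNIV h \<Longrightarrow> (\<integral>\<^sup>+t. h t \<partial>M) \<le> liminf (\<lambda>k. \<integral>\<^sup>+t. h t \<partial>code_distr (\<mu> k))"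
  by (rule weak_conv_lsc[OF real_distribution_codes real_distribution_M weak_conv])

lemma nn_integral_cutoff: "(\<integral>\<^sup>+t. ennreal (cutoff t) \<partial>M) = emeasure m S"
proof -
  have integral_cutoff: "(\<integral>\<^sup>+t. ennreal (cutoff t) \<partial>N) = ennreal (integral\<^sup>L N cutoff)"
    if "real_distribution N" for N
  proof -
    interpret real_distribution N by fact
    show ?thesis
      by (intro nn_integral_eq_integral integrable_const_bound[where B=1]) (auto simp: cutoff_nonneg cutoff_le_1)
  qed
  have "(\<lambda>k. ennreal (integral\<^sup>L (code_distr (\<mu> k)) cutoff)) \<longlonglongrightarrow> ennreal (integral\<^sup>L M cutoff)"
    using weak_conv_imp_integral_bdd_continuous_conv[OF real_distribution_codes real_distribution_M weak_conv, of cutoff 1]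
      continuous_on_cutoff[of UNIV]
    by (intro tendsto_ennrealI) (auto simp: continuous_on_eq_continuous_at cutoff_nonneg cutoff_le_1)
  moreover have "ennreal (integral\<^sup>L (code_distr (\<mu> k)) cutoff) = emeasure (\<mu> k) (S \<times> A)" for k
    unfolding integral_cutoff[OF real_distribution_codes, symmetric]
    by (subst integral_code_distr) (simp_all add: cutoff_eq_1 code_bounds, simp add: cutoff_def)
  ultimately have "(\<lambda>k. emeasure (\<mu> k) (S \<times> A)) \<longlonglongrightarrow> (\<integral>\<^sup>+t. ennreal (cutoff t) \<partial>M)"
    by (simp add: integral_cutoff real_distribution_M)
  moreover have "(\<lambda>k. emeasure (\<mu> k) (S \<times> A)) \<longlonglongrightarrow> emeasure m S"
    using marginals[of "\<lambda>_. 1" 1] by simp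
  ultimately show ?thesis by (rule LIMSEQ_unique)
qed

lemma compact_in_sets_m: "compact K \<Longrightarrow> K \<subseteq> S \<Longrightarrow> K \<in> sets m"
  unfolding sets_m SM_def
  by (auto simp: sets_restrict_space image_iff intro!: bexI[of _ K] borel_closed compact_imp_closed)

lemma emeasure_far_codes_le:
  assumes K: "compact K" "K \<subseteq> S" "K \<noteq> {}" and n: "0 < n"
  shows "emeasure M ({-1<..} \<inter> {t. ennreal (1 / n) < code_dist (K \<times> A) t}) \<le> emeasure m (S - K)"
    (is "emeasure M ?U \<le> _")
proof -
  define g where "g x = min 1 (n * infdist x K)" for x
  have g: "continuous_on S g" "0 \<le> g x" "g x \<le> 1" for x
    using n unfolding g_def by (auto intro!: continuous_intros simp: infdist_nonneg)
  have near: "indicator ?U (e z) \<le> ennreal (g (fst z))" if z: "z \<in> S \<times> A" for z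
  proof (cases "n * infdist (fst z) K < 1")
    case True
    then have "infdist (fst z) K < 1 / n" using n by (simp add: field_simps)
    then obtain x where x: "x \<in> K" "dist (fst z) x < 1 / n"
      using K(3) by (auto simp: infdist_def cINF_less_iff)
    have "code_dist (K \<times> A) (e z) \<le> ennreal (dist z (x, snd z))"
      by (rule code_dist_code) (use x z in auto)
    also have "\<dots> \<le> ennreal (1 / n)" using x(2) by (cases z) (simp add: dist_prod_def ennreal_leI)
    finally show ?thesis by (simp add: not_less[symmetric])
  next
    case False
    then show ?thesis by (simp add: g_def split: split_indicator)
  qed
  have "open {t. ennreal (1 / n) < code_dist (K \<times> A) t}"
    using lscD[OF lsc_code_dist[OF compact_Times[OF K(1) A]], of "ennreal (1 / n)"] by simp
  then have U: "open ?U" by (intro open_Int) auto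
  then have [measurable]: "?U \<in> sets borel" by (rule borel_open)
  from lsc_integral_le[OF lsc_indicator[OF U]]
  have "emeasure M ?U \<le> liminf (\<lambda>k. \<integral>\<^sup>+t. indicator ?U t \<partial>code_distr (\<mu> k))" by simp
  also have "\<dots> \<le> liminf (\<lambda>k. \<integral>\<^sup>+z. ennreal (g (fst z)) \<partial>\<mu> k)"
    using near
    by (intro Liminf_mono always_eventually allI, subst integral_code_distr) (auto intro!: nn_integral_mono)
  also have "\<dots> = (\<integral>\<^sup>+x. ennreal (g x) \<partial>m)" using marginals[OF g] by (simp add: lim_imp_Liminf)
  also have "\<dots> \<le> (\<integral>\<^sup>+x. indicator (S - K) x \<partial>m)"
    using g by (intro nn_integral_mono) (auto simp: g_def split: split_indicator)
  also have "\<dots> = emeasure m (S - K)"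
    using compact_in_sets_m[OF K(1,2)] sets.compl_sets[of K m] by (intro nn_integral_indicator) simp
  finally show ?thesis .
qed

lemma emeasure_compact_le_codes:
  assumes K: "compact K" "K \<subseteq> S"
  shows "emeasure m K \<le> emeasure M (codes (K \<times> A))"
proof (cases "K = {}")
  case False
  have compact_KA: "compact (K \<times> A)" using K(1) A by (rule compact_Times)
  then have [measurable]: "codes (K \<times> A) \<in> sets borel" by (intro borel_closed closed_codes)
  define U where "U n = {-1<..} \<inter> {t. ennreal (1 / real (Suc n)) < code_dist (K \<times> A) t}" for n
  have [measurable]: "U n \<in> sets borel" for n
    using lscD[OF lsc_code_dist[OF compact_KA], of "ennreal (1 / real (Suc n))"]
    by (auto simp: U_def intro!: sets.Int borel_open)
  have "incseq U"
  proof (rule incseq_SucI)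
    fix n have "ennreal (1 / real (Suc (Suc n))) \<le> ennreal (1 / real (Suc n))"
      by (intro ennreal_leI divide_left_mono) auto
    from le_less_trans[OF this] show "U n \<subseteq> U (Suc n)" unfolding U_def by blast
  qed
  have "{-1<..} - codes (K \<times> A) \<subseteq> (\<Union>n. U n)"
  proof
    fix t assume t: "t \<in> {-1<..} - codes (K \<times> A)"
    then have "0 < code_dist (K \<times> A) t"
      using codes_if_code_dist_eq_0[OF compact_KA] by (auto simp: zero_less_iff_neq_zero)
    then obtain r where r: "0 < r" "r < code_dist (K \<times> A) t" using dense by blast
    then obtain \<epsilon> where "r = ennreal \<epsilon>" "0 < \<epsilon>" by (cases r) auto
    moreover from this obtain n where "1 / real (Suc n) < \<epsilon>" using nat_approx_posE by blast
    ultimately have "t \<in> U n"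
      using r t by (auto simp: U_def intro: le_less_trans ennreal_leI less_imp_le)
    then show "t \<in> (\<Union>n. U n)" by blast
  qed
  then have "emeasure M ({-1<..} - codes (K \<times> A)) \<le> emeasure M (\<Union>n. U n)" by (intro emeasure_mono) auto
  also have "\<dots> = (SUP n. emeasure M (U n))"
    using \<open>incseq U\<close> by (intro SUP_emeasure_incseq[symmetric]) auto
  also have "\<dots> \<le> emeasure m (S - K)"
    unfolding U_def by (intro SUP_least emeasure_far_codes_le K False) simp
  finally have far: "emeasure M ({-1<..} - codes (K \<times> A)) \<le> emeasure m (S - K)" .
  have "emeasure m K + emeasure m (S - K) = emeasure m S"
    using compact_in_sets_m[OF K] K(2) sets.top[of m] by (subst plus_emeasure) (auto simp: Un_absorb1)
  also have "\<dots> \<le> (\<integral>\<^sup>+t. indicator {-1<..} t \<partial>M)" unfolding nn_integral_cutoff[symmetric]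
    by (intro nn_integral_mono) (auto simp: cutoff_def ennreal_neg split: split_indicator)
  also have "\<dots> \<le> emeasure M (codes (K \<times> A) \<union> ({-1<..} - codes (K \<times> A)))"
    by (simp, intro emeasure_mono) auto
  also have "\<dots> \<le> emeasure M (codes (K \<times> A)) + emeasure m (S - K)"
    using far by (intro order_trans[OF emeasure_subadditive] add_left_mono) auto
  finally show ?thesis
    using m.emeasure_finite[of "S - K"] by (simp add: ennreal_add_left_cancel_le add.commute)
qed simp

lemma ex_full_codes:
  obtains K :: "nat \<Rightarrow> 's set" where "\<And>i. K i \<subseteq> S" "\<And>i. compact (K i)" "emeasure M (\<Union>i. codes (K i \<times> A))
    = emeasure m S"
proof -
  obtain K :: "nat \<Rightarrow> 's set" where K: "\<And>i. K i \<subseteq> S" "\<And>i. compact (K i)"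
      and m_S: "emeasure m S = (SUP i. emeasure m (K i))"
    by (rule inner_regular_compacts[OF S sets_m finite_m]; rule that; assumption)
  have [measurable]: "codes (K i \<times> A) \<in> sets borel" for i
    by (intro borel_closed closed_codes compact_Times K A)
  have "emeasure m S \<le> emeasure M (\<Union>i. codes (K i \<times> A))"
    unfolding m_S
    by (intro SUP_least order_trans[OF emeasure_compact_le_codes[OF K(2,1)]] emeasure_mono) auto
  moreover have "emeasure M (\<Union>i. codes (K i \<times> A)) \<le> emeasure m S"
  proof -
    have "(\<integral>\<^sup>+t. indicator (\<Union>i. codes (K i \<times> A)) t \<partial>M) \<le> (\<integral>\<^sup>+t. ennreal (cutoff t) \<partial>M)"
      by (intro nn_integral_mono) (auto simp: codes_def cutoff_eq_1 split: split_indicator)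
    then show ?thesis by (simp add: nn_integral_cutoff)
  qed
  ultimately show thesis using that K antisym by blast
qed

lemma nn_integral_decode_le:
  assumes h: "lsc (S \<times> A) h" and L: "L \<subseteq> codes (S \<times> A)"
  shows "(\<integral>\<^sup>+t. h (decode t) * indicator L t \<partial>M) \<le> liminf (\<lambda>k. \<integral>\<^sup>+z. h z \<partial>\<mu> k)"
proof -
  obtain r :: "nat \<Rightarrow> real"
      and j where h_eq: "\<And>z. z \<in> S \<times> A \<Longrightarrow> h z = (SUP k. ennreal (r k * tent (j k) z))"
    by (rule lsc_eq_SUP_tent[OF h]; rule that; assumption)
  define h' where "h' t = (SUP k. ennreal (cutoff t * (r k * G (j k) t)))" for t
  have lsc_h': "lsc UNIV h'" unfolding h'_def
    by (intro lsc_SUP continuous_imp_lsc continuous_on_mult continuous_on_cutoff continuous_on_mult_left continuous_on_G)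
  have [measurable]: "h' \<in> borel_measurable borel" by (rule lsc_borel_measurable[OF lsc_h']) auto
  have "h (decode t) = h' t" if "t \<in> L" for t
  proof -
    have t: "t \<in> codes (S \<times> A)" using L that by blast
    then have "cutoff t = 1" by (simp add: codes_def cutoff_eq_1)
    then show ?thesis using decode_codes[OF t] by (simp add: h'_def h_eq)
  qed
  then have "(\<integral>\<^sup>+t. h (decode t) * indicator L t \<partial>M) \<le> (\<integral>\<^sup>+t. h' t \<partial>M)"
    by (intro nn_integral_mono) (auto split: split_indicator)
  also have "\<dots> \<le> liminf (\<lambda>k. \<integral>\<^sup>+t. h' t \<partial>code_distr (\<mu> k))" by (rule lsc_integral_le[OF lsc_h'])
  also have "\<dots> = liminf (\<lambda>k. \<integral>\<^sup>+z. h z \<partial>\<mu> k)"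
  proof -
    have "h' (-1) = 0" by (simp add: h'_def cutoff_def)
    moreover have "h' (e z) = h z" if "z \<in> S \<times> A" for z
      using that by (simp add: h'_def cutoff_eq_1 code_bounds G_code h_eq)
    ultimately have "(\<integral>\<^sup>+t. h' t \<partial>code_distr (\<mu> k)) = (\<integral>\<^sup>+z. h z \<partial>\<mu> k)" for k
      by (subst integral_code_distr) (auto intro!: nn_integral_cong)
    then show ?thesis by simp
  qed
  finally show ?thesis .
qed

lemma ex_limit_measure:
  obtains \<mu>' where "sets \<mu>' = sets (SM S \<Otimes>\<^sub>M SM A)" "emeasure \<mu>' (S \<times> A) = emeasure m S"
    "\<And>h. lsc (S \<times> A) h \<Longrightarrow> (\<integral>\<^sup>+z. h z \<partial>\<mu>') \<le> liminf (\<lambda>k. \<integral>\<^sup>+z. h z \<partial>\<mu> k)"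
proof -
  obtain K :: "nat \<Rightarrow> 's set" where K: "\<And>i. K i \<subseteq> S" "\<And>i. compact (K i)"
      and full: "emeasure M (\<Union>i. codes (K i \<times> A)) = emeasure m S"
    by (rule ex_full_codes; rule that; assumption)
  define L where "L = (\<Union>i. codes (K i \<times> A))"
  have [measurable]: "L \<in> sets borel" unfolding L_def
    by (intro sets.countable_UN image_subsetI borel_closed closed_codes compact_Times K A)
  have L_codes: "L \<subseteq> codes (S \<times> A)" using K(1) by (fastforce simp: L_def codes_def)
  have "decode \<in> borel_measurable (restrict_space M L)"
    using measurable_decode[OF compact_Times[OF K(2) A]] unfolding L_def
    by (simp cong: measurable_cong_sets add: sets_restrict_space_cong[OF M.events_eq_borel])
  then have decode: "decode \<in> measurable (restrict_space M L) (SM S \<Otimes>\<^sub>M SM A)"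
    using decode_codes(1)[OF subsetD[OF L_codes]]
    by (rule measurable_into_pair_SM) (simp add: space_restrict_space)
  define \<mu>' where "\<mu>' = distr (restrict_space M L) (SM S \<Otimes>\<^sub>M SM A) decode"
  have integral_\<mu>': "(\<integral>\<^sup>+z. h z \<partial>\<mu>') = (\<integral>\<^sup>+t. h (decode t) * indicator L t \<partial>M)"
    if "h \<in> borel_measurable (SM S \<Otimes>\<^sub>M SM A)" for h
    unfolding \<mu>'_def
    using decode that by (subst nn_integral_distr) (auto simp: nn_integral_restrict_space)
  show thesis
  proof
    show "sets \<mu>' = sets (SM S \<Otimes>\<^sub>M SM A)" by (simp add: \<mu>'_def)
    then have "emeasure \<mu>' (S \<times> A) = (\<integral>\<^sup>+z. 1 \<partial>\<mu>')" using sets_eq_imp_space_eq[of \<mu>'] by simp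
    also have "\<dots> = emeasure M L" by (subst integral_\<mu>') simp_all
    finally show "emeasure \<mu>' (S \<times> A) = emeasure m S" using full by (simp add: L_def)
    fix h :: "'s \<times> 'b \<Rightarrow> ennreal" assume h: "lsc (S \<times> A) h"
    show "(\<integral>\<^sup>+z. h z \<partial>\<mu>') \<le> liminf (\<lambda>k. \<integral>\<^sup>+z. h z \<partial>\<mu> k)"
      using nn_integral_decode_le[OF h L_codes]
      by (subst integral_\<mu>'[OF lsc_borel_measurable[OF h _ measurable_pair_SM_borel]]) simp_all
  qed
qed

end

theorem subprob_weakly_compact:
  fixes S :: "'s::polish_space set" and A :: "'b::polish_space set"
  assumes S: "S \<in> sets borel" and A: "compact A"
    and \<mu>: "\<And>k. sets (\<mu> k) = sets (SM S \<Otimes>\<^sub>M SM A)" "\<And>k. emeasure (\<mu> k) (S \<times> A) \<le> 1"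
    and m: "sets m = sets (SM S)" "finite_measure m"
    and conv: "\<And>(f::'s \<Rightarrow> real) B. continuous_on S f \<Longrightarrow> (\<And>x. 0 \<le> f x) \<Longrightarrow> (\<And>x. f x \<le> B) \<Longrightarrow>
      (\<lambda>k. \<integral>\<^sup>+z. ennreal (f (fst z)) \<partial>\<mu> k) \<longlonglongrightarrow> (\<integral>\<^sup>+x. ennreal (f x) \<partial>m)"
  obtains r \<mu>' where "strict_mono (r :: nat \<Rightarrow> nat)" "sets \<mu>' = sets (SM S \<Otimes>\<^sub>M SM A)"
    "emeasure \<mu>' (S \<times> A) = emeasure m S"
    "\<And>h. lsc (S \<times> A) h \<Longrightarrow> (\<integral>\<^sup>+z. h z \<partial>\<mu>') \<le> liminf (\<lambda>k. \<integral>\<^sup>+z. h z \<partial>\<mu> (r k))"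
proof -
  obtain e :: "'s \<times> 'b \<Rightarrow> real" and G where "real_code e G" using ex_real_code by blast
  then interpret real_code e G .
  have "e \<in> borel_measurable (\<mu> k)" for k
    using measurable_compose[OF measurable_pair_SM_borel measurable_code]
    by (simp cong: measurable_cong_sets[OF \<mu>(1)])
  moreover have "emeasure (\<mu> k) (space (\<mu> k)) \<le> 1" for k using \<mu>(2) sets_eq_imp_space_eq[OF \<mu>(1)] by simp
  ultimately have "tight (\<lambda>k. code_distr (\<mu> k))" by (rule tight_code_distr)
  from tight_imp_convergent_subsubsequence[OF this strict_mono_id] obtain r M where r: "strict_mono r"
    and M: "real_distribution M" "weak_conv_m ((\<lambda>k. code_distr (\<mu> k)) \<circ> id \<circ> r) M" by blast
  interpret coded_weak_limit e G S A "\<lambda>k. \<mu> (r k)" m M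
  proof (intro coded_weak_limit.intro coded_weak_limit_axioms.intro real_code_axioms)
    show "(\<lambda>k. \<integral>\<^sup>+z. ennreal (f (fst z)) \<partial>\<mu> (r k)) \<longlonglongrightarrow> (\<integral>\<^sup>+x. ennreal (f x) \<partial>m)"
      if "continuous_on S f" "\<And>x. 0 \<le> f x" "\<And>x. f x \<le> B" for f B
      using LIMSEQ_subseq_LIMSEQ[OF conv[OF that] r] by (simp add: o_def)
  qed (use S A \<mu> m M in \<open>simp_all add: o_def\<close>)
  show thesis by (rule ex_limit_measure, rule that[OF r])
qed

lemma tendsto_of_lsc_bounds:
  fixes \<mu> :: "nat \<Rightarrow> 'a::{metric_space,second_countable_topology} measure"
  assumes sp: "\<And>k. space (\<mu> k) = T" "space \<mu>' = T"
      and id: "\<And>k. (\<lambda>z. z) \<in> measurable (\<mu> k) borel" "(\<lambda>z. z) \<in> measurable \<mu>' borel"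
    and fin: "emeasure \<mu>' T < \<infinity>"
    and mass: "(\<lambda>k. emeasure (\<mu> k) T) \<longlonglongrightarrow> emeasure \<mu>' T"
    and lsc: "\<And>h. lsc T h \<Longrightarrow> (\<integral>\<^sup>+z. h z \<partial>\<mu>') \<le> liminf (\<lambda>k. \<integral>\<^sup>+z. h z \<partial>\<mu> k)"
    and f: "continuous_on T f" "\<And>z. z \<in> T \<Longrightarrow> 0 \<le> f z" "\<And>z. z \<in> T \<Longrightarrow> f z \<le> B"
  shows "(\<lambda>k. \<integral>\<^sup>+z. ennreal (f z) \<partial>\<mu> k) \<longlonglongrightarrow> (\<integral>\<^sup>+z. ennreal (f z) \<partial>\<mu>')"
proof (rule tendsto_of_liminf_bounds)
  have lsc_f: "lsc T (\<lambda>z. ennreal (f z))" "lsc T (\<lambda>z. ennreal (B - f z))"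
    by (intro continuous_imp_lsc continuous_intros f(1))+
  then show "(\<integral>\<^sup>+z. ennreal (f z) \<partial>\<mu>') \<le> liminf (\<lambda>k. \<integral>\<^sup>+z. ennreal (f z) \<partial>\<mu> k)"
    "(\<integral>\<^sup>+z. ennreal (B - f z) \<partial>\<mu>') \<le> liminf (\<lambda>k. \<integral>\<^sup>+z. ennreal (B - f z) \<partial>\<mu> k)"
    by (auto intro: lsc)
  have total: "(\<integral>\<^sup>+z. ennreal (f z) \<partial>N) + (\<integral>\<^sup>+z. ennreal (B - f z) \<partial>N) = ennreal B * emeasure N T"
    if N: "space N = T" "(\<lambda>z. z) \<in> measurable N borel" for N
  proof -
    have "(\<integral>\<^sup>+z. ennreal (f z) \<partial>N) + (\<integral>\<^sup>+z. ennreal (B - f z) \<partial>N)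
        = (\<integral>\<^sup>+z. ennreal (f z) + ennreal (B - f z) \<partial>N)"
      using lsc_f lsc_borel_measurable[of T _ N] N by (intro nn_integral_add[symmetric]) auto
    also have "\<dots> = (\<integral>\<^sup>+z. ennreal B \<partial>N)"
      using f N(1) by (intro nn_integral_cong) (simp flip: ennreal_plus)
    finally show ?thesis using N(1) by simp
  qed
  show "(\<integral>\<^sup>+z. ennreal (f z) \<partial>\<mu>') + (\<integral>\<^sup>+z. ennreal (B - f z) \<partial>\<mu>') < \<infinity>"
    unfolding total[OF sp(2) id(2)] using fin by (simp add: ennreal_mult_less_top)
  show "(\<lambda>k. (\<integral>\<^sup>+z. ennreal (f z) \<partial>\<mu> k) + (\<integral>\<^sup>+z. ennreal (B - f z) \<partial>\<mu> k))
      \<longlonglongrightarrow> (\<integral>\<^sup>+z. ennreal (f z) \<partial>\<mu>') + (\<integral>\<^sup>+z. ennreal (B - f z) \<partial>\<mu>')"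
    unfolding total[OF sp(1) id(1)] total[OF sp(2) id(2)]
    using fin mass by (intro tendsto_mult_ennreal tendsto_const) auto
qed

section \<open>Measurable selection and disintegration\<close>

lemma zero_section_sets:
  fixes S :: "'s::polish_space set" and K :: "'c::polish_space set"
  assumes K: "compact K" and g: "lsc (S \<times> K) g"
  shows "{x\<in>S. \<exists>t\<in>K. g (x, t) = 0} \<in> sets (SM S)"
proof (cases "K = {}")
  case False
  have [measurable]: "(\<lambda>x. INF t\<in>K. g (x, t)) \<in> borel_measurable (SM S)"
    by (rule lsc_borel_measurable[OF lsc_INF[OF g K False]]) auto
  have "(\<exists>t\<in>K. g (x, t) = 0) \<longleftrightarrow> (INF t\<in>K. g (x, t)) = 0" if "x \<in> S" for x
  proof -
    have "lsc K (\<lambda>t. g (x, t))" using that by (intro lsc_compose[OF g] continuous_intros) auto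
    from lsc_attains_INF[OF this K False] show ?thesis by (metis INF_lower le_zero_eq)
  qed
  then have "{x\<in>S. \<exists>t\<in>K. g (x, t) = 0} = {x\<in>space (SM S). (INF t\<in>K. g (x, t)) = 0}" by auto
  also have "\<dots> \<in> sets (SM S)" by measurable
  finally show ?thesis .
qed simp

lemma ex_measurable_real_zero:
  fixes S :: "'s::polish_space set" and L :: "real set"
  assumes L: "compact L" "L \<noteq> {}" and g: "lsc (S \<times> L) g"
  shows "\<exists>\<tau>\<in>borel_measurable (SM S). \<forall>x\<in>S. \<tau> x \<in> L \<and> ((\<exists>t\<in>L. g (x, t) = 0) \<longrightarrow> g (x, \<tau> x) = 0)"
proof -
  obtain t0 where t0: "t0 \<in> L" using L(2) by auto
  define Z where "Z x = {t\<in>L. g (x, t) = 0}" for x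
  define \<tau> where "\<tau> x = (if Z x = {} then t0 else Inf (Z x))" for x
  have compact_Z: "compact (Z x)" if "x \<in> S" for x
  proof -
    have "lsc L (\<lambda>t. g (x, t))" using that by (intro lsc_compose[OF g] continuous_intros) auto
    from lscD[OF this, of 0] have "closedin (top_of_set L) (L - {t\<in>L. 0 < g (x, t)})"
      using closedin_diff[OF closedin_topspace] by fastforce
    moreover have "L - {t\<in>L. 0 < g (x, t)} = Z x" by (auto simp: Z_def)
    ultimately show ?thesis using closedin_compact[OF L(1)] by simp
  qed
  have Inf_Z: "Inf (Z x) \<in> Z x" "t \<in> Z x \<Longrightarrow> Inf (Z x) \<le> t" if "x \<in> S" "Z x \<noteq> {}" for x t
  proof -
    have bdd: "bdd_below (Z x)"
      using compact_Z[OF that(1)] by (intro bounded_imp_bdd_below compact_imp_bounded)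
    show "Inf (Z x) \<in> Z x"
      using that compact_Z bdd by (intro closed_contains_Inf compact_imp_closed) auto
    show "t \<in> Z x \<Longrightarrow> Inf (Z x) \<le> t" using bdd by (rule cInf_lower[rotated])
  qed
  have "{x \<in> space (SM S). \<tau> x \<le> y} \<in> sets (SM S)" for y
  proof -
    have zero_sets: "{x\<in>S. \<exists>t\<in>K. g (x, t) = 0} \<in> sets (SM S)" if "K \<subseteq> L" "compact K" for K
      using that by (intro zero_section_sets lsc_subset[OF g]) auto
    have "(\<exists>t\<in>L \<inter> {..y}. g (x, t) = 0) \<longleftrightarrow> Inf (Z x) \<le> y" if x: "x \<in> S" "Z x \<noteq> {}" for x
      using Inf_Z[OF x] by (force simp: Z_def)
    then have "{x \<in> space (SM S). \<tau> x \<le> y} = {x\<in>S. \<exists>t\<in>L \<inter> {..y}. g (x, t) = 0} \<union>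
        (if t0 \<le> y then space (SM S) - {x\<in>S. \<exists>t\<in>L. g (x, t) = 0} else {})"
      by (auto simp: \<tau>_def Z_def)
    also have "\<dots> \<in> sets (SM S)"
      using zero_sets[of "L \<inter> {..y}"] zero_sets[of L] L(1)
      by (auto intro!: sets.Un sets.Diff simp del: space_SM)
    finally show ?thesis .
  qed
  then have "\<tau> \<in> borel_measurable (SM S)" by (simp add: borel_measurable_iff_le)
  moreover have "\<tau> x \<in> L" "(\<exists>t\<in>L. g (x, t) = 0) \<longrightarrow> g (x, \<tau> x) = 0" if "x \<in> S" for x
    using Inf_Z(1)[OF that] t0 by (auto simp: \<tau>_def Z_def)
  ultimately show ?thesis by blast
qed

definition zero_selector :: "'s::polish_space set \<Rightarrow> 'b::polish_space set \<Rightarrow> ('s \<times> 'b \<Rightarrow> ennreal) \<Rightarrow> 's \<Rightarrow> 'b" where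
  "zero_selector S A h = (SOME f. f \<in> measurable (SM S) (SM A) \<and> (\<forall>x\<in>S. (\<exists>a\<in>A. h (x, a) = 0) \<longrightarrow> h (x, f x) = 0))"

lemma
  fixes S :: "'s::polish_space set" and A :: "'b::polish_space set"
  assumes A: "compact A" "A \<noteq> {}" and h: "lsc (S \<times> A) h"
  shows measurable_zero_selector: "zero_selector S A h \<in> measurable (SM S) (SM A)"
    and zero_selector_eq_0: "x \<in> S \<Longrightarrow> a \<in> A \<Longrightarrow> h (x, a) = 0 \<Longrightarrow> h (x, zero_selector S A h x) = 0"
proof -
  obtain L :: "real set" and \<psi> :: "real \<Rightarrow> 'b" where L: "compact L" "continuous_on L \<psi>" "\<psi> ` L = A"
    by (rule ex_compact_code[OF A(1)]; rule that; assumption)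
  have "L \<noteq> {}" using L(3) A(2) by auto
  have "continuous_on (S \<times> L) (\<lambda>p. \<psi> (snd p))"
    by (rule continuous_on_compose2[OF L(2)]) (auto intro: continuous_intros)
  then have "lsc (S \<times> L) (\<lambda>p. h (fst p, \<psi> (snd p)))"
    using L(3) by (intro lsc_compose[OF h] continuous_intros) auto
  from ex_measurable_real_zero[OF L(1) \<open>L \<noteq> {}\<close> this] obtain \<tau> where \<tau>: "\<tau> \<in> borel_measurable (SM S)"
    and \<tau>_L: "\<And>x. x \<in> S \<Longrightarrow> \<tau> x \<in> L" and \<tau>_0: "\<And>x. x \<in> S \<Longrightarrow> \<exists>t\<in>L. h (x, \<psi> t) = 0 \<Longrightarrow> h (x, \<psi> (\<tau> x)) = 0"
    by auto
  have "(\<lambda>x. \<psi> (\<tau> x)) \<in> measurable (SM S) (SM A)"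
  proof (rule measurable_into_SM)
    have "\<tau> \<in> measurable (SM S) (restrict_space borel L)" using \<tau> \<tau>_L
      by (intro measurable_restrict_space2) auto
    then show "(\<lambda>x. \<psi> (\<tau> x)) \<in> borel_measurable (SM S)"
      by (rule measurable_compose[OF _ borel_measurable_continuous_on_restrict[OF L(2)]])
  qed (use \<tau>_L L(3) in auto)
  moreover have "\<forall>x\<in>S. (\<exists>a\<in>A. h (x, a) = 0) \<longrightarrow> h (x, \<psi> (\<tau> x)) = 0" using \<tau>_0 L(3) by blast
  ultimately have "\<exists>f. f \<in> measurable (SM S) (SM A) \<and> (\<forall>x\<in>S. (\<exists>a\<in>A. h (x, a) = 0) \<longrightarrow> h (x, f x) = 0)"
    by (intro exI[of _ "\<lambda>x. \<psi> (\<tau> x)"] conjI)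
  from someI_ex[OF this, folded zero_selector_def]
  show "zero_selector S A h \<in> measurable (SM S) (SM A)"
    "x \<in> S \<Longrightarrow> a \<in> A \<Longrightarrow> h (x, a) = 0 \<Longrightarrow> h (x, zero_selector S A h x) = 0" by blast+
qed

lemma AE_le_of_nn_integral_le:
  fixes f g :: "'a \<Rightarrow> ennreal"
  assumes [measurable]: "f \<in> borel_measurable M" "g \<in> borel_measurable M" and fin: "(\<integral>\<^sup>+x. g x \<partial>M) < \<infinity>"
    and le: "\<And>X. X \<in> sets M \<Longrightarrow> (\<integral>\<^sup>+x\<in>X. f x \<partial>M) \<le> (\<integral>\<^sup>+x\<in>X. g x \<partial>M)"
  shows "AE x in M. f x \<le> g x"
proof -
  define E where "E = {x\<in>space M. g x < f x}"
  have [measurable]: "E \<in> sets M" unfolding E_def by measurable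
  have "(\<integral>\<^sup>+x. g x * indicator E x \<partial>M) \<le> (\<integral>\<^sup>+x. g x \<partial>M)"
    by (intro nn_integral_mono) (auto split: split_indicator)
  then have finite_E: "(\<integral>\<^sup>+x. g x * indicator E x \<partial>M) < \<infinity>" using fin by (rule le_less_trans)
  have "(\<integral>\<^sup>+x. f x * indicator E x - g x * indicator E x \<partial>M)
      = (\<integral>\<^sup>+x. f x * indicator E x \<partial>M) - (\<integral>\<^sup>+x. g x * indicator E x \<partial>M)"
    using finite_E by (intro nn_integral_diff) (auto simp: E_def split: split_indicator)
  also have "\<dots> = 0"
    using le[of E] le_less_trans[OF le[of E] finite_E] by (simp add: diff_eq_0_iff_ennreal)
  finally have "AE x in M. f x * indicator E x - g x * indicator E x = 0"
    by (subst (asm) nn_integral_0_iff_AE) auto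
  then show ?thesis
  proof (rule AE_mp, intro AE_I2 impI)
    fix x assume x: "x \<in> space M" "f x * indicator E x - g x * indicator E x = 0"
    show "f x \<le> g x"
    proof (rule ccontr)
      assume "\<not> f x \<le> g x"
      then have "x \<in> E" "g x < f x" using x by (auto simp: E_def)
      then show False using x(2) by (auto simp: diff_eq_0_iff_ennreal)
    qed
  qed
qed

lemma measurable_kernel_integral:
  "L \<in> measurable M (subprob_algebra N) \<Longrightarrow> g \<in> borel_measurable (M \<Otimes>\<^sub>M N) \<Longrightarrow>
    (\<lambda>x. \<integral>\<^sup>+t. g (x, t) \<partial>L x) \<in> borel_measurable M"
  by (rule nn_integral_measurable_subprob_algebra2[where N=N]) simp_all

locale bounded_real_joint = finite_measure N for N :: "('x \<times> real) measure" +
  fixes M :: "'x measure" and a b :: real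
  assumes sets_N[measurable_cong]: "sets N = sets (M \<Otimes>\<^sub>M borel)" and AE_bounded: "AE z in N. snd z \<in> {a..b}"
begin

lemma space_N: "space N = space M \<times> UNIV"
  using sets_eq_imp_space_eq[OF sets_N] by (simp add: space_pair_measure)

definition marginal :: "'x measure" where
  "marginal = distr N M fst"

lemma sets_marginal[simp, measurable_cong]: "sets marginal = sets M"
    and space_marginal[simp]: "space marginal = space M"
  by (simp_all add: marginal_def)

sublocale marginal: finite_measure marginal
  unfolding marginal_def by (rule finite_measure_distr) simp

lemma emeasure_marginal: "X \<in> sets M \<Longrightarrow> emeasure marginal X = emeasure N (X \<times> UNIV)"
  unfolding marginal_def using sets.sets_into_space[of X M]
  by (subst emeasure_distr) (auto simp: space_N intro!: arg_cong[where f="emeasure N"])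

definition lower_marginal :: "real \<Rightarrow> 'x measure" where
  "lower_marginal y = distr (restrict_space N (space M \<times> {..y})) M fst"

lemma sets_lower_marginal[simp]: "sets (lower_marginal y) = sets M"
  by (simp add: lower_marginal_def)

lemma emeasure_lower_marginal:
  assumes X[measurable]: "X \<in> sets M" shows "emeasure (lower_marginal y) X = emeasure N (X \<times> {..y})"
proof -
  have "fst \<in> measurable (restrict_space N (space M \<times> {..y})) M"
    by (rule measurable_restrict_space1) simp
  moreover have "fst -` X \<inter> space (restrict_space N (space M \<times> {..y})) = X \<times> {..y}"
    using sets.sets_into_space[OF X] by (auto simp: space_restrict_space space_N)
  ultimately show ?thesis
    using sets.sets_into_space[OF X] X unfolding lower_marginal_def
    by (subst emeasure_distr, simp_all, subst emeasure_restrict_space) auto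
qed

lemma emeasure_Times_atMost_mono: "X \<in> sets M \<Longrightarrow> y \<le> y' \<Longrightarrow> emeasure N (X \<times> {..y}) \<le> emeasure N (X \<times> {..y'})"
  by (intro emeasure_mono) auto

definition cond_dens :: "real \<Rightarrow> 'x \<Rightarrow> ennreal" where
  "cond_dens y = RN_deriv marginal (lower_marginal y)"

lemma measurable_cond_dens[measurable]: "cond_dens y \<in> borel_measurable M"
  using borel_measurable_RN_deriv[of marginal "lower_marginal y"] unfolding cond_dens_def by simp

lemma nn_integral_cond_dens:
  assumes X: "X \<in> sets M" shows "(\<integral>\<^sup>+x\<in>X. cond_dens y x \<partial>marginal) = emeasure N (X \<times> {..y})"
proof -
  have "emeasure (lower_marginal y) E \<le> emeasure marginal E" if "E \<in> sets M" for E
    using that by (simp add: emeasure_lower_marginal emeasure_marginal) (intro emeasure_mono, auto)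
  then have "absolutely_continuous marginal (lower_marginal y)"
    unfolding absolutely_continuous_def null_sets_def by (auto, metis le_zero_eq)
  then have "density marginal (cond_dens y) = lower_marginal y"
    unfolding cond_dens_def by (rule marginal.density_RN_deriv) simp
  then show ?thesis
    using X emeasure_density[of "cond_dens y" marginal X] by (simp add: emeasure_lower_marginal)
qed

lemma nn_integral_cond_dens_finite: "(\<integral>\<^sup>+x. cond_dens y x \<partial>marginal) < \<top>"
proof -
  have "(\<integral>\<^sup>+x. cond_dens y x \<partial>marginal) = (\<integral>\<^sup>+x\<in>space M. cond_dens y x \<partial>marginal)"
    by (intro nn_integral_cong) simp
  then show ?thesis by (simp add: nn_integral_cond_dens less_top[symmetric])
qed

lemma AE_cond_dens_mono: "y \<le> y' \<Longrightarrow> AE x in marginal. cond_dens y x \<le> cond_dens y' x"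
  by (rule AE_le_of_nn_integral_le)
    (simp_all add: nn_integral_cond_dens nn_integral_cond_dens_finite emeasure_Times_atMost_mono)

lemma AE_cond_dens_le_1: "AE x in marginal. cond_dens y x \<le> 1"
proof (rule AE_le_of_nn_integral_le)
  fix X assume "X \<in> sets marginal"
  then show "(\<integral>\<^sup>+x\<in>X. cond_dens y x \<partial>marginal) \<le> (\<integral>\<^sup>+x\<in>X. 1 \<partial>marginal)"
    by (simp add: nn_integral_cond_dens emeasure_marginal) (intro emeasure_mono, auto)
qed (simp_all add: less_top[symmetric])

definition mono_dens :: "real \<Rightarrow> 'x \<Rightarrow> ennreal" where
  "mono_dens q x = min 1 (SUP p\<in>\<rat> \<inter> {..q}. cond_dens p x)"

lemma mono_dens_le_1: "mono_dens q x \<le> 1"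
  by (simp add: mono_dens_def)

lemma measurable_mono_dens[measurable]: "mono_dens q \<in> borel_measurable M"
proof -
  have [measurable]: "(\<lambda>x. SUP p\<in>\<rat> \<inter> {..q}. cond_dens p x) \<in> borel_measurable M"
    by (intro borel_measurable_SUP) (auto intro: countable_subset[OF _ countable_rat])
  show ?thesis unfolding mono_dens_def by measurable
qed

lemma AE_mono_dens: "AE x in marginal. \<forall>q\<in>\<rat>. mono_dens q x = cond_dens q x"
proof -
  have "AE x in marginal. \<forall>q\<in>\<rat>. cond_dens q x \<le> 1 \<and> (\<forall>p\<in>\<rat> \<inter> {..q}. cond_dens p x \<le> cond_dens q x)"
    using AE_cond_dens_le_1 AE_cond_dens_mono
    by (intro AE_ball_countable[THEN iffD2] ballI AE_conjI) (auto intro: countable_subset[OF _ countable_rat] simp: countable_rat)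
  then show ?thesis
  proof eventually_elim
    case (elim x)
    have "(SUP p\<in>\<rat> \<inter> {..q}. cond_dens p x) = cond_dens q x" if "q \<in> \<rat>" for q
      using elim that by (intro antisym SUP_least SUP_upper) auto
    then show ?case using elim by (simp add: mono_dens_def)
  qed
qed

definition cond_cdf :: "'x \<Rightarrow> real \<Rightarrow> ennreal" where
  "cond_cdf x y = (if y < a then 0 else if b \<le> y then 1 else (INF q\<in>\<rat> \<inter> {y<..}. mono_dens q x))"

lemma cond_cdf_le_1: "cond_cdf x y \<le> 1"
  using Rats_dense_in_real[of y "y + 1"] by (auto simp: cond_cdf_def intro!: INF_lower2 mono_dens_le_1)

lemma cond_cdf_mono: "y \<le> y' \<Longrightarrow> cond_cdf x y \<le> cond_cdf x y'"
  using cond_cdf_le_1[of x y] by (auto simp: cond_cdf_def intro!: INF_superset_mono)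

lemma cond_cdf_right:
  assumes r: "cond_cdf x y < r" shows "\<exists>q>y. cond_cdf x q < r"
proof -
  consider "y < a" | "a \<le> y" "y < b" | "a \<le> y" "b \<le> y" by linarith
  then show ?thesis
  proof cases
    case 1
    then show ?thesis using r by (intro exI[of _ "(y + a) / 2"]) (simp add: cond_cdf_def)
  next
    case 2
    then obtain q where q: "q \<in> \<rat>" "y < q" "mono_dens q x < r"
      using r by (auto simp: cond_cdf_def INF_less_iff)
    define p where "p = (y + min q b) / 2"
    have "cond_cdf x p \<le> mono_dens q x" using q 2 by (auto simp: cond_cdf_def p_def intro!: INF_lower)
    then show ?thesis using q 2 by (intro exI[of _ p]) (auto simp: p_def)
  next
    case 3
    then show ?thesis using r by (intro exI[of _ "y + 1"]) (simp add: cond_cdf_def)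
  qed
qed

lemma measurable_cond_cdf[measurable]: "(\<lambda>x. cond_cdf x y) \<in> borel_measurable M"
proof -
  have [measurable]: "(\<lambda>x. INF q\<in>\<rat> \<inter> {y<..}. mono_dens q x) \<in> borel_measurable M"
    by (intro borel_measurable_INF) (auto intro: countable_subset[OF _ countable_rat])
  show ?thesis unfolding cond_cdf_def by measurable
qed

lemma emeasure_right_limit:
  assumes X[measurable]: "X \<in> sets M"
  shows "(INF n. emeasure N (X \<times> {..y + 1 / real (Suc n)})) = emeasure N (X \<times> {..y})"
proof -
  have "decseq (\<lambda>n. X \<times> {..y + 1 / real (Suc n)})"
  proof (rule decseq_SucI)
    fix n have "1 / real (Suc (Suc n)) \<le> 1 / real (Suc n)" by (intro divide_left_mono) auto
    then show "X \<times> {..y + 1 / real (Suc (Suc n))} \<subseteq> X \<times> {..y + 1 / real (Suc n)}" by auto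
  qed
  then have "(INF n. emeasure N (X \<times> {..y + 1 / real (Suc n)})) = emeasure N (\<Inter>n. X \<times> {..y + 1 / real (Suc n)})"
    by (intro INF_emeasure_decseq) auto
  also have "(\<Inter>n. X \<times> {..y + 1 / real (Suc n)}) = X \<times> {..y}"
  proof -
    have "t \<le> y" if "\<And>n. t \<le> y + 1 / real (Suc n)" for t
    proof (rule field_le_epsilon)
      fix d :: real assume "0 < d"
      then obtain n where "1 / real (Suc n) < d" using nat_approx_posE by blast
      then show "t \<le> y + d" using that[of n] by simp
    qed
    then show ?thesis by (auto intro: order_trans)
  qed
  finally show ?thesis .
qed

lemma nn_integral_INF_mono_dens:
  assumes X[measurable]: "X \<in> sets M"
  shows "(\<integral>\<^sup>+x\<in>X. (INF q\<in>\<rat> \<inter> {y<..}. mono_dens q x) \<partial>marginal) = emeasure N (X \<times> {..y})" (is "?I = _")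
proof (rule antisym)
  have "?I \<le> emeasure N (X \<times> {..y + 1 / real (Suc n)})" for n
  proof -
    obtain q where q: "q \<in> \<rat>" "y < q" "q < y + 1 / real (Suc n)" using Rats_dense_in_real[of y "y + 1 / real (Suc n)"] by auto
    have "AE x in marginal. (INF q\<in>\<rat> \<inter> {y<..}. mono_dens q x) * indicator X x \<le> cond_dens q x * indicator X x"
      using AE_mono_dens by eventually_elim (use q in \<open>auto intro!: INF_lower2[of q] mult_right_mono\<close>)
    then have "?I \<le> emeasure N (X \<times> {..q})"
      unfolding nn_integral_cond_dens[OF X, symmetric] by (rule nn_integral_mono_AE)
    also have "\<dots> \<le> emeasure N (X \<times> {..y + 1 / real (Suc n)})"
      using q X by (intro emeasure_Times_atMost_mono) auto
    finally show ?thesis .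
  qed
  then show "?I \<le> emeasure N (X \<times> {..y})"
    unfolding emeasure_right_limit[OF X, of y, symmetric] by (rule INF_greatest)
  have "AE x in marginal. \<forall>q\<in>\<rat> \<inter> {y<..}. cond_dens y x \<le> cond_dens q x"
    by (intro AE_ball_countable[THEN iffD2] ballI AE_cond_dens_mono) (auto intro: countable_subset[OF _ countable_rat])
  with AE_mono_dens have "AE x in marginal. cond_dens y x * indicator X x
      \<le> (INF q\<in>\<rat> \<inter> {y<..}. mono_dens q x) * indicator X x"
    by eventually_elim (auto intro!: INF_greatest mult_right_mono)
  then show "emeasure N (X \<times> {..y}) \<le> ?I"
    unfolding nn_integral_cond_dens[OF X, symmetric] by (rule nn_integral_mono_AE)
qed

lemma nn_integral_cond_cdf:
  assumes X[measurable]: "X \<in> sets M"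
  shows "(\<integral>\<^sup>+x\<in>X. cond_cdf x y \<partial>marginal) = emeasure N (X \<times> {..y})"
proof -
  consider "y < a" | "a \<le> y" "y < b" | "a \<le> y" "b \<le> y" by linarith
  then show ?thesis
  proof cases
    case 1
    have "emeasure N (X \<times> {..y}) = emeasure N {}"
    proof (rule emeasure_eq_AE)
      show "AE z in N. z \<in> X \<times> {..y} \<longleftrightarrow> z \<in> {}" using AE_bounded by eventually_elim (use 1 in auto)
    qed auto
    then show ?thesis using 1 by (simp add: cond_cdf_def)
  next
    case 2
    then show ?thesis using nn_integral_INF_mono_dens[OF X, of y] by (simp add: cond_cdf_def)
  next
    case 3
    have "emeasure N (X \<times> {..y}) = emeasure N (X \<times> UNIV)"
    proof (rule emeasure_eq_AE)
      show "AE z in N. z \<in> X \<times> {..y} \<longleftrightarrow> z \<in> X \<times> UNIV" using AE_bounded by eventually_elim (use 3 in auto)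
    qed auto
    then show ?thesis using 3 by (simp add: cond_cdf_def emeasure_marginal)
  qed
qed

definition cond_kernel :: "'x \<Rightarrow> real measure" where
  "cond_kernel x = interval_measure (\<lambda>y. enn2real (cond_cdf x y))"

lemma ennreal_cond_cdf: "ennreal (enn2real (cond_cdf x y)) = cond_cdf x y"
  using cond_cdf_le_1[of x y] by (intro ennreal_enn2real) (auto simp: less_top[symmetric] top_unique)

lemma enn2real_cond_cdf_mono: "y \<le> y' \<Longrightarrow> enn2real (cond_cdf x y) \<le> enn2real (cond_cdf x y')"
  using cond_cdf_mono[of y y' x] cond_cdf_le_1[of x y']
  by (intro enn2real_mono) (auto simp: less_top[symmetric] top_unique)

lemma continuous_cond_cdf: "continuous (at_right y) (\<lambda>y. enn2real (cond_cdf x y))"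
  unfolding continuous_within
proof (rule tendstoI)
  fix \<epsilon> :: real assume \<epsilon>: "0 < \<epsilon>"
  let ?h = "\<lambda>y. enn2real (cond_cdf x y)"
  have "ennreal (?h y) < ennreal (?h y + \<epsilon>)" using \<epsilon> by (simp add: ennreal_less_iff)
  then obtain q where q: "y < q" "cond_cdf x q < ennreal (?h y + \<epsilon>)"
    using cond_cdf_right[of x y] by (auto simp: ennreal_cond_cdf)
  then have less: "?h q < ?h y + \<epsilon>" using \<epsilon>
    by (subst (asm) ennreal_cond_cdf[symmetric]) (simp add: ennreal_less_iff flip: ennreal_plus)
  show "\<forall>\<^sub>F z in at_right y. dist (?h z) (?h y) < \<epsilon>"
    unfolding eventually_at_right_field
  proof (intro exI[of _ q] conjI allI impI q)
    fix z assume "y < z" "z < q"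
    then show "dist (?h z) (?h y) < \<epsilon>"
      using enn2real_cond_cdf_mono[of y z x] enn2real_cond_cdf_mono[of z q x] less
      by (simp add: dist_real_def)
  qed
qed

lemma cond_cdf_limits:
  assumes "a \<le> b"
  shows "((\<lambda>y. enn2real (cond_cdf x y)) \<longlongrightarrow> 0) at_bot" "((\<lambda>y. enn2real (cond_cdf x y)) \<longlongrightarrow> 1) at_top"
proof -
  have "\<forall>\<^sub>F y in at_bot. enn2real (cond_cdf x y) = 0"
    using eventually_gt_at_bot[of a] by eventually_elim (simp add: cond_cdf_def)
  then show "((\<lambda>y. enn2real (cond_cdf x y)) \<longlongrightarrow> 0) at_bot" by (rule tendsto_eventually)
  have "\<forall>\<^sub>F y in at_top. enn2real (cond_cdf x y) = 1"
    using eventually_ge_at_top[of b] by eventually_elim (use assms in \<open>simp add: cond_cdf_def\<close>)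
  then show "((\<lambda>y. enn2real (cond_cdf x y)) \<longlongrightarrow> 1) at_top" by (rule tendsto_eventually)
qed

context
  assumes a_le_b: "a \<le> b"
begin

lemma real_distribution_cond_kernel: "real_distribution (cond_kernel x)"
  unfolding cond_kernel_def
  by (rule real_distribution_interval_measure[OF enn2real_cond_cdf_mono continuous_cond_cdf cond_cdf_limits[OF a_le_b]])

lemma sets_cond_kernel[simp]: "sets (cond_kernel x) = sets borel"
    and prob_space_cond_kernel: "prob_space (cond_kernel x)"
  using real_distribution_cond_kernel[of x]
  by (auto simp: real_distribution_def real_distribution_axioms_def)

lemma emeasure_cond_kernel: "emeasure (cond_kernel x) {..y} = cond_cdf x y"
proof -
  interpret real_distribution "cond_kernel x" by (rule real_distribution_cond_kernel)
  have "cdf (cond_kernel x) = (\<lambda>y. enn2real (cond_cdf x y))" unfolding cond_kernel_def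
    by (rule cdf_interval_measure[OF enn2real_cond_cdf_mono continuous_cond_cdf cond_cdf_limits(1)[OF a_le_b]])
  then have "measure (cond_kernel x) {..y} = enn2real (cond_cdf x y)" by (metis cdf_def)
  then show ?thesis by (simp add: emeasure_eq_measure ennreal_cond_cdf)
qed

lemma measurable_cond_kernel: "cond_kernel \<in> measurable M (prob_algebra borel)"
proof (rule measurable_prob_algebra_generated[where \<Omega>=UNIV and G="range atMost"])
  show "sets borel = sigma_sets UNIV (range atMost :: real set set)" by (simp add: borel_eq_atMost)
  show "Int_stable (range atMost :: real set set)" by (auto simp: Int_stable_def)
  show "(\<lambda>x. emeasure (cond_kernel x) X) \<in> borel_measurable M" if "X \<in> range atMost" for X
    using that by (auto simp: emeasure_cond_kernel)
qed (simp_all add: prob_space_cond_kernel)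

lemma nn_integral_cond_kernel:
  assumes g: "g \<in> borel_measurable (M \<Otimes>\<^sub>M borel)"
  shows "(\<integral>\<^sup>+z. g z \<partial>N) = (\<integral>\<^sup>+x. (\<integral>\<^sup>+t. g (x, t) \<partial>cond_kernel x) \<partial>marginal)"
proof (rule pos_functional_pair_eqI[OF pos_functional_nn_integral[OF sets_N] pos_functional_integral _ _ _ _ _ _ _ g])
  show "Int_stable (range atMost :: real set set)" by (auto simp: Int_stable_def)
  show "sets borel = sigma_sets (space borel) (range atMost :: real set set)"
    by (simp add: borel_eq_atMost)
  show "range (\<lambda>i. {..real i}) \<subseteq> range atMost" "(\<Union>i. {..real i}) = space borel"
    by (auto intro: real_arch_simple)
  show "(\<integral>\<^sup>+z. indicator (space M \<times> {..real i}) z \<partial>N) \<noteq> \<infinity>" for i by simp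
next
  fix x assume "x \<in> space marginal"
  then have "(\<lambda>t. (x, t)) \<in> measurable (cond_kernel x) (M \<Otimes>\<^sub>M borel)"
    using measurable_Pair1'[of x M borel] by (simp cong: measurable_cong_sets)
  then show "pos_functional (M \<Otimes>\<^sub>M borel) (\<lambda>g. \<integral>\<^sup>+t. g (x, t) \<partial>cond_kernel x)"
    by (rule pos_functional_map[OF pos_functional_nn_integral[OF refl]])
next
  fix f :: "'x \<times> real \<Rightarrow> ennreal" assume "f \<in> borel_measurable (M \<Otimes>\<^sub>M borel)"
  then show "(\<lambda>x. \<integral>\<^sup>+t. f (x, t) \<partial>cond_kernel x) \<in> borel_measurable marginal"
    using measurable_kernel_integral[OF measurable_prob_algebraD[OF measurable_cond_kernel]]
    by (simp cong: measurable_cong_sets)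
next
  fix X and Y :: "real set" assume X: "X \<in> sets M" and "Y \<in> range atMost"
  then obtain y where Y: "Y = {..y}" by auto
  have "(\<integral>\<^sup>+z. indicator (X \<times> Y) z \<partial>N) = (\<integral>\<^sup>+x\<in>X. cond_cdf x y \<partial>marginal)"
    using X by (simp add: Y nn_integral_cond_cdf)
  also have "\<dots> = (\<integral>\<^sup>+x. (\<integral>\<^sup>+t. indicator (X \<times> Y) (x, t) \<partial>cond_kernel x) \<partial>marginal)"
    by (intro nn_integral_cong) (simp add: Y indicator_times nn_integral_cmult_indicator emeasure_cond_kernel mult.commute)
  finally show "(\<integral>\<^sup>+z. indicator (X \<times> Y) z \<partial>N)
      = (\<integral>\<^sup>+x. (\<integral>\<^sup>+t. indicator (X \<times> Y) (x, t) \<partial>cond_kernel x) \<partial>marginal)" .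
qed auto

end

end

theorem disintegration:
  fixes A :: "'b::polish_space set"
  assumes A: "compact A" "A \<noteq> {}" and N: "finite_measure N" "sets N = sets (M \<Otimes>\<^sub>M SM A)"
  shows "\<exists>\<phi>\<in>measurable M (prob_algebra (SM A)). \<forall>g\<in>borel_measurable (M \<Otimes>\<^sub>M SM A).
    (\<integral>\<^sup>+z. g z \<partial>N) = (\<integral>\<^sup>+x. (\<integral>\<^sup>+a. g (x, a) \<partial>\<phi> x) \<partial>distr N M fst)"
proof -
  interpret N: finite_measure N by fact
  note N(2)[measurable_cong]
  obtain e :: "'b \<Rightarrow> real" and L \<psi> where e: "e \<in> borel_measurable borel" and L: "compact L" "L \<subseteq> {0..2}" "continuous_on L \<psi>" "\<psi> ` L = A"
    and e_L: "\<And>a. a \<in> A \<Longrightarrow> e a \<in> L" and \<psi>_e: "\<And>a. \<psi> (e a) = a"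
    by (rule ex_compact_code[OF A(1)]; rule that; assumption)
  have [measurable]: "e \<in> borel_measurable (SM A)" by (rule measurable_compose[OF measurable_SM_borel e])
  have space_N: "space N = space M \<times> A"
    using sets_eq_imp_space_eq[OF N(2)] by (simp add: space_pair_measure)
  define N' where "N' = distr N (M \<Otimes>\<^sub>M borel) (\<lambda>z. (fst z, e (snd z)))"
  interpret N': bounded_real_joint N' M 0 2
  proof (intro bounded_real_joint.intro bounded_real_joint_axioms.intro)
    show "finite_measure N'" unfolding N'_def by (rule N.finite_measure_distr) simp
    show "AE z in N'. snd z \<in> {0..2}"
      unfolding N'_def
      using e_L L(2) by (subst AE_distr_iff) (auto simp: space_N subset_iff intro!: AE_I2)
  qed (simp add: N'_def)
  have marginal: "N'.marginal = distr N M fst"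
    unfolding N'.marginal_def unfolding N'_def by (subst distr_distr) (auto simp: o_def)
  obtain a0 where a0: "a0 \<in> A" using A(2) by auto
  define \<psi>' where "\<psi>' t = (if t \<in> L then \<psi> t else a0)" for t
  have "\<psi>' \<in> borel_measurable borel" unfolding \<psi>'_def
    by (rule measurable_If_restrict_space_iff[THEN iffD2])
      (use borel_measurable_continuous_on_restrict[OF L(3)] L(1) in \<open>auto simp: borel_closed compact_imp_closed\<close>)
  then have [measurable]: "\<psi>' \<in> measurable borel (SM A)" using L(4) a0
    by (intro measurable_into_SM) (auto simp: \<psi>'_def)
  note [measurable] = N'.measurable_cond_kernel
  define \<phi> where "\<phi> x = distr (N'.cond_kernel x) (SM A) \<psi>'" for x
  have "\<phi> \<in> measurable M (prob_algebra (SM A))" unfolding \<phi>_def by measurable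
  moreover have "(\<integral>\<^sup>+z. g z \<partial>N) = (\<integral>\<^sup>+x. (\<integral>\<^sup>+a. g (x, a) \<partial>\<phi> x) \<partial>distr N M fst)"
    if g[measurable]: "g \<in> borel_measurable (M \<Otimes>\<^sub>M SM A)" for g
  proof -
    have "(\<integral>\<^sup>+z. g z \<partial>N) = (\<integral>\<^sup>+z. g (fst z, \<psi>' (e (snd z))) \<partial>N)"
      using e_L \<psi>_e by (intro nn_integral_cong) (auto simp: space_N \<psi>'_def)
    also have "\<dots> = (\<integral>\<^sup>+p. g (fst p, \<psi>' (snd p)) \<partial>N')" unfolding N'_def by (subst nn_integral_distr) auto
    also have "\<dots> = (\<integral>\<^sup>+x. (\<integral>\<^sup>+t. g (x, \<psi>' t) \<partial>N'.cond_kernel x) \<partial>N'.marginal)"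
      by (subst N'.nn_integral_cond_kernel) auto
    also have "\<dots> = (\<integral>\<^sup>+x. (\<integral>\<^sup>+a. g (x, a) \<partial>\<phi> x) \<partial>N'.marginal)"
      unfolding \<phi>_def
      by (intro nn_integral_cong nn_integral_distr[symmetric]) (auto simp: measurable_cong_sets[OF N'.sets_cond_kernel refl])
    finally show ?thesis by (simp add: marginal)
  qed
  ultimately show ?thesis by (intro bexI[of _ \<phi>] ballI)
qed

section \<open>The jump kernel of the decision process\<close>

lemma nn_integral_zero_of_null_space: "emeasure M (space M) = 0 \<Longrightarrow> (\<integral>\<^sup>+x. f x \<partial>M) = 0"
proof -
  assume "emeasure M (space M) = 0"
  then have "AE x in M. f x = 0" by (intro AE_I[of _ _ "space M"]) auto
  then have "(\<integral>\<^sup>+x. f x \<partial>M) = (\<integral>\<^sup>+x. 0 \<partial>M)" by (rule nn_integral_cong_AE)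
  then show ?thesis by simp
qed

locale ctmdp =
  fixes S :: "'s::polish_space set" and A :: "'b::polish_space set"
    and \<gamma> :: "'s measure" and q :: "'s \<Rightarrow> 'b \<Rightarrow> 's set \<Rightarrow> real"
  assumes S_ne: "S \<noteq> {}" and S_borel: "S \<in> sets borel" and A_ne: "A \<noteq> {}"
    and gamma: "prob_space \<gamma>" "sets \<gamma> = sets (SM S)"
    and q_kernel: "signed_kernel S A q"
    and q_nonneg: "\<forall>x\<in>S. \<forall>a\<in>A. \<forall>\<Gamma>\<in>sets (SM S). 0 \<le> qt q x a \<Gamma>"
    and q_conservative: "\<forall>x\<in>S. \<forall>a\<in>A. q x a S = 0"
    and qx_nonneg: "\<forall>x\<in>S. \<forall>a\<in>A. 0 \<le> qx q x a"
    and q_bounded: "\<forall>x\<in>S. bdd_above (qx q x ` A)"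
    and A_compact: "compact A"
    and C1b: "\<forall>f :: 's \<Rightarrow> real. continuous_on S f \<and> bounded (f ` S) \<longrightarrow>
               continuous_on (S \<times> A) (\<lambda>(x,a). (\<integral>y. f y \<partial>(qtM q S x a)) / qx q x a)"
    and C1c: "continuous_on (S \<times> A) (\<lambda>(x,a). qx q x a)"
begin

abbreviation "SA \<equiv> SM S \<Otimes>\<^sub>M SM A"

lemma measurable_lsc_SA: "lsc (S \<times> A) h \<Longrightarrow> h \<in> borel_measurable SA"
  by (rule lsc_borel_measurable) (auto intro: measurable_pair_SM_borel)

lemma measurable_lsc_S: "lsc S h \<Longrightarrow> h \<in> borel_measurable (SM S)"
  by (rule lsc_borel_measurable) (auto intro: measurable_SM_borel)

lemma singleton_sets[measurable]: "x \<in> S \<Longrightarrow> {x} \<in> sets (SM S)"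
  unfolding SM_def by (auto simp: sets_restrict_space image_iff intro!: bexI[of _ "{x}"])

lemma q_sums:
  "x \<in> S \<Longrightarrow> a \<in> A \<Longrightarrow> range F \<subseteq> sets (SM S) \<Longrightarrow> disjoint_family F \<Longrightarrow> (\<lambda>i. q x a (F i)) sums q x a (\<Union>i. F i)"
  using q_kernel unfolding signed_kernel_def by blast

lemma q_empty: assumes "x \<in> S" "a \<in> A" shows "q x a {} = 0"
proof -
  have "(\<lambda>i::nat. q x a {}) sums q x a (\<Union>i::nat. {})"
    by (rule q_sums) (use assms in \<open>auto simp: disjoint_family_on_def\<close>)
  then show ?thesis by (auto dest: sums_summable simp: summable_const_iff)
qed

lemma q_Un: assumes "x \<in> S" "a \<in> A" "X \<in> sets (SM S)" "Y \<in> sets (SM S)" "X \<inter> Y = {}"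
  shows "q x a (X \<union> Y) = q x a X + q x a Y"
proof -
  have "(\<lambda>i. q x a (binaryset X Y i)) sums q x a (\<Union>i. binaryset X Y i)"
    by (rule q_sums) (use assms in \<open>auto simp: disjoint_family_on_def binaryset_def\<close>)
  moreover have "(\<lambda>i. q x a (binaryset X Y i)) sums (q x a X + q x a Y)"
    by (rule binaryset_sums) (rule q_empty[OF assms(1,2)])
  ultimately show ?thesis by (simp add: UN_binaryset_eq sums_unique2)
qed

lemma qt_eq: assumes "x \<in> S" "a \<in> A" "\<Gamma> \<in> sets (SM S)"
  shows "qt q x a \<Gamma> = q x a \<Gamma> + indicator \<Gamma> x * qx q x a"
proof (cases "x \<in> \<Gamma>")
  case True
  then have "\<Gamma> = (\<Gamma> - {x}) \<union> {x}" by auto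
  with q_Un[OF assms(1,2) sets.Diff[OF assms(3) singleton_sets[OF assms(1)]] singleton_sets[OF assms(1)]]
  have "q x a \<Gamma> = q x a (\<Gamma> - {x}) + q x a {x}" by auto
  then show ?thesis using True by (simp add: qt_def qx_def)
qed (simp add: qt_def)

lemma qt_S: "x \<in> S \<Longrightarrow> a \<in> A \<Longrightarrow> qt q x a S = qx q x a"
  using qt_eq[of x a S] q_conservative sets.top[of "SM S"] by simp

lemma emeasure_qtM:
  assumes x: "x \<in> S" and a: "a \<in> A" and \<Gamma>: "\<Gamma> \<in> sets (SM S)"
  shows "emeasure (qtM q S x a) \<Gamma> = ennreal (qt q x a \<Gamma>)"
  unfolding qtM_def
proof (rule emeasure_measure_of_sigma[OF _ _ _ \<Gamma>])
  show "sigma_algebra S (sets (SM S))" using sets.sigma_algebra_axioms[of "SM S"] by simp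
  show "positive (sets (SM S)) (\<lambda>\<Gamma>. ennreal (qt q x a \<Gamma>))"
    by (simp add: positive_def qt_def q_empty[OF x a])
  show "countably_additive (sets (SM S)) (\<lambda>\<Gamma>. ennreal (qt q x a \<Gamma>))"
    unfolding countably_additive_def
  proof (intro allI impI)
    fix F :: "nat \<Rightarrow> 's set" assume F: "range F \<subseteq> sets (SM S)" "disjoint_family F"
    have "(\<lambda>i. q x a (F i - {x})) sums q x a (\<Union>i. F i - {x})"
      by (rule q_sums[OF x a]) (use F x in \<open>auto simp: disjoint_family_on_def\<close>)
    then have "(\<lambda>i. qt q x a (F i)) sums qt q x a (\<Union>i. F i)" by (simp add: qt_def)
    then show "(\<Sum>i. ennreal (qt q x a (F i))) = ennreal (qt q x a (\<Union>i. F i))"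
      using F q_nonneg x a by (subst suminf_ennreal2) (auto simp: sums_iff)
  qed
qed

lemma sets_qtM[simp]: "sets (qtM q S x a) = sets (SM S)" and space_qtM[simp]: "space (qtM q S x a) = S"
  unfolding qtM_def using sets.space_closed[of "SM S"] sets.sigma_sets_eq[of "SM S"] by simp_all

lemma continuous_on_qx: "continuous_on (S \<times> A) (\<lambda>z. qx q (fst z) (snd z))"
  using C1c by (simp add: case_prod_beta)

lemma measurable_qx[measurable]: "(\<lambda>z. qx q (fst z) (snd z)) \<in> borel_measurable SA"
proof -
  have "(\<lambda>z. ennreal (qx q (fst z) (snd z))) \<in> borel_measurable SA"
    by (intro measurable_lsc_SA continuous_imp_lsc continuous_on_qx)
  then have "(\<lambda>z. enn2real (ennreal (qx q (fst z) (snd z)))) \<in> borel_measurable SA" by measurable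
  then show ?thesis
    using qx_nonneg
    by (subst measurable_cong[of _ _ "\<lambda>z. enn2real (ennreal (qx q (fst z) (snd z)))"]) auto
qed

lemma measurable_qt[measurable]:
  assumes "\<Gamma> \<in> sets (SM S)" shows "(\<lambda>z. qt q (fst z) (snd z) \<Gamma>) \<in> borel_measurable SA"
proof -
  have [measurable]: "(\<lambda>z. q (fst z) (snd z) \<Gamma>) \<in> borel_measurable SA"
    using bspec[OF conjunct2[OF q_kernel[unfolded signed_kernel_def]] assms]
    by (simp add: case_prod_beta')
  note [measurable] = assms
  have "(\<lambda>z. q (fst z) (snd z) \<Gamma> + indicator \<Gamma> (fst z) * qx q (fst z) (snd z)) \<in> borel_measurable SA"
    by measurable
  then show ?thesis using assms
    by (subst measurable_cong[of _ _ "\<lambda>z. q (fst z) (snd z) \<Gamma> + indicator \<Gamma> (fst z) * qx q (fst z) (snd z)"])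
      (auto simp: qt_eq)
qed

definition jump_kernel :: "'s \<times> 'b \<Rightarrow> 's measure" where
  "jump_kernel z = scale_measure (ennreal (1 / qx q (fst z) (snd z))) (qtM q S (fst z) (snd z))"

definition rate :: "'s \<times> 'b \<Rightarrow> ennreal" where
  "rate z = ennreal (qx q (fst z) (snd z))"

lemma measurable_rate[measurable]: "rate \<in> borel_measurable SA"
  unfolding rate_def[abs_def] by measurable

lemma rate_finite: "rate z < \<top>" by (simp add: rate_def)

lemma sets_jump_kernel[simp]: "sets (jump_kernel z) = sets (SM S)"
  by (simp add: jump_kernel_def)

lemma space_jump_kernel[simp]: "space (jump_kernel z) = S"
  using sets_eq_imp_space_eq[OF sets_jump_kernel] by simp

lemma emeasure_jump_kernel: "z \<in> S \<times> A \<Longrightarrow> \<Gamma> \<in> sets (SM S) \<Longrightarrow>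
    emeasure (jump_kernel z) \<Gamma> = ennreal (qt q (fst z) (snd z) \<Gamma> / qx q (fst z) (snd z))"
  using q_nonneg qx_nonneg
  by (auto simp: jump_kernel_def emeasure_qtM mem_Times_iff simp flip: ennreal_mult)

lemma emeasure_jump_kernel_space: "z \<in> S \<times> A \<Longrightarrow> emeasure (jump_kernel z) S = (if rate z = 0 then 0 else 1)"
  using sets.top[of "SM S"] qx_nonneg by (auto simp: emeasure_jump_kernel qt_S rate_def)

lemma subprob_space_jump_kernel: "z \<in> S \<times> A \<Longrightarrow> subprob_space (jump_kernel z)"
  using S_ne by (intro subprob_spaceI) (auto simp: emeasure_jump_kernel_space)

lemma measurable_jump_kernel[measurable]: "jump_kernel \<in> measurable SA (subprob_algebra (SM S))"
proof (rule measurable_subprob_algebra)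
  fix \<Gamma> assume [measurable]: "\<Gamma> \<in> sets (SM S)"
  have "(\<lambda>z. ennreal (qt q (fst z) (snd z) \<Gamma> / qx q (fst z) (snd z))) \<in> borel_measurable SA"
    by measurable
  then show "(\<lambda>z. emeasure (jump_kernel z) \<Gamma>) \<in> borel_measurable SA"
    by (subst measurable_cong[of _ _ "\<lambda>z. ennreal (qt q (fst z) (snd z) \<Gamma> / qx q (fst z) (snd z))"]) (auto simp: emeasure_jump_kernel)
qed (auto intro: subprob_space_jump_kernel)

lemma rate_mult_emeasure_jump_kernel: assumes "z \<in> S \<times> A" "\<Gamma> \<in> sets (SM S)"
  shows "rate z * emeasure (jump_kernel z) \<Gamma> = ennreal (qt q (fst z) (snd z) \<Gamma>)"
proof (cases "qx q (fst z) (snd z) = 0")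
  case True
  then have "emeasure (qtM q S (fst z) (snd z)) S = 0"
    using assms sets.top[of "SM S"] by (auto simp: emeasure_qtM qt_S)
  then have "emeasure (qtM q S (fst z) (snd z)) \<Gamma> = 0"
    using emeasure_mono[of \<Gamma> S "qtM q S (fst z) (snd z)"] sets.sets_into_space[OF assms(2)] sets.top[of "SM S"] by simp
  then show ?thesis using True assms by (auto simp: rate_def emeasure_qtM)
next
  case False
  then show ?thesis using assms qx_nonneg q_nonneg
    by (auto simp: rate_def emeasure_jump_kernel simp flip: ennreal_mult)
qed

lemma measurable_nn_integral_jump_kernel:
  "f \<in> borel_measurable (SM S) \<Longrightarrow> (\<lambda>z. \<integral>\<^sup>+y. f y \<partial>jump_kernel z) \<in> borel_measurable SA"
  by (rule measurable_compose[OF measurable_jump_kernel nn_integral_measurable_subprob_algebra])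

definition jump_mean :: "('s \<Rightarrow> real) \<Rightarrow> 's \<times> 'b \<Rightarrow> real" where
  "jump_mean f z = (\<integral>y. f y \<partial>(qtM q S (fst z) (snd z))) / qx q (fst z) (snd z)"

lemma finite_measure_qtM: "z \<in> S \<times> A \<Longrightarrow> finite_measure (qtM q S (fst z) (snd z))"
  using sets.top[of "SM S"] by (intro finite_measureI) (auto simp: emeasure_qtM)

lemma nn_integral_jump_kernel_eq:
  assumes z: "z \<in> S \<times> A" and f: "f \<in> borel_measurable (SM S)" "\<And>x. x \<in> S \<Longrightarrow> 0 \<le> f x" "\<And>x. x \<in> S \<Longrightarrow> f x \<le> B"
  shows "(\<integral>\<^sup>+y. ennreal (f y) \<partial>jump_kernel z) = ennreal (jump_mean f z)" "0 \<le> jump_mean f z" "0 \<le> B \<Longrightarrow>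
      jump_mean f z \<le> B"
proof -
  interpret finite_measure "qtM q S (fst z) (snd z)" by (rule finite_measure_qtM[OF z])
  have f_meas: "f \<in> borel_measurable (qtM q S (fst z) (snd z))"
    using f(1) by (simp cong: measurable_cong_sets)
  have q_ge_0: "0 \<le> qx q (fst z) (snd z)" using z qx_nonneg by auto
  have integral_eq: "(\<integral>\<^sup>+y. ennreal (f y) \<partial>qtM q S (fst z) (snd z))
      = ennreal (\<integral>y. f y \<partial>qtM q S (fst z) (snd z))"
    using f f_meas
    by (intro nn_integral_eq_integral integrable_const_bound[where B=B]) (auto intro!: AE_I2)
  have integral_ge_0: "0 \<le> (\<integral>y. f y \<partial>qtM q S (fst z) (snd z))"
    using f by (intro integral_nonneg_AE AE_I2) auto
  show mean_eq: "(\<integral>\<^sup>+y. ennreal (f y) \<partial>jump_kernel z) = ennreal (jump_mean f z)"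
    unfolding jump_kernel_def jump_mean_def
    using f_meas q_ge_0 integral_ge_0
    by (subst nn_integral_scale_measure) (auto simp: integral_eq simp flip: ennreal_mult)
  show "0 \<le> jump_mean f z" unfolding jump_mean_def using integral_ge_0 q_ge_0 by simp
  assume B: "0 \<le> B"
  have "(\<integral>\<^sup>+y. ennreal (f y) \<partial>jump_kernel z) \<le> (\<integral>\<^sup>+y. ennreal B \<partial>jump_kernel z)"
    using f by (intro nn_integral_mono) (auto intro!: ennreal_leI)
  also have "\<dots> \<le> ennreal B" using emeasure_jump_kernel_space[OF z] by simp
  finally show "jump_mean f z \<le> B" using B mean_eq by (simp add: ennreal_le_iff)
qed

lemma continuous_on_jump_mean:
  assumes "continuous_on S f" "\<And>x. x \<in> S \<Longrightarrow> 0 \<le> f x" "\<And>x. x \<in> S \<Longrightarrow> f x \<le> B"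
  shows "continuous_on (S \<times> A) (jump_mean f)"
proof -
  have "bounded (f ` S)" using assms by (intro boundedI[of _ B]) auto
  then show ?thesis using C1b assms(1) unfolding jump_mean_def[abs_def] by (simp add: case_prod_beta)
qed

lemma lsc_rate: "lsc (S \<times> A) rate"
  unfolding rate_def[abs_def] by (rule continuous_imp_lsc[OF continuous_on_qx])

definition jump_prob :: "'s \<times> 'b \<Rightarrow> real" where "jump_prob z = (if rate z = 0 then 0 else 1)"

lemma continuous_on_jump_prob: "continuous_on (S \<times> A) jump_prob"
proof -
  have "jump_prob z = jump_mean (\<lambda>_. 1) z" if "z \<in> S \<times> A" for z
  proof -
    have "ennreal (jump_mean (\<lambda>_. 1) z) = emeasure (jump_kernel z) S"
      using nn_integral_jump_kernel_eq(1)[OF that, of "\<lambda>_. 1" 1] by simp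
    also have "\<dots> = ennreal (jump_prob z)"
      by (simp add: jump_prob_def emeasure_jump_kernel_space[OF that])
    finally show ?thesis using nn_integral_jump_kernel_eq(2)[OF that, of "\<lambda>_. 1" 1]
      by (subst (asm) ennreal_inj) (auto simp: jump_prob_def)
  qed
  then show ?thesis using continuous_on_jump_mean[of "\<lambda>_. 1" 1] by (simp cong: continuous_on_cong)
qed

lemma lsc_nn_integral_jump_kernel:
  assumes v: "lsc S v" shows "lsc (S \<times> A) (\<lambda>z. \<integral>\<^sup>+y. v y \<partial>jump_kernel z)"
proof -
  obtain \<phi> :: "nat \<Rightarrow> 's \<Rightarrow> real" and B where cont: "\<And>n. continuous_on UNIV (\<phi> n)"
    and nonneg: "\<And>n x. 0 \<le> \<phi> n x" and bound: "\<And>n x. \<phi> n x \<le> B n" and inc: "\<And>x. incseq (\<lambda>n. \<phi> n x)"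
    and v_eq: "\<And>x. x \<in> S \<Longrightarrow> v x = (SUP n. ennreal (\<phi> n x))"
    by (rule lsc_increasing_approx[OF v]; rule that; assumption)
  have contS: "continuous_on S (\<phi> n)" for n by (rule continuous_on_subset[OF cont]) simp
  have meas: "\<phi> n \<in> borel_measurable (SM S)" for n by (rule continuous_on_measurable_SM[OF contS])
  have "(\<integral>\<^sup>+y. v y \<partial>jump_kernel z) = (SUP n. ennreal (jump_mean (\<phi> n) z))" if z: "z \<in> S \<times> A" for z
  proof -
    have "(\<integral>\<^sup>+y. v y \<partial>jump_kernel z) = (SUP n. \<integral>\<^sup>+y. ennreal (\<phi> n y) \<partial>jump_kernel z)"
      using meas inc v_eq
      by (intro nn_integral_eq_SUP_approx) (simp_all add: measurable_cong_sets[OF sets_jump_kernel refl])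
    also have "\<dots> = (SUP n. ennreal (jump_mean (\<phi> n) z))"
      using nn_integral_jump_kernel_eq(1)[OF z meas nonneg bound] by simp
    finally show ?thesis .
  qed
  moreover have "lsc (S \<times> A) (\<lambda>z. SUP n. ennreal (jump_mean (\<phi> n) z))"
    by (intro lsc_SUP continuous_imp_lsc continuous_on_jump_mean[OF contS nonneg bound])
  ultimately show ?thesis by (simp cong: lsc_cong)
qed

(* By the conventions of ennreal, 0 / 0 = 0 and c / 0 = top for c > 0. *)
definition jump_cost :: "('s \<times> 'b \<Rightarrow> real) \<Rightarrow> 's \<times> 'b \<Rightarrow> ennreal" where
  "jump_cost c z = ennreal (c z) / rate z"

lemma lsc_of_lsc_on: "lsc_on T c \<Longrightarrow> (\<And>z. z \<in> T \<Longrightarrow> 0 \<le> c z) \<Longrightarrow> lsc T (\<lambda>z. ennreal (c z))"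
  unfolding lsc_def
proof
  fix r assume c: "lsc_on T c" "\<And>z. z \<in> T \<Longrightarrow> 0 \<le> c z"
  show "openin (top_of_set T) {z \<in> T. r < ennreal (c z)}"
  proof (cases r)
    case (real x)
    then have "{z \<in> T. r < ennreal (c z)} = {z \<in> T. x < c z}" using c(2) by (auto simp: ennreal_less_iff)
    then show ?thesis using c(1) by (simp add: lsc_on_def)
  qed auto
qed

lemma lsc_jump_cost:
  assumes c: "lsc_on (S \<times> A) c" "\<And>z. z \<in> S \<times> A \<Longrightarrow> 0 \<le> c z"
  shows "lsc (S \<times> A) (jump_cost c)"
proof -
  define w where "w n z = jump_prob z / (qx q (fst z) (snd z) + (1 - jump_prob z)) + (1 - jump_prob z) * real n" for n z
  have q_ge_0: "z \<in> S \<times> A \<Longrightarrow> 0 \<le> qx q (fst z) (snd z)" for z using qx_nonneg by auto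
  have denominator: "qx q (fst z) (snd z) + (1 - jump_prob z) \<noteq> 0" if "z \<in> S \<times> A" for z
    using q_ge_0[OF that] by (auto simp: jump_prob_def rate_def)
  have continuous_w: "continuous_on (S \<times> A) (w n)" for n unfolding w_def
    using denominator by (intro continuous_intros continuous_on_jump_prob continuous_on_qx) auto
  have w_ge_0: "0 \<le> w n z" if "z \<in> S \<times> A" for n z
    using q_ge_0[OF that] by (auto simp: w_def jump_prob_def)
  have "jump_cost c z = (SUP n. ennreal (c z) * ennreal (w n z))" if z: "z \<in> S \<times> A" for z
  proof (cases "rate z = 0")
    case True
    then have w: "w n z = real n" for n by (simp add: w_def jump_prob_def)
    have "(SUP n. ennreal (real n)) = \<top>"
      by (simp add: ennreal_SUP_of_nat_eq_top ennreal_of_nat_eq_real_of_nat[symmetric])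
    moreover have "(SUP n. ennreal (c z) * ennreal (w n z)) = ennreal (c z) * (SUP n. ennreal (real n))"
      unfolding w by (rule SUP_mult_left_ennreal[symmetric])
    ultimately have "(SUP n. ennreal (c z) * ennreal (w n z)) = ennreal (c z) * \<top>" by (simp only:)
    then show ?thesis using True by (simp add: jump_cost_def divide_ennreal_def)
  next
    case False
    then have "w n z = 1 / qx q (fst z) (snd z)" for n by (simp add: w_def jump_prob_def)
    moreover have "0 < qx q (fst z) (snd z)" using False q_ge_0[OF z] by (auto simp: rate_def less_le)
    ultimately show ?thesis
      using c(2)[OF z] by (simp add: jump_cost_def rate_def divide_ennreal flip: ennreal_mult)
  qed
  moreover have "lsc (S \<times> A) (\<lambda>z. SUP n. ennreal (c z) * ennreal (w n z))"
    by (intro lsc_SUP lsc_mult_continuous lsc_of_lsc_on c continuous_w w_ge_0)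
  ultimately show ?thesis by (simp cong: lsc_cong)
qed

lemma rate_mult_jump_cost_le: "rate z * jump_cost f z \<le> ennreal (f z)"
proof (cases "rate z = 0")
  case False
  then show ?thesis
    using rate_finite[of z]
    by (simp add: jump_cost_def ennreal_times_divide mult.commute[of "rate z"] ennreal_mult_divide_eq)
qed simp

lemma nn_integral_jump_kernel_rate_0: "z \<in> S \<times> A \<Longrightarrow> rate z = 0 \<Longrightarrow> (\<integral>\<^sup>+y. f y \<partial>jump_kernel z) = 0"
  by (rule nn_integral_zero_of_null_space) (simp add: emeasure_jump_kernel_space)

end

section \<open>Exponential survival\<close>

lemma constant_of_quadratic_increments:
  fixes F :: "real \<Rightarrow> real"
  assumes inc: "\<And>a b. 0 \<le> a \<Longrightarrow> a \<le> b \<Longrightarrow> \<bar>F b - F a\<bar> \<le> K * (b - a)\<^sup>2" and t: "0 \<le> t"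
  shows "F t = F 0"
proof -
  have sym: "\<bar>F y - F x\<bar> \<le> K * (y - x)\<^sup>2" if "0 \<le> x" "0 \<le> y" for x y
    using inc[of x y] inc[of y x] that by (cases "x \<le> y") (auto simp: abs_minus_commute power2_commute)
  have "(F has_field_derivative 0) (at x within {0..})" if x: "x \<in> {0..}" for x
    unfolding has_field_derivative_iff
  proof (rule Lim_null_comparison[where g="\<lambda>y. \<bar>K\<bar> * \<bar>y - x\<bar>"])
    show "\<forall>\<^sub>F y in at x within {0..}. norm ((F y - F x) / (y - x)) \<le> \<bar>K\<bar> * \<bar>y - x\<bar>"
      unfolding eventually_at
    proof (intro exI[of _ 1] conjI ballI impI)
      fix y assume y: "y \<in> {0..}" "y \<noteq> x \<and> dist y x < 1"
      have "\<bar>F y - F x\<bar> \<le> K * (y - x)\<^sup>2" using sym x y by auto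
      also have "\<dots> \<le> \<bar>K\<bar> * (y - x)\<^sup>2" by (intro mult_right_mono) auto
      finally show "norm ((F y - F x) / (y - x)) \<le> \<bar>K\<bar> * \<bar>y - x\<bar>"
        using y by (simp add: abs_divide divide_le_eq power2_eq_square abs_mult flip: abs_mult)
    qed simp
    have "((\<lambda>y. \<bar>K\<bar> * \<bar>y - x\<bar>) \<longlongrightarrow> \<bar>K\<bar> * \<bar>x - x\<bar>) (at x within {0..})" by (intro tendsto_intros)
    then show "((\<lambda>y. \<bar>K\<bar> * \<bar>y - x\<bar>) \<longlongrightarrow> 0) (at x within {0..})" by simp
  qed
  then have "\<exists>c. \<forall>x\<in>{0..}. F x = c" by (intro has_field_derivative_zero_constant) auto
  then show ?thesis using t by auto
qed

lemma exp_neg_diff_bounds: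
  fixes x y :: real assumes "x \<le> y"
  shows "exp (- y) * (y - x) \<le> exp (- x) - exp (- y)" "exp (- x) - exp (- y) \<le> exp (- x) * (y - x)"
proof -
  have "exp (-x) = exp (-y) * exp (y - x)" by (simp flip: exp_add)
  moreover have "exp (-y) * (1 + (y - x)) \<le> exp (-y) * exp (y - x)"
    by (intro mult_left_mono exp_ge_add_one_self) auto
  ultimately show "exp (- y) * (y - x) \<le> exp (- x) - exp (- y)" by (simp add: algebra_simps)
  have "exp (-y) = exp (-x) * exp (x - y)" by (simp flip: exp_add)
  moreover have "exp (-x) * (1 + (x - y)) \<le> exp (-x) * exp (x - y)"
    by (intro mult_left_mono exp_ge_add_one_self) auto
  ultimately show "exp (- x) - exp (- y) \<le> exp (- x) * (y - x)" by (simp add: algebra_simps)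
qed

lemma set_integrable_bounded_Ioc:
  fixes g :: "real \<Rightarrow> real"
  assumes g: "g \<in> borel_measurable borel" "\<And>s. \<bar>g s\<bar> \<le> L"
  shows "set_integrable lborel {a<..b} g"
proof -
  have indicator: "integrable lborel (indicat_real {a<..b})"
    by (cases "a \<le> b") (auto intro!: integrable_real_indicator)
  have L: "0 \<le> L" using order_trans[OF abs_ge_zero g(2)] .
  show ?thesis
    unfolding set_integrable_def
    by (rule Bochner_Integration.integrable_bound[where f="\<lambda>s. indicator {a<..b} s *\<^sub>R L"])
      (use g indicator L in \<open>auto split: split_indicator\<close>)
qed

lemma set_integral_Ioc_diff:
  fixes g :: "real \<Rightarrow> real"
  assumes g: "g \<in> borel_measurable borel" "\<And>s. \<bar>g s\<bar> \<le> L" and ab: "0 \<le> a" "a \<le> b"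
  shows "(LINT s:{0<..b}|lborel. g s) - (LINT s:{0<..a}|lborel. g s) = (LINT s:{a<..b}|lborel. g s)"
proof -
  have "{0<..b} = {0<..a} \<union> {a<..b}" using ab by auto
  then show ?thesis using set_integrable_bounded_Ioc[OF g] by (simp add: set_integral_Un)
qed

locale bounded_hazard =
  fixes l :: "real \<Rightarrow> real" and L :: real
  assumes measurable_l[measurable]: "l \<in> borel_measurable borel" and l_nonneg: "\<And>s. 0 \<le> l s"
      and l_le: "\<And>s. l s \<le> L"
begin

definition cumulative :: "real \<Rightarrow> real" where
  "cumulative t = (LINT s:{0<..t}|lborel. l s)"

lemma set_integrable_l: "set_integrable lborel {a<..b} l"
  using l_nonneg l_le by (intro set_integrable_bounded_Ioc) auto

lemma cumulative_nonneg: "0 \<le> cumulative t"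
  unfolding cumulative_def set_lebesgue_integral_def using l_nonneg by (intro integral_nonneg_AE) auto

lemma mono_cumulative: "mono cumulative"
proof
  fix a b :: real assume "a \<le> b"
  then show "cumulative a \<le> cumulative b" unfolding cumulative_def set_lebesgue_integral_def
    by (intro integral_mono) (use set_integrable_l l_nonneg in \<open>auto simp: set_integrable_def split: split_indicator\<close>)
qed

lemma measurable_cumulative[measurable]: "cumulative \<in> borel_measurable borel"
  using mono_cumulative by (rule borel_measurable_mono)

lemma cumulative_increment: "0 \<le> a \<Longrightarrow> a \<le> b \<Longrightarrow> cumulative b - cumulative a = (LINT s:{a<..b}|lborel. l s)"
  unfolding cumulative_def using l_nonneg l_le by (intro set_integral_Ioc_diff[of l L]) auto

lemma cumulative_increment_le: "0 \<le> a \<Longrightarrow> a \<le> b \<Longrightarrow> cumulative b - cumulative a \<le> L * (b - a)"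
proof -
  assume ab: "0 \<le> a" "a \<le> b"
  have "(LINT s:{a<..b}|lborel. l s) \<le> (LINT s:{a<..b}|lborel. L)"
    unfolding set_lebesgue_integral_def
    by (intro integral_mono)
      (use set_integrable_l set_integrable_bounded_Ioc[of "\<lambda>_. L" "\<bar>L\<bar>" a b] l_le in \<open>auto simp: set_integrable_def split: split_indicator\<close>)
  then show ?thesis using ab by (simp add: cumulative_increment set_lebesgue_integral_def mult.commute)
qed

definition jump_density :: "real \<Rightarrow> real" where
  "jump_density s = l s * exp (- cumulative s)"

lemma measurable_jump_density[measurable]: "jump_density \<in> borel_measurable borel"
  unfolding jump_density_def by measurable

lemma jump_density_nonneg: "0 \<le> jump_density s"
  using l_nonneg by (simp add: jump_density_def)

lemma jump_density_le: "\<bar>jump_density s\<bar> \<le> L"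
proof -
  have "jump_density s \<le> l s"
    using l_nonneg[of s] cumulative_nonneg[of s] by (simp add: jump_density_def mult_left_le)
  then show ?thesis using jump_density_nonneg[of s] l_le[of s] by simp
qed

lemma jump_density_integral_bounds:
  assumes ab: "0 \<le> a" "a \<le> b"
  shows "exp (- cumulative b) * (cumulative b - cumulative a) \<le> (LINT s:{a<..b}|lborel. jump_density s)"
    and "(LINT s:{a<..b}|lborel. jump_density s) \<le> exp (- cumulative a) * (cumulative b - cumulative a)"
proof -
  have int: "set_integrable lborel {a<..b} jump_density" "set_integrable lborel {a<..b} (\<lambda>s. exp (- cumulative a) * l s)"
    "set_integrable lborel {a<..b} (\<lambda>s. exp (- cumulative b) * l s)"
    using set_integrable_bounded_Ioc[OF _ jump_density_le] set_integrable_l by simp_all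
  have "(LINT s:{a<..b}|lborel. exp (- cumulative b) * l s) \<le> (LINT s:{a<..b}|lborel. jump_density s)"
    unfolding set_lebesgue_integral_def using int l_nonneg monoD[OF mono_cumulative]
    by (intro integral_mono) (auto simp: set_integrable_def jump_density_def mult.commute split: split_indicator intro!: mult_left_mono)
  then show "exp (- cumulative b) * (cumulative b - cumulative a) \<le> (LINT s:{a<..b}|lborel. jump_density s)"
    using ab by (simp add: cumulative_increment)
  have "(LINT s:{a<..b}|lborel. jump_density s) \<le> (LINT s:{a<..b}|lborel. exp (- cumulative a) * l s)"
    unfolding set_lebesgue_integral_def using int l_nonneg monoD[OF mono_cumulative]
    by (intro integral_mono) (auto simp: set_integrable_def jump_density_def mult.commute split: split_indicator intro!: mult_left_mono)
  then show "(LINT s:{a<..b}|lborel. jump_density s) \<le> exp (- cumulative a) * (cumulative b - cumulative a)"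
    using ab by (simp add: cumulative_increment)
qed

(* Both sides of the identity have the same increments up to second order, although l need not be continuous. *)
lemma jump_density_integral_eq:
  assumes t: "0 \<le> t"
  shows "(LINT s:{0<..t}|lborel. jump_density s) = 1 - exp (- cumulative t)"
proof -
  define F where "F t = 1 - exp (- cumulative t) - (LINT s:{0<..t}|lborel. jump_density s)" for t
  have "F t = F 0"
  proof (rule constant_of_quadratic_increments[of _ "L\<^sup>2", OF _ t])
    fix a b :: real assume ab: "0 \<le> a" "a \<le> b"
    define d where "d = cumulative b - cumulative a"
    have d: "0 \<le> d" "d \<le> L * (b - a)"
      using cumulative_increment_le[OF ab] monoD[OF mono_cumulative ab(2)] by (simp_all add: d_def)
    have exps: "exp (- cumulative b) * d \<le> exp (- cumulative a) - exp (- cumulative b)"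
      "exp (- cumulative a) - exp (- cumulative b) \<le> exp (- cumulative a) * d"
      unfolding d_def using d(1) by (auto intro!: exp_neg_diff_bounds simp: d_def)
    have "\<bar>F b - F a\<bar> \<le> exp (- cumulative a) * d - exp (- cumulative b) * d"
      using jump_density_integral_bounds[OF ab] set_integral_Ioc_diff[OF measurable_jump_density jump_density_le ab] exps
      by (simp add: F_def d_def abs_le_iff)
    also have "\<dots> = (exp (- cumulative a) - exp (- cumulative b)) * d" by (simp add: algebra_simps)
    also have "\<dots> \<le> (exp (- cumulative a) * d) * d" using exps(2) d(1) by (rule mult_right_mono)
    also have "\<dots> \<le> (1 * d) * d" using d(1) cumulative_nonneg[of a] by (intro mult_right_mono) auto
    also have "\<dots> \<le> (L * (b - a)) * (L * (b - a))" using d by (auto intro!: mult_mono)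
    finally show "\<bar>F b - F a\<bar> \<le> L\<^sup>2 * (b - a)\<^sup>2" by (simp add: power2_eq_square ac_simps)
  qed
  then show ?thesis by (simp add: F_def cumulative_def set_lebesgue_integral_def)
qed

lemma nn_integral_jump_density:
  assumes t: "0 \<le> t"
  shows "(\<integral>\<^sup>+s\<in>{0<..t}. ennreal (l s * exp (- cumulative s)) \<partial>lborel) = ennreal (1 - exp (- cumulative t))"
proof -
  have "(\<integral>\<^sup>+s\<in>{0<..t}. ennreal (l s * exp (- cumulative s)) \<partial>lborel)
      = (\<integral>\<^sup>+s. ennreal (indicator {0<..t} s *\<^sub>R jump_density s) \<partial>lborel)"
    by (intro nn_integral_cong) (auto simp: jump_density_def split: split_indicator)
  also have "\<dots> = ennreal (LINT s:{0<..t}|lborel. jump_density s)"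
    unfolding set_lebesgue_integral_def
    using set_integrable_bounded_Ioc[OF measurable_jump_density jump_density_le] jump_density_nonneg
    by (intro nn_integral_eq_integral) (auto simp: set_integrable_def split: split_indicator)
  finally show ?thesis by (simp add: jump_density_integral_eq[OF t])
qed

end

section \<open>Sojourns under a policy\<close>

definition posL :: "real measure" where "posL = restrict_space lborel {0<..}"

lemma space_posR[simp]: "space posR = {0<..}" and space_posL[simp]: "space posL = {0<..}"
  by (simp_all add: posR_def posL_def space_restrict_space)

lemma sets_posL[simp, measurable_cong]: "sets posL = sets posR"
  by (simp add: posL_def posR_def sets_restrict_space)

lemma measurable_posR_borel[measurable]: "(\<lambda>x. x) \<in> measurable posR borel"
  unfolding posR_def by (rule measurable_restrict_space1) simp

lemma measurable_into_posR: "f \<in> borel_measurable M \<Longrightarrow> (\<And>x. x \<in> space M \<Longrightarrow> 0 < f x) \<Longrightarrow> f \<in> measurable M posR"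
  unfolding posR_def by (rule measurable_restrict_space2) auto

lemma sets_posR_iff: "B \<in> sets posR \<longleftrightarrow> B \<in> sets borel \<and> B \<subseteq> {0<..}"
  unfolding posR_def by (auto simp: sets_restrict_space_iff)

lemma sigma_finite_posL: "sigma_finite_measure posL"
  unfolding posL_def by (rule sigma_finite_measure_restrict_space[OF sigma_finite_lborel]) simp

lemma nn_integral_posL: "(\<integral>\<^sup>+s. f s \<partial>posL) = (\<integral>\<^sup>+s. f s * indicator {0<..} s \<partial>lborel)"
  unfolding posL_def by (rule nn_integral_restrict_space) simp

lemma measurable_posL_integral:
  assumes "f \<in> borel_measurable (M \<Otimes>\<^sub>M posR)"
  shows "(\<lambda>h. \<integral>\<^sup>+s. f (h, s) \<partial>posL) \<in> borel_measurable M"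
proof -
  interpret sigma_finite_measure posL by (rule sigma_finite_posL)
  have "sets (M \<Otimes>\<^sub>M posL) = sets (M \<Otimes>\<^sub>M posR)" by (rule sets_pair_measure_cong) simp_all
  then have "(\<lambda>(h, s). f (h, s)) \<in> borel_measurable (M \<Otimes>\<^sub>M posL)"
    using assms by (simp cong: measurable_cong_sets)
  then show ?thesis by (rule borel_measurable_nn_integral)
qed

lemma emeasure_posL: "emeasure posL {0<..} = \<top>"
proof -
  have "emeasure posL {0<..} = (\<integral>\<^sup>+s. 1 \<partial>posL)" by simp
  also have "\<dots> = emeasure lborel {0::real<..}" unfolding nn_integral_posL by simp
  also have "\<dots> = \<top>"
  proof (rule ccontr)
    assume "emeasure lborel {0::real<..} \<noteq> \<top>"
    then obtain r where r: "emeasure lborel {0::real<..} = ennreal r" "0 \<le> r"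
      by (cases "emeasure lborel {0::real<..}") auto
    have "emeasure lborel {0<..r + 1} \<le> emeasure lborel {0::real<..}" by (intro emeasure_mono) auto
    then show False using r by (simp add: ennreal_le_iff)
  qed
  finally show ?thesis .
qed

locale ctmdp_policy = ctmdp S A \<gamma> q for S :: "'s::polish_space set" and A :: "'b::polish_space set" and \<gamma> q +
  fixes pol :: "('s, 'b) policy"
  assumes is_pol: "is_policy S A pol"
begin

abbreviation "HM \<equiv> histM S"
abbreviation "HP n \<equiv> histM S n \<Otimes>\<^sub>M posR"

lemma pol_measurable[measurable]: "pol n \<in> measurable (HP n) (prob_algebra (SM A))"
  using is_pol by (simp add: is_policy_def)

lemma pol_subprob[measurable]: "pol n \<in> measurable (HP n) (subprob_algebra (SM A))"
  by (rule measurable_prob_algebraD) (rule pol_measurable)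

lemma pol_prob: assumes "h \<in> space (HM n)" "0 < s"
  shows "prob_space (pol n (h, s))" "sets (pol n (h, s)) = sets (SM A)" "space (pol n (h, s)) = A"
proof -
  have "(h, s) \<in> space (HP n)" using assms by (simp add: space_pair_measure)
  from measurable_space[OF pol_measurable this] show "prob_space (pol n (h, s))"
      and sets: "sets (pol n (h, s)) = sets (SM A)"
    by (auto simp: space_prob_algebra)
  from sets_eq_imp_space_eq[OF sets] show "space (pol n (h, s)) = A" by simp
qed

lemma measurable_snd_HM[measurable]: "snd \<in> measurable (HM n) (SM S)"
    and measurable_fst_HM[measurable]: "fst \<in> measurable (HM n) (PiM {..<n} (\<lambda>_. SM S \<Otimes>\<^sub>M posR))"
  by (simp_all add: histM_def)

lemma snd_HM: "h \<in> space (HM n) \<Longrightarrow> snd h \<in> S"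
  using measurable_space[OF measurable_snd_HM, of h n] by simp

lemma measurable_pol_section:
  assumes "h \<in> space (HM n)" "0 < s" and g: "g \<in> measurable SA K"
  shows "(\<lambda>a. g (snd h, a)) \<in> measurable (pol n (h, s)) K"
  unfolding measurable_cong_sets[OF pol_prob(2)[OF assms(1,2)] refl]
  by (rule measurable_compose[OF measurable_Pair1' g]) (simp add: snd_HM[OF assms(1)])

lemma measurable_HP_section: "h \<in> space (HM n) \<Longrightarrow> f \<in> borel_measurable (HP n) \<Longrightarrow>
    (\<lambda>s. f (h, s)) \<in> borel_measurable posR"
  by (rule measurable_compose[OF measurable_Pair1'])

definition policy_mean :: "nat \<Rightarrow> ('s \<times> 'b \<Rightarrow> ennreal) \<Rightarrow> ((nat \<Rightarrow> 's \<times> real) \<times> 's) \<times> real \<Rightarrow> ennreal" where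
  "policy_mean n g p = (\<integral>\<^sup>+a. g (snd (fst p), a) \<partial>pol n p)"

lemma measurable_policy_mean[measurable]:
  assumes [measurable]: "g \<in> borel_measurable SA"
  shows "policy_mean n g \<in> borel_measurable (HP n)"
proof -
  have "(\<lambda>z. g (snd (fst (fst z)), snd z)) \<in> borel_measurable (HP n \<Otimes>\<^sub>M SM A)" by measurable
  from measurable_kernel_integral[OF pol_subprob this] show ?thesis
    by (simp add: policy_mean_def[abs_def])
qed

lemma pos_functional_policy_mean:
  assumes h: "h \<in> space (HM n)" and s: "0 < s"
  shows "pos_functional SA (\<lambda>g. policy_mean n g (h, s))"
proof -
  have "(\<lambda>a. (snd h, a)) \<in> measurable (pol n (h, s)) SA"
    by (rule measurable_pol_section[OF h s, of "\<lambda>z. z"]) simp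
  from pos_functional_map[OF pos_functional_nn_integral[OF refl] this] show ?thesis
    by (simp add: policy_mean_def)
qed

lemma policy_mean_mult_state:
  assumes h: "h \<in> space (HM n)" and s: "0 < s" and g: "g \<in> borel_measurable SA"
  shows "policy_mean n (\<lambda>z. g z * f (fst z)) (h, s) = policy_mean n g (h, s) * f (snd h)"
  using measurable_pol_section[OF h s g] by (simp add: policy_mean_def nn_integral_multc)

lemma qx_bound: assumes x: "x \<in> S" shows "\<exists>L\<ge>0. \<forall>a\<in>A. qx q x a \<le> L"
proof -
  obtain L where L: "\<forall>a\<in>A. qx q x a \<le> L" using bspec[OF q_bounded x] by (auto simp: bdd_above_def)
  moreover obtain a where "a \<in> A" using A_ne by auto
  ultimately have "0 \<le> L" using qx_nonneg x by (meson order_trans)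
  then show ?thesis using L by blast
qed

definition hazard :: "nat \<Rightarrow> ((nat \<Rightarrow> 's \<times> real) \<times> 's) \<Rightarrow> real \<Rightarrow> real" where
  "hazard n h s = (if 0 < s then \<integral>a. qx q (snd h) a \<partial>pol n (h, s) else 0)"

lemma
  assumes h: "h \<in> space (HM n)" and s: "0 < s"
  shows ennreal_hazard: "ennreal (hazard n h s) = policy_mean n rate (h, s)"
    and integrable_qx: "integrable (pol n (h, s)) (qx q (snd h))"
proof -
  interpret prob_space "pol n (h, s)" by (rule pol_prob[OF h s])
  obtain B where B: "\<And>a. a \<in> A \<Longrightarrow> qx q (snd h) a \<le> B" using qx_bound[OF snd_HM[OF h]] by blast
  have nonneg: "a \<in> A \<Longrightarrow> 0 \<le> qx q (snd h) a" for a using qx_nonneg snd_HM[OF h] by auto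
  show integrable: "integrable (pol n (h, s)) (qx q (snd h))"
    using measurable_pol_section[OF h s measurable_qx] B nonneg
    by (intro integrable_const_bound[where B=B]) (auto simp: pol_prob(3)[OF h s] intro!: AE_I2)
  have "(\<integral>\<^sup>+a. ennreal (qx q (snd h) a) \<partial>pol n (h, s)) = ennreal (\<integral>a. qx q (snd h) a \<partial>pol n (h, s))"
    using integrable nonneg
    by (intro nn_integral_eq_integral) (auto simp: pol_prob(3)[OF h s] intro!: AE_I2)
  then show "ennreal (hazard n h s) = policy_mean n rate (h, s)"
    using s by (simp add: hazard_def policy_mean_def rate_def)
qed

lemma hazard_nonneg: assumes h: "h \<in> space (HM n)" shows "0 \<le> hazard n h s"
  using qx_nonneg snd_HM[OF h]
  by (auto simp: hazard_def pol_prob(3)[OF h] intro!: integral_nonneg_AE AE_I2)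

lemma policy_mean_rate_finite: "h \<in> space (HM n) \<Longrightarrow> 0 < s \<Longrightarrow> policy_mean n rate (h, s) \<noteq> \<top>"
  by (simp flip: ennreal_hazard)

lemma ex_bounded_hazard:
  assumes h: "h \<in> space (HM n)" shows "\<exists>L. bounded_hazard (hazard n h) L"
proof -
  obtain L where L: "0 \<le> L" "\<And>a. a \<in> A \<Longrightarrow> qx q (snd h) a \<le> L" using qx_bound[OF snd_HM[OF h]] by blast
  have "bounded_hazard (hazard n h) L"
  proof
    have "(\<lambda>s. (h, if 0 < s then s else 1)) \<in> measurable borel (HP n)"
      using h by (intro measurable_Pair measurable_into_posR) auto
    from measurable_compose[OF this measurable_policy_mean[OF measurable_rate]]
    have [measurable]: "(\<lambda>s. policy_mean n rate (h, if 0 < s then s else 1)) \<in> borel_measurable borel" .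
    have "hazard n h = (\<lambda>s. if 0 < s then enn2real (policy_mean n rate (h, if 0 < s then s else 1)) else 0)"
      by (auto simp: fun_eq_iff hazard_nonneg[OF h] simp flip: ennreal_hazard[OF h]) (simp add: hazard_def)
    also have "\<dots> \<in> borel_measurable borel" by measurable
    finally show "hazard n h \<in> borel_measurable borel" .
    fix s show "0 \<le> hazard n h s" by (rule hazard_nonneg[OF h])
    show "hazard n h s \<le> L"
    proof (cases "0 < s")
      case True
      interpret prob_space "pol n (h, s)" by (rule pol_prob[OF h True])
      have "(\<integral>a. qx q (snd h) a \<partial>pol n (h, s)) \<le> (\<integral>a. L \<partial>pol n (h, s))"
        using integrable_qx[OF h True] L by (intro integral_mono) (auto simp: pol_prob(3)[OF h True])
      then show ?thesis using True by (simp add: hazard_def prob_space)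
    qed (use L in \<open>simp add: hazard_def\<close>)
  qed
  then show ?thesis ..
qed

definition survival :: "nat \<Rightarrow> ((nat \<Rightarrow> 's \<times> real) \<times> 's) \<times> real \<Rightarrow> ennreal" where
  "survival n p = ennreal (exp (- (LINT s:{0<..snd p}|lborel. hazard n (fst p) s)))"

lemma survival_le_1: "h \<in> space (HM n) \<Longrightarrow> survival n (h, s) \<le> 1"
  using hazard_nonneg[of h n] unfolding survival_def set_lebesgue_integral_def
  by (auto intro!: integral_nonneg_AE)

lemma measurable_survival[measurable]: "survival n \<in> borel_measurable (HP n)"
proof -
  define \<Lambda> where "\<Lambda> p = (\<integral>\<^sup>+s. (if s \<le> snd p then policy_mean n rate (fst p, s) else 0) \<partial>posL)" for p
  have [measurable]: "(\<lambda>z. snd z) \<in> borel_measurable (HP n \<Otimes>\<^sub>M posR)" "(\<lambda>z. snd (fst z)) \<in> borel_measurable (HP n \<Otimes>\<^sub>M posR)"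
    by (auto intro: measurable_compose[OF _ measurable_posR_borel])
  have "(\<lambda>z. if snd z \<le> snd (fst z) then policy_mean n rate (fst (fst z), snd z) else 0) \<in> borel_measurable (HP n \<Otimes>\<^sub>M posR)"
    by measurable
  from measurable_posL_integral[OF this] have [measurable]: "\<Lambda> \<in> borel_measurable (HP n)"
    by (simp add: \<Lambda>_def[abs_def] cong: if_cong)
  have "survival n p = ennreal (exp (- enn2real (\<Lambda> p)))" if p: "p \<in> space (HP n)" for p
  proof -
    have h: "fst p \<in> space (HM n)" using p by (auto simp: space_pair_measure)
    obtain L where "bounded_hazard (hazard n (fst p)) L" using ex_bounded_hazard[OF h] by blast
    then interpret bounded_hazard "hazard n (fst p)" L .
    have "(LINT s:{0<..snd p}|lborel. hazard n (fst p) s)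
        = enn2real (\<integral>\<^sup>+s. ennreal (indicator {0<..snd p} s * hazard n (fst p) s) \<partial>lborel)"
      unfolding set_lebesgue_integral_def using l_nonneg by (subst integral_eq_nn_integral) auto
    also have "(\<integral>\<^sup>+s. ennreal (indicator {0<..snd p} s * hazard n (fst p) s) \<partial>lborel) = \<Lambda> p"
      unfolding \<Lambda>_def nn_integral_posL
      by (intro nn_integral_cong) (auto simp: ennreal_hazard[OF h] split: split_indicator)
    finally show ?thesis by (simp add: survival_def)
  qed
  then show ?thesis by (subst measurable_cong[where g="\<lambda>p. ennreal (exp (- enn2real (\<Lambda> p)))"]) measurable
qed

lemma nn_integral_jump_before:
  assumes h: "h \<in> space (HM n)" and t: "0 < t"
  shows "(\<integral>\<^sup>+s. survival n (h, s) * policy_mean n rate (h, s) * indicator {..<t} s \<partial>posL)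
      = 1 - survival n (h, t)"
proof -
  obtain L where "bounded_hazard (hazard n h) L" using ex_bounded_hazard[OF h] by blast
  then interpret bounded_hazard "hazard n h" L .
  have "(\<integral>\<^sup>+s. survival n (h, s) * policy_mean n rate (h, s) * indicator {..<t} s \<partial>posL)
    = (\<integral>\<^sup>+s\<in>{0<..t}. ennreal (hazard n h s * exp (- cumulative s)) \<partial>lborel)"
    unfolding nn_integral_posL
  proof (intro nn_integral_cong_AE)
    have "AE s in lborel. s \<noteq> t" by (rule AE_lborel_singleton)
    then show "AE s in lborel. survival n (h, s) * policy_mean n rate (h, s) * indicator {..<t} s * indicator {0<..} s
        = ennreal (hazard n h s * exp (- cumulative s)) * indicator {0<..t} s"
    proof eventually_elim
      fix s assume "s \<noteq> t"
      then show "survival n (h, s) * policy_mean n rate (h, s) * indicator {..<t} s * indicator {0<..} s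
        = ennreal (hazard n h s * exp (- cumulative s)) * indicator {0<..t} s"
        using l_nonneg[of s]
        by (auto simp: survival_def cumulative_def ennreal_mult mult.commute ennreal_hazard[OF h, symmetric] split: split_indicator)
    qed
  qed
  also have "\<dots> = ennreal (1 - exp (- cumulative t))" using t by (simp add: nn_integral_jump_density)
  also have "\<dots> = 1 - survival n (h, t)"
    by (simp add: survival_def cumulative_def ennreal_minus flip: ennreal_1)
  finally show ?thesis .
qed

definition sojourn_integral :: "nat \<Rightarrow> ('s \<times> 'b \<Rightarrow> ennreal) \<Rightarrow> (nat \<Rightarrow> 's \<times> real) \<times> 's \<Rightarrow> ennreal" where
  "sojourn_integral n g h = (\<integral>\<^sup>+s. survival n (h, s) * policy_mean n g (h, s) \<partial>posL)"

lemma measurable_sojourn_integral[measurable]: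
  "g \<in> borel_measurable SA \<Longrightarrow> sojourn_integral n g \<in> borel_measurable (HM n)"
  unfolding sojourn_integral_def[abs_def]
  by (intro measurable_posL_integral borel_measurable_times_ennreal measurable_survival measurable_policy_mean)

lemma measurable_survival_policy_mean:
  "h \<in> space (HM n) \<Longrightarrow> g \<in> borel_measurable SA \<Longrightarrow>
    (\<lambda>s. survival n (h, s) * policy_mean n g (h, s)) \<in> borel_measurable posL"
  using measurable_HP_section[of h n "\<lambda>p. survival n p * policy_mean n g p"] by simp

lemma pos_functional_sojourn_integral:
  assumes h: "h \<in> space (HM n)" shows "pos_functional SA (\<lambda>g. sojourn_integral n g h)"
  unfolding sojourn_integral_def
  by (intro pos_functional_integral pos_functional_cmult pos_functional_policy_mean h measurable_survival_policy_mean) simp_all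

lemma sojourn_integral_mult_state:
  assumes h: "h \<in> space (HM n)" and g: "g \<in> borel_measurable SA"
  shows "sojourn_integral n (\<lambda>z. g z * f (fst z)) h = sojourn_integral n g h * f (snd h)"
proof -
  have "sojourn_integral n (\<lambda>z. g z * f (fst z)) h
      = (\<integral>\<^sup>+s. survival n (h, s) * policy_mean n g (h, s) * f (snd h) \<partial>posL)"
    unfolding sojourn_integral_def
    by (intro nn_integral_cong) (simp add: policy_mean_mult_state[OF h _ g] mult.assoc)
  then show ?thesis
    using measurable_survival_policy_mean[OF h g] by (simp add: sojourn_integral_def nn_integral_multc)
qed

definition jump_mass :: "nat \<Rightarrow> (nat \<Rightarrow> 's \<times> real) \<times> 's \<Rightarrow> ennreal" where
  "jump_mass n = sojourn_integral n rate"

lemma measurable_jump_mass[measurable]: "jump_mass n \<in> borel_measurable (HM n)"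
  by (simp add: jump_mass_def)

lemma jump_mass_le_1: assumes h: "h \<in> space (HM n)" shows "jump_mass n h \<le> 1"
proof -
  note [measurable] = measurable_survival_policy_mean[OF h measurable_rate]
  have "jump_mass n h = (\<integral>\<^sup>+s. (SUP k. survival n (h, s) * policy_mean n rate (h, s) * indicator {..<real (Suc k)} s) \<partial>posL)"
    unfolding jump_mass_def sojourn_integral_def
  proof (intro nn_integral_cong)
    fix s :: real
    obtain k where "s < real (Suc k)" by (meson less_trans lessI of_nat_less_iff reals_Archimedean2)
    then show "survival n (h, s) * policy_mean n rate (h, s)
        = (SUP k. survival n (h, s) * policy_mean n rate (h, s) * indicator {..<real (Suc k)} s)"
      by (intro antisym SUP_least SUP_upper2[of k]) (auto split: split_indicator)
  qed
  also have "\<dots> = (SUP k. \<integral>\<^sup>+s. survival n (h, s) * policy_mean n rate (h, s) * indicator {..<real (Suc k)} s \<partial>posL)"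
  proof (intro nn_integral_monotone_convergence_SUP)
    show "incseq (\<lambda>k s. survival n (h, s) * policy_mean n rate (h, s) * indicator {..<real (Suc k)} s)"
      by (auto simp: incseq_def le_fun_def intro!: mult_left_mono split: split_indicator)
  qed measurable
  also have "\<dots> \<le> 1"
    by (intro SUP_least) (simp add: nn_integral_jump_before[OF h] diff_le_self_ennreal)
  finally show ?thesis .
qed

lemma survival_eq_jump_after:
  assumes h: "h \<in> space (HM n)" and t: "0 < t"
  shows "survival n (h, t) = (\<integral>\<^sup>+s. survival n (h, s) * policy_mean n rate (h, s) * indicator {t..} s \<partial>posL) + (1 - jump_mass n h)"
proof -
  note [measurable] = measurable_survival_policy_mean[OF h measurable_rate]
  let ?T = "\<integral>\<^sup>+s. survival n (h, s) * policy_mean n rate (h, s) * indicator {t..} s \<partial>posL"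
  have "jump_mass n h = (\<integral>\<^sup>+s. survival n (h, s) * policy_mean n rate (h, s) * indicator {..<t} s
      + survival n (h, s) * policy_mean n rate (h, s) * indicator {t..} s \<partial>posL)"
    unfolding jump_mass_def sojourn_integral_def
    by (intro nn_integral_cong) (auto split: split_indicator)
  also have "\<dots> = (1 - survival n (h, t)) + ?T"
    by (subst nn_integral_add) (auto simp: nn_integral_jump_before[OF h t])
  finally have total: "jump_mass n h = (1 - survival n (h, t)) + ?T" .
  have "?T + (1 - jump_mass n h) + (1 - survival n (h, t)) = jump_mass n h + (1 - jump_mass n h)"
    unfolding total by (simp add: ac_simps)
  also have "\<dots> = 1" using jump_mass_le_1[OF h] by (simp add: add_diff_inverse_ennreal)
  also have "\<dots> = survival n (h, t) + (1 - survival n (h, t))"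
    using survival_le_1[OF h] by (simp add: add_diff_inverse_ennreal)
  finally show ?thesis
    using ennreal_add_left_cancel[of "1 - survival n (h, t)"] by (auto simp: add.commute)
qed

definition jump_integral :: "nat \<Rightarrow> (nat \<Rightarrow> 's \<times> real) \<times> 's \<Rightarrow> (real \<times> 's \<Rightarrow> ennreal) \<Rightarrow> ennreal" where
  "jump_integral n h f = (\<integral>\<^sup>+s. survival n (h, s) * policy_mean n (\<lambda>z. rate z * (\<integral>\<^sup>+y. f (s, y) \<partial>jump_kernel z)) (h, s) \<partial>posL)"

lemma measurable_jump_integrand:
  assumes g: "g \<in> borel_measurable (HP n \<Otimes>\<^sub>M SM S)"
  shows "(\<lambda>p. policy_mean n (\<lambda>z. rate z * (\<integral>\<^sup>+y. g (p, y) \<partial>jump_kernel z)) p) \<in> borel_measurable (HP n)"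
proof -
  note [measurable] = g
  have "(\<lambda>z. (snd (fst (fst z)), snd z)) \<in> measurable (HP n \<Otimes>\<^sub>M SM A) SA" by measurable
  from measurable_compose[OF this measurable_jump_kernel] measurable_compose[OF this measurable_rate]
  have kernel: "(\<lambda>z. jump_kernel (snd (fst (fst z)), snd z)) \<in> measurable (HP n \<Otimes>\<^sub>M SM A) (subprob_algebra (SM S))"
    and [measurable]: "(\<lambda>z. rate (snd (fst (fst z)), snd z)) \<in> borel_measurable (HP n \<Otimes>\<^sub>M SM A)" by auto
  have "(\<lambda>z. g (fst (fst z), snd z)) \<in> borel_measurable ((HP n \<Otimes>\<^sub>M SM A) \<Otimes>\<^sub>M SM S)" by measurable
  from measurable_kernel_integral[OF kernel this]
  have [measurable]: "(\<lambda>z. \<integral>\<^sup>+y. g (fst z, y) \<partial>jump_kernel (snd (fst (fst z)), snd z)) \<in> borel_measurable (HP n \<Otimes>\<^sub>M SM A)" by simp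
  have "(\<lambda>z. rate (snd (fst (fst z)), snd z) * (\<integral>\<^sup>+y. g (fst z, y) \<partial>jump_kernel (snd (fst (fst z)), snd z))) \<in> borel_measurable (HP n \<Otimes>\<^sub>M SM A)"
    by measurable
  from measurable_kernel_integral[OF pol_subprob this] show ?thesis by (simp add: policy_mean_def)
qed

lemma measurable_jump_integral:
  assumes g: "g \<in> borel_measurable (HM n \<Otimes>\<^sub>M (posR \<Otimes>\<^sub>M SM S))"
  shows "(\<lambda>h. jump_integral n h (\<lambda>w. g (h, w))) \<in> borel_measurable (HM n)"
proof -
  note [measurable] = g
  have "(\<lambda>z. g (fst (fst z), (snd (fst z), snd z))) \<in> borel_measurable (HP n \<Otimes>\<^sub>M SM S)" by measurable
  from measurable_jump_integrand[OF this]
  have [measurable]: "(\<lambda>p. policy_mean n (\<lambda>z. rate z * (\<integral>\<^sup>+y. g (fst p, (snd p, y)) \<partial>jump_kernel z)) p) \<in> borel_measurable (HP n)" by simp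
  have "(\<lambda>p. survival n p * policy_mean n (\<lambda>z. rate z * (\<integral>\<^sup>+y. g (fst p, (snd p, y)) \<partial>jump_kernel z)) p) \<in> borel_measurable (HP n)" by measurable
  from measurable_posL_integral[OF this] show ?thesis by (simp add: jump_integral_def)
qed

lemma pos_functional_jump_integral:
  assumes h: "h \<in> space (HM n)" shows "pos_functional (posR \<Otimes>\<^sub>M SM S) (jump_integral n h)"
  unfolding jump_integral_def policy_mean_def
proof (intro pos_functional_integral pos_functional_cmult)
  fix s a y assume "s \<in> space posL" "y \<in> space (jump_kernel (snd (fst (h, s)), a))"
  then show "pos_functional (posR \<Otimes>\<^sub>M SM S) (\<lambda>f. f (s, y))"
    by (intro pos_functional_eval) (simp add: space_pair_measure)
next
  fix s and f :: "real \<times> 's \<Rightarrow> ennreal" assume s: "s \<in> space posL"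
      and f: "f \<in> borel_measurable (posR \<Otimes>\<^sub>M SM S)"
  have meas_y: "(\<lambda>y. f (s, y)) \<in> borel_measurable (SM S)"
    using measurable_compose[OF measurable_Pair1' f] s by simp
  then show "(\<lambda>y. f (s, y)) \<in> borel_measurable (jump_kernel (snd (fst (h, s)), a))" for a
    by (simp add: measurable_cong_sets[OF sets_jump_kernel refl])
  have "(\<lambda>z. rate z * (\<integral>\<^sup>+y. f (s, y) \<partial>jump_kernel z)) \<in> borel_measurable SA"
    by (intro borel_measurable_times_ennreal measurable_rate measurable_nn_integral_jump_kernel meas_y)
  from measurable_pol_section[OF h _ this]
  show "(\<lambda>a. rate (snd (fst (h, s)), a) * (\<integral>\<^sup>+y. f (s, y) \<partial>jump_kernel (snd (fst (h, s)), a))) \<in> borel_measurable (pol n (h, s))"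
    using s by simp
next
  fix f :: "real \<times> 's \<Rightarrow> ennreal" assume f[measurable]: "f \<in> borel_measurable (posR \<Otimes>\<^sub>M SM S)"
  have "(\<lambda>z. f (snd (fst z), snd z)) \<in> borel_measurable (HP n \<Otimes>\<^sub>M SM S)" by measurable
  from measurable_jump_integrand[OF this]
  have [measurable]: "(\<lambda>p. policy_mean n (\<lambda>z. rate z * (\<integral>\<^sup>+y. f (snd p, y) \<partial>jump_kernel z)) p) \<in> borel_measurable (HP n)" by simp
  have "(\<lambda>p. survival n p * policy_mean n (\<lambda>z. rate z * (\<integral>\<^sup>+y. f (snd p, y) \<partial>jump_kernel z)) p) \<in> borel_measurable (HP n)" by measurable
  from measurable_HP_section[OF h this]
  show "(\<lambda>s. survival n (h, s) * (\<integral>\<^sup>+a. rate (snd (fst (h, s)), a) * (\<integral>\<^sup>+y. f (s, y) \<partial>jump_kernel (snd (fst (h, s)), a)) \<partial>pol n (h, s))) \<in> borel_measurable posL"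
    by (simp add: policy_mean_def)
qed

lemma jump_integral_time:
  assumes h: "h \<in> space (HM n)"
  shows "jump_integral n h (\<lambda>w. f (fst w)) = (\<integral>\<^sup>+s. survival n (h, s) * policy_mean n rate (h, s) * f s \<partial>posL)"
  unfolding jump_integral_def
proof (intro nn_integral_cong)
  fix s assume "s \<in> space posL"
  then have s: "0 < s" by simp
  have "policy_mean n (\<lambda>z. rate z * (\<integral>\<^sup>+y. f (fst (s, y)) \<partial>jump_kernel z)) (h, s)
      = policy_mean n (\<lambda>z. rate z * f s) (h, s)"
    unfolding policy_mean_def using emeasure_jump_kernel_space snd_HM[OF h]
    by (intro nn_integral_cong) (auto simp: pol_prob(3)[OF h s])
  then show "survival n (h, s) * policy_mean n (\<lambda>z. rate z * (\<integral>\<^sup>+y. f (fst (s, y)) \<partial>jump_kernel z)) (h, s)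
    = survival n (h, s) * policy_mean n rate (h, s) * f s"
    by (simp add: policy_mean_mult_state[OF h s measurable_rate, of "\<lambda>_. f s"] mult.assoc)
qed

lemma jump_integral_state: "jump_integral n h (\<lambda>w. f (snd w))
    = sojourn_integral n (\<lambda>z. rate z * (\<integral>\<^sup>+y. f y \<partial>jump_kernel z)) h"
  by (simp add: jump_integral_def sojourn_integral_def)

lemma policy_mean_rate_mult_jump_ratio:
  assumes h: "h \<in> space (HM n)" and s: "0 < s" and \<Gamma>: "\<Gamma> \<in> sets (SM S)"
  shows "policy_mean n rate (h, s) * ennreal (jump_ratio q (snd h) (pol n (h, s)) \<Gamma>)
      = policy_mean n (\<lambda>z. rate z * emeasure (jump_kernel z) \<Gamma>) (h, s)"
proof -
  interpret prob_space "pol n (h, s)" by (rule pol_prob[OF h s])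
  note space_pol = pol_prob(3)[OF h s]
  have qt: "0 \<le> qt q (snd h) a \<Gamma>" "qt q (snd h) a \<Gamma> \<le> qx q (snd h) a" if a: "a \<in> A" for a
  proof -
    show "0 \<le> qt q (snd h) a \<Gamma>" using q_nonneg \<Gamma> a snd_HM[OF h] by auto
    have "emeasure (qtM q S (snd h) a) \<Gamma> \<le> emeasure (qtM q S (snd h) a) S"
      using sets.sets_into_space[OF \<Gamma>] sets.top[of "SM S"] by (intro emeasure_mono) auto
    then show "qt q (snd h) a \<Gamma> \<le> qx q (snd h) a"
      using a snd_HM[OF h] \<Gamma> sets.top[of "SM S"] qx_nonneg by (simp add: emeasure_qtM qt_S)
  qed
  have integrable_qt: "integrable (pol n (h, s)) (\<lambda>a. qt q (snd h) a \<Gamma>)"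
    using measurable_pol_section[OF h s measurable_qt[OF \<Gamma>]] qt order_trans[OF qt]
    by (intro Bochner_Integration.integrable_bound[OF integrable_qx[OF h s]]) (auto simp: space_pol intro!: AE_I2)
  define X Y where "X = (\<integral>a. qx q (snd h) a \<partial>pol n (h, s))"
      and "Y = (\<integral>a. qt q (snd h) a \<Gamma> \<partial>pol n (h, s))"
  have Y_bounds: "0 \<le> Y" "Y \<le> X" unfolding X_def Y_def using integrable_qt integrable_qx[OF h s] qt
    by (auto intro!: integral_mono integral_nonneg_AE AE_I2 simp: space_pol)
  have "policy_mean n rate (h, s) = ennreal X"
    using s by (simp add: hazard_def X_def flip: ennreal_hazard[OF h])
  moreover have "policy_mean n (\<lambda>z. rate z * emeasure (jump_kernel z) \<Gamma>) (h, s)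
      = (\<integral>\<^sup>+a. ennreal (qt q (snd h) a \<Gamma>) \<partial>pol n (h, s))"
    unfolding policy_mean_def using rate_mult_emeasure_jump_kernel[OF _ \<Gamma>] snd_HM[OF h]
    by (intro nn_integral_cong) (auto simp: space_pol)
  moreover have "\<dots> = ennreal Y" unfolding Y_def
    using integrable_qt qt by (intro nn_integral_eq_integral) (auto simp: space_pol AE_I2)
  moreover have "ennreal X * ennreal (Y / X) = ennreal Y" using Y_bounds
    by (cases "X = 0") (auto simp flip: ennreal_mult)
  ultimately show ?thesis by (simp add: jump_ratio_def X_def[symmetric] Y_def[symmetric])
qed

lemma measurable_jump_ratio:
  assumes \<Gamma>: "\<Gamma> \<in> sets (SM S)"
  shows "(\<lambda>p. ennreal (jump_ratio q (snd (fst p)) (pol n p) \<Gamma>)) \<in> borel_measurable (HP n)"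
proof -
  have "(\<lambda>z. emeasure (jump_kernel z) \<Gamma>) \<in> borel_measurable SA"
    using measurable_compose[OF measurable_jump_kernel measurable_emeasure_subprob_algebra[OF \<Gamma>]] by simp
  then have [measurable]: "(\<lambda>z. rate z * emeasure (jump_kernel z) \<Gamma>) \<in> borel_measurable SA" by measurable
  have "ennreal (jump_ratio q (snd h) (pol n (h, s)) \<Gamma>)
      = policy_mean n (\<lambda>z. rate z * emeasure (jump_kernel z) \<Gamma>) (h, s) / policy_mean n rate (h, s)"
    if h: "h \<in> space (HM n)" and s: "0 < s" for h s
  proof (cases "policy_mean n rate (h, s) = 0")
    case True
    then have "hazard n h s = 0" using hazard_nonneg[OF h, of s] by (simp flip: ennreal_hazard[OF h s])
    then have "jump_ratio q (snd h) (pol n (h, s)) \<Gamma> = 0"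
      using s by (simp add: jump_ratio_def hazard_def)
    then show ?thesis using True by (simp flip: policy_mean_rate_mult_jump_ratio[OF h s \<Gamma>])
  next
    case False
    then show ?thesis using policy_mean_rate_finite[OF h s]
      by (simp add: policy_mean_rate_mult_jump_ratio[OF h s \<Gamma>, symmetric] mult.commute[of "policy_mean n rate (h, s)"] ennreal_mult_divide_eq)
  qed
  then have ratio: "ennreal (jump_ratio q (snd (fst p)) (pol n p) \<Gamma>)
      = policy_mean n (\<lambda>z. rate z * emeasure (jump_kernel z) \<Gamma>) p / policy_mean n rate p"
    if "p \<in> space (HP n)" for p using that by (auto simp: space_pair_measure)
  have "(\<lambda>p. policy_mean n (\<lambda>z. rate z * emeasure (jump_kernel z) \<Gamma>) p / policy_mean n rate p) \<in> borel_measurable (HP n)" by measurable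
  then show ?thesis using ratio by (subst measurable_cong)
qed

lemma jump_integral_rectangle:
  assumes h: "h \<in> space (HM n)" and \<Gamma>: "\<Gamma> \<in> sets (SM S)"
  shows "jump_integral n h (indicator (B \<times> \<Gamma>))
      = jump_integral n h (\<lambda>w. indicator B (fst w) * ennreal (jump_ratio q (snd h) (pol n (h, fst w)) \<Gamma>))"
  unfolding jump_integral_time[OF h, of "\<lambda>s. indicator B s * ennreal (jump_ratio q (snd h) (pol n (h, s)) \<Gamma>)"] unfolding jump_integral_def
proof (intro nn_integral_cong)
  fix s assume "s \<in> space posL"
  then have s: "0 < s" by simp
  have "(\<integral>\<^sup>+y. indicator (B \<times> \<Gamma>) (s, y) \<partial>jump_kernel z) = indicator B s * emeasure (jump_kernel z) \<Gamma>"
    for z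
    using \<Gamma> by (simp add: indicator_times nn_integral_cmult_indicator)
  then have "policy_mean n (\<lambda>z. rate z * (\<integral>\<^sup>+y. indicator (B \<times> \<Gamma>) (s, y) \<partial>jump_kernel z)) (h, s)
    = indicator B s * policy_mean n (\<lambda>z. rate z * emeasure (jump_kernel z) \<Gamma>) (h, s)"
    by (cases "s \<in> B") (auto simp: policy_mean_def)
  then show "survival n (h, s) * policy_mean n (\<lambda>z. rate z * (\<integral>\<^sup>+y. indicator (B \<times> \<Gamma>) (s, y) \<partial>jump_kernel z)) (h, s)
    = survival n (h, s) * policy_mean n rate (h, s) * (indicator B s * ennreal (jump_ratio q (snd h) (pol n (h, s)) \<Gamma>))"
    using policy_mean_rate_mult_jump_ratio[OF h s \<Gamma>, symmetric] by (simp add: ac_simps)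
qed

end

section \<open>The path measure of a policy\<close>

lemma space_optM[simp]: "space (optM M) = UNIV"
  by (simp add: optM_def space_measure_of_conv)

lemma None_sets_optM[measurable]: "{None} \<in> sets (optM M)"
  and Some_image_sets_optM: "B \<in> sets M \<Longrightarrow> Some ` B \<in> sets (optM M)"
  by (auto simp: optM_def)

lemma Some_measurable_optM[measurable]: "Some \<in> measurable M (optM M)"
  unfolding optM_def
proof (rule measurable_measure_of)
  fix Y assume "Y \<in> insert {None} ((\<lambda>B. Some ` B) ` sets M)"
  then consider "Y = {None}" | B where "B \<in> sets M" "Y = Some ` B" by auto
  then show "Some -` Y \<inter> space M \<in> sets M"
  proof cases
    case 2
    then have "Some -` Y \<inter> space M = B" using sets.sets_into_space by auto
    then show ?thesis using 2 by simp
  qed (simp add: vimage_def)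
qed auto

lemma sets_posR_generator: "sets posR = sigma_sets {0<..} (range (\<lambda>t. {0<..<t}))"
proof -
  have borel: "sets borel = sigma_sets UNIV (range lessThan :: real set set)" by (simp add: borel_Iio)
  then have "sets posR = (\<inter>) {0<..} ` sigma_sets UNIV (range lessThan)"
    by (simp add: posR_def sets_restrict_space)
  also have "\<dots> = sigma_sets {0<..} ((\<inter>) {0<..} ` range lessThan)"
    by (rule sigma_sets_Int) (simp_all flip: borel)
  also have "(\<inter>) {0<..} ` range lessThan = range (\<lambda>t::real. {0<..<t})"
    by (simp add: image_image greaterThanLessThan_def)
  finally show ?thesis .
qed

lemma Int_stable_posR_generator: "Int_stable (range (\<lambda>t::real. {0<..<t}))"
proof (rule Int_stableI)
  fix X Y assume "X \<in> range (\<lambda>t::real. {0<..<t})" "Y \<in> range (\<lambda>t::real. {0<..<t})"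
  then obtain s t where "X = {0<..<s}" "Y = {0<..<t}" by auto
  then have "X \<inter> Y = {0<..<min s t}" by auto
  then show "X \<inter> Y \<in> range (\<lambda>t::real. {0<..<t})" by simp
qed

context ctmdp
begin

abbreviation "PM \<equiv> optM (SM S) \<Otimes>\<^sub>M (borel :: ennreal measure)"

lemma space_PM[simp]: "space PM = UNIV" by (simp add: space_pair_measure)

definition default_state :: 's where "default_state = (SOME x. x \<in> S)"

lemma default_state: "default_state \<in> S"
  unfolding default_state_def using S_ne by (simp add: some_in_eq)

definition state_of :: "'s option \<Rightarrow> 's" where
  "state_of w = (if w \<in> Some ` S then the w else default_state)"

definition sojourn_of :: "ennreal \<Rightarrow> real" where
  "sojourn_of t = (if 0 < t \<and> t < \<top> then enn2real t else 1)"

lemma state_of_Some[simp]: "x \<in> S \<Longrightarrow> state_of (Some x) = x" by (simp add: state_of_def)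

lemma sojourn_of_ennreal[simp]: "0 < s \<Longrightarrow> sojourn_of (ennreal s) = s" by (simp add: sojourn_of_def)

lemma Some_S_sets[measurable]: "Some ` S \<in> sets (optM (SM S))"
  using Some_image_sets_optM[OF sets.top[of "SM S"]] by simp

lemma measurable_state_of[measurable]: "state_of \<in> measurable (optM (SM S)) (SM S)"
proof (rule measurableI)
  fix B assume B: "B \<in> sets (SM S)"
  then have "B \<subseteq> S" using sets.sets_into_space by fastforce
  then have "state_of -` B \<inter> space (optM (SM S))
      = Some ` B \<union> (if default_state \<in> B then space (optM (SM S)) - Some ` S else {})"
    by (auto simp: state_of_def split: if_splits)
  then show "state_of -` B \<inter> space (optM (SM S)) \<in> sets (optM (SM S))"
    using Some_image_sets_optM[OF B] Some_S_sets by (auto simp del: space_optM)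
qed (auto simp: state_of_def default_state)

lemma measurable_sojourn_of[measurable]: "sojourn_of \<in> measurable borel posR"
  unfolding sojourn_of_def by (rule measurable_into_posR) (auto simp: enn2real_positive_iff)

lemma ennreal_image_iff:
  assumes "B \<subseteq> {0<..}" shows "t \<in> ennreal ` B \<longleftrightarrow> 0 < t \<and> t < \<top> \<and> sojourn_of t \<in> B"
proof
  assume "t \<in> ennreal ` B"
  then show "0 < t \<and> t < \<top> \<and> sojourn_of t \<in> B" using assms by (auto simp: subset_iff)
next
  assume "0 < t \<and> t < \<top> \<and> sojourn_of t \<in> B"
  then show "t \<in> ennreal ` B" by (auto simp: sojourn_of_def image_iff intro!: bexI[of _ "enn2real t"])
qed

lemma sets_ennreal_image: assumes B: "B \<in> sets posR" shows "ennreal ` B \<in> sets borel"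
proof -
  have "ennreal ` B = {t. 0 < t \<and> t < \<top> \<and> sojourn_of t \<in> B}"
    using ennreal_image_iff[of B] B by (auto simp: sets_posR_iff)
  also have "\<dots> \<in> sets borel" using B by measurable
  finally show ?thesis .
qed

definition is_jump :: "'s option \<times> ennreal \<Rightarrow> bool" where
  "is_jump z \<longleftrightarrow> fst z \<in> Some ` S \<and> 0 < snd z \<and> snd z < \<top>"

definition jump_of :: "'s option \<times> ennreal \<Rightarrow> real \<times> 's" where
  "jump_of z = (sojourn_of (snd z), state_of (fst z))"

definition jump_point :: "real \<times> 's \<Rightarrow> 's option \<times> ennreal" where
  "jump_point w = (Some (snd w), ennreal (fst w))"

lemma measurable_is_jump[measurable]: "Measurable.pred PM is_jump"
  unfolding is_jump_def[abs_def] by measurable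

lemma measurable_jump_of[measurable]: "jump_of \<in> measurable PM (posR \<Otimes>\<^sub>M SM S)"
  unfolding jump_of_def[abs_def] by measurable

lemma measurable_jump_point[measurable]: "jump_point \<in> measurable (posR \<Otimes>\<^sub>M SM S) PM"
  unfolding jump_point_def[abs_def]
  by (intro measurable_Pair measurable_compose[OF measurable_snd Some_measurable_optM]
      measurable_compose[OF measurable_compose[OF measurable_fst measurable_posR_borel] measurable_ennreal])

lemma jump_point_jump_of: "is_jump z \<Longrightarrow> jump_point (jump_of z) = z"
  by (cases z) (auto simp: is_jump_def jump_point_def jump_of_def sojourn_of_def)

lemma is_jump_jump_point: "w \<in> space (posR \<Otimes>\<^sub>M SM S) \<Longrightarrow> is_jump (jump_point w)"
  by (auto simp: is_jump_def jump_point_def space_pair_measure)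

lemma cemetery_sets[measurable]: "{(None, \<top>)} \<in> sets PM"
proof -
  have "{None} \<times> {\<top> :: ennreal} \<in> sets PM" by (intro pair_measureI) auto
  then show ?thesis by simp
qed

definition regular :: "nat \<Rightarrow> 's path \<Rightarrow> bool" where
  "regular n \<omega> \<longleftrightarrow> fst (\<omega> 0) \<in> Some ` S \<and> (\<forall>k\<in>{1..n}. is_jump (\<omega> k))"

(* A total and measurable version of hist, agreeing with it on regular paths. *)
definition history :: "nat \<Rightarrow> 's path \<Rightarrow> (nat \<Rightarrow> 's \<times> real) \<times> 's" where
  "history n \<omega> = (restrict (\<lambda>k. (state_of (fst (\<omega> k)), sojourn_of (snd (\<omega> (Suc k))))) {..<n}, state_of (fst (\<omega> n)))"

lemma measurable_regular: assumes "{..n} \<subseteq> I" shows "Measurable.pred (PiM I (\<lambda>_. PM)) (regular n)"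
  unfolding regular_def
proof (intro pred_intros_logic pred_intros_finite)
  have coord: "(\<lambda>\<omega>. \<omega> k) \<in> measurable (PiM I (\<lambda>_. PM)) PM" if "k \<le> n" for k
    using subsetD[OF assms, of k] that by (auto intro: measurable_component_singleton)
  note [measurable] = coord[of 0, simplified]
  show "Measurable.pred (PiM I (\<lambda>_. PM)) (\<lambda>\<omega>. fst (\<omega> 0) \<in> Some ` S)" by measurable
  show "Measurable.pred (PiM I (\<lambda>_. PM)) (\<lambda>\<omega>. is_jump (\<omega> k))" if "k \<in> {1..n}" for k
    using measurable_compose[OF coord measurable_is_jump, of k] that by simp
qed simp

lemma measurable_history: assumes "{..n} \<subseteq> I" shows "history n \<in> measurable (PiM I (\<lambda>_. PM)) (histM S n)"
proof -
  have [measurable]: "(\<lambda>\<omega>. \<omega> k) \<in> measurable (PiM I (\<lambda>_. PM)) PM" if "k \<le> n" for k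
    using subsetD[OF assms, of k] that by (intro measurable_component_singleton) simp
  show ?thesis unfolding history_def histM_def by (intro measurable_Pair measurable_restrict) measurable
qed

lemma regular_Suc: "regular (Suc n) \<omega> \<longleftrightarrow> regular n \<omega> \<and> is_jump (\<omega> (Suc n))"
  by (auto simp: regular_def atLeastAtMostSuc_conv)

lemma regular_state: "regular n \<omega> \<Longrightarrow> k \<le> n \<Longrightarrow> fst (\<omega> k) \<in> Some ` S"
  by (cases k) (auto simp: regular_def is_jump_def)

lemma regular_history_cong:
  assumes "\<And>k. k \<le> n \<Longrightarrow> \<omega> k = \<omega>' k" shows "regular n \<omega> \<longleftrightarrow> regular n \<omega>'" "history n \<omega> = history n \<omega>'"
  using assms by (auto simp: regular_def history_def fun_eq_iff restrict_def)

lemma regular_hist: assumes "regular n \<omega>" shows "hist n \<omega> = history n \<omega>"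
proof -
  have "is_jump (\<omega> (Suc k))" if "k < n" for k using assms that by (simp add: regular_def)
  then show ?thesis using regular_state[OF assms]
    by (auto simp: hist_def history_def xs_def th_def fun_eq_iff restrict_def state_of_def sojourn_of_def is_jump_def)
qed

lemma alive_hist_iff: assumes H: "H \<in> sets (histM S n)"
  shows "alive n \<omega> \<and> hist n \<omega> \<in> H \<longleftrightarrow> regular n \<omega> \<and> history n \<omega> \<in> H"
proof
  assume alive: "alive n \<omega> \<and> hist n \<omega> \<in> H"
  then have "hist n \<omega> \<in> space (histM S n)" using sets.sets_into_space[OF H] by auto
  then have "the (xs \<omega> n) \<in> S" and k: "\<And>k. k < n \<Longrightarrow> the (xs \<omega> k) \<in> S \<and> 0 < enn2real (th \<omega> (Suc k))"
    by (auto simp: hist_def histM_def space_pair_measure space_PiM PiE_iff)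
  then have states: "xs \<omega> k \<in> Some ` S" if "k \<le> n" for k
    using alive that
    by (cases "k = n") (auto simp: alive_def image_iff intro!: bexI[of _ "the (xs \<omega> k)"])
  have "is_jump (\<omega> k)" if "k \<in> {1..n}" for k
    using that states[of k] k[of "k - 1"] by (auto simp: is_jump_def xs_def th_def enn2real_positive_iff)
  then have "regular n \<omega>" using states[of 0] by (simp add: regular_def xs_def)
  then show "regular n \<omega> \<and> history n \<omega> \<in> H" using alive regular_hist by auto
next
  assume r: "regular n \<omega> \<and> history n \<omega> \<in> H"
  then have "alive n \<omega>" using regular_state[of n \<omega>] by (auto simp: alive_def xs_def)
  then show "alive n \<omega> \<and> hist n \<omega> \<in> H" using r regular_hist by auto
qed

lemma Omega_iff:
  "\<omega> \<in> Omega S \<longleftrightarrow> fst (\<omega> 0) \<in> Some ` S \<and> snd (\<omega> 0) = 0 \<and> (\<forall>n. regular (Suc n) \<omega> \<or> \<omega> (Suc n) = (None, \<top>))"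
proof
  assume \<omega>: "\<omega> \<in> Omega S"
  have "regular n \<omega> \<and> is_jump (\<omega> (Suc n)) \<or> \<omega> (Suc n) = (None, \<top>)" for n
  proof (induction n)
    case 0
    show ?case using \<omega>
      by (auto simp: Omega_def regular_def is_jump_def xs_def th_def prod_eq_iff less_top[symmetric])
  next
    case (Suc n)
    then show ?case using \<omega> unfolding regular_Suc
      by (auto simp: Omega_def is_jump_def xs_def th_def prod_eq_iff less_top[symmetric])
  qed
  then show "fst (\<omega> 0) \<in> Some ` S \<and> snd (\<omega> 0) = 0 \<and> (\<forall>n. regular (Suc n) \<omega> \<or> \<omega> (Suc n) = (None, \<top>))"
    using \<omega> by (simp add: regular_Suc) (auto simp: Omega_def xs_def th_def)
next
  assume \<omega>: "fst (\<omega> 0) \<in> Some ` S \<and> snd (\<omega> 0) = 0 \<and> (\<forall>n. regular (Suc n) \<omega> \<or> \<omega> (Suc n) = (None, \<top>))"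
  then have point: "is_jump (\<omega> (Suc n)) \<or> \<omega> (Suc n) = (None, \<top>)" for n by (metis regular_Suc)
  have "xs \<omega> n \<in> Some ` S \<or> xs \<omega> n = None" for n
    using \<omega> point[of "n - 1"] by (cases n) (auto simp: xs_def is_jump_def)
  moreover have "0 < th \<omega> (Suc n) \<and> (th \<omega> (Suc n) = \<top> \<longleftrightarrow> xs \<omega> (Suc n) = None)" for n
    using point[of n] by (auto simp: xs_def th_def is_jump_def)
  moreover have "th \<omega> (Suc (Suc n)) = \<top>" if "th \<omega> (Suc n) = \<top>" for n
  proof -
    have "\<not> regular (Suc (Suc n)) \<omega>" using that by (simp add: regular_Suc is_jump_def th_def)
    then show ?thesis using \<omega> by (metis snd_conv th_def)
  qed
  ultimately show "\<omega> \<in> Omega S" using \<omega> by (auto simp: Omega_def xs_def th_def)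
qed

definition path_prefix :: "nat \<Rightarrow> (nat \<Rightarrow> 's \<times> real) \<times> 's \<Rightarrow> 's path" where
  "path_prefix n h = restrict (\<lambda>k. (Some (if k < n then fst (fst h k) else snd h), if k = 0 then 0 else ennreal (snd (fst h (k - 1))))) {0..<Suc n}"

lemma path_prefix_history:
  assumes "snd (\<omega> 0) = 0" and r: "regular n \<omega>"
  shows "path_prefix n (history n \<omega>) = restrict \<omega> {0..<Suc n}"
proof
  fix k
  show "path_prefix n (history n \<omega>) k = restrict \<omega> {0..<Suc n} k"
  proof (cases "k \<le> n")
    case True
    have "fst (\<omega> k) = Some (state_of (fst (\<omega> k)))" using regular_state[OF r True] by auto
    moreover have "snd (\<omega> k) = ennreal (sojourn_of (snd (\<omega> k)))" if "k \<noteq> 0"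
      using r True that by (auto simp: regular_def is_jump_def sojourn_of_def)
    ultimately show ?thesis using True assms(1) by (auto simp: path_prefix_def history_def prod_eq_iff)
  qed (simp add: path_prefix_def)
qed

lemma measurable_path_prefix[measurable]: "path_prefix n \<in> measurable (histM S n) (PiM {0..<Suc n} (\<lambda>_. PM))"
  unfolding path_prefix_def
proof (intro measurable_restrict measurable_Pair)
  fix k assume k: "k \<in> {0..<Suc n}"
  have [measurable]: "snd \<in> measurable (histM S n) (SM S)" by (simp add: histM_def)
  have coord[measurable]: "(\<lambda>h. fst h i) \<in> measurable (histM S n) (SM S \<Otimes>\<^sub>M posR)" if "i < n" for i
    unfolding histM_def
    by (rule measurable_compose[OF measurable_fst measurable_component_singleton]) (use that in auto)
  show "(\<lambda>h. Some (if k < n then fst (fst h k) else snd h)) \<in> measurable (histM S n) (optM (SM S))"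
    using coord[of k] by (cases "k < n") (auto intro!: measurable_compose[OF _ Some_measurable_optM])
  show "(\<lambda>h. if k = 0 then 0 else ennreal (snd (fst h (k - 1)))) \<in> borel_measurable (histM S n)"
  proof (cases "k = 0")
    case False
    then have "(\<lambda>h. snd (fst h (k - 1))) \<in> borel_measurable (histM S n)"
      using k
      by (intro measurable_compose[OF measurable_compose[OF coord measurable_snd] measurable_posR_borel]) auto
    then show ?thesis using False by simp
  qed simp
qed

end

context ctmdp_policy
begin

lemma pos_functional_next:
  assumes h: "h \<in> space (HM n)"
  shows "pos_functional PM (\<lambda>f. jump_integral n h (\<lambda>w. f (jump_point w)) + (1 - jump_mass n h) * f (None, \<top>))"
  by (intro pos_functional_add pos_functional_cmult pos_functional_eval
      pos_functional_map[OF pos_functional_jump_integral[OF h] measurable_jump_point]) simp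

definition next_kernel :: "nat \<Rightarrow> (nat \<Rightarrow> 's \<times> real) \<times> 's \<Rightarrow> ('s option \<times> ennreal) measure" where
  "next_kernel n h = functional_measure PM (\<lambda>f. jump_integral n h (\<lambda>w. f (jump_point w)) + (1 - jump_mass n h) * f (None, \<top>))"

lemma sets_next_kernel[simp, measurable_cong]: "sets (next_kernel n h) = sets PM"
  and space_next_kernel[simp]: "space (next_kernel n h) = UNIV"
  by (simp_all add: next_kernel_def)

lemma nn_integral_next_kernel:
  assumes h: "h \<in> space (HM n)" and f: "f \<in> borel_measurable PM"
  shows "(\<integral>\<^sup>+z. f z \<partial>next_kernel n h) = jump_integral n h (\<lambda>w. f (jump_point w)) + (1 - jump_mass n h) * f (None, \<top>)"
  unfolding next_kernel_def by (rule nn_integral_functional_measure[OF pos_functional_next[OF h] f])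

lemma jump_integral_const:
  assumes h: "h \<in> space (HM n)" shows "jump_integral n h (\<lambda>w. c) = c * jump_mass n h"
proof -
  have "jump_integral n h (\<lambda>w. 1) = jump_mass n h"
    using jump_integral_time[OF h, of "\<lambda>_. 1"] by (simp add: jump_mass_def sojourn_integral_def)
  then show ?thesis using pos_functionalD(3)[OF pos_functional_jump_integral[OF h], of "\<lambda>_. 1" c] by simp
qed

lemma prob_space_next_kernel: assumes h: "h \<in> space (HM n)" shows "prob_space (next_kernel n h)"
proof (rule prob_spaceI)
  have "emeasure (next_kernel n h) (space (next_kernel n h)) = (\<integral>\<^sup>+z. 1 \<partial>next_kernel n h)" by simp
  also have "\<dots> = jump_mass n h + (1 - jump_mass n h)"
    by (subst nn_integral_next_kernel[OF h]) (simp_all add: jump_integral_const[OF h])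
  finally show "emeasure (next_kernel n h) (space (next_kernel n h)) = 1"
    using jump_mass_le_1[OF h] by (simp add: add_diff_inverse_ennreal)
qed

lemma measurable_next_kernel[measurable]: "next_kernel n \<in> measurable (HM n) (subprob_algebra PM)"
proof (rule measurable_subprob_algebra)
  fix E assume E[measurable]: "E \<in> sets PM"
  have "(\<lambda>z. indicator E (jump_point (snd z)) :: ennreal) \<in> borel_measurable (HM n \<Otimes>\<^sub>M (posR \<Otimes>\<^sub>M SM S))"
    by measurable
  from measurable_jump_integral[OF this]
  have [measurable]: "(\<lambda>h. jump_integral n h (\<lambda>w. indicator E (jump_point w))) \<in> borel_measurable (HM n)"
    by simp
  have "(\<lambda>h. jump_integral n h (\<lambda>w. indicator E (jump_point w)) + (1 - jump_mass n h) * indicator E (None, \<top>)) \<in> borel_measurable (HM n)"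
    by measurable
  then show "(\<lambda>h. emeasure (next_kernel n h) E) \<in> borel_measurable (HM n)"
    by (rule measurable_cong[THEN iffD1, rotated])
      (simp add: next_kernel_def emeasure_functional_measure[OF pos_functional_next])
qed (auto intro: prob_space_next_kernel prob_space_imp_subprob_space)

lemma measurable_next_kernel_integral:
  "F \<in> borel_measurable (HM n \<Otimes>\<^sub>M PM) \<Longrightarrow> (\<lambda>h. \<integral>\<^sup>+z. F (h, z) \<partial>next_kernel n h) \<in> borel_measurable (HM n)"
  by (rule measurable_kernel_integral[OF measurable_next_kernel])

lemma AE_next_kernel: assumes h: "h \<in> space (HM n)"
  shows "AE z in next_kernel n h. is_jump z \<or> z = (None, \<top>)"
proof -
  let ?E = "{z. \<not> (is_jump z \<or> z = (None, \<top>))}"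
  have "Measurable.pred PM (\<lambda>z. \<not> (is_jump z \<or> z \<in> {(None, \<top>)}))" by measurable
  then have E: "?E \<in> sets PM" by (simp add: pred_def)
  have "jump_integral n h (\<lambda>w. indicator ?E (jump_point w)) = jump_integral n h (\<lambda>w. 0)"
    by (rule pos_functionalD(1)[OF pos_functional_jump_integral[OF h]]) (simp add: is_jump_jump_point)
  then have "emeasure (next_kernel n h) ?E = 0"
    using nn_integral_next_kernel[OF h borel_measurable_indicator[OF E]] E
    by (simp add: jump_integral_const[OF h])
  then show ?thesis using E by (intro AE_I[of _ _ ?E]) auto
qed

lemma next_kernel_survival:
  assumes h: "h \<in> space (HM n)" and t: "0 < t"
  shows "(\<integral>\<^sup>+z. indicator {ennreal t..} (snd z) \<partial>next_kernel n h) = survival n (h, t)"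
proof -
  have "(\<integral>\<^sup>+z. indicator {ennreal t..} (snd z) \<partial>next_kernel n h)
    = jump_integral n h (\<lambda>w. indicator {ennreal t..} (snd (jump_point w))) + (1 - jump_mass n h)"
    by (subst nn_integral_next_kernel[OF h]) auto
  also have "jump_integral n h (\<lambda>w. indicator {ennreal t..} (snd (jump_point w)))
      = jump_integral n h (\<lambda>w. indicator {t..} (fst w))"
    by (rule pos_functionalD(1)[OF pos_functional_jump_integral[OF h]])
      (auto simp: jump_point_def space_pair_measure ennreal_le_iff split: split_indicator)
  finally show ?thesis by (simp add: jump_integral_time[OF h] survival_eq_jump_after[OF h t])
qed

lemma next_kernel_jump:
  assumes h: "h \<in> space (HM n)" and B: "B \<in> sets posR" and \<Gamma>: "\<Gamma> \<in> sets (SM S)"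
  shows "(\<integral>\<^sup>+z. indicator (ennreal ` B) (snd z) * indicator (Some ` \<Gamma>) (fst z) \<partial>next_kernel n h)
    = (\<integral>\<^sup>+z. indicator (ennreal ` B) (snd z) * ennreal (jump_ratio q (snd h) (pol n (h, sojourn_of (snd z))) \<Gamma>) \<partial>next_kernel n h)"
proof -
  let ?r = "\<lambda>s. ennreal (jump_ratio q (snd h) (pol n (h, s)) \<Gamma>)"
  have [measurable]: "ennreal ` B \<in> sets borel" "Some ` \<Gamma> \<in> sets (optM (SM S))"
    by (rule sets_ennreal_image[OF B], rule Some_image_sets_optM[OF \<Gamma>])
  have "?r \<in> borel_measurable posR" using measurable_HP_section[OF h measurable_jump_ratio[OF \<Gamma>]] by simp
  from measurable_compose[OF _ this]
  have [measurable]: "(\<lambda>z. ?r (sojourn_of (snd z))) \<in> borel_measurable PM" by measurable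
  have time: "ennreal s \<in> ennreal ` B \<longleftrightarrow> s \<in> B" if "0 < s" for s
    using ennreal_image_iff[of B "ennreal s"] that B by (simp add: sets_posR_iff)
  have state: "Some y \<in> Some ` \<Gamma> \<longleftrightarrow> y \<in> \<Gamma>" for y by auto
  have top: "\<top> \<notin> ennreal ` B" by auto
  have "(\<integral>\<^sup>+z. indicator (ennreal ` B) (snd z) * indicator (Some ` \<Gamma>) (fst z) \<partial>next_kernel n h)
    = jump_integral n h (\<lambda>w. indicator (ennreal ` B) (snd (jump_point w)) * indicator (Some ` \<Gamma>) (fst (jump_point w)))"
    by (subst nn_integral_next_kernel[OF h]) (auto simp: top)
  also have "\<dots> = jump_integral n h (indicator (B \<times> \<Gamma>))"
    by (rule pos_functionalD(1)[OF pos_functional_jump_integral[OF h]])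
      (simp add: jump_point_def space_pair_measure mem_Times_iff time state indicator_def)
  also have "\<dots> = jump_integral n h (\<lambda>w. indicator B (fst w) * ?r (fst w))"
    by (rule jump_integral_rectangle[OF h \<Gamma>])
  also have "\<dots> = jump_integral n h (\<lambda>w. indicator (ennreal ` B) (snd (jump_point w)) * ?r (sojourn_of (snd (jump_point w))))"
    by (rule pos_functionalD(1)[OF pos_functional_jump_integral[OF h]])
      (simp add: jump_point_def space_pair_measure mem_Times_iff time state indicator_def)
  also have "\<dots> = (\<integral>\<^sup>+z. indicator (ennreal ` B) (snd z) * ?r (sojourn_of (snd z)) \<partial>next_kernel n h)"
    by (subst nn_integral_next_kernel[OF h]) (auto simp: top)
  finally show ?thesis .
qed

definition transition :: "nat \<Rightarrow> 's path \<Rightarrow> ('s option \<times> ennreal) measure" where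
  "transition m \<omega> = (case m of 0 \<Rightarrow> distr \<gamma> PM (\<lambda>x. (Some x, 0))
    | Suc n \<Rightarrow> if regular n \<omega> then next_kernel n (history n \<omega>) else return PM (None, \<top>))"

lemma measurable_initial_point: "(\<lambda>x. (Some x, 0)) \<in> measurable \<gamma> PM"
  unfolding measurable_cong_sets[OF gamma(2) refl] by measurable

lemma prob_space_transition: assumes "\<omega> \<in> space (PiM {0..<m} (\<lambda>_. PM))"
  shows "prob_space (transition m \<omega>)"
proof (cases m)
  case 0
  then show ?thesis
    using prob_space.prob_space_distr[OF gamma(1) measurable_initial_point] by (simp add: transition_def)
next
  case (Suc n)
  then have "history n \<omega> \<in> space (HM n)"
    using assms by (intro measurable_space[OF measurable_history[of n "{0..<m}"]]) auto
  then show ?thesis using Suc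
    by (auto simp: transition_def intro!: prob_space_next_kernel prob_space_return)
qed

lemma measurable_transition: "transition m \<in> measurable (PiM {0..<m} (\<lambda>_. PM)) (subprob_algebra PM)"
proof (cases m)
  case 0
  have "prob_space (distr \<gamma> PM (\<lambda>x. (Some x, 0)))"
    by (rule prob_space.prob_space_distr[OF gamma(1) measurable_initial_point])
  then show ?thesis unfolding transition_def 0
    by (auto simp: space_subprob_algebra prob_space_imp_subprob_space intro!: measurable_const)
next
  case (Suc n)
  have sub: "{..n} \<subseteq> {0..<Suc n}" by auto
  show ?thesis unfolding transition_def Suc nat.case
    using measurable_regular[OF sub] measurable_compose[OF measurable_history[OF sub] measurable_next_kernel]
    by (intro measurable_If) (auto simp: space_subprob_algebra pred_def intro!: measurable_const prob_space_imp_subprob_space prob_space_return)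
qed

definition transition_law :: "'s path measure \<Rightarrow> bool" where
  "transition_law P \<longleftrightarrow> (\<forall>m. \<forall>f\<in>borel_measurable (PiM {0..<Suc m} (\<lambda>_. PM)).
    (\<integral>\<^sup>+\<omega>. f (restrict \<omega> {0..<Suc m}) \<partial>P)
      = (\<integral>\<^sup>+\<omega>. (\<integral>\<^sup>+z. f ((restrict \<omega> {0..<m})(m := z)) \<partial>transition m (restrict \<omega> {0..<m})) \<partial>P))"

sublocale IT: Ionescu_Tulcea transition "\<lambda>_. PM"
  by (rule Ionescu_Tulcea.intro[OF measurable_transition prob_space_transition])

lemma measurable_transition_integral:
  assumes f: "f \<in> borel_measurable (PiM {0..<Suc m} (\<lambda>_. PM))"
  shows "(\<lambda>x. \<integral>\<^sup>+z. f (x(m := z)) \<partial>transition m x) \<in> borel_measurable (PiM {0..<m} (\<lambda>_. PM))"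
proof -
  have "(\<lambda>x. \<integral>\<^sup>+y. f y \<partial>IT.eP m x) \<in> borel_measurable (PiM {0..<m} (\<lambda>_. PM))"
    by (rule measurable_compose[OF IT.measurable_eP nn_integral_measurable_subprob_algebra[OF f]])
  then show ?thesis by (rule measurable_cong[THEN iffD1, rotated]) (rule IT.nn_integral_eP[OF _ f])
qed

definition path_law :: "'s path measure" where "path_law = IT.PF.lim"

lemma sets_path_law: "sets path_law = sets (OmegaM S)"
  by (simp add: path_law_def OmegaM_def)

lemma nn_integral_path_law:
  assumes f: "f \<in> borel_measurable (PiM {0..<n} (\<lambda>_. PM))"
  shows "(\<integral>\<^sup>+\<omega>. f (restrict \<omega> {0..<n}) \<partial>path_law) = (\<integral>\<^sup>+x. f x \<partial>IT.C 0 n (\<lambda>_. undefined))"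
proof -
  have up_to: "IT.up_to {0..<n} = n"
  proof (rule antisym)
    have "{0..<n} \<subseteq> {0..<IT.up_to {0..<n}}" by (rule IT.up_to) simp
    then show "n \<le> IT.up_to {0..<n}" by auto
  qed (simp add: IT.up_to_iff_Ico)
  have "distr path_law (PiM {0..<n} (\<lambda>_. PM)) (\<lambda>\<omega>. restrict \<omega> {0..<n}) = IT.CI {0..<n}"
    unfolding path_law_def by (rule IT.distr_lim) simp
  also have "\<dots> = IT.C 0 n (\<lambda>_. undefined)"
    unfolding IT.CI_def up_to using IT.distr_C[of n n "\<lambda>_. undefined" 0] by simp
  finally have "IT.C 0 n (\<lambda>_. undefined) = distr path_law (PiM {0..<n} (\<lambda>_. PM)) (\<lambda>\<omega>. restrict \<omega> {0..<n})" ..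
  moreover have "(\<lambda>\<omega>. restrict \<omega> {0..<n}) \<in> measurable path_law (PiM {0..<n} (\<lambda>_. PM))"
    unfolding measurable_cong_sets[OF sets_path_law refl] OmegaM_def
    by (rule measurable_restrict_subset) simp
  ultimately show ?thesis using f by (simp add: nn_integral_distr)
qed

lemma prob_space_path_law: "prob_space path_law"
proof (rule prob_spaceI)
  have "emeasure path_law (space path_law) = (\<integral>\<^sup>+x. 1 \<partial>IT.C 0 0 (\<lambda>_. undefined))"
    using nn_integral_path_law[of "\<lambda>_. 1" 0] by simp
  also have "\<dots> = 1"
    using prob_space.emeasure_space_1[OF IT.prob_space_C[of "\<lambda>_. undefined" 0 0]]
    by (simp add: space_PiM)
  finally show "emeasure path_law (space path_law) = 1" .
qed

lemma transition_law_path_law: "transition_law path_law"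
  unfolding transition_law_def
proof (intro allI ballI)
  fix m and f :: "'s path \<Rightarrow> ennreal" assume f: "f \<in> borel_measurable (PiM {0..<Suc m} (\<lambda>_. PM))"
  let ?start = "\<lambda>_::nat. undefined :: 's option \<times> ennreal"
  have start: "?start \<in> space (PiM {0..<0} (\<lambda>_. PM))" by (simp add: space_PiM)
  have space_C: "space (IT.C 0 m ?start) = space (PiM {0..<m} (\<lambda>_. PM))" using IT.space_C[OF start, of m]
    by simp
  have eP: "IT.eP m \<in> measurable (IT.C 0 m ?start) (subprob_algebra (PiM {0..<Suc m} (\<lambda>_. PM)))"
    using IT.measurable_eP[of m] IT.sets_C[OF start, of m] by (simp cong: measurable_cong_sets)
  have "(\<integral>\<^sup>+\<omega>. f (restrict \<omega> {0..<Suc m}) \<partial>path_law) = (\<integral>\<^sup>+x. f x \<partial>(IT.C 0 m ?start \<bind> IT.eP m))"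
    unfolding nn_integral_path_law[OF f] by simp
  also have "\<dots> = (\<integral>\<^sup>+x. (\<integral>\<^sup>+y. f y \<partial>IT.eP m x) \<partial>IT.C 0 m ?start)" by (rule nn_integral_bind[OF f eP])
  also have "\<dots> = (\<integral>\<^sup>+x. (\<integral>\<^sup>+z. f (x(m := z)) \<partial>transition m x) \<partial>IT.C 0 m ?start)"
    by (intro nn_integral_cong IT.nn_integral_eP f) (simp add: space_C)
  also have "\<dots> = (\<integral>\<^sup>+\<omega>. (\<integral>\<^sup>+z. f ((restrict \<omega> {0..<m})(m := z)) \<partial>transition m (restrict \<omega> {0..<m})) \<partial>path_law)"
    by (rule nn_integral_path_law[OF measurable_transition_integral[OF f], symmetric])
  finally show "(\<integral>\<^sup>+\<omega>. f (restrict \<omega> {0..<Suc m}) \<partial>path_law)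
      = (\<integral>\<^sup>+\<omega>. (\<integral>\<^sup>+z. f ((restrict \<omega> {0..<m})(m := z)) \<partial>transition m (restrict \<omega> {0..<m})) \<partial>path_law)" .
qed

end

locale path_measure = ctmdp_policy S A \<gamma> q pol for S :: "'s::polish_space set" and A :: "'b::polish_space set" and \<gamma> q pol +
  fixes P :: "'s path measure"
  assumes sets_P: "sets P = sets (OmegaM S)" and prob_space_P: "prob_space P"
begin

lemma sets_P_PiM[measurable_cong]: "sets P = sets (PiM UNIV (\<lambda>_. PM))"
  by (simp add: sets_P OmegaM_def)

lemma space_P: "space P = UNIV"
  using sets_eq_imp_space_eq[OF sets_P_PiM] by (simp add: space_PiM)

lemma measurable_coordinate[measurable]: "(\<lambda>\<omega>. \<omega> k) \<in> measurable P PM"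
  by measurable

lemma measurable_regular_P[measurable]: "Measurable.pred P (regular n)"
  using measurable_regular[of n UNIV] by measurable

lemma measurable_history_P[measurable]: "history n \<in> measurable P (HM n)"
  using measurable_history[of n UNIV] by measurable

lemma history_space: "history n \<omega> \<in> space (HM n)"
  using measurable_space[OF measurable_history_P, of \<omega>] by (simp add: space_P)

lemma measurable_indicator_regular[measurable]: "(indicator {\<omega>. regular n \<omega>} :: _ \<Rightarrow> ennreal) \<in> borel_measurable P"
  by (intro borel_measurable_indicator') measurable

lemma measurable_prefix: "(\<lambda>\<omega>. restrict \<omega> {0..<n}) \<in> measurable P (PiM {0..<n} (\<lambda>_. PM))"
  unfolding measurable_cong_sets[OF sets_P_PiM refl] by (rule measurable_restrict_subset) simp

definition hist_law :: "nat \<Rightarrow> ((nat \<Rightarrow> 's \<times> real) \<times> 's) measure" where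
  "hist_law n = distr (density P (indicator {\<omega>. regular n \<omega>})) (HM n) (history n)"

lemma sets_hist_law[simp, measurable_cong]: "sets (hist_law n) = sets (HM n)"
  and space_hist_law[simp]: "space (hist_law n) = space (HM n)"
  by (simp_all add: hist_law_def)

lemma nn_integral_hist_law:
  assumes [measurable]: "f \<in> borel_measurable (HM n)"
  shows "(\<integral>\<^sup>+h. f h \<partial>hist_law n) = (\<integral>\<^sup>+\<omega>\<in>{\<omega>. regular n \<omega>}. f (history n \<omega>) \<partial>P)"
  by (simp add: hist_law_def nn_integral_distr nn_integral_density mult.commute)

lemma emeasure_survival_event:
  assumes [measurable]: "H \<in> sets (HM n)"
  shows "emeasure P {\<omega>\<in>space P. alive n \<omega> \<and> hist n \<omega> \<in> H \<and> ennreal t \<le> th \<omega> (Suc n)}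
    = (\<integral>\<^sup>+\<omega>\<in>{\<omega>. regular n \<omega>}. indicator H (history n \<omega>) * indicator {ennreal t..} (snd (\<omega> (Suc n))) \<partial>P)"
proof -
  let ?E = "{\<omega>\<in>space P. regular n \<omega> \<and> history n \<omega> \<in> H \<and> ennreal t \<le> snd (\<omega> (Suc n))}"
  have "{\<omega>\<in>space P. alive n \<omega> \<and> hist n \<omega> \<in> H \<and> ennreal t \<le> th \<omega> (Suc n)} = ?E"
    using alive_hist_iff[OF assms] by (auto simp: th_def)
  moreover have "emeasure P ?E = (\<integral>\<^sup>+\<omega>. indicator ?E \<omega> \<partial>P)"
    by (intro nn_integral_indicator[symmetric]) measurable
  moreover have "\<dots> = (\<integral>\<^sup>+\<omega>\<in>{\<omega>. regular n \<omega>}. indicator H (history n \<omega>) * indicator {ennreal t..} (snd (\<omega> (Suc n))) \<partial>P)"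
    by (intro nn_integral_cong) (auto split: split_indicator)
  ultimately show ?thesis by simp
qed

lemma survival_event_integral:
  assumes H[measurable]: "H \<in> sets (HM n)" and t: "0 < t"
  shows "(\<integral>\<^sup>+\<omega>\<in>{\<omega>\<in>space P. alive n \<omega> \<and> hist n \<omega> \<in> H}.
      ennreal (exp (- (LINT s:{0<..t}|lborel. (\<integral>a. qx q (snd (hist n \<omega>)) a \<partial>pol n (hist n \<omega>, s))))) \<partial>P)
    = (\<integral>\<^sup>+h. indicator H h * survival n (h, t) \<partial>hist_law n)"
proof -
  have [measurable]: "(\<lambda>h. survival n (h, t)) \<in> borel_measurable (HM n)"
    using t by (intro measurable_compose[OF measurable_Pair2' measurable_survival]) simp
  have "(LINT s:{0<..t}|lborel. (\<integral>a. qx q (snd h) a \<partial>pol n (h, s)))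
      = (LINT s:{0<..t}|lborel. hazard n h s)" for h
    unfolding set_lebesgue_integral_def
    by (intro Bochner_Integration.integral_cong) (auto simp: hazard_def split: split_indicator)
  then have "(\<integral>\<^sup>+\<omega>\<in>{\<omega>\<in>space P. alive n \<omega> \<and> hist n \<omega> \<in> H}.
      ennreal (exp (- (LINT s:{0<..t}|lborel. (\<integral>a. qx q (snd (hist n \<omega>)) a \<partial>pol n (hist n \<omega>, s))))) \<partial>P)
    = (\<integral>\<^sup>+\<omega>\<in>{\<omega>. regular n \<omega>}. indicator H (history n \<omega>) * survival n (history n \<omega>, t) \<partial>P)"
    using alive_hist_iff[OF H] regular_hist[of n]
    by (intro nn_integral_cong) (auto simp: survival_def split: split_indicator)
  then show ?thesis by (simp add: nn_integral_hist_law)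
qed

lemma emeasure_jump_event:
  assumes H[measurable]: "H \<in> sets (HM n)" and B: "B \<in> sets posR" and \<Gamma>: "\<Gamma> \<in> sets (SM S)"
  shows "emeasure P {\<omega>\<in>space P. alive n \<omega> \<and> hist n \<omega> \<in> H \<and> th \<omega> (Suc n) \<in> ennreal ` B \<and> xs \<omega> (Suc n) \<in> Some ` \<Gamma>}
    = (\<integral>\<^sup>+\<omega>\<in>{\<omega>. regular n \<omega>}. indicator H (history n \<omega>)
        * (indicator (ennreal ` B) (snd (\<omega> (Suc n))) * indicator (Some ` \<Gamma>) (fst (\<omega> (Suc n)))) \<partial>P)"
proof -
  have [measurable]: "ennreal ` B \<in> sets borel" "Some ` \<Gamma> \<in> sets (optM (SM S))"
    by (rule sets_ennreal_image[OF B], rule Some_image_sets_optM[OF \<Gamma>])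
  let ?E = "{\<omega>\<in>space P. regular n \<omega> \<and> history n \<omega> \<in> H \<and> snd (\<omega> (Suc n)) \<in> ennreal ` B \<and> fst (\<omega> (Suc n)) \<in> Some ` \<Gamma>}"
  have "{\<omega>\<in>space P. alive n \<omega> \<and> hist n \<omega> \<in> H \<and> th \<omega> (Suc n) \<in> ennreal ` B \<and> xs \<omega> (Suc n) \<in> Some ` \<Gamma>} = ?E"
    using alive_hist_iff[OF H] by (auto simp: th_def xs_def)
  moreover have "emeasure P ?E = (\<integral>\<^sup>+\<omega>. indicator ?E \<omega> \<partial>P)"
    by (intro nn_integral_indicator[symmetric]) measurable
  moreover have "\<dots> = (\<integral>\<^sup>+\<omega>\<in>{\<omega>. regular n \<omega>}. indicator H (history n \<omega>)
        * (indicator (ennreal ` B) (snd (\<omega> (Suc n))) * indicator (Some ` \<Gamma>) (fst (\<omega> (Suc n)))) \<partial>P)"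
    by (intro nn_integral_cong) (auto simp: space_P split: split_indicator)
  ultimately show ?thesis by simp
qed

lemma jump_event_integral:
  assumes H: "H \<in> sets (HM n)" and B: "B \<in> sets posR"
  shows "(\<integral>\<^sup>+\<omega>\<in>{\<omega>\<in>space P. alive n \<omega> \<and> hist n \<omega> \<in> H \<and> th \<omega> (Suc n) \<in> ennreal ` B}.
      ennreal (jump_ratio q (snd (hist n \<omega>)) (pol n (hist n \<omega>, enn2real (th \<omega> (Suc n)))) \<Gamma>) \<partial>P)
    = (\<integral>\<^sup>+\<omega>\<in>{\<omega>. regular n \<omega>}. indicator H (history n \<omega>) * (indicator (ennreal ` B) (snd (\<omega> (Suc n)))
        * ennreal (jump_ratio q (snd (history n \<omega>)) (pol n (history n \<omega>, sojourn_of (snd (\<omega> (Suc n))))) \<Gamma>)) \<partial>P)"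
proof (intro nn_integral_cong)
  fix \<omega> :: "'s path"
  have "0 < snd (\<omega> (Suc n)) \<and> snd (\<omega> (Suc n)) < \<top>" if "snd (\<omega> (Suc n)) \<in> ennreal ` B"
    using ennreal_image_iff[of B "snd (\<omega> (Suc n))"] B that by (simp add: sets_posR_iff)
  then show "ennreal (jump_ratio q (snd (hist n \<omega>)) (pol n (hist n \<omega>, enn2real (th \<omega> (Suc n)))) \<Gamma>)
      * indicator {\<omega>\<in>space P. alive n \<omega> \<and> hist n \<omega> \<in> H \<and> th \<omega> (Suc n) \<in> ennreal ` B} \<omega>
    = indicator H (history n \<omega>) * (indicator (ennreal ` B) (snd (\<omega> (Suc n)))
        * ennreal (jump_ratio q (snd (history n \<omega>)) (pol n (history n \<omega>, sojourn_of (snd (\<omega> (Suc n))))) \<Gamma>)) * indicator {\<omega>. regular n \<omega>} \<omega>"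
    using alive_hist_iff[OF H, of \<omega>] regular_hist[of n \<omega>]
    by (cases "regular n \<omega> \<and> history n \<omega> \<in> H \<and> snd (\<omega> (Suc n)) \<in> ennreal ` B")
      (auto simp: space_P th_def sojourn_of_def split: split_indicator)
qed

lemma transition_law_AE:
  assumes law: "transition_law P" and R: "Measurable.pred (PiM {0..<Suc m} (\<lambda>_. PM)) R"
    and step: "\<And>\<omega>. AE z in transition m (restrict \<omega> {0..<m}). R ((restrict \<omega> {0..<m})(m := z))"
  shows "AE \<omega> in P. R (restrict \<omega> {0..<Suc m})"
proof -
  have [measurable]: "(indicator {x. \<not> R x} :: _ \<Rightarrow> ennreal) \<in> borel_measurable (PiM {0..<Suc m} (\<lambda>_. PM))"
    using R by (intro borel_measurable_indicator') measurable
  have pred: "Measurable.pred P (\<lambda>\<omega>. R (restrict \<omega> {0..<Suc m}))"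
    by (rule measurable_compose[OF measurable_prefix R])
  have zero: "(\<integral>\<^sup>+z. indicator {x. \<not> R x} ((restrict \<omega> {0..<m})(m := z)) \<partial>transition m (restrict \<omega> {0..<m})) = 0" for \<omega>
  proof -
    have "(\<integral>\<^sup>+z. indicator {x. \<not> R x} ((restrict \<omega> {0..<m})(m := z)) \<partial>transition m (restrict \<omega> {0..<m}))
      = (\<integral>\<^sup>+z. 0 \<partial>transition m (restrict \<omega> {0..<m}))"
      using step[of \<omega>] by (intro nn_integral_cong_AE) (auto elim!: eventually_mono)
    then show ?thesis by simp
  qed
  have "(\<integral>\<^sup>+\<omega>. indicator {x. \<not> R x} (restrict \<omega> {0..<Suc m}) \<partial>P) = (\<integral>\<^sup>+\<omega>. 0 \<partial>P)"
    using law by (simp add: transition_law_def zero del: restrict_upd)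
  then have "AE \<omega> in P. indicator {x. \<not> R x} (restrict \<omega> {0..<Suc m}) = (0 :: ennreal)"
    by (simp add: nn_integral_0_iff_AE measurable_compose[OF measurable_prefix])
  then show ?thesis by eventually_elim (simp add: indicator_def split: if_splits)
qed

lemma hist_law_mass_le_1: "emeasure (hist_law n) (space (HM n)) \<le> 1"
proof -
  interpret prob_space P by (rule prob_space_P)
  have "emeasure (hist_law n) (space (hist_law n)) = (\<integral>\<^sup>+h. 1 \<partial>hist_law n)" by simp
  also have "\<dots> = (\<integral>\<^sup>+\<omega>\<in>{\<omega>. regular n \<omega>}. 1 \<partial>P)" by (rule nn_integral_hist_law) simp
  also have "\<dots> \<le> (\<integral>\<^sup>+\<omega>. 1 \<partial>P)" by (intro nn_integral_mono) (auto split: split_indicator)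
  finally show ?thesis by (simp add: emeasure_space_1)
qed

lemma nn_integral_split_regular:
  assumes [measurable]: "g \<in> borel_measurable P"
  shows "(\<integral>\<^sup>+\<omega>. g \<omega> \<partial>P) = (\<integral>\<^sup>+\<omega>\<in>{\<omega>. regular n \<omega>}. g \<omega> \<partial>P) + (\<integral>\<^sup>+\<omega>\<in>{\<omega>. \<not> regular n \<omega>}. g \<omega> \<partial>P)"
proof -
  have [measurable]: "(indicator {\<omega>. \<not> regular n \<omega>} :: _ \<Rightarrow> ennreal) \<in> borel_measurable P"
    by (intro borel_measurable_indicator') measurable
  show ?thesis
    by (subst nn_integral_add[symmetric]) (auto intro!: nn_integral_cong split: split_indicator)
qed

end

locale markov_path_measure = path_measure S A \<gamma> q pol P
  for S :: "'s::polish_space set" and A :: "'b::polish_space set" and \<gamma> q pol P +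
  assumes transition_law: "transition_law P"
begin

lemma nn_integral_initial:
  assumes [measurable]: "g \<in> borel_measurable PM"
  shows "(\<integral>\<^sup>+\<omega>. g (\<omega> 0) \<partial>P) = (\<integral>\<^sup>+x. g (Some x, 0) \<partial>\<gamma>)"
proof -
  interpret prob_space P by (rule prob_space_P)
  have "(\<lambda>x. g (x 0)) \<in> borel_measurable (PiM {0..<Suc 0} (\<lambda>_. PM))" by measurable
  from transition_law[unfolded transition_law_def, rule_format, OF this]
  show ?thesis
    using measurable_initial_point by (simp add: transition_def nn_integral_distr emeasure_space_1)
qed

lemma nn_integral_next:
  assumes F[measurable]: "F \<in> borel_measurable (HM n \<Otimes>\<^sub>M PM)"
  shows "(\<integral>\<^sup>+\<omega>\<in>{\<omega>. regular n \<omega>}. F (history n \<omega>, \<omega> (Suc n)) \<partial>P)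
      = (\<integral>\<^sup>+h. (\<integral>\<^sup>+z. F (h, z) \<partial>next_kernel n h) \<partial>hist_law n)"
proof -
  let ?I = "{0..<Suc (Suc n)}" and ?prev = "\<lambda>\<omega>. restrict \<omega> {0..<Suc n}"
  define f where "f x = F (history n x, x (Suc n)) * indicator {\<omega>. regular n \<omega>} x" for x
  have sub: "{..n} \<subseteq> ?I" by auto
  note [measurable] = measurable_regular[OF sub] measurable_history[OF sub]
  have [measurable]: "(indicator {\<omega>. regular n \<omega>} :: _ \<Rightarrow> ennreal) \<in> borel_measurable (PiM ?I (\<lambda>_. PM))"
    by (intro borel_measurable_indicator') measurable
  have "f \<in> borel_measurable (PiM ?I (\<lambda>_. PM))" unfolding f_def by measurable
  note step = transition_law[unfolded transition_law_def, rule_format, OF this]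
  have prefix: "regular n (restrict \<omega> ?I) \<longleftrightarrow> regular n \<omega>" "history n (restrict \<omega> ?I) = history n \<omega>"
    "regular n (?prev \<omega>) \<longleftrightarrow> regular n \<omega>" "history n (?prev \<omega>) = history n \<omega>"
    "regular n ((?prev \<omega>)(Suc n := z)) \<longleftrightarrow> regular n \<omega>" "history n ((?prev \<omega>)(Suc n := z)) = history n \<omega>" for \<omega> z
    by (rule regular_history_cong; simp)+
  have "(\<integral>\<^sup>+\<omega>\<in>{\<omega>. regular n \<omega>}. F (history n \<omega>, \<omega> (Suc n)) \<partial>P) = (\<integral>\<^sup>+\<omega>. f (restrict \<omega> ?I) \<partial>P)"
    by (intro nn_integral_cong) (simp add: f_def prefix indicator_def)
  also have "\<dots> = (\<integral>\<^sup>+\<omega>. (\<integral>\<^sup>+z. f ((?prev \<omega>)(Suc n := z)) \<partial>transition (Suc n) (?prev \<omega>)) \<partial>P)"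
    by (rule step)
  also have "\<dots> = (\<integral>\<^sup>+\<omega>\<in>{\<omega>. regular n \<omega>}. (\<integral>\<^sup>+z. F (history n \<omega>, z) \<partial>next_kernel n (history n \<omega>)) \<partial>P)"
    by (intro nn_integral_cong) (simp add: f_def prefix transition_def indicator_def del: restrict_upd)
  also have "\<dots> = (\<integral>\<^sup>+h. (\<integral>\<^sup>+z. F (h, z) \<partial>next_kernel n h) \<partial>hist_law n)"
    by (rule nn_integral_hist_law[symmetric]) (rule measurable_next_kernel_integral[OF F])
  finally show ?thesis .
qed

lemma AE_Omega: "AE \<omega> in P. \<omega> \<in> Omega S"
proof -
  have "AE \<omega> in P. fst (restrict \<omega> {0..<Suc 0} 0) \<in> Some ` S \<and> snd (restrict \<omega> {0..<Suc 0} 0) = 0"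
  proof (rule transition_law_AE[OF transition_law])
    show "AE z in transition 0 (restrict \<omega> {0..<0}). fst (((restrict \<omega> {0..<0})(0 := z)) 0) \<in> Some ` S \<and> snd (((restrict \<omega> {0..<0})(0 := z)) 0) = 0" for \<omega>
      unfolding transition_def nat.case using sets_eq_imp_space_eq[OF gamma(2)]
      by (subst AE_distr_iff[OF measurable_initial_point]) (measurable, auto intro!: AE_I2)
  qed measurable
  then have start: "AE \<omega> in P. fst (\<omega> 0) \<in> Some ` S \<and> snd (\<omega> 0) = 0" by simp
  have step: "AE \<omega> in P. regular (Suc n) \<omega> \<or> \<omega> (Suc n) = (None, \<top>)" for n
  proof -
    let ?I = "{0..<Suc (Suc n)}"
    have cong: "regular (Suc n) (restrict \<omega> ?I) \<longleftrightarrow> regular (Suc n) \<omega>" for \<omega>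
      by (rule regular_history_cong) simp
    have "AE \<omega> in P. regular (Suc n) (restrict \<omega> ?I) \<or> restrict \<omega> ?I (Suc n) \<in> {(None, \<top>)}"
    proof (rule transition_law_AE[OF transition_law])
      have [measurable]: "Measurable.pred (PiM ?I (\<lambda>_. PM)) (regular (Suc n))"
        by (rule measurable_regular) auto
      show "Measurable.pred (PiM ?I (\<lambda>_. PM)) (\<lambda>x. regular (Suc n) x \<or> x (Suc n) \<in> {(None, \<top>)})"
        by measurable
      fix \<omega> :: "'s path"
      let ?prev = "restrict \<omega> {0..<Suc n}"
      have "regular n (?prev(Suc n := z)) \<longleftrightarrow> regular n ?prev" for z by (rule regular_history_cong) simp
      moreover have "AE z in transition (Suc n) ?prev. regular n ?prev \<and> is_jump z \<or> z = (None, \<top>)"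
        unfolding transition_def nat.case
      proof (cases "regular n ?prev")
        case False
        have "Measurable.pred PM (\<lambda>z. z \<in> {(None, \<top>)})" by measurable
        then show "AE z in (if regular n ?prev then next_kernel n (history n ?prev) else return PM (None, \<top>)).
            regular n ?prev \<and> is_jump z \<or> z = (None, \<top>)"
          using False by (simp add: AE_return)
      qed (simp add: AE_next_kernel[OF history_space])
      ultimately show "AE z in transition (Suc n) ?prev. regular (Suc n) (?prev(Suc n := z)) \<or> (?prev(Suc n := z)) (Suc n) \<in> {(None, \<top>)}"
        by (simp add: regular_Suc)
    qed
    then show ?thesis by (simp add: cong)
  qed
  have "AE \<omega> in P. \<forall>n. regular (Suc n) \<omega> \<or> \<omega> (Suc n) = (None, \<top>)"
    using step by (simp add: AE_all_countable)
  with start show ?thesis by eventually_elim (simp add: Omega_iff)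
qed

lemma nn_integral_survival:
  assumes f[measurable]: "f \<in> borel_measurable (HM n)" and t: "0 < t"
  shows "(\<integral>\<^sup>+\<omega>\<in>{\<omega>. regular n \<omega>}. f (history n \<omega>) * indicator {ennreal t..} (snd (\<omega> (Suc n))) \<partial>P)
    = (\<integral>\<^sup>+h. f h * survival n (h, t) \<partial>hist_law n)"
proof -
  have "(\<lambda>z. f (fst z) * indicator {ennreal t..} (snd (snd z))) \<in> borel_measurable (HM n \<Otimes>\<^sub>M PM)"
    by measurable
  from nn_integral_next[OF this]
  have "(\<integral>\<^sup>+\<omega>\<in>{\<omega>. regular n \<omega>}. f (history n \<omega>) * indicator {ennreal t..} (snd (\<omega> (Suc n))) \<partial>P)
    = (\<integral>\<^sup>+h. (\<integral>\<^sup>+z. f h * indicator {ennreal t..} (snd z) \<partial>next_kernel n h) \<partial>hist_law n)" by simp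
  also have "\<dots> = (\<integral>\<^sup>+h. f h * survival n (h, t) \<partial>hist_law n)"
  proof (intro nn_integral_cong)
    fix h assume h: "h \<in> space (hist_law n)"
    have "(\<lambda>z. indicator {ennreal t..} (snd z) :: ennreal) \<in> borel_measurable (next_kernel n h)"
      unfolding measurable_cong_sets[OF sets_next_kernel refl]
      by (rule measurable_compose[OF measurable_snd]) simp
    then show "(\<integral>\<^sup>+z. f h * indicator {ennreal t..} (snd z) \<partial>next_kernel n h) = f h * survival n (h, t)"
      using h by (simp add: nn_integral_cmult next_kernel_survival t)
  qed
  finally show ?thesis .
qed

lemma emeasure_initial_event:
  assumes \<Gamma>: "\<Gamma> \<in> sets (SM S)" shows "emeasure P {\<omega>\<in>space P. xs \<omega> 0 \<in> Some ` \<Gamma>} = emeasure \<gamma> \<Gamma>"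
proof -
  have [measurable]: "Some ` \<Gamma> \<in> sets (optM (SM S))" by (rule Some_image_sets_optM[OF \<Gamma>])
  have "emeasure P {\<omega>\<in>space P. xs \<omega> 0 \<in> Some ` \<Gamma>} = (\<integral>\<^sup>+\<omega>. indicator {\<omega>\<in>space P. xs \<omega> 0 \<in> Some ` \<Gamma>} \<omega> \<partial>P)"
    unfolding xs_def by (intro nn_integral_indicator[symmetric]) measurable
  also have "\<dots> = (\<integral>\<^sup>+\<omega>. indicator (Some ` \<Gamma>) (fst (\<omega> 0)) \<partial>P)"
    by (intro nn_integral_cong) (auto simp: xs_def split: split_indicator)
  also have "\<dots> = (\<integral>\<^sup>+x. indicator (Some ` \<Gamma>) (Some x) \<partial>\<gamma>)"
    using nn_integral_initial[of "\<lambda>z. indicator (Some ` \<Gamma>) (fst z)"] by simp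
  also have "\<dots> = (\<integral>\<^sup>+x. indicator \<Gamma> x \<partial>\<gamma>)" by (intro nn_integral_cong) (auto split: split_indicator)
  finally show ?thesis using \<Gamma> gamma(2) by simp
qed

lemma emeasure_jump_event_eq:
  assumes H[measurable]: "H \<in> sets (HM n)" and B: "B \<in> sets posR" and \<Gamma>: "\<Gamma> \<in> sets (SM S)"
  shows "emeasure P {\<omega>\<in>space P. alive n \<omega> \<and> hist n \<omega> \<in> H \<and> th \<omega> (Suc n) \<in> ennreal ` B \<and> xs \<omega> (Suc n) \<in> Some ` \<Gamma>}
    = (\<integral>\<^sup>+\<omega>\<in>{\<omega>\<in>space P. alive n \<omega> \<and> hist n \<omega> \<in> H \<and> th \<omega> (Suc n) \<in> ennreal ` B}.
        ennreal (jump_ratio q (snd (hist n \<omega>)) (pol n (hist n \<omega>, enn2real (th \<omega> (Suc n)))) \<Gamma>) \<partial>P)"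
proof -
  have [measurable]: "ennreal ` B \<in> sets borel" "Some ` \<Gamma> \<in> sets (optM (SM S))"
    by (rule sets_ennreal_image[OF B], rule Some_image_sets_optM[OF \<Gamma>])
  let ?r = "\<lambda>z. ennreal (jump_ratio q (snd (fst z)) (pol n (fst z, sojourn_of (snd (snd z)))) \<Gamma>)"
  have "(\<lambda>z. (fst z, sojourn_of (snd (snd z)))) \<in> measurable (HM n \<Otimes>\<^sub>M PM) (HP n)" by measurable
  from measurable_compose[OF this measurable_jump_ratio[OF \<Gamma>]]
  have ratio[measurable]: "?r \<in> borel_measurable (HM n \<Otimes>\<^sub>M PM)" by simp
  let ?jump = "\<lambda>z. indicator (ennreal ` B) (snd (snd z)) * indicator (Some ` \<Gamma>) (fst (snd z)) :: ennreal"
    and ?mean = "\<lambda>z. indicator (ennreal ` B) (snd (snd z)) * ?r z"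
  have "(\<lambda>z. indicator H (fst z) * ?jump z) \<in> borel_measurable (HM n \<Otimes>\<^sub>M PM)" by measurable
  note jump = nn_integral_next[OF this]
  have "(\<lambda>z. indicator H (fst z) * ?mean z) \<in> borel_measurable (HM n \<Otimes>\<^sub>M PM)" by measurable
  note mean = nn_integral_next[OF this]
  have "(\<integral>\<^sup>+z. indicator H h * ?jump (h, z) \<partial>next_kernel n h)
      = (\<integral>\<^sup>+z. indicator H h * ?mean (h, z) \<partial>next_kernel n h)"
    if h: "h \<in> space (HM n)" for h
    using next_kernel_jump[OF h B \<Gamma>] by (cases "h \<in> H") simp_all
  then have "(\<integral>\<^sup>+h. (\<integral>\<^sup>+z. indicator H h * ?jump (h, z) \<partial>next_kernel n h) \<partial>hist_law n)
    = (\<integral>\<^sup>+h. (\<integral>\<^sup>+z. indicator H h * ?mean (h, z) \<partial>next_kernel n h) \<partial>hist_law n)"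
    by (rule nn_integral_cong) simp
  with jump mean show ?thesis
    by (simp add: emeasure_jump_event[OF H B \<Gamma>] jump_event_integral[OF H B])
qed

lemma strategic_P: "strategic S \<gamma> q pol P"
  unfolding strategic_def
proof (intro conjI ballI allI impI sets_P prob_space_P AE_Omega emeasure_initial_event emeasure_jump_event_eq)
  fix n H t assume H[measurable]: "H \<in> sets (HM n)" and t: "(0 :: real) < t"
  show "emeasure P {\<omega>\<in>space P. alive n \<omega> \<and> hist n \<omega> \<in> H \<and> ennreal t \<le> th \<omega> (Suc n)}
    = (\<integral>\<^sup>+\<omega>\<in>{\<omega>\<in>space P. alive n \<omega> \<and> hist n \<omega> \<in> H}.
        ennreal (exp (- (LINT s:{0<..t}|lborel. (\<integral>a. qx q (snd (hist n \<omega>)) a \<partial>pol n (hist n \<omega>, s))))) \<partial>P)"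
    by (simp add: emeasure_survival_event[OF H] survival_event_integral[OF H t] nn_integral_survival t)
qed (simp_all add: sets_posR_iff)

lemma nn_integral_hist_law_0:
  assumes [measurable]: "f \<in> borel_measurable (SM S)"
  shows "(\<integral>\<^sup>+h. f (snd h) \<partial>hist_law 0) = (\<integral>\<^sup>+x. f x \<partial>\<gamma>)"
proof -
  have "(\<integral>\<^sup>+h. f (snd h) \<partial>hist_law 0) = (\<integral>\<^sup>+\<omega>\<in>{\<omega>. regular 0 \<omega>}. f (snd (history 0 \<omega>)) \<partial>P)"
    by (rule nn_integral_hist_law) measurable
  also have "\<dots> = (\<integral>\<^sup>+\<omega>. f (state_of (fst (\<omega> 0))) * indicator (Some ` S) (fst (\<omega> 0)) \<partial>P)"
    by (intro nn_integral_cong) (simp add: regular_def history_def indicator_def)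
  also have "\<dots> = (\<integral>\<^sup>+x. f (state_of (Some x)) * indicator (Some ` S) (Some x) \<partial>\<gamma>)"
    using nn_integral_initial[of "\<lambda>z. f (state_of (fst z)) * indicator (Some ` S) (fst z)"] by simp
  also have "\<dots> = (\<integral>\<^sup>+x. f x \<partial>\<gamma>)"
    using sets_eq_imp_space_eq[OF gamma(2)] by (intro nn_integral_cong) simp
  finally show ?thesis .
qed

lemma nn_integral_hist_law_Suc:
  assumes [measurable]: "f \<in> borel_measurable (SM S)"
  shows "(\<integral>\<^sup>+h. f (snd h) \<partial>hist_law (Suc n))
    = (\<integral>\<^sup>+h. sojourn_integral n (\<lambda>z. rate z * (\<integral>\<^sup>+y. f y \<partial>jump_kernel z)) h \<partial>hist_law n)"
proof -
  let ?f = "\<lambda>z. f (snd (jump_of z)) * indicator {z. is_jump z} z"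
  have [measurable]: "(indicator {z. is_jump z} :: _ \<Rightarrow> ennreal) \<in> borel_measurable PM"
    by (intro borel_measurable_indicator') measurable
  have f: "?f \<in> borel_measurable PM" by measurable
  have no_jump: "\<not> is_jump (None, \<top>)" by (simp add: is_jump_def)
  have "(\<integral>\<^sup>+h. f (snd h) \<partial>hist_law (Suc n)) = (\<integral>\<^sup>+\<omega>\<in>{\<omega>. regular (Suc n) \<omega>}. f (snd (history (Suc n) \<omega>)) \<partial>P)"
    by (rule nn_integral_hist_law) measurable
  also have "\<dots> = (\<integral>\<^sup>+\<omega>\<in>{\<omega>. regular n \<omega>}. ?f (\<omega> (Suc n)) \<partial>P)"
    by (intro nn_integral_cong) (simp add: regular_Suc history_def jump_of_def indicator_def)
  also have "\<dots> = (\<integral>\<^sup>+h. (\<integral>\<^sup>+z. ?f z \<partial>next_kernel n h) \<partial>hist_law n)"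
    using nn_integral_next[OF measurable_compose[OF measurable_snd f]] by simp
  also have "\<dots> = (\<integral>\<^sup>+h. jump_integral n h (\<lambda>w. f (snd w)) \<partial>hist_law n)"
  proof (intro nn_integral_cong)
    fix h assume "h \<in> space (hist_law n)"
    then have h: "h \<in> space (HM n)" by simp
    have "(\<integral>\<^sup>+z. ?f z \<partial>next_kernel n h) = jump_integral n h (\<lambda>w. ?f (jump_point w))"
      using no_jump by (simp add: nn_integral_next_kernel[OF h f])
    also have "\<dots> = jump_integral n h (\<lambda>w. f (snd w))"
      by (rule pos_functionalD(1)[OF pos_functional_jump_integral[OF h]])
        (auto simp: is_jump_jump_point, simp add: jump_of_def jump_point_def space_pair_measure)
    finally show "(\<integral>\<^sup>+z. ?f z \<partial>next_kernel n h) = jump_integral n h (\<lambda>w. f (snd w))" .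
  qed
  finally show ?thesis by (simp add: jump_integral_state)
qed

end

lemma (in ctmdp_policy) transition_law_unique:
  assumes P: "path_measure S A \<gamma> q pol P" "transition_law P" and P': "path_measure S A \<gamma> q pol P'" "transition_law P'"
  shows "P = P'"
proof (rule measure_eqI_PiM_infinite[where I=UNIV and M="\<lambda>_. PM"])
  interpret P: path_measure S A \<gamma> q pol P by fact
  interpret P': path_measure S A \<gamma> q pol P' by fact
  interpret prob_P: prob_space P by (rule P.prob_space_P)
  interpret prob_P': prob_space P' by (rule P'.prob_space_P)
  show "sets P = sets (PiM UNIV (\<lambda>_. PM))" "sets P' = sets (PiM UNIV (\<lambda>_. PM))"
    by (rule P.sets_P_PiM P'.sets_P_PiM)+
  show "finite_measure P" by unfold_locales
  have prefix_eq: "(\<integral>\<^sup>+\<omega>. f (restrict \<omega> {0..<m}) \<partial>P) = (\<integral>\<^sup>+\<omega>. f (restrict \<omega> {0..<m}) \<partial>P')"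
    if "f \<in> borel_measurable (PiM {0..<m} (\<lambda>_. PM))" for f m
    using that
  proof (induction m arbitrary: f)
    case 0
    then show ?case by (simp add: prob_P.emeasure_space_1 prob_P'.emeasure_space_1)
  next
    case (Suc m)
    note step = transition_law_def[THEN iffD1, rule_format, OF _ Suc.prems]
    show ?case unfolding step[OF P(2)] step[OF P'(2)]
      by (rule Suc.IH) (rule measurable_transition_integral[OF Suc.prems])
  qed
  fix X and J :: "nat set" assume J: "finite J" and X: "\<And>i. i \<in> J \<Longrightarrow> X i \<in> sets PM"
  obtain n where n: "J \<subseteq> {0..<n}" using finite_nat_bounded[OF J] by (auto simp: atLeast0LessThan)
  define E where "E = prod_emb {0..<n} (\<lambda>_. PM) J (Pi\<^sub>E J X)"
  have E: "E \<in> sets (PiM {0..<n} (\<lambda>_. PM))" unfolding E_def using J X n by (intro sets_PiM_I) auto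
  have emb: "\<omega> \<in> prod_emb UNIV (\<lambda>_. PM) J (Pi\<^sub>E J X) \<longleftrightarrow> restrict \<omega> {0..<n} \<in> E" for \<omega>
    using n by (auto simp: E_def prod_emb_def Int_absorb1 space_PiM)
  have "emeasure Q (prod_emb UNIV (\<lambda>_. PM) J (Pi\<^sub>E J X)) = (\<integral>\<^sup>+\<omega>. indicator E (restrict \<omega> {0..<n}) \<partial>Q)"
    if "sets Q = sets (PiM UNIV (\<lambda>_. PM))" for Q
  proof -
    have "prod_emb UNIV (\<lambda>_. PM) J (Pi\<^sub>E J X) \<in> sets Q" using J X that by (auto intro!: sets_PiM_I)
    then have "emeasure Q (prod_emb UNIV (\<lambda>_. PM) J (Pi\<^sub>E J X))
        = (\<integral>\<^sup>+\<omega>. indicator (prod_emb UNIV (\<lambda>_. PM) J (Pi\<^sub>E J X)) \<omega> \<partial>Q)"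
      by simp
    also have "\<dots> = (\<integral>\<^sup>+\<omega>. indicator E (restrict \<omega> {0..<n}) \<partial>Q)" by (simp add: indicator_def emb)
    finally show ?thesis .
  qed
  then show "emeasure P (prod_emb UNIV (\<lambda>_. PM) J (Pi\<^sub>E J X))
      = emeasure P' (prod_emb UNIV (\<lambda>_. PM) J (Pi\<^sub>E J X))"
    using P.sets_P_PiM P'.sets_P_PiM prefix_eq[OF borel_measurable_indicator[OF E]] by simp
qed

locale strategic_measure = path_measure S A \<gamma> q pol P
  for S :: "'s::polish_space set" and A :: "'b::polish_space set" and \<gamma> q pol P +
  assumes strategic: "strategic S \<gamma> q pol P"
begin

lemma AE_Omega: "AE \<omega> in P. \<omega> \<in> Omega S"
  using strategic by (simp add: strategic_def)

lemma AE_regular: "AE \<omega> in P. fst (\<omega> 0) \<in> Some ` S \<and> snd (\<omega> 0)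
    = 0 \<and> (\<forall>n. regular (Suc n) \<omega> \<or> \<omega> (Suc n) = (None, \<top>))"
  using AE_Omega by (simp only: Omega_iff)

lemma measurable_jump_history: "(\<lambda>\<omega>. (history n \<omega>, jump_of (\<omega> (Suc n)))) \<in> measurable P (HM n \<Otimes>\<^sub>M (posR \<Otimes>\<^sub>M SM S))"
  by (intro measurable_Pair measurable_history_P measurable_compose[OF measurable_coordinate measurable_jump_of])

lemma pos_functional_regular:
  assumes T: "T \<in> measurable P N" shows "pos_functional N (\<lambda>f. \<integral>\<^sup>+\<omega>\<in>{\<omega>. regular n \<omega>}. f (T \<omega>) \<partial>P)"
proof -
  have "pos_functional P (\<lambda>f. \<integral>\<^sup>+\<omega>. indicator {\<omega>. regular n \<omega>} \<omega> * f \<omega> \<partial>P)"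
    by (intro pos_functional_integral pos_functional_cmult pos_functional_eval borel_measurable_times_ennreal measurable_indicator_regular)
  from pos_functional_map[OF this T] show ?thesis by (simp add: mult.commute)
qed

lemma regular_integral_finite:
  assumes "\<And>\<omega>. f \<omega> \<le> 1" shows "(\<integral>\<^sup>+\<omega>\<in>{\<omega>. regular n \<omega>}. f \<omega> \<partial>P) \<noteq> \<infinity>"
proof -
  interpret prob_space P by (rule prob_space_P)
  have "(\<integral>\<^sup>+\<omega>\<in>{\<omega>. regular n \<omega>}. f \<omega> \<partial>P) \<le> (\<integral>\<^sup>+\<omega>. 1 \<partial>P)"
    using assms by (intro nn_integral_mono) (simp split: split_indicator)
  then show ?thesis by (auto simp: emeasure_space_1 top_unique)
qed

lemma pos_functional_hist_jump:
  "pos_functional (HM n \<Otimes>\<^sub>M (posR \<Otimes>\<^sub>M SM S)) (\<lambda>f. \<integral>\<^sup>+h. jump_integral n h (\<lambda>w. f (h, w)) \<partial>hist_law n)"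
proof (rule pos_functional_integral)
  fix h assume "h \<in> space (hist_law n)"
  then have h: "h \<in> space (HM n)" by simp
  show "pos_functional (HM n \<Otimes>\<^sub>M (posR \<Otimes>\<^sub>M SM S)) (\<lambda>f. jump_integral n h (\<lambda>w. f (h, w)))"
    by (rule pos_functional_map[OF pos_functional_jump_integral[OF h] measurable_Pair1'[OF h]])
next
  fix f :: "_ \<Rightarrow> ennreal" assume "f \<in> borel_measurable (HM n \<Otimes>\<^sub>M (posR \<Otimes>\<^sub>M SM S))"
  from measurable_jump_integral[OF this] show "(\<lambda>h. jump_integral n h (\<lambda>w. f (h, w))) \<in> borel_measurable (hist_law n)" by simp
qed

lemma jump_before_event:
  assumes H[measurable]: "H \<in> sets (HM n)" and t: "0 < t"
  shows "(\<integral>\<^sup>+\<omega>\<in>{\<omega>. regular (Suc n) \<omega>}. indicator (H \<times> {0<..<t}) (history n \<omega>, sojourn_of (snd (\<omega> (Suc n)))) \<partial>P)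
    = (\<integral>\<^sup>+h. indicator H h * (1 - survival n (h, t)) \<partial>hist_law n)"
    (is "?before = ?rhs")
proof -
  let ?late = "\<integral>\<^sup>+h. indicator H h * survival n (h, t) \<partial>hist_law n"
  have [measurable]: "(\<lambda>h. survival n (h, t)) \<in> borel_measurable (HM n)"
    using t by (intro measurable_compose[OF measurable_Pair2' measurable_survival]) simp
  have [measurable]: "(\<lambda>\<omega>. sojourn_of (snd (\<omega> (Suc n)))) \<in> measurable P posR"
    by (rule measurable_compose[OF measurable_compose[OF measurable_coordinate measurable_snd] measurable_sojourn_of])
  have [measurable]: "(\<lambda>\<omega>. snd (\<omega> (Suc n))) \<in> borel_measurable P"
    by (rule measurable_compose[OF measurable_coordinate measurable_snd])
  have [measurable]: "H \<times> {0<..<t} \<in> sets (HP n)" by (intro pair_measureI) (auto simp: sets_posR_iff)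
  have late: "?late = (\<integral>\<^sup>+\<omega>\<in>{\<omega>. regular n \<omega>}. indicator H (history n \<omega>) * indicator {ennreal t..} (snd (\<omega> (Suc n))) \<partial>P)"
    using strategic H t emeasure_survival_event[OF H, of t] survival_event_integral[OF H t]
    by (auto simp: strategic_def)
  have "?before + ?late = (\<integral>\<^sup>+\<omega>. indicator (H \<times> {0<..<t}) (history n \<omega>, sojourn_of (snd (\<omega> (Suc n)))) * indicator {\<omega>. regular (Suc n) \<omega>} \<omega>
      + indicator H (history n \<omega>) * indicator {ennreal t..} (snd (\<omega> (Suc n))) * indicator {\<omega>. regular n \<omega>} \<omega> \<partial>P)"
    unfolding late by (rule nn_integral_add[symmetric]) measurable
  also have "\<dots> = (\<integral>\<^sup>+\<omega>\<in>{\<omega>. regular n \<omega>}. indicator H (history n \<omega>) \<partial>P)"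
  proof (intro nn_integral_cong_AE)
    show "AE \<omega> in P. indicator (H \<times> {0<..<t}) (history n \<omega>, sojourn_of (snd (\<omega> (Suc n)))) * indicator {\<omega>. regular (Suc n) \<omega>} \<omega>
        + indicator H (history n \<omega>) * indicator {ennreal t..} (snd (\<omega> (Suc n))) * indicator {\<omega>. regular n \<omega>} \<omega>
      = (indicator H (history n \<omega>) * indicator {\<omega>. regular n \<omega>} \<omega> :: ennreal)"
      using AE_regular
    proof eventually_elim
      case (elim \<omega>)
      then consider s where "is_jump (\<omega> (Suc n))" "0 < s" "snd (\<omega> (Suc n)) = ennreal s" | "\<omega> (Suc n)
          = (None, \<top>)"
        by (metis ennreal_cases ennreal_less_zero_iff is_jump_def order_less_irrefl regular_Suc)
      then show ?case
        by cases (auto simp: regular_Suc ennreal_le_iff is_jump_def split: split_indicator)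
    qed
  qed
  also have "\<dots> = (\<integral>\<^sup>+h. indicator H h \<partial>hist_law n)" by (rule nn_integral_hist_law[symmetric]) simp
  also have "\<dots> = (\<integral>\<^sup>+h. indicator H h * (1 - survival n (h, t)) + indicator H h * survival n (h, t) \<partial>hist_law n)"
    by (intro nn_integral_cong) (auto simp: survival_le_1 diff_add_cancel_ennreal split: split_indicator)
  also have "\<dots> = ?rhs + ?late" by (rule nn_integral_add) measurable
  finally have "?late + ?before = ?late + ?rhs" by (simp add: add.commute)
  moreover have "?late \<noteq> \<infinity>" unfolding late by (rule regular_integral_finite) (simp add: indicator_def)
  ultimately show ?thesis by (simp add: ennreal_add_left_cancel)
qed

lemma jump_integral_before:
  assumes h: "h \<in> space (HM n)" and t: "0 < t"
  shows "jump_integral n h (\<lambda>w. indicator (H \<times> {0<..<t}) (h, fst w)) = indicator H h * (1 - survival n (h, t))"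
proof -
  have "jump_integral n h (\<lambda>w. indicator (H \<times> {0<..<t}) (h, fst w))
      = (\<integral>\<^sup>+s. survival n (h, s) * policy_mean n rate (h, s) * indicator (H \<times> {0<..<t}) (h, s) \<partial>posL)"
    by (rule jump_integral_time[OF h])
  also have "\<dots> = (\<integral>\<^sup>+s. indicator H h * (survival n (h, s) * policy_mean n rate (h, s) * indicator {..<t} s) \<partial>posL)"
    by (intro nn_integral_cong) (auto split: split_indicator)
  also have "\<dots> = indicator H h * (1 - survival n (h, t))"
    by (cases "h \<in> H") (simp_all add: nn_integral_jump_before[OF h t])
  finally show ?thesis .
qed

lemma sojourn_law:
  assumes f: "f \<in> borel_measurable (HP n)"
  shows "(\<integral>\<^sup>+\<omega>\<in>{\<omega>. regular (Suc n) \<omega>}. f (history n \<omega>, sojourn_of (snd (\<omega> (Suc n)))) \<partial>P)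
    = (\<integral>\<^sup>+h. jump_integral n h (\<lambda>w. f (h, fst w)) \<partial>hist_law n)"
proof (rule pos_functional_pair_eqI[where M="HM n" and N=posR and f=f and G="range (\<lambda>t. {0<..<t})" and C="\<lambda>i. {0<..<real i}"])
  show "pos_functional (HP n) (\<lambda>f. \<integral>\<^sup>+\<omega>\<in>{\<omega>. regular (Suc n) \<omega>}. f (history n \<omega>, sojourn_of (snd (\<omega> (Suc n)))) \<partial>P)"
    by (intro pos_functional_regular measurable_Pair measurable_history_P
        measurable_compose[OF measurable_compose[OF measurable_coordinate measurable_snd] measurable_sojourn_of])
  have "(\<lambda>z. (fst z, fst (snd z))) \<in> measurable (HM n \<Otimes>\<^sub>M (posR \<Otimes>\<^sub>M SM S)) (HP n)" by measurable
  from pos_functional_map[OF pos_functional_hist_jump this]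
  show "pos_functional (HP n) (\<lambda>f. \<integral>\<^sup>+h. jump_integral n h (\<lambda>w. f (h, fst w)) \<partial>hist_law n)" by simp
  show "sets posR = sigma_sets (space posR) (range (\<lambda>t::real. {0<..<t}))"
    by (simp add: sets_posR_generator)
  show "(\<Union>i. {0<..<real i}) = space posR" using reals_Archimedean2 by auto
  show "(\<integral>\<^sup>+\<omega>\<in>{\<omega>. regular (Suc n) \<omega>}. indicator (space (HM n) \<times> {0<..<real i}) (history n \<omega>, sojourn_of (snd (\<omega> (Suc n)))) \<partial>P) \<noteq> \<infinity>" for i
    by (rule regular_integral_finite) (simp add: indicator_def)
next
  fix H Y assume H: "H \<in> sets (HM n)" and "Y \<in> range (\<lambda>t::real. {0<..<t})"
  then obtain t :: real where Y: "Y = {0<..<t}" by auto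
  show "(\<integral>\<^sup>+\<omega>\<in>{\<omega>. regular (Suc n) \<omega>}. indicator (H \<times> Y) (history n \<omega>, sojourn_of (snd (\<omega> (Suc n)))) \<partial>P)
    = (\<integral>\<^sup>+h. jump_integral n h (\<lambda>w. indicator (H \<times> Y) (h, fst w)) \<partial>hist_law n)"
  proof (cases "0 < t")
    case True
    have "(\<integral>\<^sup>+h. jump_integral n h (\<lambda>w. indicator (H \<times> {0<..<t}) (h, fst w)) \<partial>hist_law n)
        = (\<integral>\<^sup>+h. indicator H h * (1 - survival n (h, t)) \<partial>hist_law n)"
      by (rule nn_integral_cong) (simp add: jump_integral_before True)
    then show ?thesis by (simp add: Y jump_before_event[OF H True])
  next
    case False
    then have "Y = {}" by (simp add: Y)
    moreover have "(\<integral>\<^sup>+h. jump_integral n h (\<lambda>w. 0) \<partial>hist_law n) = (\<integral>\<^sup>+h. 0 \<partial>hist_law n)"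
      by (rule nn_integral_cong) (simp add: jump_integral_const)
    ultimately show ?thesis by simp
  qed
qed (use f Int_stable_posR_generator in auto)

lemma jump_law_rectangle:
  assumes H[measurable]: "H \<in> sets (HM n)" and B: "B \<in> sets posR" and \<Gamma>: "\<Gamma> \<in> sets (SM S)"
  shows "(\<integral>\<^sup>+\<omega>\<in>{\<omega>. regular (Suc n) \<omega>}. indicator (H \<times> (B \<times> \<Gamma>)) (history n \<omega>, jump_of (\<omega> (Suc n))) \<partial>P)
    = (\<integral>\<^sup>+h. jump_integral n h (\<lambda>w. indicator (H \<times> (B \<times> \<Gamma>)) (h, w)) \<partial>hist_law n)"
proof -
  let ?g = "\<lambda>p. indicator H (fst p) * (indicator B (snd p) * ennreal (jump_ratio q (snd (fst p)) (pol n p) \<Gamma>))"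
  note [measurable] = measurable_jump_ratio[OF \<Gamma>] B
  have g: "?g \<in> borel_measurable (HP n)" by measurable
  have B_pos: "B \<subseteq> {0<..}" "B \<in> sets borel" and \<Gamma>_S: "\<Gamma> \<subseteq> S"
    using B sets.sets_into_space[OF \<Gamma>] by (auto simp: sets_posR_iff)
  have state: "z \<in> Some ` \<Gamma> \<longleftrightarrow> z \<in> Some ` S \<and> state_of z \<in> \<Gamma>" for z using \<Gamma>_S by (auto simp: state_of_def)
  have "(\<integral>\<^sup>+\<omega>\<in>{\<omega>. regular (Suc n) \<omega>}. indicator (H \<times> (B \<times> \<Gamma>)) (history n \<omega>, jump_of (\<omega> (Suc n))) \<partial>P)
    = (\<integral>\<^sup>+\<omega>\<in>{\<omega>. regular n \<omega>}. indicator H (history n \<omega>) * (indicator (ennreal ` B) (snd (\<omega> (Suc n))) * indicator (Some ` \<Gamma>) (fst (\<omega> (Suc n)))) \<partial>P)"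
    by (intro nn_integral_cong)
      (auto simp: regular_Suc is_jump_def jump_of_def ennreal_image_iff[OF B_pos(1)] state split: split_indicator)
  also have "\<dots> = (\<integral>\<^sup>+\<omega>\<in>{\<omega>. regular n \<omega>}. indicator H (history n \<omega>) * (indicator (ennreal ` B) (snd (\<omega> (Suc n)))
        * ennreal (jump_ratio q (snd (history n \<omega>)) (pol n (history n \<omega>, sojourn_of (snd (\<omega> (Suc n))))) \<Gamma>)) \<partial>P)"
    using strategic H B_pos \<Gamma>
    unfolding emeasure_jump_event[OF H B \<Gamma>, symmetric] jump_event_integral[OF H B, symmetric] strategic_def
    by blast
  also have "\<dots> = (\<integral>\<^sup>+\<omega>\<in>{\<omega>. regular (Suc n) \<omega>}. ?g (history n \<omega>, sojourn_of (snd (\<omega> (Suc n)))) \<partial>P)"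
  proof (intro nn_integral_cong_AE)
    show "AE \<omega> in P. indicator H (history n \<omega>) * (indicator (ennreal ` B) (snd (\<omega> (Suc n)))
        * ennreal (jump_ratio q (snd (history n \<omega>)) (pol n (history n \<omega>, sojourn_of (snd (\<omega> (Suc n))))) \<Gamma>)) * indicator {\<omega>. regular n \<omega>} \<omega>
      = ?g (history n \<omega>, sojourn_of (snd (\<omega> (Suc n)))) * indicator {\<omega>. regular (Suc n) \<omega>} \<omega>"
      using AE_regular
    proof eventually_elim
      case (elim \<omega>)
      then show ?case
        by (auto simp: regular_Suc is_jump_def ennreal_image_iff[OF B_pos(1)] dest!: spec[of _ n] split: split_indicator)
    qed
  qed
  also have "\<dots> = (\<integral>\<^sup>+h. jump_integral n h (\<lambda>w. ?g (h, fst w)) \<partial>hist_law n)" by (rule sojourn_law[OF g])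
  also have "\<dots> = (\<integral>\<^sup>+h. jump_integral n h (\<lambda>w. indicator (H \<times> (B \<times> \<Gamma>)) (h, w)) \<partial>hist_law n)"
  proof (rule nn_integral_cong)
    fix h assume "h \<in> space (hist_law n)"
    then have "jump_integral n h (indicator (B \<times> \<Gamma>))
        = jump_integral n h (\<lambda>w. indicator B (fst w) * ennreal (jump_ratio q (snd h) (pol n (h, fst w)) \<Gamma>))"
      by (intro jump_integral_rectangle \<Gamma>) simp
    moreover have "jump_integral n h (\<lambda>w. indicator (B \<times> \<Gamma>) w) = jump_integral n h (indicator (B \<times> \<Gamma>))"
      by simp
    ultimately show "jump_integral n h (\<lambda>w. ?g (h, fst w))
        = jump_integral n h (\<lambda>w. indicator (H \<times> (B \<times> \<Gamma>)) (h, w))"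
      by (cases "h \<in> H") (simp_all add: indicator_times)
  qed
  finally show ?thesis .
qed

lemma jump_law:
  assumes f: "f \<in> borel_measurable (HM n \<Otimes>\<^sub>M (posR \<Otimes>\<^sub>M SM S))"
  shows "(\<integral>\<^sup>+\<omega>\<in>{\<omega>. regular (Suc n) \<omega>}. f (history n \<omega>, jump_of (\<omega> (Suc n))) \<partial>P)
      = (\<integral>\<^sup>+h. jump_integral n h (\<lambda>w. f (h, w)) \<partial>hist_law n)"
proof (rule pos_functional_pair_eqI[where M="HM n" and N="posR \<Otimes>\<^sub>M SM S" and f=f
      and G="{B \<times> \<Gamma> |B \<Gamma>. B \<in> sets posR \<and> \<Gamma> \<in> sets (SM S)}" and C="\<lambda>_. space posR \<times> space (SM S)"])
  show "{B \<times> \<Gamma> |B \<Gamma>. B \<in> sets posR \<and> \<Gamma> \<in> sets (SM S)} \<subseteq> Pow (space (posR \<Otimes>\<^sub>M SM S))"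
    unfolding space_pair_measure by (rule pair_measure_closed)
  show "sets (posR \<Otimes>\<^sub>M SM S) = sigma_sets (space (posR \<Otimes>\<^sub>M SM S)) {B \<times> \<Gamma> |B \<Gamma>. B \<in> sets posR \<and> \<Gamma> \<in> sets (SM S)}"
    by (simp only: sets_pair_measure space_pair_measure)
  show "range (\<lambda>_::nat. space posR \<times> space (SM S)) \<subseteq> {B \<times> \<Gamma> |B \<Gamma>. B \<in> sets posR \<and> \<Gamma> \<in> sets (SM S)}"
    by blast
  show "(\<Union>i::nat. space posR \<times> space (SM S)) = space (posR \<Otimes>\<^sub>M SM S)" by (simp add: space_pair_measure)
  show "(\<integral>\<^sup>+\<omega>\<in>{\<omega>. regular (Suc n) \<omega>}. indicator (space (HM n) \<times> (space posR \<times> space (SM S))) (history n \<omega>, jump_of (\<omega> (Suc n))) \<partial>P) \<noteq> \<infinity>"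
    by (rule regular_integral_finite) (simp add: indicator_def)
qed (auto intro: f pos_functional_regular[OF measurable_jump_history] pos_functional_hist_jump Int_stable_pair_measure_generator jump_law_rectangle)

lemma measurable_no_jump: "(\<lambda>\<omega>. indicator {(None, \<top>)} (\<omega> (Suc n)) :: ennreal) \<in> borel_measurable P"
  by (rule measurable_compose[OF measurable_coordinate]) (simp add: cemetery_sets)

lemma no_jump_event:
  assumes H[measurable]: "H \<in> sets (HM n)"
  shows "(\<integral>\<^sup>+\<omega>\<in>{\<omega>. regular n \<omega>}. indicator H (history n \<omega>) * indicator {(None, \<top>)} (\<omega> (Suc n)) \<partial>P)
    = (\<integral>\<^sup>+h. (1 - jump_mass n h) * indicator H h \<partial>hist_law n)"
    (is "?stop = ?rhs")
proof -
  note [measurable] = measurable_no_jump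
  let ?go = "\<integral>\<^sup>+\<omega>\<in>{\<omega>. regular (Suc n) \<omega>}. indicator H (history n \<omega>) \<partial>P"
  have go: "?go = (\<integral>\<^sup>+h. jump_mass n h * indicator H h \<partial>hist_law n)"
  proof -
    have "(\<lambda>z. indicator H (fst z) :: ennreal) \<in> borel_measurable (HM n \<Otimes>\<^sub>M (posR \<Otimes>\<^sub>M SM S))"
      by measurable
    from jump_law[OF this] have "?go = (\<integral>\<^sup>+h. jump_integral n h (\<lambda>w. indicator H h) \<partial>hist_law n)" by simp
    also have "\<dots> = (\<integral>\<^sup>+h. jump_mass n h * indicator H h \<partial>hist_law n)"
      by (rule nn_integral_cong) (simp add: jump_integral_const mult.commute)
    finally show ?thesis .
  qed
  have "?go + ?stop = (\<integral>\<^sup>+\<omega>. indicator H (history n \<omega>) * indicator {\<omega>. regular (Suc n) \<omega>} \<omega>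
      + indicator H (history n \<omega>) * indicator {(None, \<top>)} (\<omega> (Suc n)) * indicator {\<omega>. regular n \<omega>} \<omega> \<partial>P)"
    by (rule nn_integral_add[symmetric]) measurable
  also have "\<dots> = (\<integral>\<^sup>+\<omega>\<in>{\<omega>. regular n \<omega>}. indicator H (history n \<omega>) \<partial>P)"
  proof (intro nn_integral_cong_AE)
    show "AE \<omega> in P. indicator H (history n \<omega>) * indicator {\<omega>. regular (Suc n) \<omega>} \<omega>
        + indicator H (history n \<omega>) * indicator {(None, \<top>)} (\<omega> (Suc n)) * indicator {\<omega>. regular n \<omega>} \<omega>
      = (indicator H (history n \<omega>) * indicator {\<omega>. regular n \<omega>} \<omega> :: ennreal)"
      using AE_regular
    proof eventually_elim
      case (elim \<omega>)
      then show ?case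
        by (cases "\<omega> (Suc n) = (None, \<top>)") (auto simp: regular_Suc is_jump_def dest!: spec[of _ n] split: split_indicator)
    qed
  qed
  also have "\<dots> = (\<integral>\<^sup>+h. indicator H h \<partial>hist_law n)" by (rule nn_integral_hist_law[symmetric]) simp
  also have "\<dots> = (\<integral>\<^sup>+h. jump_mass n h * indicator H h + (1 - jump_mass n h) * indicator H h \<partial>hist_law n)"
    by (intro nn_integral_cong) (simp add: jump_mass_le_1 add_diff_inverse_ennreal flip: distrib_right)
  also have "\<dots> = ?go + ?rhs" unfolding go by (rule nn_integral_add) measurable
  finally have "?go + ?stop = ?go + ?rhs" .
  moreover have "?go \<noteq> \<infinity>" by (rule regular_integral_finite) (simp add: indicator_def)
  ultimately show ?thesis by (simp add: ennreal_add_left_cancel)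
qed

lemma no_jump_law:
  assumes f: "f \<in> borel_measurable (HM n)"
  shows "(\<integral>\<^sup>+\<omega>\<in>{\<omega>. regular n \<omega>}. f (history n \<omega>) * indicator {(None, \<top>)} (\<omega> (Suc n)) \<partial>P)
    = (\<integral>\<^sup>+h. (1 - jump_mass n h) * f h \<partial>hist_law n)"
proof (rule pos_functional_eqI[where f=f and G="sets (HM n)" and C="\<lambda>_. space (HM n)"])
  show "pos_functional (HM n) (\<lambda>f. \<integral>\<^sup>+\<omega>\<in>{\<omega>. regular n \<omega>}. f (history n \<omega>) * indicator {(None, \<top>)} (\<omega> (Suc n)) \<partial>P)"
    unfolding mult.assoc mult.commute[of "_ (history n _)"]
    by (intro pos_functional_integral pos_functional_cmult pos_functional_eval history_space borel_measurable_times_ennreal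
        measurable_indicator_regular measurable_no_jump measurable_compose[OF measurable_history_P])
  show "pos_functional (HM n) (\<lambda>f. \<integral>\<^sup>+h. (1 - jump_mass n h) * f h \<partial>hist_law n)"
    by (intro pos_functional_integral pos_functional_cmult pos_functional_eval) (simp_all, measurable)
  show "(\<integral>\<^sup>+\<omega>\<in>{\<omega>. regular n \<omega>}. indicator (space (HM n)) (history n \<omega>) * indicator {(None, \<top>)} (\<omega> (Suc n)) \<partial>P) \<noteq> \<infinity>"
    by (rule regular_integral_finite) (simp add: indicator_def)
qed (use f in \<open>auto simp: no_jump_event sets.Int_stable sets.sigma_sets_eq sets.space_closed\<close>)

lemma next_law:
  assumes F[measurable]: "F \<in> borel_measurable (HM n \<Otimes>\<^sub>M PM)"
  shows "(\<integral>\<^sup>+\<omega>\<in>{\<omega>. regular n \<omega>}. F (history n \<omega>, \<omega> (Suc n)) \<partial>P)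
      = (\<integral>\<^sup>+h. (\<integral>\<^sup>+z. F (h, z) \<partial>next_kernel n h) \<partial>hist_law n)"
proof -
  have [measurable]: "(\<lambda>h. F (h, (None, \<top>))) \<in> borel_measurable (HM n)"
    by (rule measurable_compose[OF measurable_Pair2' F]) simp
  have jump_F: "(\<lambda>z. F (fst z, jump_point (snd z))) \<in> borel_measurable (HM n \<Otimes>\<^sub>M (posR \<Otimes>\<^sub>M SM S))"
    by measurable
  have [measurable]: "(\<lambda>\<omega>. F (history n \<omega>, jump_point (jump_of (\<omega> (Suc n))))) \<in> borel_measurable P"
    using measurable_compose[OF measurable_jump_history jump_F] by simp
  note [measurable] = measurable_no_jump
  have "(\<integral>\<^sup>+\<omega>\<in>{\<omega>. regular n \<omega>}. F (history n \<omega>, \<omega> (Suc n)) \<partial>P)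
    = (\<integral>\<^sup>+\<omega>. F (history n \<omega>, jump_point (jump_of (\<omega> (Suc n)))) * indicator {\<omega>. regular (Suc n) \<omega>} \<omega>
      + F (history n \<omega>, (None, \<top>)) * indicator {(None, \<top>)} (\<omega> (Suc n)) * indicator {\<omega>. regular n \<omega>} \<omega> \<partial>P)"
  proof (intro nn_integral_cong_AE)
    show "AE \<omega> in P. F (history n \<omega>, \<omega> (Suc n)) * indicator {\<omega>. regular n \<omega>} \<omega>
      = F (history n \<omega>, jump_point (jump_of (\<omega> (Suc n)))) * indicator {\<omega>. regular (Suc n) \<omega>} \<omega>
      + F (history n \<omega>, (None, \<top>)) * indicator {(None, \<top>)} (\<omega> (Suc n)) * indicator {\<omega>. regular n \<omega>} \<omega>"
      using AE_regular
    proof eventually_elim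
      case (elim \<omega>)
      then consider "is_jump (\<omega> (Suc n))" "\<omega> (Suc n) \<noteq> (None, \<top>)" | "\<not> is_jump (\<omega> (Suc n))" "\<omega> (Suc n)
          = (None, \<top>)"
        by (auto simp: regular_Suc is_jump_def)
      then show ?case by cases (auto simp: regular_Suc jump_point_jump_of split: split_indicator)
    qed
  qed
  also have "\<dots> = (\<integral>\<^sup>+h. jump_integral n h (\<lambda>w. F (h, jump_point w)) \<partial>hist_law n) + (\<integral>\<^sup>+h. (1 - jump_mass n h) * F (h, (None, \<top>)) \<partial>hist_law n)"
    using jump_law[OF jump_F] no_jump_law[of "\<lambda>h. F (h, (None, \<top>))"] by (subst nn_integral_add) simp_all
  also have "\<dots> = (\<integral>\<^sup>+h. jump_integral n h (\<lambda>w. F (h, jump_point w)) + (1 - jump_mass n h) * F (h, (None, \<top>)) \<partial>hist_law n)"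
  proof (rule nn_integral_add[symmetric])
    show "(\<lambda>h. jump_integral n h (\<lambda>w. F (h, jump_point w))) \<in> borel_measurable (hist_law n)"
      using measurable_jump_integral[OF jump_F] by simp
  qed measurable
  also have "\<dots> = (\<integral>\<^sup>+h. (\<integral>\<^sup>+z. F (h, z) \<partial>next_kernel n h) \<partial>hist_law n)"
    by (rule nn_integral_cong) (simp add: nn_integral_next_kernel measurable_compose[OF measurable_Pair1' F])
  finally show ?thesis .
qed

lemma measurable_initial_state: "(\<lambda>\<omega>. state_of (fst (\<omega> 0))) \<in> measurable P (SM S)"
  by (rule measurable_compose[OF measurable_compose[OF measurable_coordinate measurable_fst] measurable_state_of])

lemma distr_initial_state: "distr P (SM S) (\<lambda>\<omega>. state_of (fst (\<omega> 0))) = \<gamma>"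
proof (rule measure_eqI)
  fix \<Gamma> assume "\<Gamma> \<in> sets (distr P (SM S) (\<lambda>\<omega>. state_of (fst (\<omega> 0))))"
  then have \<Gamma>: "\<Gamma> \<in> sets (SM S)" by simp
  then have [measurable]: "Some ` \<Gamma> \<in> sets (optM (SM S))" by (rule Some_image_sets_optM)
  have "emeasure P ((\<lambda>\<omega>. state_of (fst (\<omega> 0))) -` \<Gamma> \<inter> space P) = emeasure P {\<omega>\<in>space P. xs \<omega> 0 \<in> Some ` \<Gamma>}"
  proof (rule emeasure_eq_AE)
    show "AE \<omega> in P. \<omega> \<in> (\<lambda>\<omega>. state_of (fst (\<omega> 0))) -` \<Gamma> \<inter> space P \<longleftrightarrow> \<omega> \<in> {\<omega>\<in>space P. xs \<omega> 0 \<in> Some ` \<Gamma>}"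
      using AE_regular by eventually_elim (auto simp: xs_def space_P)
    show "{\<omega>\<in>space P. xs \<omega> 0 \<in> Some ` \<Gamma>} \<in> sets P"
      unfolding xs_def by measurable
  qed (rule measurable_sets[OF measurable_initial_state \<Gamma>])
  then show "emeasure (distr P (SM S) (\<lambda>\<omega>. state_of (fst (\<omega> 0)))) \<Gamma> = emeasure \<gamma> \<Gamma>"
    using strategic \<Gamma> by (simp add: emeasure_distr[OF measurable_initial_state \<Gamma>] strategic_def)
qed (simp add: gamma(2))

lemma initial_law:
  assumes [measurable]: "g \<in> borel_measurable PM"
  shows "(\<integral>\<^sup>+\<omega>. g (\<omega> 0) \<partial>P) = (\<integral>\<^sup>+x. g (Some x, 0) \<partial>\<gamma>)"
proof -
  have "(\<lambda>x. g (Some x, 0)) \<in> borel_measurable (distr P (SM S) (\<lambda>\<omega>. state_of (fst (\<omega> 0))))" by measurable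
  from nn_integral_distr[OF measurable_initial_state this]
  have "(\<integral>\<^sup>+x. g (Some x, 0) \<partial>\<gamma>) = (\<integral>\<^sup>+\<omega>. g (Some (state_of (fst (\<omega> 0))), 0) \<partial>P)"
    by (simp add: distr_initial_state)
  also have "\<dots> = (\<integral>\<^sup>+\<omega>. g (\<omega> 0) \<partial>P)"
    using AE_regular
    by (intro nn_integral_cong_AE, eventually_elim) (auto simp: prod_eq_iff intro!: arg_cong[of _ _ g])
  finally show ?thesis ..
qed

lemma measurable_extend:
  assumes "p \<in> measurable M (PiM {0..<m} (\<lambda>_. PM))" "z \<in> measurable M PM"
  shows "(\<lambda>x. (p x)(m := z x)) \<in> measurable M (PiM {0..<Suc m} (\<lambda>_. PM))"
  by (rule measurable_fun_upd[OF _ assms]) (simp add: atLeast0_lessThan_Suc Un_commute)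

lemma prefix_cong:
  "regular n (restrict \<omega> {0..<Suc n}) \<longleftrightarrow> regular n \<omega>" "history n (restrict \<omega> {0..<Suc n}) = history n \<omega>"
  by (rule regular_history_cong; simp)+

context
  fixes n and f :: "'s path \<Rightarrow> ennreal"
  assumes f: "f \<in> borel_measurable (PiM {0..<Suc (Suc n)} (\<lambda>_. PM))"
begin

lemma transition_law_regular:
  "(\<integral>\<^sup>+\<omega>\<in>{\<omega>. regular n \<omega>}. f (restrict \<omega> {0..<Suc (Suc n)}) \<partial>P)
    = (\<integral>\<^sup>+\<omega>\<in>{\<omega>. regular n \<omega>}. (\<integral>\<^sup>+z. f ((restrict \<omega> {0..<Suc n})(Suc n := z)) \<partial>transition (Suc n) (restrict \<omega> {0..<Suc n})) \<partial>P)"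
proof -
  have "(\<lambda>z. (path_prefix n (fst z))(Suc n := snd z)) \<in> measurable (HM n \<Otimes>\<^sub>M PM) (PiM {0..<Suc (Suc n)} (\<lambda>_. PM))"
    by (intro measurable_extend measurable_compose[OF measurable_fst measurable_path_prefix] measurable_snd)
  from measurable_compose[OF this f]
  have F: "(\<lambda>z. f ((path_prefix n (fst z))(Suc n := snd z))) \<in> borel_measurable (HM n \<Otimes>\<^sub>M PM)" .
  have start: "AE \<omega> in P. snd (\<omega> 0) = 0" using AE_regular by eventually_elim simp
  have "(\<integral>\<^sup>+\<omega>\<in>{\<omega>. regular n \<omega>}. f (restrict \<omega> {0..<Suc (Suc n)}) \<partial>P)
    = (\<integral>\<^sup>+\<omega>\<in>{\<omega>. regular n \<omega>}. f ((path_prefix n (history n \<omega>))(Suc n := \<omega> (Suc n))) \<partial>P)"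
  proof (intro nn_integral_cong_AE)
    have upd: "restrict \<omega> {0..<Suc (Suc n)} = (restrict \<omega> {0..<Suc n})(Suc n := \<omega> (Suc n))" for \<omega> :: "'s path"
      by (auto simp: fun_eq_iff restrict_def)
    show "AE \<omega> in P. f (restrict \<omega> {0..<Suc (Suc n)}) * indicator {\<omega>. regular n \<omega>} \<omega>
      = f ((path_prefix n (history n \<omega>))(Suc n := \<omega> (Suc n))) * indicator {\<omega>. regular n \<omega>} \<omega>"
      using start by eventually_elim (simp only: upd, simp add: path_prefix_history indicator_def)
  qed
  also have "\<dots> = (\<integral>\<^sup>+h. (\<integral>\<^sup>+z. f ((path_prefix n h)(Suc n := z)) \<partial>next_kernel n h) \<partial>hist_law n)"
    using next_law[OF F] by simp
  also have "\<dots> = (\<integral>\<^sup>+\<omega>\<in>{\<omega>. regular n \<omega>}. (\<integral>\<^sup>+z. f ((path_prefix n (history n \<omega>))(Suc n := z)) \<partial>next_kernel n (history n \<omega>)) \<partial>P)"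
    using measurable_next_kernel_integral[OF F] by (intro nn_integral_hist_law) simp
  also have "\<dots> = (\<integral>\<^sup>+\<omega>\<in>{\<omega>. regular n \<omega>}. (\<integral>\<^sup>+z. f ((restrict \<omega> {0..<Suc n})(Suc n := z)) \<partial>transition (Suc n) (restrict \<omega> {0..<Suc n})) \<partial>P)"
    using start by (intro nn_integral_cong_AE, eventually_elim)
      (simp add: path_prefix_history transition_def prefix_cong indicator_def del: restrict_upd)
  finally show ?thesis .
qed

lemma transition_law_stopped:
  "(\<integral>\<^sup>+\<omega>\<in>{\<omega>. \<not> regular n \<omega>}. f (restrict \<omega> {0..<Suc (Suc n)}) \<partial>P)
    = (\<integral>\<^sup>+\<omega>\<in>{\<omega>. \<not> regular n \<omega>}. (\<integral>\<^sup>+z. f ((restrict \<omega> {0..<Suc n})(Suc n := z)) \<partial>transition (Suc n) (restrict \<omega> {0..<Suc n})) \<partial>P)"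
proof (intro nn_integral_cong_AE)
  show "AE \<omega> in P. f (restrict \<omega> {0..<Suc (Suc n)}) * indicator {\<omega>. \<not> regular n \<omega>} \<omega>
    = (\<integral>\<^sup>+z. f ((restrict \<omega> {0..<Suc n})(Suc n := z)) \<partial>transition (Suc n) (restrict \<omega> {0..<Suc n})) * indicator {\<omega>. \<not> regular n \<omega>} \<omega>"
    using AE_regular
  proof eventually_elim
    case (elim \<omega>)
    show ?case
    proof (cases "regular n \<omega>")
      case False
      then have stop: "\<omega> (Suc n) = (None, \<top>)" using elim by (metis regular_Suc)
      have "(\<lambda>z. (restrict \<omega> {0..<Suc n})(Suc n := z)) \<in> measurable PM (PiM {0..<Suc (Suc n)} (\<lambda>_. PM))"
        by (rule measurable_extend) (auto simp: space_PiM)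
      from measurable_compose[OF this f] have "(\<lambda>z. f ((restrict \<omega> {0..<Suc n})(Suc n := z))) \<in> borel_measurable PM" .
      then have "(\<integral>\<^sup>+z. f ((restrict \<omega> {0..<Suc n})(Suc n := z)) \<partial>transition (Suc n) (restrict \<omega> {0..<Suc n}))
        = f ((restrict \<omega> {0..<Suc n})(Suc n := (None, \<top>)))"
        using False by (simp add: transition_def prefix_cong nn_integral_return del: restrict_upd)
      moreover have "(restrict \<omega> {0..<Suc n})(Suc n := (None, \<top>)) = restrict \<omega> {0..<Suc (Suc n)}"
        using stop by (auto simp: fun_eq_iff restrict_def)
      ultimately show ?thesis by (simp del: restrict_upd)
    qed simp
  qed
qed

end

lemma transition_law_P: "transition_law P"
  unfolding transition_law_def
proof (intro allI ballI)
  fix m and f :: "'s path \<Rightarrow> ennreal" assume f: "f \<in> borel_measurable (PiM {0..<Suc m} (\<lambda>_. PM))"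
  show "(\<integral>\<^sup>+\<omega>. f (restrict \<omega> {0..<Suc m}) \<partial>P)
    = (\<integral>\<^sup>+\<omega>. (\<integral>\<^sup>+z. f ((restrict \<omega> {0..<m})(m := z)) \<partial>transition m (restrict \<omega> {0..<m})) \<partial>P)"
  proof (cases m)
    case 0
    have "(\<lambda>z. (\<lambda>_. undefined)(0 := z)) \<in> measurable PM (PiM {0..<Suc 0} (\<lambda>_. PM))"
      by (rule measurable_extend) (auto simp: space_PiM)
    from measurable_compose[OF this] f 0
    have g: "(\<lambda>z. f ((\<lambda>_. undefined)(0 := z))) \<in> borel_measurable PM" by simp
    interpret prob_space P by (rule prob_space_P)
    have "restrict \<omega> {0..<Suc 0} = (\<lambda>_. undefined)(0 := \<omega> 0)" for \<omega> :: "'s path" by auto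
    then show ?thesis unfolding 0
      using initial_law[OF g] measurable_initial_point g
      by (simp add: transition_def nn_integral_distr emeasure_space_1)
  next
    case (Suc n)
    then have f: "f \<in> borel_measurable (PiM {0..<Suc (Suc n)} (\<lambda>_. PM))" using f by simp
    note split = nn_integral_split_regular[OF measurable_compose[OF measurable_prefix], of _ _ n]
    show ?thesis
      unfolding Suc split[OF f] split[OF measurable_transition_integral[OF f]] transition_law_regular[OF f] transition_law_stopped[OF f] ..
  qed
qed

end

sublocale ctmdp_policy \<subseteq> markov_path_measure S A \<gamma> q pol path_law
  by (intro markov_path_measure.intro path_measure.intro path_measure_axioms.intro markov_path_measure_axioms.intro
      ctmdp_policy_axioms sets_path_law prob_space_path_law transition_law_path_law)

context ctmdp_policy
begin

theorem strategic_unique: assumes "strategic S \<gamma> q pol P" shows "P = path_law"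
proof -
  interpret P: strategic_measure S A \<gamma> q pol P
    using assms
    by (intro strategic_measure.intro path_measure.intro path_measure_axioms.intro strategic_measure_axioms.intro
        ctmdp_policy_axioms) (simp_all add: strategic_def)
  show ?thesis
    by (rule transition_law_unique)
      (rule P.path_measure_axioms P.transition_law_P path_measure_axioms transition_law)+
qed

lemma Pstrat_eq_path_law: "Pstrat S \<gamma> q pol = path_law"
  unfolding Pstrat_def
  by (rule the_equality[of "strategic S \<gamma> q pol"]) (rule strategic_P strategic_unique)+

end

section \<open>The objective as a sum over sojourns\<close>

lemma jt_0: "jt \<omega> 0 = 0" by (simp add: jt_def)

lemma jt_Suc: "jt \<omega> (Suc n) = jt \<omega> n + th \<omega> (Suc n)" by (simp add: jt_def)

lemma jt_mono: "m \<le> n \<Longrightarrow> jt \<omega> m \<le> jt \<omega> n"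
  by (induction n) (auto simp: jt_Suc le_Suc_eq intro: order_trans add_increasing2)

lemma jt_interval_unique:
  assumes "jt \<omega> n < t" "t \<le> jt \<omega> (Suc n)" "jt \<omega> m < t" "t \<le> jt \<omega> (Suc m)" shows "m = n"
proof (rule ccontr)
  assume "m \<noteq> n"
  then consider "Suc m \<le> n" | "Suc n \<le> m" by linarith
  then show False using jt_mono[of "Suc m" n \<omega>] jt_mono[of "Suc n" m \<omega>] assms by cases simp_all
qed

lemma (in ctmdp) jt_finite_iff: assumes "\<omega> \<in> Omega S" shows "jt \<omega> n < \<top> \<longleftrightarrow> regular n \<omega>"
proof (induction n)
  case 0
  then show ?case using assms by (simp add: jt_0 Omega_iff regular_def)
next
  case (Suc n)
  have "regular (Suc n) \<omega> \<or> \<omega> (Suc n) = (None, \<top>)" using assms by (simp add: Omega_iff)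
  then show ?case using Suc by (auto simp: jt_Suc th_def regular_Suc is_jump_def)
qed

context ctmdp_policy
begin

definition sojourn_cost_rate :: "('s \<times> 'b \<Rightarrow> ennreal) \<Rightarrow> 's path \<Rightarrow> nat \<Rightarrow> real \<Rightarrow> ennreal" where
  "sojourn_cost_rate g \<omega> n s = (if regular n \<omega> \<and> 0 < s \<and> ennreal s \<le> th \<omega> (Suc n) then policy_mean n g (history n \<omega>, s) else 0)"

lemma sojourn_time_iff:
  assumes \<omega>: "\<omega> \<in> Omega S" "regular n \<omega>" and t: "0 \<le> t"
  shows "0 < t - enn2real (jt \<omega> n) \<and> ennreal (t - enn2real (jt \<omega> n)) \<le> th \<omega> (Suc n)
      \<longleftrightarrow> jt \<omega> n < ennreal t \<and> ennreal t \<le> jt \<omega> (Suc n)"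
proof -
  obtain r where r: "jt \<omega> n = ennreal r" "0 \<le> r"
    using jt_finite_iff[OF \<omega>(1), of n] \<omega>(2) by (cases "jt \<omega> n") auto
  have start: "0 < t - r \<longleftrightarrow> ennreal r < ennreal t" using r t by (simp add: ennreal_less_iff)
  show ?thesis
  proof (cases "th \<omega> (Suc n)")
    case (real x)
    have "ennreal (t - r) \<le> ennreal x \<longleftrightarrow> ennreal t \<le> ennreal (r + x)" if "r < t"
      using real r by (simp add: ennreal_le_iff algebra_simps del: ennreal_plus)
    then show ?thesis using start r real by (auto simp: jt_Suc)
  next
    case top
    then show ?thesis using start r by (auto simp: jt_Suc)
  qed
qed

lemma sojourn_cost_rate_outside:
  assumes "\<omega> \<in> Omega S" "0 \<le> t" "\<not> (jt \<omega> n < ennreal t \<and> ennreal t \<le> jt \<omega> (Suc n))"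
  shows "sojourn_cost_rate g \<omega> n (t - enn2real (jt \<omega> n)) = 0"
  using assms sojourn_time_iff by (auto simp: sojourn_cost_rate_def)

lemma cost_rate_in_sojourn:
  assumes \<omega>: "\<omega> \<in> Omega S" and t: "0 \<le> t" and n: "jt \<omega> n < ennreal t" "ennreal t < jt \<omega> (Suc n)"
  shows "cost_rate c pol \<omega> t = sojourn_cost_rate (\<lambda>z. ennreal (c z)) \<omega> n (t - enn2real (jt \<omega> n))"
proof -
  have "jt \<omega> n < \<top>" using n(1) by (rule less_trans) simp
  then have r: "regular n \<omega>" using jt_finite_iff[OF \<omega>] by simp
  have "ennreal t < jinf \<omega>" unfolding jinf_def using n(2) by (auto simp: less_SUP_iff)
  moreover have policy_index: "(THE m. jt \<omega> m < ennreal t \<and> ennreal t \<le> jt \<omega> (Suc m)) = n"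
    using n by (intro the_equality) (auto intro: jt_interval_unique[of \<omega> n "ennreal t"])
  moreover have state_index: "(THE m. jt \<omega> m \<le> ennreal t \<and> ennreal t < jt \<omega> (Suc m)) = n"
  proof (rule the_equality)
    fix m assume m: "jt \<omega> m \<le> ennreal t \<and> ennreal t < jt \<omega> (Suc m)"
    consider "Suc m \<le> n" | "m = n" | "Suc n \<le> m" by linarith
    then show "m = n"
    proof cases
      case 1
      then show ?thesis using jt_mono[of "Suc m" n \<omega>] m n by (meson leD less_le_trans order_less_trans)
    next
      case 3
      then show ?thesis using jt_mono[of "Suc n" m \<omega>] m n by (meson leD le_less_trans order_trans)
    qed
  qed (use n in auto)
  moreover have "the (xs \<omega> n) = snd (history n \<omega>)"
    unfolding regular_hist[OF r, symmetric] by (simp add: hist_def)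
  moreover have "0 < t - enn2real (jt \<omega> n) \<and> ennreal (t - enn2real (jt \<omega> n)) \<le> th \<omega> (Suc n)"
    using sojourn_time_iff[OF \<omega> r t] n by simp
  ultimately show ?thesis using n r regular_hist[OF r]
    by (auto simp: cost_rate_def state_at_def polAt_def sojourn_cost_rate_def policy_mean_def intro: less_imp_le)
qed

lemma cost_rate_eq:
  assumes \<omega>: "\<omega> \<in> Omega S" and t: "0 \<le> t" "\<And>n. ennreal t \<noteq> jt \<omega> n"
  shows "cost_rate c pol \<omega> t = (\<Sum>n. sojourn_cost_rate (\<lambda>z. ennreal (c z)) \<omega> n (t - enn2real (jt \<omega> n)))"
proof (cases "\<exists>n. jt \<omega> n < ennreal t \<and> ennreal t \<le> jt \<omega> (Suc n)")
  case True
  then obtain n where n: "jt \<omega> n < ennreal t" "ennreal t \<le> jt \<omega> (Suc n)" by auto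
  then have "ennreal t < jt \<omega> (Suc n)" using t(2)[of "Suc n"] by (simp add: order_less_le)
  from cost_rate_in_sojourn[OF \<omega> t(1) n(1) this]
  have "cost_rate c pol \<omega> t = sojourn_cost_rate (\<lambda>z. ennreal (c z)) \<omega> n (t - enn2real (jt \<omega> n))" .
  also have "\<dots> = (\<Sum>m. sojourn_cost_rate (\<lambda>z. ennreal (c z)) \<omega> m (t - enn2real (jt \<omega> m)))"
    using jt_interval_unique[OF n] sojourn_cost_rate_outside[OF \<omega> t(1)]
    by (subst suminf_finite[of "{n}"]) auto
  finally show ?thesis .
next
  case False
  then show ?thesis using sojourn_cost_rate_outside[OF \<omega> t(1)] by (auto simp: cost_rate_def)
qed

lemma measurable_sojourn_cost_rate:
  assumes g: "g \<in> borel_measurable SA" shows "sojourn_cost_rate g \<omega> n \<in> borel_measurable borel"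
proof -
  have "(\<lambda>s. (history n \<omega>, if 0 < s then s else 1)) \<in> measurable borel (HP n)"
    using history_space by (intro measurable_Pair measurable_into_posR) auto
  from measurable_compose[OF this measurable_policy_mean[OF g]]
  have [measurable]: "(\<lambda>s. policy_mean n g (history n \<omega>, if 0 < s then s else 1)) \<in> borel_measurable borel" .
  have "sojourn_cost_rate g \<omega> n = (\<lambda>s. if regular n \<omega> \<and> 0 < s \<and> ennreal s \<le> th \<omega> (Suc n)
      then policy_mean n g (history n \<omega>, if 0 < s then s else 1) else 0)"
    by (auto simp: sojourn_cost_rate_def)
  also have "\<dots> \<in> borel_measurable borel" by measurable
  finally show ?thesis .
qed

lemma path_cost_eq:
  assumes c: "c \<in> borel_measurable SA" and \<omega>: "\<omega> \<in> Omega S"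
  shows "path_cost c pol \<omega> = (\<Sum>n. \<integral>\<^sup>+s. sojourn_cost_rate (\<lambda>z. ennreal (c z)) \<omega> n s \<partial>lborel)"
proof -
  let ?g = "\<lambda>z. ennreal (c z)"
  have g: "?g \<in> borel_measurable SA" using c by simp
  have "path_cost c pol \<omega> = (\<integral>\<^sup>+t. (\<Sum>n. sojourn_cost_rate ?g \<omega> n (t - enn2real (jt \<omega> n))) \<partial>lborel)"
    unfolding path_cost_def
  proof (intro nn_integral_cong_AE)
    have "AE t in lborel. \<forall>n. t \<noteq> enn2real (jt \<omega> n)" by (simp add: AE_all_countable AE_lborel_singleton)
    then show "AE t in lborel. cost_rate c pol \<omega> t * indicator {0..} t
        = (\<Sum>n. sojourn_cost_rate ?g \<omega> n (t - enn2real (jt \<omega> n)))"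
    proof eventually_elim
      case (elim t)
      show ?case
      proof (cases "0 \<le> t")
        case True
        then have "ennreal t \<noteq> jt \<omega> n" for n using elim[rule_format, of n] by (metis enn2real_ennreal)
        then show ?thesis using cost_rate_eq[OF \<omega> True] True by simp
      next
        case False
        then have "\<not> 0 < t - enn2real (jt \<omega> n)" for n using enn2real_nonneg[of "jt \<omega> n"] by linarith
        then show ?thesis using False by (auto simp: sojourn_cost_rate_def)
      qed
    qed
  qed
  also have "\<dots> = (\<Sum>n. \<integral>\<^sup>+t. sojourn_cost_rate ?g \<omega> n (t - enn2real (jt \<omega> n)) \<partial>lborel)"
    using measurable_sojourn_cost_rate[OF g] by (intro nn_integral_suminf) simp
  also have "\<dots> = (\<Sum>n. \<integral>\<^sup>+s. sojourn_cost_rate ?g \<omega> n s \<partial>lborel)"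
    using nn_integral_real_affine[OF measurable_sojourn_cost_rate[OF g], of 1 \<omega> _ "- enn2real (jt \<omega> _)"]
    by (intro suminf_cong) simp
  finally show ?thesis .
qed

lemma measurable_sojourn_path:
  fixes f :: "_ \<Rightarrow> ennreal" assumes f: "f \<in> borel_measurable (HP n)"
  shows "(\<lambda>z. f (history n (fst z), snd z) * indicator {ennreal (snd z)..} (snd (fst z (Suc n)))) \<in> borel_measurable (path_law \<Otimes>\<^sub>M posR)"
proof -
  have [measurable]: "(\<lambda>z. f (history n (fst z), snd z)) \<in> borel_measurable (path_law \<Otimes>\<^sub>M posR)"
    by (intro measurable_compose[OF measurable_Pair f] measurable_compose[OF measurable_fst measurable_history_P] measurable_snd)
  have [measurable]: "(\<lambda>z. snd z) \<in> borel_measurable (path_law \<Otimes>\<^sub>M posR)"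
    "(\<lambda>z. snd (fst z (Suc n))) \<in> borel_measurable (path_law \<Otimes>\<^sub>M posR)"
    by (rule measurable_compose[OF measurable_snd measurable_posR_borel],
        rule measurable_compose[OF measurable_fst measurable_compose[OF measurable_coordinate measurable_snd]])
  have "(\<lambda>z. if ennreal (snd z) \<le> snd (fst z (Suc n)) then f (history n (fst z), snd z) else 0) \<in> borel_measurable (path_law \<Otimes>\<^sub>M posR)"
    by measurable
  then show ?thesis by (rule measurable_cong[THEN iffD1, rotated]) simp
qed

lemma nn_integral_sojourn:
  assumes f: "f \<in> borel_measurable (HP n)"
  shows "(\<integral>\<^sup>+\<omega>\<in>{\<omega>. regular n \<omega>}. (\<integral>\<^sup>+s. f (history n \<omega>, s) * indicator {ennreal s..} (snd (\<omega> (Suc n))) \<partial>posL) \<partial>path_law)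
    = (\<integral>\<^sup>+h. (\<integral>\<^sup>+s. f (h, s) * survival n (h, s) \<partial>posL) \<partial>hist_law n)"
proof -
  interpret path_law: prob_space path_law by (rule prob_space_path_law)
  interpret posL: sigma_finite_measure posL by (rule sigma_finite_posL)
  interpret path_posL: pair_sigma_finite path_law posL by unfold_locales
  have "emeasure (hist_law n) (space (hist_law n)) \<noteq> \<infinity>"
    using hist_law_mass_le_1[of n] by (auto simp: top_unique)
  then interpret hist: finite_measure "hist_law n" by (rule finite_measureI)
  interpret hist_posL: pair_sigma_finite "hist_law n" posL by unfold_locales
  let ?k = "\<lambda>\<omega> s. f (history n \<omega>, s) * indicator {ennreal s..} (snd (\<omega> (Suc n))) * indicator {\<omega>. regular n \<omega>} \<omega>"
  have path_pair: "sets (path_law \<Otimes>\<^sub>M posL) = sets (path_law \<Otimes>\<^sub>M posR)"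
      and hist_pair: "sets (hist_law n \<Otimes>\<^sub>M posL) = sets (HP n)"
    by (rule sets_pair_measure_cong; simp)+
  have "(\<lambda>z. indicator {\<omega>. regular n \<omega>} (fst z) :: ennreal) \<in> borel_measurable (path_law \<Otimes>\<^sub>M posR)"
    by (rule measurable_compose[OF measurable_fst measurable_indicator_regular])
  from borel_measurable_times_ennreal[OF measurable_sojourn_path[OF f] this]
  have measurable_k: "(\<lambda>(\<omega>, s). ?k \<omega> s) \<in> borel_measurable (path_law \<Otimes>\<^sub>M posL)"
    by (simp add: case_prod_beta' measurable_cong_sets[OF path_pair refl])
  have survival: "(\<lambda>(h, s). f (h, s) * survival n (h, s)) \<in> borel_measurable (hist_law n \<Otimes>\<^sub>M posL)"
    using borel_measurable_times_ennreal[OF f measurable_survival]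
    by (simp add: case_prod_beta' measurable_cong_sets[OF hist_pair refl])
  have "(\<integral>\<^sup>+\<omega>\<in>{\<omega>. regular n \<omega>}. (\<integral>\<^sup>+s. f (history n \<omega>, s) * indicator {ennreal s..} (snd (\<omega> (Suc n))) \<partial>posL) \<partial>path_law)
    = (\<integral>\<^sup>+\<omega>. (\<integral>\<^sup>+s. ?k \<omega> s \<partial>posL) \<partial>path_law)"
    by (intro nn_integral_cong) (simp split: split_indicator)
  also have "\<dots> = (\<integral>\<^sup>+s. (\<integral>\<^sup>+\<omega>. ?k \<omega> s \<partial>path_law) \<partial>posL)"
    by (rule path_posL.Fubini'[OF measurable_k, symmetric])
  also have "\<dots> = (\<integral>\<^sup>+s. (\<integral>\<^sup>+h. f (h, s) * survival n (h, s) \<partial>hist_law n) \<partial>posL)"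
  proof (rule nn_integral_cong)
    fix s assume "s \<in> space posL"
    then have s: "0 < s" by simp
    then have "(\<lambda>h. f (h, s)) \<in> borel_measurable (HM n)"
      by (intro measurable_compose[OF measurable_Pair2' f]) simp
    then show "(\<integral>\<^sup>+\<omega>. ?k \<omega> s \<partial>path_law) = (\<integral>\<^sup>+h. f (h, s) * survival n (h, s) \<partial>hist_law n)"
      by (rule nn_integral_survival[OF _ s])
  qed
  also have "\<dots> = (\<integral>\<^sup>+h. (\<integral>\<^sup>+s. f (h, s) * survival n (h, s) \<partial>posL) \<partial>hist_law n)"
    by (rule hist_posL.Fubini'[OF survival])
  finally show ?thesis .
qed

theorem objective_eq:
  assumes c: "c \<in> borel_measurable SA"
  shows "objective S \<gamma> q c pol = (\<Sum>n. \<integral>\<^sup>+h. sojourn_integral n (\<lambda>z. ennreal (c z)) h \<partial>hist_law n)"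
proof -
  let ?g = "\<lambda>z. ennreal (c z)"
  have g: "?g \<in> borel_measurable SA" using c by simp
  let ?cost = "\<lambda>n \<omega>. (\<integral>\<^sup>+s. policy_mean n ?g (history n \<omega>, s) * indicator {ennreal s..} (snd (\<omega> (Suc n))) \<partial>posL) * indicator {\<omega>. regular n \<omega>} \<omega>"
  have sojourn_cost: "(\<integral>\<^sup>+s. sojourn_cost_rate ?g \<omega> n s \<partial>lborel) = ?cost n \<omega>" for \<omega> n
  proof -
    have "(\<integral>\<^sup>+s. sojourn_cost_rate ?g \<omega> n s \<partial>lborel)
      = (\<integral>\<^sup>+s. policy_mean n ?g (history n \<omega>, s) * indicator {ennreal s..} (snd (\<omega> (Suc n))) * indicator {\<omega>. regular n \<omega>} \<omega> \<partial>posL)"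
      unfolding nn_integral_posL
      by (intro nn_integral_cong) (auto simp: sojourn_cost_rate_def th_def split: split_indicator)
    then show ?thesis by (cases "regular n \<omega>") simp_all
  qed
  have [measurable]: "?cost n \<in> borel_measurable path_law" for n
    using measurable_posL_integral[OF measurable_sojourn_path[OF measurable_policy_mean[OF g]]]
    by (intro borel_measurable_times_ennreal measurable_indicator_regular) simp
  have "objective S \<gamma> q c pol = (\<integral>\<^sup>+\<omega>. (\<Sum>n. ?cost n \<omega>) \<partial>path_law)"
    unfolding objective_def Pstrat_eq_path_law
    using AE_Omega
    by (intro nn_integral_cong_AE, eventually_elim) (simp add: path_cost_eq[OF c] sojourn_cost)
  also have "\<dots> = (\<Sum>n. \<integral>\<^sup>+\<omega>. ?cost n \<omega> \<partial>path_law)" by (rule nn_integral_suminf) measurable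
  also have "\<dots> = (\<Sum>n. \<integral>\<^sup>+h. sojourn_integral n ?g h \<partial>hist_law n)"
    using nn_integral_sojourn[OF measurable_policy_mean[OF g]]
    by (simp add: sojourn_integral_def mult.commute)
  finally show ?thesis .
qed

end

section \<open>Occupation sequences of the embedded chain\<close>

context ctmdp
begin

definition occupation_seq :: "(nat \<Rightarrow> ('s \<times> 'b) measure) \<Rightarrow> bool" where
  "occupation_seq \<mu> \<longleftrightarrow> (\<forall>n. sets (\<mu> n) = sets SA) \<and>
    (\<forall>f\<in>borel_measurable (SM S). (\<integral>\<^sup>+z. f (fst z) \<partial>\<mu> 0) = (\<integral>\<^sup>+x. f x \<partial>\<gamma>)) \<and>
    (\<forall>n. \<forall>f\<in>borel_measurable (SM S). (\<integral>\<^sup>+z. f (fst z) \<partial>\<mu> (Suc n)) = (\<integral>\<^sup>+z. (\<integral>\<^sup>+y. f y \<partial>jump_kernel z) \<partial>\<mu> n))"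

lemma occupation_seqD:
  assumes "occupation_seq \<mu>"
  shows "sets (\<mu> n) = sets SA" "space (\<mu> n) = S \<times> A"
    "f \<in> borel_measurable (SM S) \<Longrightarrow> (\<integral>\<^sup>+z. f (fst z) \<partial>\<mu> 0) = (\<integral>\<^sup>+x. f x \<partial>\<gamma>)"
    "f \<in> borel_measurable (SM S) \<Longrightarrow> (\<integral>\<^sup>+z. f (fst z) \<partial>\<mu> (Suc n)) = (\<integral>\<^sup>+z. (\<integral>\<^sup>+y. f y \<partial>jump_kernel z) \<partial>\<mu> n)"
proof -
  show sets: "sets (\<mu> n) = sets SA" using assms by (simp add: occupation_seq_def)
  show "space (\<mu> n) = S \<times> A" using sets_eq_imp_space_eq[OF sets] by simp
qed (use assms in \<open>auto simp: occupation_seq_def\<close>)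

lemma occupation_seq_mass_le_1: assumes "occupation_seq \<mu>" shows "emeasure (\<mu> n) (S \<times> A) \<le> 1"
proof (induction n)
  case 0
  have "emeasure (\<mu> 0) (S \<times> A) = (\<integral>\<^sup>+x. 1 \<partial>\<gamma>)"
    using occupation_seqD(3)[OF assms, of "\<lambda>_. 1"] occupation_seqD(2)[OF assms, of 0] by simp
  then show ?case using prob_space.emeasure_space_1[OF gamma(1)] by simp
next
  case (Suc n)
  have "emeasure (\<mu> (Suc n)) (S \<times> A) = (\<integral>\<^sup>+z. (\<integral>\<^sup>+y. 1 \<partial>jump_kernel z) \<partial>\<mu> n)"
    using occupation_seqD(4)[OF assms, of "\<lambda>_. 1" n] occupation_seqD(2)[OF assms, of "Suc n"] by simp
  also have "\<dots> \<le> (\<integral>\<^sup>+z. 1 \<partial>\<mu> n)"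
    using emeasure_jump_kernel_space
    by (intro nn_integral_mono) (auto simp: occupation_seqD(2)[OF assms])
  finally show ?case using Suc occupation_seqD(2)[OF assms, of n] by simp
qed

end

locale ctmdp_costs = ctmdp S A \<gamma> q for S :: "'s::polish_space set" and A :: "'b::polish_space set" and \<gamma> q +
  fixes c :: "nat \<Rightarrow> 's \<times> 'b \<Rightarrow> real" and N :: nat
  assumes c_meas: "\<forall>i\<le>N. c i \<in> borel_measurable SA"
    and c_nonneg: "\<forall>i\<le>N. \<forall>z\<in>S \<times> A. 0 \<le> c i z"
    and c_lsc: "\<forall>i\<le>N. lsc_on (S \<times> A) (c i)"
begin

lemma measurable_c[measurable]: "i \<le> N \<Longrightarrow> c i \<in> borel_measurable SA"
  using c_meas by simp

lemma lsc_c: "i \<le> N \<Longrightarrow> lsc (S \<times> A) (\<lambda>z. ennreal (c i z))"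
  using c_lsc c_nonneg by (intro lsc_of_lsc_on) auto

lemma measurable_jump_cost: "i \<le> N \<Longrightarrow> jump_cost (c i) \<in> borel_measurable SA"
  unfolding jump_cost_def[abs_def]
  by (intro borel_measurable_divide_ennreal measurable_rate measurable_compose[OF measurable_c measurable_ennreal])

lemma lsc_jump_cost_c: "i \<le> N \<Longrightarrow> lsc (S \<times> A) (jump_cost (c i))"
  using c_lsc c_nonneg by (intro lsc_jump_cost) auto

definition rest_cost :: "'s \<times> 'b \<Rightarrow> ennreal" where
  "rest_cost z = rate z + (\<Sum>i\<le>N. ennreal (c i z))"

lemma lsc_rest_cost: "lsc (S \<times> A) rest_cost"
  unfolding rest_cost_def[abs_def] by (intro lsc_add lsc_rate lsc_sum lsc_c) simp

definition rest_action :: "'s \<Rightarrow> 'b" where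
  "rest_action = zero_selector S A rest_cost"

lemma measurable_rest_action[measurable]: "rest_action \<in> measurable (SM S) (SM A)"
  unfolding rest_action_def by (rule measurable_zero_selector[OF A_compact A_ne lsc_rest_cost])

lemma rest_action_in_A: "x \<in> S \<Longrightarrow> rest_action x \<in> A"
  using measurable_space[OF measurable_rest_action] by simp

lemma rest_action_eq_0: "x \<in> S \<Longrightarrow> a \<in> A \<Longrightarrow> rest_cost (x, a) = 0 \<Longrightarrow> rest_cost (x, rest_action x) = 0"
  unfolding rest_action_def by (rule zero_selector_eq_0[OF A_compact A_ne lsc_rest_cost])

end

locale ctmdp_costs_policy = ctmdp_costs S A \<gamma> q c N + ctmdp_policy S A \<gamma> q pol
  for S :: "'s::polish_space set" and A :: "'b::polish_space set" and \<gamma> q c N pol +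
  assumes finite_costs: "\<And>i. i \<le> N \<Longrightarrow> objective S \<gamma> q (c i) pol < \<top>"
begin

lemma sojourn_integral_mono: "(\<And>z. f z \<le> g z) \<Longrightarrow> sojourn_integral n f h \<le> sojourn_integral n g h"
  unfolding sojourn_integral_def policy_mean_def by (intro nn_integral_mono mult_left_mono) simp_all

lemma AE_sojourn_cost_finite: assumes i: "i \<le> N"
  shows "AE h in hist_law n. sojourn_integral n (\<lambda>z. ennreal (c i z)) h < \<top>"
proof -
  let ?cost = "\<lambda>n. \<integral>\<^sup>+h. sojourn_integral n (\<lambda>z. ennreal (c i z)) h \<partial>hist_law n"
  have "?cost n \<le> (\<Sum>k. ?cost k)" using sum_le_suminf[of ?cost "{n}"] by simp
  also have "\<dots> = objective S \<gamma> q (c i) pol" using i by (simp add: objective_eq measurable_c)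
  finally have "?cost n \<noteq> \<infinity>" using finite_costs[OF i] by (auto simp: top_unique)
  moreover have "sojourn_integral n (\<lambda>z. ennreal (c i z)) \<in> borel_measurable (hist_law n)"
    using measurable_sojourn_integral[OF measurable_compose[OF measurable_c[OF i] measurable_ennreal]]
    by simp
  ultimately have "AE h in hist_law n. sojourn_integral n (\<lambda>z. ennreal (c i z)) h \<noteq> \<infinity>"
by (intro nn_integral_PInf_AE)
  then show ?thesis by (simp add: less_top)
qed

lemma sojourn_integral_const_top:
  assumes h: "h \<in> space (HM n)" and "jump_mass n h < 1" "0 < \<epsilon>"
  shows "sojourn_integral n (\<lambda>_. \<epsilon>) h = \<top>"
proof -
  have "\<top> = (\<integral>\<^sup>+s. (1 - jump_mass n h) * \<epsilon> \<partial>posL)"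
    using assms(2,3) by (simp add: emeasure_posL ennreal_mult_eq_top_iff diff_eq_0_iff_ennreal not_le)
  also have "\<dots> \<le> (\<integral>\<^sup>+s. survival n (h, s) * \<epsilon> \<partial>posL)"
    by (intro nn_integral_mono mult_right_mono) (simp_all add: survival_eq_jump_after[OF h])
  also have "\<dots> = sojourn_integral n (\<lambda>_. \<epsilon>) h"
    unfolding sojourn_integral_def policy_mean_def
    using prob_space.emeasure_space_1[OF pol_prob(1)[OF h]] by (intro nn_integral_cong) simp
  finally show ?thesis by (simp add: top_unique)
qed

lemma sojourn_integral_rest_cost:
  assumes h: "h \<in> space (HM n)"
  shows "sojourn_integral n rest_cost h = jump_mass n h + (\<Sum>i\<le>N. sojourn_integral n (\<lambda>z. ennreal (c i z)) h)"
proof -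
  have measurable_cost: "(\<lambda>z. ennreal (c i z)) \<in> borel_measurable SA" if "i \<le> N" for i
    using that by (intro measurable_compose[OF measurable_c measurable_ennreal])
  note functional = pos_functional_sojourn_integral[OF h]
  have "sojourn_integral n (\<lambda>z. rate z + (\<Sum>i\<le>N. ennreal (c i z))) h
    = jump_mass n h + sojourn_integral n (\<lambda>z. \<Sum>i\<le>N. ennreal (c i z)) h"
    unfolding jump_mass_def
    using measurable_cost
    by (intro pos_functionalD(2)[OF functional] measurable_rate borel_measurable_sum) simp
  also have "sojourn_integral n (\<lambda>z. \<Sum>i\<le>N. ennreal (c i z)) h
      = (\<Sum>i\<le>N. sojourn_integral n (\<lambda>z. ennreal (c i z)) h)"
    using measurable_cost by (intro pos_functional_sum[OF functional]) simp_all
  finally show ?thesis by (simp add: rest_cost_def[abs_def])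
qed

lemma rest_action_free:
  assumes h: "h \<in> space (HM n)" and fin: "\<And>i. i \<le> N \<Longrightarrow> sojourn_integral n (\<lambda>z. ennreal (c i z)) h < \<top>"
    and lt: "jump_mass n h < 1"
  shows "rest_cost (snd h, rest_action (snd h)) = 0"
proof (rule ccontr)
  assume rest: "rest_cost (snd h, rest_action (snd h)) \<noteq> 0"
  have x: "snd h \<in> S" by (rule snd_HM[OF h])
  have "lsc A (\<lambda>a. rest_cost (snd h, a))"
    using x by (intro lsc_compose[OF lsc_rest_cost] continuous_intros) auto
  from lsc_attains_INF[OF this A_compact A_ne]
  obtain b where b: "b \<in> A" "rest_cost (snd h, b) = (INF a\<in>A. rest_cost (snd h, a))" by blast
  define \<epsilon> where "\<epsilon> = rest_cost (snd h, b)"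
  have min: "\<epsilon> \<le> rest_cost (snd h, a)" if "a \<in> A" for a unfolding \<epsilon>_def b(2)
    using that by (rule INF_lower)
  have "0 < \<epsilon>" using rest_action_eq_0[OF x b(1)] rest by (auto simp: \<epsilon>_def zero_less_iff_neq_zero)
  then have "\<top> = sojourn_integral n (\<lambda>_. \<epsilon>) h" by (rule sojourn_integral_const_top[OF h lt, symmetric])
  also have "\<dots> \<le> sojourn_integral n rest_cost h"
    unfolding sojourn_integral_def policy_mean_def
    using min by (intro nn_integral_mono mult_left_mono) (simp_all add: pol_prob(3)[OF h])
  also have "\<dots> < \<top>" using jump_mass_le_1[OF h] fin
    by (auto simp: sojourn_integral_rest_cost[OF h] less_top[symmetric] top_unique)
  finally show False by simp
qed

lemma AE_rest: "AE h in hist_law n. jump_mass n h = 1 \<or> rest_cost (snd h, rest_action (snd h)) = 0"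
proof -
  have "AE h in hist_law n. \<forall>i\<in>{..N}. sojourn_integral n (\<lambda>z. ennreal (c i z)) h < \<top>"
    by (intro AE_finite_allI) (auto intro: AE_sojourn_cost_finite)
  with AE_space show ?thesis
  proof eventually_elim
    case (elim h)
    then show ?case using rest_action_free[of h n] jump_mass_le_1[of h n] by (auto simp: order_less_le)
  qed
qed

(* The mass that never jumps is put on an action of rate and cost zero; finiteness of the costs provides one. *)
definition policy_occupation :: "nat \<Rightarrow> ('s \<times> 'b) measure" where
  "policy_occupation n = functional_measure SA
    (\<lambda>g. \<integral>\<^sup>+h. sojourn_integral n (\<lambda>z. rate z * g z) h + (1 - jump_mass n h) * g (snd h, rest_action (snd h)) \<partial>hist_law n)"

lemma nn_integral_policy_occupation:
  assumes g: "g \<in> borel_measurable SA"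
  shows "(\<integral>\<^sup>+z. g z \<partial>policy_occupation n)
    = (\<integral>\<^sup>+h. sojourn_integral n (\<lambda>z. rate z * g z) h + (1 - jump_mass n h) * g (snd h, rest_action (snd h)) \<partial>hist_law n)"
  unfolding policy_occupation_def
proof (rule nn_integral_functional_measure[OF pos_functional_integral g])
  fix h assume "h \<in> space (hist_law n)"
  then have h: "h \<in> space (HM n)" by simp
  then show "pos_functional SA (\<lambda>g. sojourn_integral n (\<lambda>z. rate z * g z) h + (1 - jump_mass n h) * g (snd h, rest_action (snd h)))"
    by (intro pos_functional_add pos_functional_cmult pos_functional_eval pos_functional_density pos_functional_sojourn_integral measurable_rate)
      (simp_all add: snd_HM rest_action_in_A)
next
  fix g :: "_ \<Rightarrow> ennreal" assume g[measurable]: "g \<in> borel_measurable SA"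
  have [measurable]: "(\<lambda>h. g (snd h, rest_action (snd h))) \<in> borel_measurable (HM n)" by measurable
  show "(\<lambda>h. sojourn_integral n (\<lambda>z. rate z * g z) h + (1 - jump_mass n h) * g (snd h, rest_action (snd h))) \<in> borel_measurable (hist_law n)"
    by measurable
qed

lemma policy_occupation_marginal: assumes f[measurable]: "f \<in> borel_measurable (SM S)"
  shows "(\<integral>\<^sup>+z. f (fst z) \<partial>policy_occupation n) = (\<integral>\<^sup>+h. f (snd h) \<partial>hist_law n)"
proof -
  have "(\<lambda>z. f (fst z)) \<in> borel_measurable SA" by measurable
  from nn_integral_policy_occupation[OF this]
  have "(\<integral>\<^sup>+z. f (fst z) \<partial>policy_occupation n)
    = (\<integral>\<^sup>+h. sojourn_integral n (\<lambda>z. rate z * f (fst z)) h + (1 - jump_mass n h) * f (snd h) \<partial>hist_law n)" by simp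
  also have "\<dots> = (\<integral>\<^sup>+h. f (snd h) \<partial>hist_law n)"
    by (intro nn_integral_cong)
      (simp add: sojourn_integral_mult_state jump_mass_le_1 add_diff_inverse_ennreal flip: jump_mass_def distrib_right)
  finally show ?thesis .
qed

lemma occupation_seq_policy_occupation: "occupation_seq policy_occupation"
  unfolding occupation_seq_def
proof (intro conjI allI ballI)
  show "sets (policy_occupation n) = sets SA" for n by (simp add: policy_occupation_def)
next
  fix f :: "'s \<Rightarrow> ennreal" assume f: "f \<in> borel_measurable (SM S)"
  show "(\<integral>\<^sup>+z. f (fst z) \<partial>policy_occupation 0) = (\<integral>\<^sup>+x. f x \<partial>\<gamma>)"
    by (simp add: policy_occupation_marginal[OF f] nn_integral_hist_law_0[OF f])
next
  fix n and f :: "'s \<Rightarrow> ennreal" assume f: "f \<in> borel_measurable (SM S)"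
  have "(\<integral>\<^sup>+z. f (fst z) \<partial>policy_occupation (Suc n))
    = (\<integral>\<^sup>+h. sojourn_integral n (\<lambda>z. rate z * (\<integral>\<^sup>+y. f y \<partial>jump_kernel z)) h \<partial>hist_law n)"
    by (simp add: policy_occupation_marginal[OF f] nn_integral_hist_law_Suc[OF f])
  also have "\<dots> = (\<integral>\<^sup>+h. sojourn_integral n (\<lambda>z. rate z * (\<integral>\<^sup>+y. f y \<partial>jump_kernel z)) h
      + (1 - jump_mass n h) * (\<integral>\<^sup>+y. f y \<partial>jump_kernel (snd h, rest_action (snd h))) \<partial>hist_law n)"
    using AE_rest[of n] AE_space[of "hist_law n"]
  proof (intro nn_integral_cong_AE, eventually_elim)
    case (elim h)
    have "(\<integral>\<^sup>+y. f y \<partial>jump_kernel (snd h, rest_action (snd h))) = 0" if "jump_mass n h \<noteq> 1"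
      using elim that snd_HM[of h n]
      by (intro nn_integral_jump_kernel_rate_0) (auto simp: rest_cost_def rest_action_in_A)
    then show ?case by (cases "jump_mass n h = 1") simp_all
  qed
  also have "\<dots> = (\<integral>\<^sup>+z. (\<integral>\<^sup>+y. f y \<partial>jump_kernel z) \<partial>policy_occupation n)"
    by (rule nn_integral_policy_occupation[OF measurable_nn_integral_jump_kernel[OF f], symmetric])
  finally show "(\<integral>\<^sup>+z. f (fst z) \<partial>policy_occupation (Suc n))
      = (\<integral>\<^sup>+z. (\<integral>\<^sup>+y. f y \<partial>jump_kernel z) \<partial>policy_occupation n)" .
qed

lemma policy_occupation_cost_le: assumes i: "i \<le> N"
  shows "(\<Sum>n. \<integral>\<^sup>+z. jump_cost (c i) z \<partial>policy_occupation n) \<le> objective S \<gamma> q (c i) pol"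
proof -
  have "(\<integral>\<^sup>+z. jump_cost (c i) z \<partial>policy_occupation n)
      \<le> (\<integral>\<^sup>+h. sojourn_integral n (\<lambda>z. ennreal (c i z)) h \<partial>hist_law n)" for n
    unfolding nn_integral_policy_occupation[OF measurable_jump_cost[OF i]]
    using AE_rest[of n]
  proof (intro nn_integral_mono_AE, eventually_elim)
    case (elim h)
    have "jump_cost (c i) (snd h, rest_action (snd h)) = 0" if "jump_mass n h \<noteq> 1"
      using elim that i by (simp add: rest_cost_def jump_cost_def sum_eq_0_iff)
    then have rest: "(1 - jump_mass n h) * jump_cost (c i) (snd h, rest_action (snd h)) = 0"
      by (cases "jump_mass n h = 1") simp_all
    show ?case unfolding rest add_0_right by (intro sojourn_integral_mono rate_mult_jump_cost_le)
  qed
  then show ?thesis using i by (simp add: objective_eq measurable_c suminf_le)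
qed

end

section \<open>Compactness of occupation sequences\<close>

lemma sets_SM_generator:
  fixes S :: "'a::topological_space set"
  assumes "S \<in> sets borel" shows "sets (SM S) = sigma_sets S ((\<inter>) S ` {U. open U})"
proof -
  have borel: "sets borel = sigma_sets UNIV {U :: 'a set. open U}" by (simp add: borel_def)
  then have "sets (SM S) = (\<inter>) S ` sigma_sets UNIV {U. open U}" by (simp add: SM_def sets_restrict_space)
  also have "\<dots> = sigma_sets S ((\<inter>) S ` {U. open U})"
    using assms by (intro sigma_sets_Int) (simp_all flip: borel)
  finally show ?thesis .
qed

context
  fixes S :: "'s::{metric_space,second_countable_topology} set" and M N :: "'s measure"
  assumes sets: "sets M = sets (SM S)" "sets N = sets (SM S)"
    and eq: "\<And>f B. continuous_on S f \<Longrightarrow> (\<And>x. 0 \<le> f x) \<Longrightarrow> (\<And>x. f x \<le> B) \<Longrightarrow>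
        (\<integral>\<^sup>+x. ennreal (f x) \<partial>M) = (\<integral>\<^sup>+x. ennreal (f x) \<partial>N)"
begin

lemma nn_integral_lsc_eqI:
  assumes h: "lsc S h" shows "(\<integral>\<^sup>+x. h x \<partial>M) = (\<integral>\<^sup>+x. h x \<partial>N)"
proof -
  obtain \<phi> :: "nat \<Rightarrow> 's \<Rightarrow> real" and B where cont: "\<And>n. continuous_on UNIV (\<phi> n)"
    and nonneg: "\<And>n x. 0 \<le> \<phi> n x" and bound: "\<And>n x. \<phi> n x \<le> B n" and inc: "\<And>x. incseq (\<lambda>n. \<phi> n x)"
    and h_eq: "\<And>x. x \<in> S \<Longrightarrow> h x = (SUP n. ennreal (\<phi> n x))"
    by (rule lsc_increasing_approx[OF h]; rule that; assumption)
  have contS: "continuous_on S (\<phi> n)" for n by (rule continuous_on_subset[OF cont]) simp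
  have "(\<integral>\<^sup>+x. h x \<partial>L) = (SUP n. \<integral>\<^sup>+x. ennreal (\<phi> n x) \<partial>L)" if L: "sets L = sets (SM S)" for L
    using continuous_on_measurable_SM[OF contS] inc h_eq sets_eq_imp_space_eq[OF L]
    by (intro nn_integral_eq_SUP_approx) (simp_all add: measurable_cong_sets[OF L refl])
  then show ?thesis using sets eq[OF contS nonneg bound] by simp
qed

lemma finite_measure_eqI_continuous:
  assumes S: "S \<in> sets borel" and fin: "emeasure M S \<noteq> \<infinity>" shows "M = N"
proof (rule measure_eqI_generator_eq[where E="(\<inter>) S ` {U. open U}" and \<Omega>=S and A="\<lambda>_. S"])
  show "Int_stable ((\<inter>) S ` {U. open U})"
  proof (rule Int_stableI)
    fix X Y assume "X \<in> (\<inter>) S ` {U. open U}" "Y \<in> (\<inter>) S ` {U. open U}"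
    then obtain U V where "X = S \<inter> U" "Y = S \<inter> V" "open U" "open V" by auto
    then have "X \<inter> Y = S \<inter> (U \<inter> V)" "open (U \<inter> V)" by auto
    then show "X \<inter> Y \<in> (\<inter>) S ` {U. open U}" by blast
  qed
  show "sets M = sigma_sets S ((\<inter>) S ` {U. open U})" "sets N = sigma_sets S ((\<inter>) S ` {U. open U})"
    by (simp_all only: sets sets_SM_generator[OF S])
  fix X assume "X \<in> (\<inter>) S ` {U. open U}"
  then obtain U where U: "open U" "X = S \<inter> U" by auto
  have "emeasure L X = (\<integral>\<^sup>+x. indicator U x \<partial>L)" if L: "sets L = sets (SM S)" for L
  proof -
    have "X \<in> sets L" using U by (simp add: L SM_def sets_restrict_space)
    then have "emeasure L X = (\<integral>\<^sup>+x. indicator X x \<partial>L)" by simp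
    also have "\<dots> = (\<integral>\<^sup>+x. indicator U x \<partial>L)"
      using sets_eq_imp_space_eq[OF L] by (intro nn_integral_cong) (simp add: U indicator_def)
    finally show ?thesis .
  qed
  moreover have "(\<integral>\<^sup>+x. indicator U x \<partial>M) = (\<integral>\<^sup>+x. indicator U x \<partial>N)"
    by (intro nn_integral_lsc_eqI lsc_subset[OF lsc_indicator[OF U(1)]]) simp
  ultimately show "emeasure M X = emeasure N X" using sets by simp
qed (use fin in auto)

end

lemma suminf_liminf_le:
  fixes u :: "nat \<Rightarrow> nat \<Rightarrow> ennreal"
  shows "(\<Sum>n. liminf (\<lambda>k. u k n)) \<le> liminf (\<lambda>k. \<Sum>n. u k n)"
  using nn_integral_liminf[of u "count_space UNIV"] by (simp add: nn_integral_count_space_nat)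

context ctmdp
begin

definition weak_limit :: "(nat \<Rightarrow> ('s \<times> 'b) measure) \<Rightarrow> ('s \<times> 'b) measure \<Rightarrow> bool" where
  "weak_limit M \<mu> \<longleftrightarrow> sets \<mu> = sets SA \<and> (\<lambda>k. emeasure (M k) (S \<times> A)) \<longlonglongrightarrow> emeasure \<mu> (S \<times> A) \<and>
    (\<forall>h. lsc (S \<times> A) h \<longrightarrow> (\<integral>\<^sup>+z. h z \<partial>\<mu>) \<le> liminf (\<lambda>k. \<integral>\<^sup>+z. h z \<partial>M k))"

lemma weak_limitD:
  assumes "weak_limit M \<mu>"
  shows "sets \<mu> = sets SA" "space \<mu> = S \<times> A" "(\<lambda>k. emeasure (M k) (S \<times> A)) \<longlonglongrightarrow> emeasure \<mu> (S \<times> A)"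
    "lsc (S \<times> A) h \<Longrightarrow> (\<integral>\<^sup>+z. h z \<partial>\<mu>) \<le> liminf (\<lambda>k. \<integral>\<^sup>+z. h z \<partial>M k)"
proof -
  show sets: "sets \<mu> = sets SA" using assms by (simp add: weak_limit_def)
  show "space \<mu> = S \<times> A" using sets_eq_imp_space_eq[OF sets] by simp
qed (use assms in \<open>auto simp: weak_limit_def\<close>)

lemma weak_limit_subseq:
  assumes w: "weak_limit M \<mu>" and r: "strict_mono r" shows "weak_limit (\<lambda>k. M (r k)) \<mu>"
  unfolding weak_limit_def
proof (intro conjI allI impI weak_limitD(1)[OF w])
  show "(\<lambda>k. emeasure (M (r k)) (S \<times> A)) \<longlonglongrightarrow> emeasure \<mu> (S \<times> A)"
    using LIMSEQ_subseq_LIMSEQ[OF weak_limitD(3)[OF w] r] by (simp add: o_def)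
  fix h assume "lsc (S \<times> A) h"
  then have "(\<integral>\<^sup>+z. h z \<partial>\<mu>) \<le> liminf (\<lambda>k. \<integral>\<^sup>+z. h z \<partial>M k)" by (rule weak_limitD(4)[OF w])
  also have "\<dots> \<le> liminf (\<lambda>k. \<integral>\<^sup>+z. h z \<partial>M (r k))"
    using liminf_subseq_mono[OF r, of "\<lambda>k. \<integral>\<^sup>+z. h z \<partial>M k"] by (simp add: o_def)
  finally show "(\<integral>\<^sup>+z. h z \<partial>\<mu>) \<le> liminf (\<lambda>k. \<integral>\<^sup>+z. h z \<partial>M (r k))" .
qed

lemma weak_limit_offset: assumes w: "weak_limit (\<lambda>k. M (k + m)) \<mu>" shows "weak_limit M \<mu>"
  using w LIMSEQ_offset[of "\<lambda>k. emeasure (M k) (S \<times> A)" m] liminf_shift_k[of "\<lambda>k. \<integral>\<^sup>+z. h z \<partial>M k" m for h]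
  unfolding weak_limit_def by auto

lemma weak_limit_mass_le_1:
  assumes w: "weak_limit M \<mu>" and M: "\<And>k. emeasure (M k) (S \<times> A) \<le> 1" shows "emeasure \<mu> (S \<times> A) \<le> 1"
  by (rule LIMSEQ_le_const2[OF weak_limitD(3)[OF w]]) (use M in auto)

lemma weak_limit_tendsto:
  assumes w: "weak_limit M \<mu>" and M: "\<And>k. sets (M k) = sets SA" "\<And>k. emeasure (M k) (S \<times> A) \<le> 1"
    and f: "continuous_on (S \<times> A) f" "\<And>z. z \<in> S \<times> A \<Longrightarrow> 0 \<le> f z" "\<And>z. z \<in> S \<times> A \<Longrightarrow> f z \<le> B"
  shows "(\<lambda>k. \<integral>\<^sup>+z. ennreal (f z) \<partial>M k) \<longlonglongrightarrow> (\<integral>\<^sup>+z. ennreal (f z) \<partial>\<mu>)"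
proof (rule tendsto_of_lsc_bounds[where T="S \<times> A"])
  show "space (M k) = S \<times> A" for k using sets_eq_imp_space_eq[OF M(1)] by simp
  show "(\<lambda>z. z) \<in> measurable (M k) borel" for k
    unfolding measurable_cong_sets[OF M(1) refl] by (rule measurable_pair_SM_borel)
  show "(\<lambda>z. z) \<in> measurable \<mu> borel"
    unfolding measurable_cong_sets[OF weak_limitD(1)[OF w] refl] by (rule measurable_pair_SM_borel)
  show "emeasure \<mu> (S \<times> A) < \<infinity>" using weak_limit_mass_le_1[OF w M(2)] by (rule order.strict_trans1) simp
qed (use f weak_limitD[OF w] in auto)

definition next_state_law :: "('s \<times> 'b) measure \<Rightarrow> 's measure" where
  "next_state_law \<mu> = functional_measure (SM S) (\<lambda>f. \<integral>\<^sup>+z. (\<integral>\<^sup>+y. f y \<partial>jump_kernel z) \<partial>\<mu>)"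

lemma sets_next_state_law[simp]: "sets (next_state_law \<mu>) = sets (SM S)"
  by (simp add: next_state_law_def)

lemma nn_integral_next_state_law:
  assumes "sets \<mu> = sets SA" "f \<in> borel_measurable (SM S)"
  shows "(\<integral>\<^sup>+x. f x \<partial>next_state_law \<mu>) = (\<integral>\<^sup>+z. (\<integral>\<^sup>+y. f y \<partial>jump_kernel z) \<partial>\<mu>)"
  unfolding next_state_law_def
proof (rule nn_integral_functional_measure[OF pos_functional_integral assms(2)])
  show "pos_functional (SM S) (integral\<^sup>N (jump_kernel z))" for z
    by (rule pos_functional_nn_integral) simp
  show "g \<in> borel_measurable (SM S) \<Longrightarrow> (\<lambda>z. integral\<^sup>N (jump_kernel z) g) \<in> borel_measurable \<mu>" for g
    using measurable_nn_integral_jump_kernel[of g] by (simp add: measurable_cong_sets[OF assms(1) refl])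
qed

lemma next_state_law_mass_le_1:
  assumes "sets \<mu> = sets SA" "emeasure \<mu> (S \<times> A) \<le> 1" shows "emeasure (next_state_law \<mu>) S \<le> 1"
proof -
  have space: "space \<mu> = S \<times> A" using sets_eq_imp_space_eq[OF assms(1)] by simp
  have "emeasure (next_state_law \<mu>) S = (\<integral>\<^sup>+x. 1 \<partial>next_state_law \<mu>)"
    using sets_eq_imp_space_eq[OF sets_next_state_law[of \<mu>]] by simp
  also have "\<dots> = (\<integral>\<^sup>+z. (\<integral>\<^sup>+y. 1 \<partial>jump_kernel z) \<partial>\<mu>)"
    by (rule nn_integral_next_state_law[OF assms(1)]) simp
  also have "\<dots> \<le> (\<integral>\<^sup>+z. 1 \<partial>\<mu>)"
    using emeasure_jump_kernel_space by (intro nn_integral_mono) (auto simp: space)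
  also have "\<dots> \<le> 1" using assms(2) by (simp add: space)
  finally show ?thesis .
qed

lemma measurable_ennreal_continuous: "continuous_on S f \<Longrightarrow> (\<lambda>x. ennreal (f x)) \<in> borel_measurable (SM S)"
  by (rule measurable_compose[OF continuous_on_measurable_SM measurable_ennreal])

lemma occupation_step_tendsto:
  assumes o: "\<And>k. occupation_seq (\<mu> k)" and w: "weak_limit (\<lambda>k. \<mu> k n) \<mu>'"
    and f: "continuous_on S f" "\<And>x. 0 \<le> f x" "\<And>x. f x \<le> B"
  shows "(\<lambda>k. \<integral>\<^sup>+z. ennreal (f (fst z)) \<partial>\<mu> k (Suc n)) \<longlonglongrightarrow> (\<integral>\<^sup>+x. ennreal (f x) \<partial>next_state_law \<mu>')"
proof -
  have B: "0 \<le> B" using f(2,3) order_trans by blast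
  have f_meas: "f \<in> borel_measurable (SM S)" by (rule continuous_on_measurable_SM[OF f(1)])
  note jump_mean = nn_integral_jump_kernel_eq[OF _ f_meas f(2,3)]
  have "(\<lambda>k. \<integral>\<^sup>+z. ennreal (jump_mean f z) \<partial>\<mu> k n) \<longlonglongrightarrow> (\<integral>\<^sup>+z. ennreal (jump_mean f z) \<partial>\<mu>')"
    by (rule weak_limit_tendsto[OF w occupation_seqD(1)[OF o] occupation_seq_mass_le_1[OF o]
          continuous_on_jump_mean[OF f] jump_mean(2) jump_mean(3)[OF _ B]])
  moreover have "(\<integral>\<^sup>+z. ennreal (jump_mean f z) \<partial>\<mu>') = (\<integral>\<^sup>+x. ennreal (f x) \<partial>next_state_law \<mu>')"
    unfolding nn_integral_next_state_law[OF weak_limitD(1)[OF w] measurable_ennreal_continuous[OF f(1)]]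
    by (intro nn_integral_cong jump_mean(1)[symmetric]) (simp add: weak_limitD(2)[OF w])
  moreover have "(\<integral>\<^sup>+z. ennreal (f (fst z)) \<partial>\<mu> k (Suc n)) = (\<integral>\<^sup>+z. ennreal (jump_mean f z) \<partial>\<mu> k n)" for k
    unfolding occupation_seqD(4)[OF o measurable_ennreal_continuous[OF f(1)]]
    by (intro nn_integral_cong jump_mean(1)) (simp add: occupation_seqD(2)[OF o])
  ultimately show ?thesis by simp
qed

lemma ex_weak_limit:
  assumes M: "\<And>k. sets (M k) = sets SA" "\<And>k. emeasure (M k) (S \<times> A) \<le> 1"
    and m: "sets m = sets (SM S)" "emeasure m S \<le> 1"
    and conv: "\<And>f B. continuous_on S f \<Longrightarrow> (\<And>x. 0 \<le> f x) \<Longrightarrow> (\<And>x. f x \<le> B) \<Longrightarrow>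
      (\<lambda>k. \<integral>\<^sup>+z. ennreal (f (fst z)) \<partial>M k) \<longlonglongrightarrow> (\<integral>\<^sup>+x. ennreal (f x) \<partial>m)"
  shows "\<exists>r \<mu>. strict_mono r \<and> weak_limit (\<lambda>k. M (r k)) \<mu>"
proof -
  have space_m: "space m = S" using sets_eq_imp_space_eq[OF m(1)] by simp
  have space_M: "space (M k) = S \<times> A" for k using sets_eq_imp_space_eq[OF M(1)] by simp
  have "emeasure m S < \<infinity>" using m(2) by (rule order.strict_trans1) simp
  then have fin: "finite_measure m" by (intro finite_measureI) (simp add: space_m)
  obtain r \<mu> where r: "strict_mono r" "sets \<mu> = sets SA" "emeasure \<mu> (S \<times> A) = emeasure m S"
    "\<And>h. lsc (S \<times> A) h \<Longrightarrow> (\<integral>\<^sup>+z. h z \<partial>\<mu>) \<le> liminf (\<lambda>k. \<integral>\<^sup>+z. h z \<partial>M (r k))"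
    by (rule subprob_weakly_compact[OF S_borel A_compact M m(1) fin conv]) blast+
  have "(\<lambda>k. emeasure (M k) (S \<times> A)) \<longlonglongrightarrow> emeasure m S"
    using conv[of "\<lambda>_. 1" 1] by (simp add: space_m space_M)
  from LIMSEQ_subseq_LIMSEQ[OF this r(1)] have "weak_limit (\<lambda>k. M (r k)) \<mu>"
    using r by (simp add: weak_limit_def o_def)
  then show ?thesis using r(1) by blast
qed

lemma ex_weak_limit_0:
  fixes \<mu> :: "nat \<Rightarrow> nat \<Rightarrow> ('s \<times> 'b) measure"
  assumes o: "\<And>k. occupation_seq (\<mu> k)"
  shows "\<exists>r \<mu>'. strict_mono r \<and> weak_limit (\<lambda>k. \<mu> (r k) 0) \<mu>'"
proof (rule ex_weak_limit[where M="\<lambda>k. \<mu> k 0", OF occupation_seqD(1)[OF o] occupation_seq_mass_le_1[OF o] gamma(2)])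
  show "emeasure \<gamma> S \<le> 1" by (rule prob_space.emeasure_le_1[OF gamma(1)])
  show "(\<lambda>k. \<integral>\<^sup>+z. ennreal (f (fst z)) \<partial>\<mu> k 0) \<longlonglongrightarrow> (\<integral>\<^sup>+x. ennreal (f x) \<partial>\<gamma>)" if "continuous_on S f" for f
    using occupation_seqD(3)[OF o measurable_ennreal_continuous[OF that]] by simp
qed

lemma ex_weak_limit_Suc:
  fixes \<mu> :: "nat \<Rightarrow> nat \<Rightarrow> ('s \<times> 'b) measure"
  assumes o: "\<And>k. occupation_seq (\<mu> k)" and w: "weak_limit (\<lambda>k. \<mu> k n) \<mu>'"
  shows "\<exists>r \<mu>'. strict_mono r \<and> weak_limit (\<lambda>k. \<mu> (r k) (Suc n)) \<mu>'"
  by (rule ex_weak_limit[where M="\<lambda>k. \<mu> k (Suc n)", OF occupation_seqD(1)[OF o] occupation_seq_mass_le_1[OF o] sets_next_state_law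
        next_state_law_mass_le_1[OF weak_limitD(1)[OF w] weak_limit_mass_le_1[OF w occupation_seq_mass_le_1[OF o]]]
        occupation_step_tendsto[OF o w]])

lemma ex_common_weak_limits:
  fixes \<mu> :: "nat \<Rightarrow> nat \<Rightarrow> ('s \<times> 'b) measure"
  assumes o: "\<And>k. occupation_seq (\<mu> k)"
  shows "\<exists>r. strict_mono r \<and> (\<forall>m\<le>n. \<exists>\<mu>'. weak_limit (\<lambda>k. \<mu> (r k) m) \<mu>')"
proof (induction n)
  case 0
  then show ?case using ex_weak_limit_0[of \<mu>] o by auto
next
  case (Suc n)
  then obtain r where r: "strict_mono r" "\<forall>m\<le>n. \<exists>\<mu>'. weak_limit (\<lambda>k. \<mu> (r k) m) \<mu>'" by blast
  then obtain \<mu>' where "weak_limit (\<lambda>k. \<mu> (r k) n) \<mu>'" by blast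
  from ex_weak_limit_Suc[OF o this]
  obtain s \<mu>'' where s: "strict_mono s" "weak_limit (\<lambda>k. \<mu> (r (s k)) (Suc n)) \<mu>''" by blast
  have "\<exists>\<mu>'. weak_limit (\<lambda>k. \<mu> (r (s k)) m) \<mu>'" if "m \<le> Suc n" for m
  proof (cases "m = Suc n")
    case False
    then have "m \<le> n" using that by simp
    then obtain \<mu>' where "weak_limit (\<lambda>k. \<mu> (r k) m) \<mu>'" using r(2) by blast
    then show ?thesis using weak_limit_subseq[OF _ s(1)] by blast
  qed (use s(2) in blast)
  then show ?case using strict_mono_o[OF r(1) s(1)] by (intro exI[of _ "\<lambda>k. r (s k)"]) (simp add: o_def)
qed

lemma marginal_tendsto:
  assumes o: "\<And>k. occupation_seq (\<mu> k)" and w: "weak_limit (\<lambda>k. \<mu> k n) \<mu>'"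
    and f: "continuous_on S f" "\<And>x. 0 \<le> f x" "\<And>x. f x \<le> B"
  shows "(\<lambda>k. \<integral>\<^sup>+z. ennreal (f (fst z)) \<partial>\<mu> k n) \<longlonglongrightarrow> (\<integral>\<^sup>+x. ennreal (f x) \<partial>distr \<mu>' (SM S) fst)"
proof -
  have fst: "fst \<in> measurable \<mu>' (SM S)"
    unfolding measurable_cong_sets[OF weak_limitD(1)[OF w] refl] by (rule measurable_fst)
  have "continuous_on (S \<times> A) (\<lambda>z. f (fst z))"
    by (rule continuous_on_compose2[OF f(1)]) (auto intro: continuous_intros)
  then have "(\<lambda>k. \<integral>\<^sup>+z. ennreal (f (fst z)) \<partial>\<mu> k n) \<longlonglongrightarrow> (\<integral>\<^sup>+z. ennreal (f (fst z)) \<partial>\<mu>')"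
    using f
    by (intro weak_limit_tendsto[OF w occupation_seqD(1)[OF o] occupation_seq_mass_le_1[OF o]]) auto
  then show ?thesis using measurable_ennreal_continuous[OF f(1)] by (simp add: nn_integral_distr[OF fst])
qed

lemma occupation_seq_weak_limit:
  assumes o: "\<And>k. occupation_seq (\<mu> k)" and w: "\<And>n. weak_limit (\<lambda>k. \<mu> k n) (\<mu>' n)"
  shows "occupation_seq \<mu>'"
proof -
  have fst: "fst \<in> measurable (\<mu>' n) (SM S)" for n
    unfolding measurable_cong_sets[OF weak_limitD(1)[OF w] refl] by (rule measurable_fst)
  have "emeasure (distr (\<mu>' n) (SM S) fst) S \<le> 1" for n
    using weak_limit_mass_le_1[OF w[of n] occupation_seq_mass_le_1[OF o]] sets.top[of "SM S"]
    by (subst emeasure_distr[OF fst]) (auto simp: weak_limitD(2)[OF w] vimage_fst Times_Int_Times)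
  then have fin: "emeasure (distr (\<mu>' n) (SM S) fst) S \<noteq> \<infinity>" for n
    by (metis infinity_ennreal_def ennreal_one_neq_top top_unique)
  have marginal_0: "distr (\<mu>' 0) (SM S) fst = \<gamma>"
  proof (rule finite_measure_eqI_continuous[OF _ gamma(2) _ S_borel fin])
    fix f :: "'s \<Rightarrow> real" and B assume f: "continuous_on S f" "\<And>x. 0 \<le> f x" "\<And>x. f x \<le> B"
    show "(\<integral>\<^sup>+x. ennreal (f x) \<partial>distr (\<mu>' 0) (SM S) fst) = (\<integral>\<^sup>+x. ennreal (f x) \<partial>\<gamma>)"
      using marginal_tendsto[OF o w[of 0] f]
      by (simp add: occupation_seqD(3)[OF o measurable_ennreal_continuous[OF f(1)]] LIMSEQ_const_iff)
  qed simp
  have marginal_Suc: "distr (\<mu>' (Suc n)) (SM S) fst = next_state_law (\<mu>' n)" for n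
  proof (rule finite_measure_eqI_continuous[OF _ sets_next_state_law _ S_borel fin])
    fix f :: "'s \<Rightarrow> real" and B assume f: "continuous_on S f" "\<And>x. 0 \<le> f x" "\<And>x. f x \<le> B"
    show "(\<integral>\<^sup>+x. ennreal (f x) \<partial>distr (\<mu>' (Suc n)) (SM S) fst) = (\<integral>\<^sup>+x. ennreal (f x) \<partial>next_state_law (\<mu>' n))"
      by (rule LIMSEQ_unique[OF marginal_tendsto[OF o w f] occupation_step_tendsto[OF o w f]])
  qed simp
  show ?thesis unfolding occupation_seq_def
  proof (intro conjI allI ballI weak_limitD(1)[OF w])
    fix f :: "'s \<Rightarrow> ennreal" assume f: "f \<in> borel_measurable (SM S)"
    have "(\<integral>\<^sup>+z. f (fst z) \<partial>\<mu>' n) = (\<integral>\<^sup>+x. f x \<partial>distr (\<mu>' n) (SM S) fst)" for n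
      using f by (simp add: nn_integral_distr[OF fst])
    then show "(\<integral>\<^sup>+z. f (fst z) \<partial>\<mu>' 0) = (\<integral>\<^sup>+x. f x \<partial>\<gamma>)"
      and "(\<integral>\<^sup>+z. f (fst z) \<partial>\<mu>' (Suc n)) = (\<integral>\<^sup>+z. (\<integral>\<^sup>+y. f y \<partial>jump_kernel z) \<partial>\<mu>' n)" for n
      by (simp_all only: marginal_0 marginal_Suc nn_integral_next_state_law[OF weak_limitD(1)[OF w] f])
  qed
qed

lemma ex_diagonal_weak_limits:
  fixes \<mu> :: "nat \<Rightarrow> nat \<Rightarrow> ('s \<times> 'b) measure"
  assumes o: "\<And>k. occupation_seq (\<mu> k)"
  shows "\<exists>s \<mu>'. strict_mono s \<and> (\<forall>n. weak_limit (\<lambda>k. \<mu> (s k) n) (\<mu>' n))"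
proof -
  interpret subseqs "\<lambda>n s. \<forall>m\<le>n. \<exists>\<mu>'. weak_limit (\<lambda>k. \<mu> (s k) m) \<mu>'"
  proof
    fix n s assume "strict_mono (s :: nat \<Rightarrow> nat)"
    show "\<exists>r. strict_mono r \<and> (\<forall>m\<le>n. \<exists>\<mu>'. weak_limit (\<lambda>k. \<mu> ((s \<circ> r) k) m) \<mu>')"
      using ex_common_weak_limits[of "\<lambda>k. \<mu> (s k)"] o by simp
  qed
  have "\<exists>\<mu>'. weak_limit (\<lambda>k. \<mu> (diagseq k) n) \<mu>'" for n
  proof -
    have "\<forall>m\<le>n. \<exists>\<mu>'. weak_limit (\<lambda>k. \<mu> ((diagseq \<circ> (+) (Suc n)) k) m) \<mu>'"
    proof (rule diagseq_holds)
      fix r s :: "nat \<Rightarrow> nat" and n assume "strict_mono r" "\<forall>m\<le>n. \<exists>\<mu>'. weak_limit (\<lambda>k. \<mu> (s k) m) \<mu>'"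
      then show "\<forall>m\<le>n. \<exists>\<mu>'. weak_limit (\<lambda>k. \<mu> ((s \<circ> r) k) m) \<mu>'"
        using weak_limit_subseq by fastforce
    qed
    then obtain \<mu>' where "weak_limit (\<lambda>k. \<mu> (diagseq (k + Suc n)) n) \<mu>'" by (auto simp: add.commute)
    from weak_limit_offset[of "\<lambda>k. \<mu> (diagseq k) n", OF this] show ?thesis by blast
  qed
  then have "\<exists>\<mu>'. \<forall>n. weak_limit (\<lambda>k. \<mu> (diagseq k) n) (\<mu>' n)" by (intro choice allI)
  then show ?thesis using subseq_diagseq by blast
qed

theorem occupation_seq_compact:
  fixes \<mu> :: "nat \<Rightarrow> nat \<Rightarrow> ('s \<times> 'b) measure"
  assumes o: "\<And>k. occupation_seq (\<mu> k)"
  obtains s \<mu>' where "strict_mono s" "occupation_seq \<mu>'"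
    "\<And>h. lsc (S \<times> A) h \<Longrightarrow> (\<Sum>n. \<integral>\<^sup>+z. h z \<partial>\<mu>' n) \<le> liminf (\<lambda>k. \<Sum>n. \<integral>\<^sup>+z. h z \<partial>\<mu> (s k) n)"
proof -
  obtain s \<mu>' where s: "strict_mono s" and w: "\<And>n. weak_limit (\<lambda>k. \<mu> (s k) n) (\<mu>' n)"
    using ex_diagonal_weak_limits[of \<mu>, OF o] by blast
  have "(\<Sum>n. \<integral>\<^sup>+z. h z \<partial>\<mu>' n) \<le> liminf (\<lambda>k. \<Sum>n. \<integral>\<^sup>+z. h z \<partial>\<mu> (s k) n)" if h: "lsc (S \<times> A) h" for h
  proof -
    have "(\<Sum>n. \<integral>\<^sup>+z. h z \<partial>\<mu>' n) \<le> (\<Sum>n. liminf (\<lambda>k. \<integral>\<^sup>+z. h z \<partial>\<mu> (s k) n))"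
      by (intro suminf_le weak_limitD(4)[OF w h]) auto
    also have "\<dots> \<le> liminf (\<lambda>k. \<Sum>n. \<integral>\<^sup>+z. h z \<partial>\<mu> (s k) n)" by (rule suminf_liminf_le)
    finally show ?thesis .
  qed
  then show thesis using that[OF s occupation_seq_weak_limit[of "\<lambda>k. \<mu> (s k)", OF o w]] by blast
qed

end

section \<open>The value function\<close>

lemma ennreal_divide_mult_le: "(a::ennreal) / b * b \<le> a"
proof -
  consider "b = 0" | "b = \<top>" | "b \<noteq> 0" "b \<noteq> \<top>" by blast
  then show ?thesis
  proof cases
    case 3
    then have "b * (a / b) = a"
      by (simp add: ennreal_times_divide mult.commute[of b] ennreal_mult_divide_eq)
    then show ?thesis by (simp add: mult.commute)
  qed simp_all
qed

lemma ennreal_le_inverse: assumes le: "(x::ennreal) * l \<le> 1" shows "x \<le> 1 / l"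
proof -
  consider "l = 0" | "l = \<top>" | "l \<noteq> 0" "l \<noteq> \<top>" by blast
  then show ?thesis
  proof cases
    case 2
    then have "x = 0" using le by (cases "x = 0") (auto simp: ennreal_mult_top top_unique)
    then show ?thesis by simp
  next
    case 3
    then have "x = x * l / l" by (simp add: ennreal_mult_divide_eq)
    also have "\<dots> \<le> 1 / l" using le by (rule divide_right_mono_ennreal)
    finally show ?thesis .
  qed simp
qed

lemma lsc_common_zero:
  fixes g :: "nat \<Rightarrow> 'a::metric_space \<Rightarrow> ennreal"
  assumes A: "compact A" and lsc: "\<And>n. lsc A (g n)" and mono: "\<And>m n a. m \<le> n \<Longrightarrow> a \<in> A \<Longrightarrow> g m a \<le> g n a"
    and zero: "\<And>n. \<exists>a\<in>A. g n a = 0"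
  shows "\<exists>a\<in>A. \<forall>n. g n a = 0"
proof -
  define Z where "Z n = {a \<in> A. g n a = 0}" for n
  have "(\<Inter>n. Z n) \<noteq> {}"
  proof (rule compact_space_imp_nest)
    show "compact_space (top_of_set A)" using A by (simp add: compact_space_subtopology)
    show "decseq Z"
    proof (intro decseq_SucI subsetI)
      fix n a assume "a \<in> Z (Suc n)"
      then show "a \<in> Z n" using mono[of n "Suc n" a] by (simp add: Z_def)
    qed
    fix n
    have "Z n = A - {a \<in> A. 0 < g n a}" by (auto simp: Z_def zero_less_iff_neq_zero)
    moreover have "openin (top_of_set A) {a \<in> A. 0 < g n a}" using lsc by (rule lscD)
    ultimately show "closedin (top_of_set A) (Z n)" by (simp add: closedin_diff)
    show "Z n \<noteq> {}" using zero[of n] by (auto simp: Z_def)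
  qed
  then show ?thesis by (auto simp: Z_def)
qed

context ctmdp_costs
begin

definition total_jump_cost :: "'s \<times> 'b \<Rightarrow> ennreal" where
  "total_jump_cost z = (\<Sum>i\<le>N. jump_cost (c i) z)"

definition bellman :: "('s \<Rightarrow> ennreal) \<Rightarrow> 's \<times> 'b \<Rightarrow> ennreal" where
  "bellman v z = total_jump_cost z + (\<integral>\<^sup>+y. v y \<partial>jump_kernel z)"

lemma lsc_total_jump_cost: "lsc (S \<times> A) total_jump_cost"
  unfolding total_jump_cost_def[abs_def] by (intro lsc_sum lsc_jump_cost_c) simp

lemma lsc_bellman: "lsc S v \<Longrightarrow> lsc (S \<times> A) (bellman v)"
  unfolding bellman_def[abs_def] by (intro lsc_add lsc_total_jump_cost lsc_nn_integral_jump_kernel)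

lemma bellman_mono: "(\<And>y. y \<in> S \<Longrightarrow> v y \<le> w y) \<Longrightarrow> bellman v z \<le> bellman w z"
  unfolding bellman_def by (intro add_left_mono nn_integral_mono) simp

primrec value_iterate :: "nat \<Rightarrow> 's \<Rightarrow> ennreal" where
  "value_iterate 0 x = 0"
| "value_iterate (Suc n) x = (INF a\<in>A. bellman (value_iterate n) (x, a))"

declare value_iterate.simps(2)[simp del]

lemma lsc_value_iterate: "lsc S (value_iterate n)"
proof (induction n)
  case 0
  show ?case using continuous_imp_lsc[of S "\<lambda>_. 0"] by (simp cong: lsc_cong)
next
  case (Suc n)
  from lsc_INF[OF lsc_bellman[OF Suc] A_compact A_ne] show ?case
    by (simp add: value_iterate.simps(2) cong: lsc_cong)
qed

lemma measurable_value_iterate: "value_iterate n \<in> borel_measurable (SM S)"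
  by (rule measurable_lsc_S[OF lsc_value_iterate])

lemma value_iterate_le: "a \<in> A \<Longrightarrow> value_iterate (Suc n) x \<le> bellman (value_iterate n) (x, a)"
  unfolding value_iterate.simps by (rule INF_lower)

lemma value_iterate_le_Suc: "x \<in> S \<Longrightarrow> value_iterate n x \<le> value_iterate (Suc n) x"
proof (induction n arbitrary: x)
  case (Suc n)
  then show ?case unfolding value_iterate.simps(2)[of "Suc n"] value_iterate.simps(2)[of n x]
    by (intro INF_mono) (blast intro: bellman_mono)
qed simp

lemma value_iterate_mono: "m \<le> n \<Longrightarrow> x \<in> S \<Longrightarrow> value_iterate m x \<le> value_iterate n x"
  by (induction n) (auto simp: le_Suc_eq intro: order_trans value_iterate_le_Suc)

definition value_fun :: "'s \<Rightarrow> ennreal" where "value_fun x = (SUP n. value_iterate n x)"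

lemma lsc_value_fun: "lsc S value_fun"
  unfolding value_fun_def[abs_def] by (intro lsc_SUP lsc_value_iterate)

lemma measurable_value_fun: "value_fun \<in> borel_measurable (SM S)"
  by (rule measurable_lsc_S[OF lsc_value_fun])

lemma bellman_value_fun: "bellman value_fun z = (SUP n. bellman (value_iterate n) z)"
proof -
  have "(\<integral>\<^sup>+y. value_fun y \<partial>jump_kernel z) = (SUP n. \<integral>\<^sup>+y. value_iterate n y \<partial>jump_kernel z)"
    unfolding value_fun_def
    by (rule nn_integral_monotone_convergence_SUP_AE)
      (use measurable_value_iterate value_iterate_le_Suc in \<open>auto simp: measurable_cong_sets[OF sets_jump_kernel refl]\<close>)
  then show ?thesis by (simp add: bellman_def ennreal_SUP_add_right)
qed

lemma ex_free_action:
  assumes x: "x \<in> S" and zero: "value_fun x = 0"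
  shows "\<exists>a\<in>A. bellman value_fun (x, a) = 0"
proof -
  have "\<exists>a\<in>A. \<forall>n. bellman (value_iterate n) (x, a) = 0"
  proof (rule lsc_common_zero[OF A_compact])
    show lsc: "lsc A (\<lambda>a. bellman (value_iterate n) (x, a))" for n
      using x by (intro lsc_compose[OF lsc_bellman[OF lsc_value_iterate]] continuous_intros) auto
    show "bellman (value_iterate m) (x, a) \<le> bellman (value_iterate n) (x, a)" if "m \<le> n" for m n a
      using value_iterate_mono[OF that] by (rule bellman_mono)
    have "value_iterate (Suc n) x \<le> value_fun x" for n unfolding value_fun_def by (rule SUP_upper) simp
    then have "(INF a\<in>A. bellman (value_iterate n) (x, a)) = 0" for n
      using zero by (simp add: value_iterate.simps(2))
    then show "\<exists>a\<in>A. bellman (value_iterate n) (x, a) = 0" for n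
      using lsc_attains_INF[OF lsc A_compact A_ne, of n] by simp
  qed
  then obtain a where "a \<in> A" "\<And>n. bellman (value_iterate n) (x, a) = 0" by blast
  then show ?thesis by (intro bexI[of _ a]) (simp_all add: bellman_value_fun)
qed

definition free_action :: "'s \<Rightarrow> 'b" where
  "free_action = zero_selector S A (bellman value_fun)"

lemma measurable_free_action[measurable]: "free_action \<in> measurable (SM S) (SM A)"
  unfolding free_action_def
  by (rule measurable_zero_selector[OF A_compact A_ne lsc_bellman[OF lsc_value_fun]])

lemma free_action_in_A: "x \<in> S \<Longrightarrow> free_action x \<in> A"
  using measurable_space[OF measurable_free_action] by simp

lemma
  assumes "x \<in> S" "value_fun x = 0"
  shows total_jump_cost_free_action: "total_jump_cost (x, free_action x) = 0"
    and value_fun_free_action: "(\<integral>\<^sup>+y. value_fun y \<partial>jump_kernel (x, free_action x)) = 0"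
proof -
  have "bellman value_fun (x, free_action x) = 0"
    using ex_free_action[OF assms] zero_selector_eq_0[OF A_compact A_ne lsc_bellman[OF lsc_value_fun] assms(1)]
    unfolding free_action_def by blast
  then show "total_jump_cost (x, free_action x) = 0" "(\<integral>\<^sup>+y. value_fun y \<partial>jump_kernel (x, free_action x)) = 0"
    by (simp_all add: bellman_def)
qed

lemma cost_free_action: "x \<in> S \<Longrightarrow> value_fun x = 0 \<Longrightarrow> i \<le> N \<Longrightarrow> ennreal (c i (x, free_action x)) = 0"
  using total_jump_cost_free_action[of x] rate_finite[of "(x, free_action x)"]
  by (auto simp: total_jump_cost_def sum_eq_0_iff jump_cost_def ennreal_divide_eq_0_iff)

lemma total_jump_cost_rate_0:
  assumes z: "z \<in> S \<times> A" and pos: "0 < value_fun (fst z)" and rate: "rate z = 0"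
  shows "total_jump_cost z = \<top>"
proof -
  obtain n where n: "0 < value_iterate n (fst z)" using pos by (auto simp: value_fun_def less_SUP_iff)
  then obtain m where m: "n = Suc m" by (cases n) auto
  have "0 < bellman (value_iterate m) z"
    using n value_iterate_le[of "snd z" m "fst z"] z unfolding m by (auto intro: less_le_trans)
  then have "0 < total_jump_cost z"
    using nn_integral_jump_kernel_rate_0[OF z rate] by (simp add: bellman_def)
  then obtain i where i: "i \<le> N" "jump_cost (c i) z \<noteq> 0"
    by (auto simp: total_jump_cost_def zero_less_iff_neq_zero)
  then have "jump_cost (c i) z = \<top>"
    using rate
    by (auto simp: jump_cost_def ennreal_divide_eq_0_iff divide_ennreal_def ennreal_mult_eq_top_iff)
  then show ?thesis using i(1) by (auto simp: total_jump_cost_def)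
qed

end

section \<open>Stationary policies from total occupation measures\<close>

lemma measurable_section:
  assumes "\<phi> \<in> measurable (SM S) (prob_algebra (SM A))" "x \<in> S" "g \<in> borel_measurable (SM S \<Otimes>\<^sub>M SM A)"
  shows "(\<lambda>a. g (x, a)) \<in> borel_measurable (\<phi> x)"
proof -
  have sets: "sets (\<phi> x) = sets (SM A)"
    using measurable_space[OF assms(1), of x] assms(2) by (simp add: space_prob_algebra)
  show ?thesis unfolding measurable_cong_sets[OF sets refl]
    by (rule measurable_compose[OF measurable_Pair1' assms(3)]) (simp add: assms(2))
qed

locale total_occupation = ctmdp_costs S A \<gamma> q c N for S :: "'s::polish_space set" and A :: "'b::polish_space set" and \<gamma> q c N +
  fixes M :: "('s \<times> 'b) measure"
  assumes sets_M[measurable_cong]: "sets M = sets SA"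
    and flow: "f \<in> borel_measurable (SM S) \<Longrightarrow>
        (\<integral>\<^sup>+z. f (fst z) \<partial>M) = (\<integral>\<^sup>+x. f x \<partial>\<gamma>) + (\<integral>\<^sup>+z. (\<integral>\<^sup>+y. f y \<partial>jump_kernel z) \<partial>M)"
    and finite_total: "(\<integral>\<^sup>+z. total_jump_cost z \<partial>M) < \<top>"
begin

lemma space_M[simp]: "space M = S \<times> A"
  using sets_eq_imp_space_eq[OF sets_M] by simp

lemma measurable_M: "f \<in> borel_measurable SA \<Longrightarrow> f \<in> borel_measurable M"
  by (simp add: measurable_cong_sets[OF sets_M refl])

lemma measurable_fst_SA: "G \<in> borel_measurable (SM S) \<Longrightarrow> (\<lambda>z. G (fst z)) \<in> borel_measurable SA"
  by (rule measurable_compose[OF measurable_fst])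

lemma finite_value_iterate: "(\<integral>\<^sup>+z. value_iterate j (fst z) \<partial>M) < \<top>"
proof (induction j)
  case (Suc j)
  have "(\<integral>\<^sup>+z. value_iterate (Suc j) (fst z) \<partial>M) \<le> (\<integral>\<^sup>+z. bellman (value_iterate j) z \<partial>M)"
    using value_iterate_le by (intro nn_integral_mono) auto
  also have "\<dots> = (\<integral>\<^sup>+z. total_jump_cost z \<partial>M) + (\<integral>\<^sup>+z. (\<integral>\<^sup>+y. value_iterate j y \<partial>jump_kernel z) \<partial>M)"
    unfolding bellman_def
    by (intro nn_integral_add measurable_M measurable_lsc_SA lsc_total_jump_cost lsc_nn_integral_jump_kernel lsc_value_iterate)
  also have "\<dots> \<le> (\<integral>\<^sup>+z. total_jump_cost z \<partial>M) + (\<integral>\<^sup>+z. value_iterate j (fst z) \<partial>M)"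
    unfolding flow[OF measurable_value_iterate] by (intro add_left_mono) simp
  also have "\<dots> < \<top>" using Suc finite_total by simp
  finally show ?case .
qed simp

definition iterate_weight :: "nat \<Rightarrow> ennreal" where
  "iterate_weight j = ennreal ((1/2) ^ j) / (1 + (\<integral>\<^sup>+z. value_iterate j (fst z) \<partial>M))"

definition weighted_value :: "'s \<Rightarrow> ennreal" where
  "weighted_value x = (\<Sum>j. iterate_weight j * value_iterate j x)"

lemma measurable_weighted_value: "weighted_value \<in> borel_measurable (SM S)"
  unfolding weighted_value_def[abs_def]
  by (intro borel_measurable_suminf_order borel_measurable_times_ennreal measurable_value_iterate) simp

lemma finite_weighted_value: "(\<integral>\<^sup>+z. weighted_value (fst z) \<partial>M) < \<top>"
proof -
  have meas: "(\<lambda>z. value_iterate j (fst z)) \<in> borel_measurable M" for j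
    by (intro measurable_M measurable_fst_SA measurable_value_iterate)
  have "(\<integral>\<^sup>+z. weighted_value (fst z) \<partial>M) = (\<Sum>j. \<integral>\<^sup>+z. iterate_weight j * value_iterate j (fst z) \<partial>M)"
    unfolding weighted_value_def
    using meas by (intro nn_integral_suminf borel_measurable_times_ennreal) auto
  also have "\<dots> = (\<Sum>j. iterate_weight j * (\<integral>\<^sup>+z. value_iterate j (fst z) \<partial>M))"
    by (simp add: nn_integral_cmult[OF meas])
  also have "\<dots> \<le> (\<Sum>j. ennreal ((1/2) ^ j))"
  proof (intro suminf_le summableI)
    fix j
    have "iterate_weight j * (\<integral>\<^sup>+z. value_iterate j (fst z) \<partial>M)
        \<le> iterate_weight j * (1 + (\<integral>\<^sup>+z. value_iterate j (fst z) \<partial>M))"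
      by (intro mult_left_mono) auto
    also have "\<dots> \<le> ennreal ((1/2) ^ j)" unfolding iterate_weight_def by (rule ennreal_divide_mult_le)
    finally show "iterate_weight j * (\<integral>\<^sup>+z. value_iterate j (fst z) \<partial>M) \<le> ennreal ((1/2) ^ j)" .
  qed
  also have "\<dots> = ennreal 2" using geometric_sums[of "1/2::real"] by (intro suminf_ennreal_eq) auto
  finally show ?thesis by (rule order.strict_trans1) simp
qed

lemma weighted_value_pos: assumes "0 < value_fun x" shows "0 < weighted_value x"
proof -
  obtain j where j: "0 < value_iterate j x" using assms by (auto simp: value_fun_def less_SUP_iff)
  have "0 < iterate_weight j"
    using finite_value_iterate[of j] by (simp add: iterate_weight_def ennreal_zero_less_divide)
  then have "0 < iterate_weight j * value_iterate j x" using j by (simp add: ennreal_zero_less_mult_iff)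
  also have "\<dots> \<le> weighted_value x"
    unfolding weighted_value_def
    using sum_le_suminf[OF summableI, of "{j}" "\<lambda>j. iterate_weight j * value_iterate j x"] by simp
  finally show ?thesis .
qed

definition positive_rate :: "'s \<times> 'b \<Rightarrow> ennreal" where
  "positive_rate z = ennreal (qx q (fst z) (snd z) + (1 - jump_prob z))"

definition min_rate :: "'s \<Rightarrow> ennreal" where
  "min_rate x = (INF a\<in>A. positive_rate (x, a))"

lemma lsc_positive_rate: "lsc (S \<times> A) positive_rate"
  unfolding positive_rate_def[abs_def]
  by (intro continuous_imp_lsc continuous_intros continuous_on_qx continuous_on_jump_prob)

lemma positive_rate_eq: "z \<in> S \<times> A \<Longrightarrow> positive_rate z = (if rate z = 0 then 1 else rate z)"
  using qx_nonneg by (cases z) (force simp: positive_rate_def jump_prob_def rate_def ennreal_eq_0_iff)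

lemma measurable_min_rate: "min_rate \<in> borel_measurable (SM S)"
  unfolding min_rate_def[abs_def] by (intro measurable_lsc_S lsc_INF lsc_positive_rate A_compact A_ne)

lemma min_rate_pos: assumes x: "x \<in> S" shows "0 < min_rate x"
proof -
  have "lsc A (\<lambda>a. positive_rate (x, a))"
    using x by (intro lsc_compose[OF lsc_positive_rate] continuous_intros) auto
  from lsc_attains_INF[OF this A_compact A_ne] obtain a where "a \<in> A" "positive_rate (x, a) = min_rate x"
    unfolding min_rate_def by blast
  then show ?thesis
    using positive_rate_eq[of "(x, a)"] x by (auto simp: zero_less_iff_neq_zero split: if_splits)
qed

lemma min_rate_le: "z \<in> S \<times> A \<Longrightarrow> rate z \<noteq> 0 \<Longrightarrow> min_rate (fst z) \<le> rate z"
  unfolding min_rate_def by (rule INF_lower2[of "snd z"]) (auto simp: positive_rate_eq)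

(* A density making the measure of the sojourn times finite: weighted_value controls the mass, min_rate the factor 1 / rate. *)
definition damping :: "'s \<Rightarrow> ennreal" where
  "damping x = min 1 (weighted_value x) * min 1 (min_rate x)"

lemma measurable_damping: "damping \<in> borel_measurable (SM S)"
  unfolding damping_def[abs_def] using measurable_weighted_value measurable_min_rate by measurable

lemma damping_cancel: assumes "x \<in> S" "0 < value_fun x" shows "damping x * (1 / damping x) = 1"
proof -
  have "damping x \<noteq> 0"
    using weighted_value_pos[OF assms(2)] min_rate_pos[OF assms(1)] by (auto simp: damping_def min_def)
  moreover have "damping x \<noteq> \<top>" by (auto simp: damping_def ennreal_mult_eq_top_iff min_def)
  ultimately show ?thesis by (simp add: ennreal_times_divide ennreal_divide_self less_top)
qed

definition mean_sojourn :: "'s \<times> 'b \<Rightarrow> ennreal" where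
  "mean_sojourn z = (if 0 < value_fun (fst z) \<and> rate z \<noteq> 0 then 1 / rate z else 0)"

lemma measurable_mean_sojourn: "mean_sojourn \<in> borel_measurable SA"
proof -
  have [measurable]: "(\<lambda>z. value_fun (fst z)) \<in> borel_measurable SA"
    by (rule measurable_fst_SA[OF measurable_value_fun])
  show ?thesis unfolding mean_sojourn_def[abs_def] by measurable
qed

lemma mean_sojourn_rate_le_1: "mean_sojourn z * rate z \<le> 1"
  unfolding mean_sojourn_def by (auto simp: ennreal_divide_mult_le)

lemma mean_sojourn_rate: "0 < value_fun (fst z) \<Longrightarrow> rate z \<noteq> 0 \<Longrightarrow> mean_sojourn z * rate z = 1"
  using rate_finite[of z]
  by (simp add: mean_sojourn_def mult.commute[of "1 / rate z"] ennreal_times_divide)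

lemma mean_sojourn_damping_le: assumes z: "z \<in> S \<times> A"
  shows "mean_sojourn z * damping (fst z) \<le> weighted_value (fst z)"
proof (cases "0 < value_fun (fst z) \<and> rate z \<noteq> 0")
  case True
  then have "min 1 (min_rate (fst z)) \<le> rate z" using min_rate_le[OF z] by (simp add: min.coboundedI2)
  then have "mean_sojourn z * damping (fst z) \<le> mean_sojourn z * (weighted_value (fst z) * rate z)"
    unfolding damping_def by (intro mult_left_mono mult_mono) auto
  also have "\<dots> = (mean_sojourn z * rate z) * weighted_value (fst z)" by (simp add: ac_simps)
  also have "\<dots> \<le> 1 * weighted_value (fst z)" by (intro mult_right_mono mean_sojourn_rate_le_1) simp
  finally show ?thesis by simp
qed (auto simp: mean_sojourn_def)

definition sojourn_measure :: "('s \<times> 'b) measure" where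
  "sojourn_measure = density M (\<lambda>z. mean_sojourn z * damping (fst z))"

lemma measurable_mean_sojourn_damping: "(\<lambda>z. mean_sojourn z * damping (fst z)) \<in> borel_measurable M"
  by (intro measurable_M borel_measurable_times_ennreal measurable_mean_sojourn measurable_fst_SA measurable_damping)

lemma sets_sojourn_measure: "sets sojourn_measure = sets SA"
  by (simp add: sojourn_measure_def sets_M)

lemma finite_sojourn_measure: "finite_measure sojourn_measure"
proof (rule finite_measureI)
  have "emeasure sojourn_measure (space sojourn_measure) = (\<integral>\<^sup>+z. 1 \<partial>sojourn_measure)" by simp
  also have "\<dots> = (\<integral>\<^sup>+z. mean_sojourn z * damping (fst z) \<partial>M)"
    unfolding sojourn_measure_def
    by (subst nn_integral_density[OF measurable_mean_sojourn_damping]) simp_all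
  also have "\<dots> \<le> (\<integral>\<^sup>+z. weighted_value (fst z) \<partial>M)"
    using mean_sojourn_damping_le by (intro nn_integral_mono) auto
  also have "\<dots> < \<top>" by (rule finite_weighted_value)
  finally show "emeasure sojourn_measure (space sojourn_measure) \<noteq> \<infinity>" by simp
qed

definition sojourn_kernel :: "'s \<Rightarrow> 'b measure" where
  "sojourn_kernel = (SOME \<phi>. \<phi> \<in> measurable (SM S) (prob_algebra (SM A)) \<and>
     (\<forall>g\<in>borel_measurable SA. (\<integral>\<^sup>+z. g z \<partial>sojourn_measure) = (\<integral>\<^sup>+x. (\<integral>\<^sup>+a. g (x, a) \<partial>\<phi> x) \<partial>distr sojourn_measure (SM S) fst)))"

lemma measurable_sojourn_kernel: "sojourn_kernel \<in> measurable (SM S) (prob_algebra (SM A))"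
  and sojourn_measure_disintegration: "g \<in> borel_measurable SA \<Longrightarrow>
    (\<integral>\<^sup>+z. g z \<partial>sojourn_measure) = (\<integral>\<^sup>+x. (\<integral>\<^sup>+a. g (x, a) \<partial>sojourn_kernel x) \<partial>distr sojourn_measure (SM S) fst)"
proof -
  have "\<exists>\<phi>. \<phi> \<in> measurable (SM S) (prob_algebra (SM A)) \<and>
     (\<forall>g\<in>borel_measurable SA. (\<integral>\<^sup>+z. g z \<partial>sojourn_measure) = (\<integral>\<^sup>+x. (\<integral>\<^sup>+a. g (x, a) \<partial>\<phi> x) \<partial>distr sojourn_measure (SM S) fst))"
    using disintegration[OF A_compact A_ne finite_sojourn_measure sets_sojourn_measure] by blast
  from someI_ex[OF this, folded sojourn_kernel_def]
  show "sojourn_kernel \<in> measurable (SM S) (prob_algebra (SM A))"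
    and "g \<in> borel_measurable SA \<Longrightarrow>
      (\<integral>\<^sup>+z. g z \<partial>sojourn_measure) = (\<integral>\<^sup>+x. (\<integral>\<^sup>+a. g (x, a) \<partial>sojourn_kernel x) \<partial>distr sojourn_measure (SM S) fst)" by blast+
qed

definition state_integral :: "('s \<Rightarrow> ennreal) \<Rightarrow> ennreal" where
  "state_integral G = (\<integral>\<^sup>+x. 1 / damping x * G x \<partial>distr sojourn_measure (SM S) fst)"

lemma state_integral_mono: "(\<And>x. x \<in> S \<Longrightarrow> F x \<le> G x) \<Longrightarrow> state_integral F \<le> state_integral G"
  unfolding state_integral_def by (intro nn_integral_mono mult_left_mono) auto

lemma nn_integral_mean_sojourn:
  assumes g: "g \<in> borel_measurable SA"
  shows "(\<integral>\<^sup>+z. mean_sojourn z * g z \<partial>M) = state_integral (\<lambda>x. \<integral>\<^sup>+a. g (x, a) \<partial>sojourn_kernel x)"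
proof -
  have "(\<lambda>z. 1 / damping (fst z)) \<in> borel_measurable SA"
    by (intro borel_measurable_divide_ennreal measurable_fst_SA[OF measurable_damping]) simp
  then have meas: "(\<lambda>z. 1 / damping (fst z) * g z) \<in> borel_measurable SA"
    by (intro borel_measurable_times_ennreal g)
  have "(\<integral>\<^sup>+z. mean_sojourn z * g z \<partial>M) = (\<integral>\<^sup>+z. mean_sojourn z * damping (fst z) * (1 / damping (fst z) * g z) \<partial>M)"
  proof (rule nn_integral_cong)
    fix z assume "z \<in> space M"
    then have "fst z \<in> S" by auto
    have "mean_sojourn z * damping (fst z) * (1 / damping (fst z) * g z)
        = mean_sojourn z * g z * (damping (fst z) * (1 / damping (fst z)))"
      by (simp only: ac_simps)
    then show "mean_sojourn z * g z = mean_sojourn z * damping (fst z) * (1 / damping (fst z) * g z)"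
      using damping_cancel[OF \<open>fst z \<in> S\<close>]
      by (cases "0 < value_fun (fst z)") (simp_all add: mean_sojourn_def)
  qed
  also have "\<dots> = (\<integral>\<^sup>+z. 1 / damping (fst z) * g z \<partial>sojourn_measure)"
    unfolding sojourn_measure_def
    by (rule nn_integral_density[OF measurable_mean_sojourn_damping measurable_M[OF meas], symmetric])
  also have "\<dots> = (\<integral>\<^sup>+x. (\<integral>\<^sup>+a. 1 / damping x * g (x, a) \<partial>sojourn_kernel x) \<partial>distr sojourn_measure (SM S) fst)"
    using sojourn_measure_disintegration[OF meas] by simp
  also have "\<dots> = state_integral (\<lambda>x. \<integral>\<^sup>+a. g (x, a) \<partial>sojourn_kernel x)"
    unfolding state_integral_def
    by (intro nn_integral_cong nn_integral_cmult measurable_section[OF measurable_sojourn_kernel _ g]) simp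
  finally show ?thesis .
qed

lemma AE_rate: "AE z in M. 0 < value_fun (fst z) \<longrightarrow> rate z \<noteq> 0"
proof -
  have "AE z in M. total_jump_cost z \<noteq> \<infinity>"
    using finite_total
    by (intro nn_integral_PInf_AE measurable_M measurable_lsc_SA lsc_total_jump_cost) auto
  then show ?thesis by (rule AE_mp) (use total_jump_cost_rate_0 in \<open>auto intro!: AE_I2\<close>)
qed

lemma state_integral_rate:
  assumes G: "G \<in> borel_measurable (SM S)" "\<And>x. x \<in> S \<Longrightarrow> value_fun x = 0 \<Longrightarrow> G x = 0"
  shows "(\<integral>\<^sup>+z. G (fst z) \<partial>M) = state_integral (\<lambda>x. (\<integral>\<^sup>+a. rate (x, a) \<partial>sojourn_kernel x) * G x)"
proof -
  have "(\<integral>\<^sup>+z. G (fst z) \<partial>M) = (\<integral>\<^sup>+z. mean_sojourn z * (rate z * G (fst z)) \<partial>M)"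
  proof (intro nn_integral_cong_AE, rule AE_mp[OF AE_rate], intro AE_I2 impI)
    fix z assume z: "z \<in> space M" "0 < value_fun (fst z) \<longrightarrow> rate z \<noteq> 0"
    show "G (fst z) = mean_sojourn z * (rate z * G (fst z))"
    proof (cases "0 < value_fun (fst z)")
      case True
      then show ?thesis using mean_sojourn_rate[OF True] z(2) by (simp add: mult.assoc[symmetric])
    next
      case False
      then show ?thesis using G(2)[of "fst z"] z(1) by (auto simp: zero_less_iff_neq_zero)
    qed
  qed
  also have "\<dots> = state_integral (\<lambda>x. \<integral>\<^sup>+a. rate (x, a) * G x \<partial>sojourn_kernel x)"
    using nn_integral_mean_sojourn[OF borel_measurable_times_ennreal[OF measurable_rate measurable_fst_SA[OF G(1)]]] by simp
  also have "\<dots> = state_integral (\<lambda>x. (\<integral>\<^sup>+a. rate (x, a) \<partial>sojourn_kernel x) * G x)"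
    unfolding state_integral_def using measurable_section[OF measurable_sojourn_kernel _ measurable_rate]
    by (intro nn_integral_cong) (simp add: nn_integral_multc)
  finally show ?thesis .
qed

definition stationary_kernel :: "'s \<Rightarrow> 'b measure" where
  "stationary_kernel x = (if 0 < value_fun x then sojourn_kernel x else return (SM A) (free_action x))"

lemma measurable_stationary_kernel: "stationary_kernel \<in> measurable (SM S) (prob_algebra (SM A))"
  unfolding stationary_kernel_def[abs_def]
proof (intro measurable_If measurable_sojourn_kernel)
  show "(\<lambda>x. return (SM A) (free_action x)) \<in> measurable (SM S) (prob_algebra (SM A))"
    by (rule measurable_compose[OF measurable_free_action measurable_return_prob_space])
  show "{x \<in> space (SM S). 0 < value_fun x} \<in> sets (SM S)" using measurable_value_fun by measurable
qed

definition stationary_policy :: "('s, 'b) policy" where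
  "stationary_policy n p = stationary_kernel (snd (fst p))"

lemma is_policy_stationary_policy: "is_policy S A stationary_policy"
  unfolding is_policy_def stationary_policy_def[abs_def] histM_def
  by (intro allI measurable_compose[OF _ measurable_stationary_kernel]) measurable

lemma stationary_stationary_policy: "stationary S A stationary_policy"
  unfolding stationary_def using measurable_stationary_kernel by (auto simp: stationary_policy_def)

interpretation stationary: ctmdp_policy S A \<gamma> q stationary_policy
  by (intro ctmdp_policy.intro ctmdp_axioms ctmdp_policy_axioms.intro is_policy_stationary_policy)

definition action_mean :: "('s \<times> 'b \<Rightarrow> ennreal) \<Rightarrow> 's \<Rightarrow> ennreal" where
  "action_mean g x = (\<integral>\<^sup>+a. g (x, a) \<partial>stationary_kernel x)"

lemma measurable_action_mean: "g \<in> borel_measurable SA \<Longrightarrow> action_mean g \<in> borel_measurable (SM S)"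
  unfolding action_mean_def[abs_def]
  by (rule measurable_kernel_integral[OF measurable_prob_algebraD[OF measurable_stationary_kernel]])

lemma action_mean_free:
  assumes x: "x \<in> S" "value_fun x = 0" and g: "g \<in> borel_measurable SA"
  shows "action_mean g x = g (x, free_action x)"
proof -
  have "(\<lambda>a. g (x, a)) \<in> borel_measurable (SM A)"
    using measurable_compose[OF measurable_Pair1'[of x "SM S" "SM A"] g] x(1) by simp
  then show ?thesis
    using free_action_in_A[OF x(1)] x(2)
    by (simp add: action_mean_def stationary_kernel_def nn_integral_return)
qed

lemma sojourn_integral_le:
  assumes h: "h \<in> space (histM S n)"
  shows "stationary.sojourn_integral n g h \<le> action_mean g (snd h) / action_mean rate (snd h)"
proof -
  define T where "T = (\<integral>\<^sup>+s. stationary.survival n (h, s) \<partial>posL)"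
  have sojourn: "stationary.sojourn_integral n f h = T * action_mean f (snd h)" for f
    unfolding stationary.sojourn_integral_def T_def
    using stationary.measurable_HP_section[OF h stationary.measurable_survival]
    by (subst nn_integral_multc[symmetric]) (simp_all add: stationary.policy_mean_def stationary_policy_def action_mean_def)
  have "T \<le> 1 / action_mean rate (snd h)"
    using stationary.jump_mass_le_1[OF h]
    by (intro ennreal_le_inverse) (simp add: stationary.jump_mass_def sojourn)
  then have "T * action_mean g (snd h) \<le> 1 / action_mean rate (snd h) * action_mean g (snd h)"
    by (intro mult_right_mono) auto
  then show ?thesis
    by (simp add: sojourn mult.commute[of _ "action_mean g (snd h)"] ennreal_times_divide)
qed

lemma
  assumes g: "g \<in> borel_measurable SA" and free: "\<And>x. x \<in> S \<Longrightarrow> value_fun x = 0 \<Longrightarrow> action_mean g x = 0"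
  shows measurable_action_quotient: "(\<lambda>x. action_mean g x / action_mean rate x) \<in> borel_measurable (SM S)"
    and action_quotient_le: "(\<integral>\<^sup>+z. action_mean g (fst z) / action_mean rate (fst z) \<partial>M)
        \<le> (\<integral>\<^sup>+z. mean_sojourn z * g z \<partial>M)"
proof -
  show meas: "(\<lambda>x. action_mean g x / action_mean rate x) \<in> borel_measurable (SM S)"
    by (intro borel_measurable_divide_ennreal measurable_action_mean g measurable_rate)
  have "(\<integral>\<^sup>+z. action_mean g (fst z) / action_mean rate (fst z) \<partial>M)
    = state_integral (\<lambda>x. (\<integral>\<^sup>+a. rate (x, a) \<partial>sojourn_kernel x) * (action_mean g x / action_mean rate x))"
    using free by (intro state_integral_rate[OF meas]) simp
  also have "\<dots> \<le> state_integral (\<lambda>x. \<integral>\<^sup>+a. g (x, a) \<partial>sojourn_kernel x)"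
  proof (rule state_integral_mono)
    fix x assume x: "x \<in> S"
    show "(\<integral>\<^sup>+a. rate (x, a) \<partial>sojourn_kernel x) * (action_mean g x / action_mean rate x)
        \<le> (\<integral>\<^sup>+a. g (x, a) \<partial>sojourn_kernel x)"
    proof (cases "0 < value_fun x")
      case True
      then have "(\<integral>\<^sup>+a. f (x, a) \<partial>sojourn_kernel x) = action_mean f x" for f
        by (simp add: action_mean_def stationary_kernel_def)
      then show ?thesis
        using ennreal_divide_mult_le[of "action_mean g x" "action_mean rate x"]
        by (simp add: mult.commute)
    next
      case False
      then show ?thesis using free[OF x] by (simp add: zero_less_iff_neq_zero)
    qed
  qed
  also have "\<dots> = (\<integral>\<^sup>+z. mean_sojourn z * g z \<partial>M)" by (rule nn_integral_mean_sojourn[OF g, symmetric])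
  finally show "(\<integral>\<^sup>+z. action_mean g (fst z) / action_mean rate (fst z) \<partial>M) \<le> (\<integral>\<^sup>+z. mean_sojourn z * g z \<partial>M)" .
qed

lemma action_mean_next_state_free:
  assumes x: "x \<in> S" "value_fun x = 0" and G: "G \<in> borel_measurable (SM S)" "\<And>y. y \<in> S \<Longrightarrow>
      value_fun y = 0 \<Longrightarrow> G y = 0"
  shows "action_mean (\<lambda>z. rate z * (\<integral>\<^sup>+y. G y \<partial>jump_kernel z)) x = 0"
proof -
  have "AE y in jump_kernel (x, free_action x). value_fun y = 0"
    using value_fun_free_action[OF x] measurable_value_fun
    by (subst (asm) nn_integral_0_iff_AE) (simp_all add: measurable_cong_sets[OF sets_jump_kernel refl])
  then have "AE y in jump_kernel (x, free_action x). G y = 0"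
    by (rule AE_mp) (use G(2) in \<open>auto intro!: AE_I2\<close>)
  then have "(\<integral>\<^sup>+y. G y \<partial>jump_kernel (x, free_action x)) = (\<integral>\<^sup>+y. 0 \<partial>jump_kernel (x, free_action x))"
    by (rule nn_integral_cong_AE)
  then show ?thesis
    using action_mean_free[OF x borel_measurable_times_ennreal[OF measurable_rate measurable_nn_integral_jump_kernel[OF G(1)]]] by simp
qed

(* The state marginals of the stationary policy satisfy the balance equation of M with an inequality, hence stay below M. *)
lemma sum_state_marginal_le:
  assumes "G \<in> borel_measurable (SM S)" "\<And>x. x \<in> S \<Longrightarrow> value_fun x = 0 \<Longrightarrow> G x = 0"
  shows "(\<Sum>k<n. \<integral>\<^sup>+h. G (snd h) \<partial>stationary.hist_law k) \<le> (\<integral>\<^sup>+z. G (fst z) \<partial>M)"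
  using assms
proof (induction n arbitrary: G)
  case (Suc n)
  define g where "g z = rate z * (\<integral>\<^sup>+y. G y \<partial>jump_kernel z)" for z
  have g: "g \<in> borel_measurable SA" unfolding g_def[abs_def]
    by (intro borel_measurable_times_ennreal measurable_rate measurable_nn_integral_jump_kernel Suc.prems)
  have free: "action_mean g x = 0" if "x \<in> S" "value_fun x = 0" for x
    using action_mean_next_state_free[OF that Suc.prems] by (simp add: g_def[abs_def])
  have "(\<Sum>k<Suc n. \<integral>\<^sup>+h. G (snd h) \<partial>stationary.hist_law k)
    = (\<integral>\<^sup>+x. G x \<partial>\<gamma>) + (\<Sum>k<n. \<integral>\<^sup>+h. stationary.sojourn_integral k g h \<partial>stationary.hist_law k)"
    unfolding sum.lessThan_Suc_shift stationary.nn_integral_hist_law_0[OF Suc.prems(1)] stationary.nn_integral_hist_law_Suc[OF Suc.prems(1)]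
    by (simp add: g_def[abs_def])
  also have "\<dots> \<le> (\<integral>\<^sup>+x. G x \<partial>\<gamma>) + (\<Sum>k<n. \<integral>\<^sup>+h. action_mean g (snd h) / action_mean rate (snd h) \<partial>stationary.hist_law k)"
    by (intro add_left_mono sum_mono nn_integral_mono sojourn_integral_le) simp
  also have "\<dots> \<le> (\<integral>\<^sup>+x. G x \<partial>\<gamma>) + (\<integral>\<^sup>+z. action_mean g (fst z) / action_mean rate (fst z) \<partial>M)"
    using free by (intro add_left_mono Suc.IH[OF measurable_action_quotient[OF g]]) simp_all
  also have "\<dots> \<le> (\<integral>\<^sup>+x. G x \<partial>\<gamma>) + (\<integral>\<^sup>+z. mean_sojourn z * g z \<partial>M)"
    by (intro add_left_mono action_quotient_le[OF g free])
  also have "\<dots> \<le> (\<integral>\<^sup>+x. G x \<partial>\<gamma>) + (\<integral>\<^sup>+z. (\<integral>\<^sup>+y. G y \<partial>jump_kernel z) \<partial>M)"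
  proof (intro add_left_mono nn_integral_mono)
    fix z
    have "mean_sojourn z * g z = mean_sojourn z * rate z * (\<integral>\<^sup>+y. G y \<partial>jump_kernel z)"
      by (simp add: g_def mult.assoc)
    also have "\<dots> \<le> 1 * (\<integral>\<^sup>+y. G y \<partial>jump_kernel z)" by (intro mult_right_mono mean_sojourn_rate_le_1) simp
    finally show "mean_sojourn z * g z \<le> (\<integral>\<^sup>+y. G y \<partial>jump_kernel z)" by simp
  qed
  also have "\<dots> = (\<integral>\<^sup>+z. G (fst z) \<partial>M)" by (rule flow[OF Suc.prems(1), symmetric])
  finally show ?case .
qed simp

lemma objective_stationary_policy_le:
  assumes i: "i \<le> N" shows "objective S \<gamma> q (c i) stationary_policy \<le> (\<integral>\<^sup>+z. jump_cost (c i) z \<partial>M)"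
proof -
  define g where "g z = ennreal (c i z)" for z
  have g: "g \<in> borel_measurable SA"
    unfolding g_def[abs_def] by (rule measurable_compose[OF measurable_c[OF i] measurable_ennreal])
  have free: "action_mean g x = 0" if "x \<in> S" "value_fun x = 0" for x
    using cost_free_action[OF that i] by (simp add: action_mean_free[OF that g] g_def)
  have "objective S \<gamma> q (c i) stationary_policy
      = (\<Sum>n. \<integral>\<^sup>+h. stationary.sojourn_integral n g h \<partial>stationary.hist_law n)"
    unfolding g_def by (rule stationary.objective_eq[OF measurable_c[OF i]])
  also have "\<dots> \<le> (\<Sum>n. \<integral>\<^sup>+h. action_mean g (snd h) / action_mean rate (snd h) \<partial>stationary.hist_law n)"
    by (intro suminf_le summableI nn_integral_mono sojourn_integral_le) simp
  also have "\<dots> \<le> (\<integral>\<^sup>+z. action_mean g (fst z) / action_mean rate (fst z) \<partial>M)"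
    using free
    by (intro suminf_le_const summableI sum_state_marginal_le[OF measurable_action_quotient[OF g]]) simp_all
  also have "\<dots> \<le> (\<integral>\<^sup>+z. mean_sojourn z * g z \<partial>M)" by (rule action_quotient_le[OF g free])
  also have "\<dots> \<le> (\<integral>\<^sup>+z. jump_cost (c i) z \<partial>M)"
    by (intro nn_integral_mono) (auto simp: mean_sojourn_def g_def jump_cost_def mult.commute[of _ "ennreal _"] ennreal_times_divide)
  finally show ?thesis .
qed

end

context ctmdp_costs
begin

definition occupation_cost :: "nat \<Rightarrow> (nat \<Rightarrow> ('s \<times> 'b) measure) \<Rightarrow> ennreal" where
  "occupation_cost i \<mu> = (\<Sum>n. \<integral>\<^sup>+z. jump_cost (c i) z \<partial>\<mu> n)"

lemma ex_occupation_of_policy: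
  assumes "is_policy S A pol" "\<And>i. i \<le> N \<Longrightarrow> objective S \<gamma> q (c i) pol < \<top>"
  shows "\<exists>\<mu>. occupation_seq \<mu> \<and> (\<forall>i\<le>N. occupation_cost i \<mu> \<le> objective S \<gamma> q (c i) pol)"
proof -
  interpret ctmdp_costs_policy S A \<gamma> q c N pol
    using assms by (intro ctmdp_costs_policy.intro ctmdp_policy.intro ctmdp_policy_axioms.intro
        ctmdp_costs_policy_axioms.intro ctmdp_axioms ctmdp_costs_axioms)
  show ?thesis
    using occupation_seq_policy_occupation policy_occupation_cost_le by (auto simp: occupation_cost_def)
qed

lemma ex_stationary_of_occupation:
  assumes o: "occupation_seq \<mu>" and fin: "\<And>i. i \<le> N \<Longrightarrow> occupation_cost i \<mu> < \<top>"
  shows "\<exists>pol. stationary S A pol \<and> is_policy S A pol \<and> (\<forall>i\<le>N. objective S \<gamma> q (c i) pol \<le> occupation_cost i \<mu>)"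
proof -
  define M where "M = functional_measure SA (\<lambda>g. \<Sum>n. \<integral>\<^sup>+z. g z \<partial>\<mu> n)"
  have nn_integral_M: "(\<integral>\<^sup>+z. g z \<partial>M) = (\<Sum>n. \<integral>\<^sup>+z. g z \<partial>\<mu> n)" if "g \<in> borel_measurable SA" for g
    unfolding M_def
    by (intro nn_integral_functional_measure[OF pos_functional_suminf[OF pos_functional_nn_integral]] occupation_seqD(1)[OF o] that)
  have sets_M: "sets M = sets SA" by (simp add: M_def)
  have cost_M: "(\<integral>\<^sup>+z. jump_cost (c i) z \<partial>M) = occupation_cost i \<mu>" if "i \<le> N" for i
    by (simp add: nn_integral_M measurable_jump_cost that occupation_cost_def)
  interpret total_occupation S A \<gamma> q c N M
  proof (intro total_occupation.intro total_occupation_axioms.intro ctmdp_costs_axioms sets_M)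
    fix f :: "'s \<Rightarrow> ennreal" assume f: "f \<in> borel_measurable (SM S)"
    have "(\<integral>\<^sup>+z. f (fst z) \<partial>M) = (\<Sum>n. \<integral>\<^sup>+z. f (fst z) \<partial>\<mu> n)"
      by (rule nn_integral_M[OF measurable_compose[OF measurable_fst f]])
    also have "\<dots> = (\<integral>\<^sup>+z. f (fst z) \<partial>\<mu> 0) + (\<Sum>n. \<integral>\<^sup>+z. f (fst z) \<partial>\<mu> (Suc n))"
      using suminf_offset[OF summableI, of "\<lambda>n. \<integral>\<^sup>+z. f (fst z) \<partial>\<mu> n" 1] by (simp add: add.commute)
    finally show "(\<integral>\<^sup>+z. f (fst z) \<partial>M) = (\<integral>\<^sup>+x. f x \<partial>\<gamma>) + (\<integral>\<^sup>+z. (\<integral>\<^sup>+y. f y \<partial>jump_kernel z) \<partial>M)"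
      unfolding occupation_seqD(3,4)[OF o f] nn_integral_M[OF measurable_nn_integral_jump_kernel[OF f]] .
  next
    have "(\<integral>\<^sup>+z. total_jump_cost z \<partial>M) = (\<Sum>i\<le>N. \<integral>\<^sup>+z. jump_cost (c i) z \<partial>M)"
      unfolding total_jump_cost_def
      by (rule nn_integral_sum) (simp add: measurable_cong_sets[OF sets_M refl] measurable_jump_cost)
    also have "\<dots> < \<top>" using fin by (auto simp: less_top[symmetric] cost_M)
    finally show "(\<integral>\<^sup>+z. total_jump_cost z \<partial>M) < \<top>" .
  qed
  show ?thesis
    using stationary_stationary_policy is_policy_stationary_policy objective_stationary_policy_le
    by (auto simp: cost_M)
qed

lemma occupation_cost_compact:
  fixes \<mu> :: "nat \<Rightarrow> nat \<Rightarrow> ('s \<times> 'b) measure"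
  assumes o: "\<And>k. occupation_seq (\<mu> k)" and u: "\<And>i k. i \<le> N \<Longrightarrow> occupation_cost i (\<mu> k) \<le> u i k"
  obtains s \<mu>' where "strict_mono s" "occupation_seq \<mu>'" "\<And>i. i \<le> N \<Longrightarrow>
    occupation_cost i \<mu>' \<le> liminf (\<lambda>k. u i (s k))"
proof -
  obtain s \<mu>' where s: "strict_mono s" "occupation_seq \<mu>'"
    "\<And>h. lsc (S \<times> A) h \<Longrightarrow> (\<Sum>n. \<integral>\<^sup>+z. h z \<partial>\<mu>' n) \<le> liminf (\<lambda>k. \<Sum>n. \<integral>\<^sup>+z. h z \<partial>\<mu> (s k) n)"
    by (rule occupation_seq_compact[of \<mu>, OF o], rule that)
  have "occupation_cost i \<mu>' \<le> liminf (\<lambda>k. u i (s k))" if "i \<le> N" for i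
  proof -
    have "occupation_cost i \<mu>' \<le> liminf (\<lambda>k. occupation_cost i (\<mu> (s k)))"
      unfolding occupation_cost_def by (rule s(3)[OF lsc_jump_cost_c[OF that]])
    also have "\<dots> \<le> liminf (\<lambda>k. u i (s k))" using u[OF that] by (intro Liminf_mono always_eventually allI)
    finally show ?thesis .
  qed
  then show thesis by (rule that[OF s(1,2)])
qed

lemma ex_optimal_occupation:
  assumes "\<exists>pol. feasible S A \<gamma> q c N d pol \<and> objective S \<gamma> q (c 0) pol < \<top>"
  shows "\<exists>\<mu>. occupation_seq \<mu> \<and> occupation_cost 0 \<mu> < \<top> \<and> (\<forall>j\<in>{1..N}. occupation_cost j \<mu> \<le> ennreal (d j)) \<and>
    (\<forall>pol. feasible S A \<gamma> q c N d pol \<longrightarrow> occupation_cost 0 \<mu> \<le> objective S \<gamma> q (c 0) pol)"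
proof -
  define F where "F = {pol. feasible S A \<gamma> q c N d pol \<and> objective S \<gamma> q (c 0) pol < \<top>}"
  have "objective S \<gamma> q (c 0) ` F \<noteq> {}" using assms by (auto simp: F_def)
  from ennreal_Inf_countable_INF[OF this] obtain u where u: "decseq u" "range u \<subseteq> objective S \<gamma> q (c 0) ` F"
    "(INF pol\<in>F. objective S \<gamma> q (c 0) pol) = (INF k. u k)" by blast
  then have "\<exists>p. p \<in> F \<and> u k = objective S \<gamma> q (c 0) p" for k by blast
  then have "\<exists>p. \<forall>k. p k \<in> F \<and> u k = objective S \<gamma> q (c 0) (p k)" by (intro choice allI)
  then obtain p where p: "\<And>k. p k \<in> F" "\<And>k. u k = objective S \<gamma> q (c 0) (p k)" by blast
  have bound: "objective S \<gamma> q (c j) (p k) \<le> ennreal (d j)" if "j \<in> {1..N}" for j k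
    using p(1)[of k] that by (simp add: F_def feasible_def)
  have "objective S \<gamma> q (c i) (p k) < \<top>" if "i \<le> N" for i k
    using p(1)[of k] bound[of i k] that by (cases "i = 0") (auto simp: F_def intro: le_less_trans)
  then have "\<exists>\<mu>. occupation_seq \<mu> \<and> (\<forall>i\<le>N. occupation_cost i \<mu> \<le> objective S \<gamma> q (c i) (p k))" for k
    using p(1)[of k] by (intro ex_occupation_of_policy) (auto simp: F_def feasible_def)
  then have "\<exists>\<mu>. \<forall>k. occupation_seq (\<mu> k) \<and> (\<forall>i\<le>N. occupation_cost i (\<mu> k) \<le> objective S \<gamma> q (c i) (p k))" by (intro choice allI)
  then obtain \<mu> where \<mu>: "\<And>k. occupation_seq (\<mu> k)" "\<And>i k. i \<le> N \<Longrightarrow>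
      occupation_cost i (\<mu> k) \<le> objective S \<gamma> q (c i) (p k)" by blast
  obtain s \<mu>' where s: "strict_mono s" "occupation_seq \<mu>'"
    "\<And>i. i \<le> N \<Longrightarrow> occupation_cost i \<mu>' \<le> liminf (\<lambda>k. objective S \<gamma> q (c i) (p (s k)))"
    by (rule occupation_cost_compact[of \<mu>, OF \<mu>], assumption, rule that)
  have "(\<lambda>k. u (s k)) \<longlonglongrightarrow> (INF pol\<in>F. objective S \<gamma> q (c 0) pol)"
    using LIMSEQ_subseq_LIMSEQ[OF LIMSEQ_INF[OF u(1)] s(1)] by (simp add: u(3) o_def)
  then have "liminf (\<lambda>k. objective S \<gamma> q (c 0) (p (s k))) = (INF pol\<in>F. objective S \<gamma> q (c 0) pol)"
    unfolding p(2) by (rule lim_imp_Liminf[rotated]) simp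
  then have cost: "occupation_cost 0 \<mu>' \<le> objective S \<gamma> q (c 0) pol" if "pol \<in> F" for pol
    using s(3)[of 0] INF_lower[OF that, of "objective S \<gamma> q (c 0)"] by simp
  have "occupation_cost j \<mu>' \<le> ennreal (d j)" if j: "j \<in> {1..N}" for j
  proof -
    have "occupation_cost j \<mu>' \<le> liminf (\<lambda>k. objective S \<gamma> q (c j) (p (s k)))"
      using j by (intro s(3)) simp
    also have "\<dots> \<le> liminf (\<lambda>k::nat. ennreal (d j))"
      using bound[OF j] by (intro Liminf_mono always_eventually allI)
    finally show ?thesis by (simp add: Liminf_const)
  qed
  moreover have "occupation_cost 0 \<mu>' < \<top>"
    using cost[OF p(1)] p(1)[of 0] by (auto simp: F_def intro: le_less_trans)
  moreover have "occupation_cost 0 \<mu>' \<le> objective S \<gamma> q (c 0) pol" if "feasible S A \<gamma> q c N d pol"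
    for pol
    using cost[of pol] that
    by (cases "objective S \<gamma> q (c 0) pol < \<top>") (simp_all add: F_def less_top[symmetric])
  ultimately show ?thesis using s(2) by blast
qed

theorem ex_stationary_optimal:
  assumes "\<exists>pol. feasible S A \<gamma> q c N d pol \<and> objective S \<gamma> q (c 0) pol < \<top>"
  shows "\<exists>pol. stationary S A pol \<and> feasible S A \<gamma> q c N d pol \<and>
     objective S \<gamma> q (c 0) pol = (INF p\<in>{p. feasible S A \<gamma> q c N d p}. objective S \<gamma> q (c 0) p)"
proof -
  obtain \<mu> where \<mu>: "occupation_seq \<mu>" "occupation_cost 0 \<mu> < \<top>" "\<And>j. j \<in> {1..N} \<Longrightarrow>
      occupation_cost j \<mu> \<le> ennreal (d j)"
    "\<And>pol. feasible S A \<gamma> q c N d pol \<Longrightarrow> occupation_cost 0 \<mu> \<le> objective S \<gamma> q (c 0) pol"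
    using ex_optimal_occupation[OF assms] by blast
  have "occupation_cost i \<mu> < \<top>" if "i \<le> N" for i
    using \<mu>(2) \<mu>(3)[of i] that by (cases "i = 0") (auto intro: le_less_trans)
  then obtain pol where pol: "stationary S A pol" "is_policy S A pol" "\<And>i. i \<le> N \<Longrightarrow>
      objective S \<gamma> q (c i) pol \<le> occupation_cost i \<mu>"
    using ex_stationary_of_occupation[OF \<mu>(1)] by blast
  have "objective S \<gamma> q (c j) pol \<le> ennreal (d j)" if "j \<in> {1..N}" for j
    using order_trans[OF pol(3) \<mu>(3)[OF that]] that by simp
  then have feasible: "feasible S A \<gamma> q c N d pol" using pol(2) by (simp add: feasible_def)
  moreover have "objective S \<gamma> q (c 0) pol = (INF p\<in>{p. feasible S A \<gamma> q c N d p}. objective S \<gamma> q (c 0) p)"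
    using feasible order_trans[OF pol(3) \<mu>(4)] by (intro antisym INF_greatest INF_lower) simp_all
  ultimately show ?thesis using pol(1) by blast
qed

end

theorem theorem6p2:
  fixes S :: "'s::polish_space set" and A :: "'b::polish_space set"
    and \<gamma> :: "'s measure" and q :: "'s \<Rightarrow> 'b \<Rightarrow> 's set \<Rightarrow> real"
    and c :: "nat \<Rightarrow> 's \<times> 'b \<Rightarrow> real" and N :: nat and d :: "nat \<Rightarrow> real"
  assumes S: "S \<noteq> {}" "S \<in> sets borel"
    and A: "A \<noteq> {}" "A \<in> sets borel"
    and gamma: "prob_space \<gamma>" "sets \<gamma> = sets (SM S)"
    and q_kernel: "signed_kernel S A q"
    and q_nonneg: "\<forall>x\<in>S. \<forall>a\<in>A. \<forall>\<Gamma>\<in>sets (SM S). 0 \<le> qt q x a \<Gamma>"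
    and q_conservative: "\<forall>x\<in>S. \<forall>a\<in>A. q x a S = 0"
    and qx_nonneg: "\<forall>x\<in>S. \<forall>a\<in>A. 0 \<le> qx q x a"
    and q_bounded: "\<forall>x\<in>S. bdd_above (qx q x ` A)"
    and c_meas: "\<forall>i\<le>N. c i \<in> borel_measurable (SM S \<Otimes>\<^sub>M SM A)"
    and c_nonneg: "\<forall>i\<le>N. \<forall>z\<in>S \<times> A. 0 \<le> c i z"
    and d_nonneg: "\<forall>j\<in>{1..N}. 0 \<le> d j"
    \<comment> \<open>Condition 1\<close>
    and C1a: "compact A"
    and C1b: "\<forall>f :: 's \<Rightarrow> real. continuous_on S f \<and> bounded (f ` S) \<longrightarrow>
               continuous_on (S \<times> A) (\<lambda>(x,a). (\<integral>y. f y \<partial>(qtM q S x a)) / qx q x a)"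
    and C1c: "continuous_on (S \<times> A) (\<lambda>(x,a). qx q x a)"
    and C1d: "\<forall>i\<le>N. lsc_on (S \<times> A) (c i)"
    \<comment> \<open>Condition 2\<close>
    and C2: "\<exists>pol. feasible S A \<gamma> q c N d pol \<and> objective S \<gamma> q (c 0) pol < \<top>"
  shows "\<exists>pol. stationary S A pol \<and> feasible S A \<gamma> q c N d pol \<and>
           objective S \<gamma> q (c 0) pol =
             (INF p\<in>{p. feasible S A \<gamma> q c N d p}. objective S \<gamma> q (c 0) p)"
proof -
  interpret ctmdp_costs S A \<gamma> q c N
    by (intro ctmdp_costs.intro ctmdp.intro ctmdp_costs_axioms.intro)
      (fact S A gamma q_kernel q_nonneg q_conservative qx_nonneg q_bounded C1a C1b C1c c_meas c_nonneg C1d)+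
  show ?thesis by (rule ex_stationary_optimal[OF C2])
qed

end
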